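(* Let $\mathcal F$ be a $\Delta$-field of characteristic $0$, $\Delta=\{\delta_1,\ldots,\delta_m\}$, $m>1$, let $\mathbf u=(u_1,\ldots,u_n)$ be $\Delta$-indeterminates over $\mathcal F$, and let $$\mathcal G=\mathcal F\Big\langle\frac{P_1(\mathbf u)}{Q_1(\mathbf u)},\ldots,\frac{P_r(\mathbf u)}{Q_r(\mathbf u)}\Big\rangle\subseteq\mathcal F\langle\mathbf u\rangle,$$ where for each $j$, $P_j,Q_j\in\mathcal F\{\mathbf u\}$ are relatively prime and $P_j/Q_j\notin\mathcal F$. In $\mathcal F\{u_1,\ldots,u_n,x_1,\ldots,x_r\}$ consider the prime $\Delta$-ideal $$\mathcal P=\big[x_1Q_1(\mathbf u)-P_1(\mathbf u),\ldots,x_rQ_r(\mathbf u)-P_r(\mathbf u)\big]:\Big(\prod_{j=1}^rQ_j\Big)^\infty,$$ and let $\mathcal C$ be a characteristic set of $\mathcal P$ under the elimination ranking $x_1\prec\cdots\prec x_r\prec u_1\prec\cdots\prec u_n$. Let $d$ be the number of $x_j$ ($1\le j\le r$) that are not leading variables of $\mathcal C$. Since $\mathcal P$ has differential dimension $n$, exactly $d$ of the variables $u_1,\ldots,u_n$ are leading variables of $\mathcal C$; for $i=1,\ldots,d$ let $l_i\ge 1$ be the number of elements of $\mathcal C$ whose leading variable is the $i$-th of these $d$ variables. Then a necessary and sufficient condition for $\mathcal G$ to have a Lüroth generator (i.e. an element $v\in\mathcal G$ with $\mathcal G=\mathcal F\langle v\rangle$) is that $d=1$ and $l_1=1$.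
   Context: A $\Delta$-field is a field endowed with a finite set $\Delta=\{\delta_1,\ldots,\delta_m\}$ of pairwise commuting derivations. $\mathbb N$ includes $0$; $\Theta=\{\delta_1^{e_1}\cdots\delta_m^{e_m}:e_i\in\mathbb N\}$. Elements $u_1,\ldots,u_n$ are $\Delta$-indeterminates over $\mathcal F$ if $(\theta u_j)_{\theta\in\Theta,\,1\le j\le n}$ is algebraically independent over $\mathcal F$. $\mathcal F\{y_1,\ldots,y_N\}=\mathcal F[\theta y_j:\theta\in\Theta,\,1\le j\le N]$ is the $\Delta$-polynomial ring, and $\mathcal F\langle a_1,\ldots,a_k\rangle$ denotes the $\Delta$-field generated over $\mathcal F$ by $a_1,\dots,a_k$. A $\Delta$-ideal is an ideal closed under the $\delta_i$; $[S]$ is the $\Delta$-ideal generated by $S$; $I:h^\infty=\{p: h^kp\in I\text{ for some }k\in\mathbb N\}$. A ranking is a total order on the set of derivatives $\theta y_j$ such that $\delta_k\theta y_j>\theta y_j$ and $\theta_1y_i>\theta_2y_j\Rightarrow\delta_k\theta_1y_i>\delta_k\theta_2y_j$. The elimination ranking $w_1\prec\cdots\prec w_N$ is the ranking in which $\theta_1w_i<\theta_2w_j$ for all $\theta_1,\theta_2\in\Theta$ whenever $i<j$, and, on the derivatives of each single variable $w_j$, $\prod_i\delta_i^{k_i}(w_j)<\prod_i\delta_i^{l_i}(w_j)$ iff $(\sum_ik_i,k_1,\ldots,k_m)<_{lex}(\sum_il_i,l_1,\ldots,l_m)$. Given a ranking and a $\Delta$-polynomial $f\notin\mathcal F$, its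 leader is the greatest derivative $\theta y_j$ effectively appearing in $f$, and $y_j$ is then the leading variable of $f$. A $\Delta$-polynomial $g$ is reduced w.r.t. $f$, where $f$ has leader $\theta y_j$ and degree $d_0$ in it, if no proper derivative of $\theta y_j$ appears in $g$ and $\deg(g,\theta y_j)<d_0$. A set of $\Delta$-polynomials is autoreduced if each element is reduced w.r.t. every other element (such sets are finite). A characteristic set of a $\Delta$-ideal $\mathcal J$ is an autoreduced set $\mathcal C\subset\mathcal J$ such that $\mathcal J$ contains no nonzero element reduced w.r.t. all elements of $\mathcal C$. A variable is a leading variable of $\mathcal C$ if it is the leading variable of some element of $\mathcal C$. The differential dimension of a prime $\Delta$-ideal equals the number of variables that are not leading variables of a characteristic set of it. *)

theory Defs
  imports Complex_Main "HOL-Library.Poly_Mapping" "HOL-Library.Cardinality"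
begin

section \<open>Differential rings and fields\<close>

definition derivation :: "('a::comm_ring_1 \<Rightarrow> 'a) \<Rightarrow> bool" where
  "derivation D \<longleftrightarrow>
     (\<forall>a b. D (a + b) = D a + D b) \<and> (\<forall>a b. D (a * b) = D a * b + a * D b)"

text \<open>The derivations \<open>\<delta>\<^sub>1, \<dots>, \<delta>\<^sub>m\<close> form a family indexed by a finite linearly ordered type of
  cardinality \<open>m\<close>; the order of the indices is used by the ranking below.\<close>

definition delta_ring :: "('m \<Rightarrow> 'a::comm_ring_1 \<Rightarrow> 'a) \<Rightarrow> bool" where
  "delta_ring D \<longleftrightarrow> (\<forall>i. derivation (D i)) \<and> (\<forall>i j a. D i (D j a) = D j (D i a))"

abbreviation delta_field :: "('m \<Rightarrow> 'a::field \<Rightarrow> 'a) \<Rightarrow> bool" where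
  "delta_field D \<equiv> delta_ring D"

definition delta_field_extension ::
  "('m \<Rightarrow> 'f::field \<Rightarrow> 'f) \<Rightarrow> ('f \<Rightarrow> 'k::field) \<Rightarrow> ('m \<Rightarrow> 'k \<Rightarrow> 'k) \<Rightarrow> bool" where
  "delta_field_extension d \<iota> D \<longleftrightarrow>
     delta_field d \<and> delta_field D \<and> \<iota> 1 = 1 \<and>
     (\<forall>a b. \<iota> (a + b) = \<iota> a + \<iota> b) \<and> (\<forall>a b. \<iota> (a * b) = \<iota> a * \<iota> b) \<and>
     (\<forall>i a. \<iota> (d i a) = D i (\<iota> a))"

text \<open>An exponent vector \<open>e\<close> stands for the operator \<open>\<theta> = \<delta>\<^sub>1\<^bsup>e\<^sub>1\<^esup> \<cdots> \<delta>\<^sub>m\<^bsup>e\<^sub>m\<^esup>\<close>.\<close>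

definition theta :: "('m::{finite,linorder} \<Rightarrow> 'a \<Rightarrow> 'a) \<Rightarrow> ('m \<Rightarrow> nat) \<Rightarrow> 'a \<Rightarrow> 'a" where
  "theta D e a = foldr (\<lambda>i. D i ^^ e i) (sorted_list_of_set UNIV) a"

definition delta_subfield :: "('m \<Rightarrow> 'k::field \<Rightarrow> 'k) \<Rightarrow> 'k set \<Rightarrow> bool" where
  "delta_subfield D K \<longleftrightarrow>
     1 \<in> K \<and> (\<forall>a\<in>K. \<forall>b\<in>K. a - b \<in> K) \<and> (\<forall>a\<in>K. \<forall>b\<in>K. a * b \<in> K) \<and>
     (\<forall>a\<in>K. inverse a \<in> K) \<and> (\<forall>i. \<forall>a\<in>K. D i a \<in> K)"

definition delta_field_gen ::
  "('f \<Rightarrow> 'k::field) \<Rightarrow> ('m \<Rightarrow> 'k \<Rightarrow> 'k) \<Rightarrow> 'k set \<Rightarrow> 'k set" where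
  "delta_field_gen \<iota> D A = (\<lambda>K. delta_subfield D K \<and> range \<iota> \<subseteq> K) hull A"


section \<open>Differential polynomials\<close>

text \<open>The pair \<open>(v, e)\<close> stands for the derivative \<open>\<theta> v\<close> with \<open>\<theta>\<close> given by the exponent
  vector \<open>e\<close>; \<open>('m, 'v, 'f) dpoly\<close> is the ring of polynomials in these derivatives.\<close>

type_synonym ('m, 'v) deriv = "'v \<times> ('m \<Rightarrow> nat)"

type_synonym ('m, 'v, 'f) dpoly = "(('m, 'v) deriv \<Rightarrow>\<^sub>0 nat) \<Rightarrow>\<^sub>0 'f"

definition dconst :: "'f::zero \<Rightarrow> ('m, 'v, 'f) dpoly" where
  "dconst c = Poly_Mapping.single 0 c"

definition dvar :: "'v \<Rightarrow> ('m, 'v, 'f::zero_neq_one) dpoly" where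
  "dvar v = Poly_Mapping.single (Poly_Mapping.single (v, \<lambda>_. 0) 1) 1"

definition deriv_shift :: "'m \<Rightarrow> ('m, 'v) deriv \<Rightarrow> ('m, 'v) deriv" where
  "deriv_shift i w = (fst w, (snd w)(i := Suc (snd w i)))"

text \<open>The derivation \<open>\<delta>\<^sub>i\<close> of the \<open>\<Delta>\<close>-polynomial ring: on a term \<open>c t\<close> it is
  \<open>\<delta>\<^sub>i(c) t + c (\<Sum>w. deg(t, w) (t / w) \<delta>\<^sub>i w)\<close>.\<close>

definition dpoly_deriv ::
  "('m \<Rightarrow> 'f::comm_ring_1 \<Rightarrow> 'f) \<Rightarrow> 'm \<Rightarrow> ('m, 'v, 'f) dpoly \<Rightarrow> ('m, 'v, 'f) dpoly" where
  "dpoly_deriv d i p =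
     (\<Sum>t\<in>Poly_Mapping.keys p.
        Poly_Mapping.single t (d i (Poly_Mapping.lookup p t)) +
        (\<Sum>w\<in>Poly_Mapping.keys t.
           Poly_Mapping.single
             (t - Poly_Mapping.single w 1 + Poly_Mapping.single (deriv_shift i w) 1)
             (of_nat (Poly_Mapping.lookup t w) * Poly_Mapping.lookup p t)))"

text \<open>\<open>dpoly_eval \<iota> D a p\<close> is \<open>p(a)\<close>, for a point \<open>a\<close> in a \<open>\<Delta>\<close>-ring \<open>(R, D)\<close> over the
  coefficient field via \<open>\<iota>\<close>.\<close>

definition dpoly_eval ::
  "('f::zero \<Rightarrow> 'a::comm_ring_1) \<Rightarrow> ('m::{finite,linorder} \<Rightarrow> 'a \<Rightarrow> 'a) \<Rightarrow> ('v \<Rightarrow> 'a) \<Rightarrow>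
    ('m, 'v, 'f) dpoly \<Rightarrow> 'a" where
  "dpoly_eval \<iota> D a p =
     (\<Sum>t\<in>Poly_Mapping.keys p.
        \<iota> (Poly_Mapping.lookup p t) *
        (\<Prod>w\<in>Poly_Mapping.keys t. theta D (snd w) (a (fst w)) ^ Poly_Mapping.lookup t w))"

definition delta_indeterminates ::
  "('f::field \<Rightarrow> 'k::field) \<Rightarrow> ('m::{finite,linorder} \<Rightarrow> 'k \<Rightarrow> 'k) \<Rightarrow> ('n \<Rightarrow> 'k) \<Rightarrow> bool" where
  "delta_indeterminates \<iota> D u \<longleftrightarrow>
     (\<forall>p :: ('m, 'n, 'f) dpoly. dpoly_eval \<iota> D u p = 0 \<longrightarrow> p = 0)"

text \<open>The library constant \<open>coprime\<close> lives in a class with a division operation, of which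
  \<open>dpoly\<close> is not an instance.\<close>

definition relatively_prime :: "'a::comm_semiring_1 \<Rightarrow> 'a \<Rightarrow> bool" where
  "relatively_prime a b \<longleftrightarrow> (\<forall>c. c dvd a \<longrightarrow> c dvd b \<longrightarrow> c dvd 1)"

definition delta_ideal :: "('m \<Rightarrow> 'a::comm_ring_1 \<Rightarrow> 'a) \<Rightarrow> 'a set \<Rightarrow> bool" where
  "delta_ideal D I \<longleftrightarrow>
     0 \<in> I \<and> (\<forall>a\<in>I. \<forall>b\<in>I. a + b \<in> I) \<and> (\<forall>c. \<forall>a\<in>I. c * a \<in> I) \<and>
     (\<forall>i. \<forall>a\<in>I. D i a \<in> I)"

definition delta_ideal_gen :: "('m \<Rightarrow> 'a::comm_ring_1 \<Rightarrow> 'a) \<Rightarrow> 'a set \<Rightarrow> 'a set" where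
  "delta_ideal_gen D S = delta_ideal D hull S"

definition saturation :: "'a::comm_ring_1 set \<Rightarrow> 'a \<Rightarrow> 'a set" where
  "saturation I h = {p. \<exists>k. h ^ k * p \<in> I}"


section \<open>Rankings and characteristic sets\<close>

text \<open>In this section \<open>lt\<close> is the strict order of a ranking.\<close>

definition ranking :: "(('m, 'v) deriv \<Rightarrow> ('m, 'v) deriv \<Rightarrow> bool) \<Rightarrow> bool" where
  "ranking lt \<longleftrightarrow>
     (\<forall>w. \<not> lt w w) \<and> (\<forall>w w' w''. lt w w' \<longrightarrow> lt w' w'' \<longrightarrow> lt w w'') \<and>
     (\<forall>w w'. w \<noteq> w' \<longrightarrow> lt w w' \<or> lt w' w) \<and>
     (\<forall>i w. lt w (deriv_shift i w)) \<and>
     (\<forall>i w w'. lt w w' \<longrightarrow> lt (deriv_shift i w) (deriv_shift i w'))"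

definition derivs :: "('m, 'v, 'f::zero) dpoly \<Rightarrow> ('m, 'v) deriv set" where
  "derivs f = (\<Union>t\<in>Poly_Mapping.keys f. Poly_Mapping.keys t)"

definition leader ::
  "(('m, 'v) deriv \<Rightarrow> ('m, 'v) deriv \<Rightarrow> bool) \<Rightarrow> ('m, 'v, 'f::zero) dpoly \<Rightarrow> ('m, 'v) deriv" where
  "leader lt f = (THE w. w \<in> derivs f \<and> (\<forall>w'\<in>derivs f. w' \<noteq> w \<longrightarrow> lt w' w))"

definition leading_var ::
  "(('m, 'v) deriv \<Rightarrow> ('m, 'v) deriv \<Rightarrow> bool) \<Rightarrow> ('m, 'v, 'f::zero) dpoly \<Rightarrow> 'v" where
  "leading_var lt f = fst (leader lt f)"

definition deg_in :: "('m, 'v, 'f::zero) dpoly \<Rightarrow> ('m, 'v) deriv \<Rightarrow> nat" where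
  "deg_in f w = Max (insert 0 ((\<lambda>t. Poly_Mapping.lookup t w) ` Poly_Mapping.keys f))"

text \<open>On exponent vectors, \<open><\<close> is the strict part of the componentwise order.\<close>

definition proper_derivative :: "('m, 'v) deriv \<Rightarrow> ('m, 'v) deriv \<Rightarrow> bool" where
  "proper_derivative w' w \<longleftrightarrow> fst w' = fst w \<and> snd w < snd w'"

definition reduced_wrt ::
  "(('m, 'v) deriv \<Rightarrow> ('m, 'v) deriv \<Rightarrow> bool) \<Rightarrow>
    ('m, 'v, 'f::zero) dpoly \<Rightarrow> ('m, 'v, 'f) dpoly \<Rightarrow> bool" where
  "reduced_wrt lt g f \<longleftrightarrow>
     (\<forall>w\<in>derivs g. \<not> proper_derivative w (leader lt f)) \<and>
     deg_in g (leader lt f) < deg_in f (leader lt f)"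

definition autoreduced ::
  "(('m, 'v) deriv \<Rightarrow> ('m, 'v) deriv \<Rightarrow> bool) \<Rightarrow> ('m, 'v, 'f::zero) dpoly set \<Rightarrow> bool" where
  "autoreduced lt C \<longleftrightarrow>
     (\<forall>f\<in>C. f \<notin> range dconst) \<and> (\<forall>f\<in>C. \<forall>g\<in>C. g \<noteq> f \<longrightarrow> reduced_wrt lt g f)"

definition characteristic_set ::
  "(('m, 'v) deriv \<Rightarrow> ('m, 'v) deriv \<Rightarrow> bool) \<Rightarrow>
    ('m, 'v, 'f::zero) dpoly set \<Rightarrow> ('m, 'v, 'f) dpoly set \<Rightarrow> bool" where
  "characteristic_set lt J C \<longleftrightarrow>
     C \<subseteq> J \<and> autoreduced lt C \<and> \<not> (\<exists>g\<in>J. g \<noteq> 0 \<and> (\<forall>f\<in>C. reduced_wrt lt g f))"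

datatype ('r, 'n) xu = X 'r | U 'n

fun xu_less :: "('r::linorder, 'n::linorder) xu \<Rightarrow> ('r, 'n) xu \<Rightarrow> bool" where
  "xu_less (X j) (X k) \<longleftrightarrow> j < k"
| "xu_less (X j) (U i) \<longleftrightarrow> True"
| "xu_less (U i) (X j) \<longleftrightarrow> False"
| "xu_less (U i) (U k) \<longleftrightarrow> i < k"

definition theta_less :: "('m::{finite,linorder} \<Rightarrow> nat) \<Rightarrow> ('m \<Rightarrow> nat) \<Rightarrow> bool" where
  "theta_less k l \<longleftrightarrow>
     sum k UNIV < sum l UNIV \<or>
     sum k UNIV = sum l UNIV \<and> (\<exists>i. k i < l i \<and> (\<forall>j<i. k j = l j))"

definition elim_less ::
  "('m::{finite,linorder}, ('r::linorder, 'n::linorder) xu) deriv \<Rightarrow> ('m, ('r, 'n) xu) deriv \<Rightarrow> bool"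
  where
  "elim_less w w' \<longleftrightarrow>
     xu_less (fst w) (fst w') \<or> fst w = fst w' \<and> theta_less (snd w) (snd w')"

lemma ranking_elim_less:
  "ranking (elim_less :: ('m::{finite,linorder}, ('r::linorder, 'n::linorder) xu) deriv \<Rightarrow> _)"
proof -
  have xu_irrefl: "\<not> xu_less v v" for v :: "('r, 'n) xu"
    by (cases v) auto
  have xu_trans: "xu_less v v''" if "xu_less v v'" "xu_less v' v''" for v v' v'' :: "('r, 'n) xu"
    using that by (cases v; cases v'; cases v'') auto
  have xu_total: "xu_less v v' \<or> xu_less v' v" if "v \<noteq> v'" for v v' :: "('r, 'n) xu"
    using that by (cases v; cases v') auto
  have th_irrefl: "\<not> theta_less k k" for k :: "'m \<Rightarrow> nat"
    by (auto simp: theta_less_def)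
  have lex_trans: "\<exists>i. k i < q i \<and> (\<forall>j<i. k j = q j)"
    if "k i < l i" "\<forall>j<i. k j = l j" "l i' < q i'" "\<forall>j<i'. l j = q j"
    for k l q :: "'m \<Rightarrow> nat" and i i'
  proof (rule exI[of _ "min i i'"])
    show "k (min i i') < q (min i i') \<and> (\<forall>j<min i i'. k j = q j)"
      using that by (cases i i' rule: linorder_cases) (auto simp: min_def)
  qed
  have th_trans: "theta_less k q" if "theta_less k l" "theta_less l q" for k l q :: "'m \<Rightarrow> nat"
  proof -
    have "sum k UNIV \<le> sum l UNIV" "sum l UNIV \<le> sum q UNIV"
      using that by (auto simp: theta_less_def)
    moreover have "\<exists>i. k i < q i \<and> (\<forall>j<i. k j = q j)"
      if "sum k UNIV = sum l UNIV" "sum l UNIV = sum q UNIV"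
      using that \<open>theta_less k l\<close> \<open>theta_less l q\<close> lex_trans[of k _ l _ q]
      by (fastforce simp: theta_less_def)
    ultimately show ?thesis
      unfolding theta_less_def
      by (cases "sum k UNIV = sum l UNIV"; cases "sum l UNIV = sum q UNIV") simp_all
  qed
  have th_total: "theta_less k l \<or> theta_less l k" if "k \<noteq> l" for k l :: "'m \<Rightarrow> nat"
  proof -
    define i where "i = Min {i. k i \<noteq> l i}"
    have ne: "{i. k i \<noteq> l i} \<noteq> {}" using that by auto
    have "k i \<noteq> l i" using Min_in[OF _ ne] unfolding i_def by simp
    moreover have "k j = l j" if "j < i" for j
    proof (rule ccontr)
      assume "k j \<noteq> l j"
      then have "i \<le> j" unfolding i_def by (intro Min_le) auto
      with that show False by simp
    qed
    ultimately have "(k i < l i \<and> (\<forall>j<i. k j = l j)) \<or> (l i < k i \<and> (\<forall>j<i. l j = k j))"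
      by auto
    then show ?thesis
      unfolding theta_less_def using linorder_neqE_nat by blast
  qed
  have sum_upd: "sum (k(i := Suc (k i))) UNIV = Suc (sum k UNIV)" for k :: "'m \<Rightarrow> nat" and i
  proof -
    have "sum (k(i := Suc (k i))) (UNIV - {i}) = sum k (UNIV - {i})"
      by (rule sum.cong) auto
    then show ?thesis
      using sum.remove[of UNIV i k] sum.remove[of UNIV i "k(i := Suc (k i))"] by simp
  qed
  have th_shift: "theta_less (k(i := Suc (k i))) (l(i := Suc (l i)))" if "theta_less k l"
    for k l :: "'m \<Rightarrow> nat" and i
    using that unfolding theta_less_def sum_upd by (elim disjE conjE exE) fastforce+
  show ?thesis
    unfolding ranking_def
  proof (intro conjI allI impI)
    fix w w' w'' :: "('m, ('r, 'n) xu) deriv"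
    assume "elim_less w w'" "elim_less w' w''"
    then show "elim_less w w''"
      unfolding elim_less_def by (auto intro: xu_trans th_trans)
  next
    fix w w' :: "('m, ('r, 'n) xu) deriv"
    assume "w \<noteq> w'"
    then show "elim_less w w' \<or> elim_less w' w"
      unfolding elim_less_def
      using xu_total[of "fst w" "fst w'"] th_total[of "snd w" "snd w'"] by (auto simp: prod_eq_iff)
  next
    fix i and w :: "('m, ('r, 'n) xu) deriv"
    show "elim_less w (deriv_shift i w)"
      unfolding elim_less_def deriv_shift_def theta_less_def fst_conv snd_conv sum_upd by simp
  next
    fix i and w w' :: "('m, ('r, 'n) xu) deriv"
    assume "elim_less w w'"
    then show "elim_less (deriv_shift i w) (deriv_shift i w')"
      unfolding elim_less_def deriv_shift_def by (auto intro: th_shift)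
  qed (auto simp: elim_less_def xu_irrefl th_irrefl)
qed

end

theory Submission
  imports Defs "HOL-Computational_Algebra.Computational_Algebra"
begin

text \<open>
  Let \<open>G\<close> be the field generated by the fractions \<open>w\<close>. Call a derivative \<open>t\<close> of \<open>u\<close> and an \<open>e \<ge> 1\<close> a
  leading pair of \<open>G\<close> if some polynomial \<open>A\<close> over \<open>G\<close> in derivatives \<open>\<le> t\<close>, of degree \<open>e\<close> in \<open>t\<close>, vanishes
  at \<open>u\<close>, and every polynomial over \<open>G\<close> that vanishes at \<open>u\<close> and is reduced with respect to \<open>(t, e)\<close>
  is zero (\<open>Alg\<close> and \<open>Red\<close> below).

  If \<open>G = F\<langle>v\<rangle>\<close>, take for \<open>t\<close> the greatest derivative occurring in \<open>v = P(u)/Q(u)\<close>, written with minimal degree \<open>e\<close> in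
  \<open>t\<close>, and \<open>A = P(y) - v Q(y)\<close>. Conversely, given a leading pair, choose \<open>A\<close> of minimal support with one
  coefficient \<open>1\<close>: its coefficients involve no derivative beyond \<open>t\<close>. Specialize the indeterminates of
  \<open>A\<close> other than \<open>t\<close> to integers; by Gauss's lemma the quotient \<open>v\<close> of two coefficients of the resulting
  polynomial in \<open>t\<close> is a fraction of degree at most \<open>e\<close> in \<open>t\<close>. So \<open>F\<langle>v\<rangle>\<close> and \<open>G\<close> have the same leading pair, and reducing numerator and
  denominator of an element of \<open>G\<close> modulo \<open>P(y) - v Q(y)\<close> gives \<open>G = F\<langle>v\<rangle>\<close>.

  The ideal is the kernel of evaluation at \<open>(w, u)\<close>. Clearing denominators and reducing modulo the
  elements of \<open>C\<close> led by some \<open>x\<^sub>j\<close> shows that \<open>G\<close> has a leading pair iff exactly one element of \<open>C\<close> is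
  led by some \<open>u\<^sub>i\<close>. Finally \<open>d\<close> is the number of leading \<open>u\<^sub>i\<close>, because exactly \<open>n\<close> variables are not
  leading: more than \<open>n\<close> would be algebraically dependent by counting monomials, while the gradients of
  the derivatives that are not derivatives of leaders span those of all derivatives of \<open>u\<close>.
\<close>

subsection \<open>Polynomials in derivatives\<close>

text \<open>Leading pairs serve to compare fields: for G' inside G, a leading polynomial with
  coefficients already in G' forces G = G', since a reduced relation over G is zero and thus
  expresses elements of G by coefficients of remainders over G'. The obstacle is that the
  coefficients of A might involve derivatives of u far beyond t; then the degree in t would say
  nothing about them. This is excluded by moving twice in the same direction: if \<tau> is the
  greatest such derivative, a relation that produces \<tau> is a combination of derivatives of A,
  among them \<theta> A with \<theta> t = \<tau>, and the partial derivative of its coefficients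
  with respect to \<theta> \<tau> isolates the one of A with respect to \<tau>, which minimal
  support forbids to vanish at u. Such arguments rest on one commutation rule between the \<delta>'s
  and partial derivatives, treated once in \<open>leading_operator\<close>. The degree bound then
  comes from the two-sided polynomial of the classical proof of Lueroth's theorem: in \<Sum> m(u)
  b_m(y), over the monomials m of A, the degree in the value of t is visible from the m.\<close>

abbreviation "lk \<equiv> Poly_Mapping.lookup"
abbreviation "ks \<equiv> Poly_Mapping.keys"
abbreviation "sg \<equiv> Poly_Mapping.single"

definition subring :: "'a::comm_ring_1 set \<Rightarrow> bool" where
  "subring R \<longleftrightarrow> 0 \<in> R \<and> 1 \<in> R \<and> (\<forall>a\<in>R. - a \<in> R) \<and> (\<forall>a\<in>R. \<forall>b\<in>R. a + b \<in> R \<and> a * b \<in> R)"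

text \<open>Homomorphisms and derivations are relative to a subset: \<Psi> in
  \<open>small_generator\<close> is a homomorphism only on the values of polynomials over F, and
  \<open>pd\<close> is a derivation only on \<open>FU\<close>.\<close>

definition rhom_on :: "'a::comm_ring_1 set \<Rightarrow> ('a \<Rightarrow> 'b::comm_ring_1) \<Rightarrow> bool" where
  "rhom_on R \<phi> \<longleftrightarrow> \<phi> 1 = 1 \<and> (\<forall>a\<in>R. \<forall>b\<in>R. \<phi> (a + b) = \<phi> a + \<phi> b \<and> \<phi> (a * b) = \<phi> a * \<phi> b)"

definition deriv_on :: "'a::comm_ring_1 set \<Rightarrow> ('a \<Rightarrow> 'a) \<Rightarrow> bool" where
  "deriv_on R D \<longleftrightarrow> (\<forall>a\<in>R. \<forall>b\<in>R. D (a + b) = D a + D b \<and> D (a * b) = D a * b + a * D b)"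

definition over :: "'a::zero set \<Rightarrow> ('m, 'v, 'a) dpoly set" where
  "over R = {p. \<forall>t. lk p t \<in> R}"

definition dv :: "('m, 'v) deriv \<Rightarrow> ('m, 'v, 'a::zero_neq_one) dpoly" where
  "dv w = sg (sg w 1) 1"

definition mono_val :: "(('m, 'v) deriv \<Rightarrow>\<^sub>0 nat) \<Rightarrow> (('m, 'v) deriv \<Rightarrow> 'b::comm_ring_1) \<Rightarrow> 'b" where
  "mono_val t \<rho> = (\<Prod>w\<in>ks t. \<rho> w ^ lk t w)"

text \<open>The derivatives receive unrelated values. This covers evaluation at a differential point
  as well as maps that ignore the \<delta>'s: specialization to natural numbers, \<open>emb\<close>,
  \<open>psub\<close>, and the passage \<open>ph\<close> to univariate polynomials.\<close>

definition peval :: "('a::zero \<Rightarrow> 'b::comm_ring_1) \<Rightarrow> (('m, 'v) deriv \<Rightarrow> 'b) \<Rightarrow> ('m, 'v, 'a) dpoly \<Rightarrow> 'b" where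
  "peval \<phi> \<rho> p = (\<Sum>t\<in>ks p. \<phi> (lk p t) * mono_val t \<rho>)"

lemma dpoly_eval_eq_peval: "dpoly_eval \<iota> D a = peval \<iota> (\<lambda>w. theta D (snd w) (a (fst w)))"
  by (simp add: fun_eq_iff dpoly_eval_def peval_def mono_val_def)

lemma peval_0 [simp]: "peval \<phi> \<rho> 0 = 0" by (simp add: peval_def)

lemma subringD:
  assumes "subring R"
  shows "0 \<in> R" "1 \<in> R" "a \<in> R \<Longrightarrow> - a \<in> R" "a \<in> R \<Longrightarrow> b \<in> R \<Longrightarrow> a + b \<in> R"
    "a \<in> R \<Longrightarrow> b \<in> R \<Longrightarrow> a * b \<in> R" "a \<in> R \<Longrightarrow> b \<in> R \<Longrightarrow> a - b \<in> R"
  using assms unfolding subring_def by (auto simp: diff_conv_add_uminus simp del: add_uminus_conv_diff)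

lemma subring_sum: "subring R \<Longrightarrow> (\<And>i. i \<in> I \<Longrightarrow> f i \<in> R) \<Longrightarrow> sum f I \<in> R"
  by (induction I rule: infinite_finite_induct) (auto intro: subringD)

lemma subring_prod: "subring R \<Longrightarrow> (\<And>i. i \<in> I \<Longrightarrow> f i \<in> R) \<Longrightarrow> prod f I \<in> R"
  by (induction I rule: infinite_finite_induct) (auto intro: subringD)

lemma subring_power: "subring R \<Longrightarrow> a \<in> R \<Longrightarrow> a ^ n \<in> R"
  by (induction n) (auto intro: subringD)

lemma subring_of_nat: "subring R \<Longrightarrow> of_nat n \<in> R"
  by (induction n) (auto intro: subringD)

lemma subring_UNIV [simp]: "subring UNIV"
  by (simp add: subring_def)

lemma rhom_onD:
  assumes "rhom_on R \<phi>"
  shows "\<phi> 1 = 1" "a \<in> R \<Longrightarrow> b \<in> R \<Longrightarrow> \<phi> (a + b) = \<phi> a + \<phi> b"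
    "a \<in> R \<Longrightarrow> b \<in> R \<Longrightarrow> \<phi> (a * b) = \<phi> a * \<phi> b"
  using assms by (auto simp: rhom_on_def)

lemma rhom_on_0: "subring R \<Longrightarrow> rhom_on R \<phi> \<Longrightarrow> \<phi> 0 = 0"
  using rhom_onD(2)[of R \<phi> 0 0] by (auto intro: subringD)

lemma rhom_on_uminus: "subring R \<Longrightarrow> rhom_on R \<phi> \<Longrightarrow> a \<in> R \<Longrightarrow> \<phi> (- a) = - \<phi> a"
  using rhom_onD(2)[of R \<phi> a "- a"] rhom_on_0[of R \<phi>] subringD(3)[of R a]
  by (simp add: eq_neg_iff_add_eq_0 add.commute)

lemma rhom_on_id [simp]: "rhom_on R (\<lambda>x. x)"
  by (simp add: rhom_on_def)

lemma deriv_onD: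
  assumes "deriv_on R D"
  shows "a \<in> R \<Longrightarrow> b \<in> R \<Longrightarrow> D (a + b) = D a + D b"
    "a \<in> R \<Longrightarrow> b \<in> R \<Longrightarrow> D (a * b) = D a * b + a * D b"
  using assms by (auto simp: deriv_on_def)

lemma deriv_on_0: "subring R \<Longrightarrow> deriv_on R D \<Longrightarrow> D 0 = 0"
  using deriv_onD(1)[of R D 0 0] by (auto intro: subringD)

lemma deriv_on_1: "subring R \<Longrightarrow> deriv_on R D \<Longrightarrow> D 1 = 0"
  using deriv_onD(2)[of R D 1 1] by (auto intro: subringD)

lemma deriv_on_uminus: "subring R \<Longrightarrow> deriv_on R D \<Longrightarrow> a \<in> R \<Longrightarrow> D (- a) = - D a"
  using deriv_onD(1)[of R D a "- a"] deriv_on_0[of R D] subringD(3)[of R a]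
  by (simp add: eq_neg_iff_add_eq_0 add.commute)

lemma deriv_on_diff: "subring R \<Longrightarrow> deriv_on R D \<Longrightarrow> a \<in> R \<Longrightarrow> b \<in> R \<Longrightarrow> D (a - b) = D a - D b"
  using deriv_onD(1)[of R D a "- b"] deriv_on_uminus[of R D b] subringD(3)[of R b] by simp

lemma deriv_on_sum:
  assumes "subring R" "deriv_on R D" "\<And>i. i \<in> I \<Longrightarrow> f i \<in> R"
  shows "D (sum f I) = (\<Sum>i\<in>I. D (f i))"
  using assms(3)
proof (induction I rule: infinite_finite_induct)
  case (insert i I)
  then have "f i \<in> R" "sum f I \<in> R" by (auto intro: subring_sum assms)
  then show ?case using insert deriv_onD(1)[OF assms(2), of "f i" "sum f I"] by simp
qed (use deriv_on_0 assms in auto)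

lemma rhom_on_sum:
  assumes "subring R" "rhom_on R D" "\<And>i. i \<in> I \<Longrightarrow> f i \<in> R"
  shows "D (sum f I) = (\<Sum>i\<in>I. D (f i))"
  using assms(3)
proof (induction I rule: infinite_finite_induct)
  case (insert i I)
  then have "f i \<in> R" "sum f I \<in> R" by (auto intro: subring_sum assms)
  then show ?case using insert rhom_onD(2)[OF assms(2), of "f i" "sum f I"] by simp
qed (use rhom_on_0 assms in auto)

lemma single_mult: "sg s a * sg t (b::'a::comm_ring_1) = sg (s + t) (a * b)"
  by (rule mult_single)

lemma sum_single: "p = (\<Sum>t\<in>ks p. sg t (lk p t))"
proof (rule poly_mapping_eqI)
  fix k
  show "lk p k = lk (\<Sum>t\<in>ks p. sg t (lk p t)) k"
    by (simp add: lookup_sum lookup_single when_def sum.delta' in_keys_iff)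
qed

lemma over_0 [simp]: "subring R \<Longrightarrow> 0 \<in> over R" by (simp add: over_def subringD)
lemma over_single: "subring R \<Longrightarrow> c \<in> R \<Longrightarrow> sg t c \<in> over R"
  by (auto simp: over_def lookup_single when_def intro: subringD)
lemma over_1 [simp]: "subring R \<Longrightarrow> 1 \<in> over R"
  using over_single[of R 1 0] subringD[of R] by simp
lemma over_dconst: "subring R \<Longrightarrow> c \<in> R \<Longrightarrow> dconst c \<in> over R"
  by (simp add: over_single dconst_def)
lemma over_dv: "subring R \<Longrightarrow> dv w \<in> over R"
  by (simp add: over_single dv_def subringD)
lemma over_UNIV [simp]: "p \<in> over UNIV" by (simp add: over_def)
lemma over_mono: "p \<in> over R \<Longrightarrow> R \<subseteq> S \<Longrightarrow> p \<in> over S" by (auto simp: over_def)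
lemma overD: "p \<in> over R \<Longrightarrow> lk p t \<in> R" by (simp add: over_def)

lemma subring_over:
  assumes "subring R" shows "subring (over R :: ('m, 'v, 'a::comm_ring_1) dpoly set)"
  unfolding subring_def
proof (intro conjI ballI)
  fix p q :: "('m, 'v, 'a) dpoly" assume p: "p \<in> over R" and q: "q \<in> over R"
  show "p + q \<in> over R" using p q assms by (auto simp: over_def lookup_add intro: subringD)
  have "p * q = (\<Sum>s\<in>ks p. \<Sum>t\<in>ks q. sg (s + t) (lk p s * lk q t))"
    by (subst (1) sum_single[of p], subst (1) sum_single[of q]) (simp add: sum_product single_mult)
  moreover have "lk (\<Sum>s\<in>ks p. \<Sum>t\<in>ks q. sg (s + t) (lk p s * lk q t)) k \<in> R" for k
    unfolding lookup_sum using p q assms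
    by (intro subring_sum) (auto simp: over_def lookup_single when_def intro: subringD)
  ultimately show "p * q \<in> over R" by (simp add: over_def)
qed (use assms in \<open>auto simp: over_def lookup_one when_def intro: subringD\<close>)

lemmas overI = subringD[OF subring_over] subring_sum[OF subring_over] subring_power[OF subring_over]
  subring_prod[OF subring_over] over_dconst over_dv

lemma dconst_0 [simp]: "dconst 0 = 0" by (simp add: dconst_def)
lemma dconst_1 [simp]: "dconst 1 = 1" by (simp add: dconst_def)
lemma dconst_add: "dconst (a + b) = dconst a + dconst (b::'a::comm_ring_1)"
  by (simp add: dconst_def single_add)
lemma dconst_mult: "dconst (a * b) = dconst a * dconst (b::'a::comm_ring_1)"
  by (simp add: dconst_def single_mult)
lemma dconst_eq_iff [simp]: "dconst a = dconst b \<longleftrightarrow> a = b"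
  by (metis dconst_def lookup_single_eq)
lemma dconst_eq_0 [simp]: "dconst a = 0 \<longleftrightarrow> a = 0"
  using dconst_eq_iff[of a 0] by simp
lemma rhom_dconst: "rhom_on R (dconst :: 'a::comm_ring_1 \<Rightarrow> _)"
  by (simp add: rhom_on_def dconst_add dconst_mult)
lemma lookup_dconst: "lk (dconst c) t = (if t = 0 then c else 0)"
  by (simp add: dconst_def lookup_single when_def)

lemma lookup_dconst_mult: "lk (dconst c * p) t = c * lk p (t :: _ \<Rightarrow>\<^sub>0 nat)" for p :: "('m,'v,'a::comm_ring_1) dpoly"
proof -
  have "dconst c * p = (\<Sum>s\<in>ks p. sg s (c * lk p s))"
    by (subst (1) sum_single[of p]) (simp add: sum_distrib_left dconst_def single_mult)
  then show ?thesis
    by (simp add: lookup_sum lookup_single when_def sum.delta in_keys_iff)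
qed

lemma single_eq_prod_dv:
  fixes t :: "('m, 'v) deriv \<Rightarrow>\<^sub>0 nat"
  shows "sg t (c::'a::comm_ring_1) = dconst c * (\<Prod>w\<in>ks t. dv w ^ lk t w)"
proof -
  have pw: "dv w ^ n = sg (sg w n) (1::'a)" for w :: "('m,'v) deriv" and n
    by (induction n) (auto simp: dv_def single_mult single_add[symmetric])
  have "(\<Prod>w\<in>W. dv w ^ lk t w) = sg (\<Sum>w\<in>W. sg w (lk t w)) (1::'a)" for W
    by (induction W rule: infinite_finite_induct) (simp_all add: pw single_mult)
  then show ?thesis
    using sum_single[of t] by (simp add: dconst_def single_mult)
qed

lemma derivs_finite [simp]: "finite (derivs p)" by (simp add: derivs_def)

lemma derivsI: "t \<in> ks p \<Longrightarrow> w \<in> ks t \<Longrightarrow> w \<in> derivs p" by (auto simp: derivs_def)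

text \<open>Identities between homomorphisms or between derivations are proved by this rule: both
  sides are compatible with sums and products, so constants from R and derivatives from W
  suffice.\<close>

lemma dpoly_induct [consumes 2, case_names const var add mult]:
  assumes "p \<in> over R" "derivs p \<subseteq> W"
    and const: "\<And>c. c \<in> R \<Longrightarrow> P (dconst c)" and var: "\<And>w. w \<in> W \<Longrightarrow> P (dv w)"
    and add: "\<And>p q. P p \<Longrightarrow> P q \<Longrightarrow> P (p + q)" and mult: "\<And>p q. P p \<Longrightarrow> P q \<Longrightarrow> P (p * q)"
    and R: "subring R"
  shows "P (p :: ('m, 'v, 'a::comm_ring_1) dpoly)"
proof -
  have 1: "P 1" using const[of 1] R by (simp add: subringD)
  have 0: "P 0" using const[of 0] R by (simp add: subringD)
  have pow: "P (q ^ n)" if "P q" for q n by (induction n) (auto intro: 1 mult that)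
  have prod: "P (prod f I)" if "\<And>i. i \<in> I \<Longrightarrow> P (f i)" for f and I :: "('m,'v) deriv set"
    using that by (induction I rule: infinite_finite_induct) (auto intro: 1 mult)
  have sum: "P (sum f I)" if "\<And>i. i \<in> I \<Longrightarrow> P (f i)" for f and I :: "(('m,'v) deriv \<Rightarrow>\<^sub>0 nat) set"
    using that by (induction I rule: infinite_finite_induct) (auto intro: 0 add)
  have "P (sg t (lk p t))" if "t \<in> ks p" for t
    unfolding single_eq_prod_dv
    by (intro mult const prod pow var) (use that assms(1,2) in \<open>auto simp: over_def derivs_def\<close>)
  then show ?thesis by (subst sum_single) (intro sum, auto)
qed

lemma mono_val_superset:
  assumes "finite W" "ks t \<subseteq> W" shows "mono_val t \<rho> = (\<Prod>w\<in>W. \<rho> w ^ lk t w)"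
  unfolding mono_val_def using assms by (intro prod.mono_neutral_left) (auto simp: in_keys_iff)

lemma mono_val_add: "mono_val (s + t) \<rho> = mono_val s \<rho> * mono_val t \<rho>"
proof -
  let ?W = "ks s \<union> ks t"
  have "mono_val (s + t) \<rho> = (\<Prod>w\<in>?W. \<rho> w ^ lk (s + t) w)"
    by (rule mono_val_superset) (auto dest: subsetD[OF Poly_Mapping.keys_add])
  also have "\<dots> = (\<Prod>w\<in>?W. \<rho> w ^ lk s w) * (\<Prod>w\<in>?W. \<rho> w ^ lk t w)"
    by (simp add: lookup_add power_add prod.distrib)
  also have "\<dots> = mono_val s \<rho> * mono_val t \<rho>"
    by (simp add: mono_val_superset[of ?W])
  finally show ?thesis .
qed

context
  fixes R :: "'a::comm_ring_1 set" and \<phi> :: "'a \<Rightarrow> 'b::comm_ring_1" and \<rho> :: "('m,'v) deriv \<Rightarrow> 'b"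
  assumes R: "subring R" and \<phi>: "rhom_on R \<phi>"
begin

lemma peval_superset:
  assumes "finite S" "ks p \<subseteq> S" shows "peval \<phi> \<rho> p = (\<Sum>t\<in>S. \<phi> (lk p t) * mono_val t \<rho>)"
  unfolding peval_def using assms rhom_on_0[OF R \<phi>]
  by (intro sum.mono_neutral_left) (auto simp: in_keys_iff)

lemma peval_single [simp]: "peval \<phi> \<rho> (sg t c) = \<phi> c * mono_val t \<rho>"
  by (subst peval_superset[of "{t}"]) (auto simp: lookup_single)

lemma peval_add:
  assumes "p \<in> over R" "q \<in> over R" shows "peval \<phi> \<rho> (p + q) = peval \<phi> \<rho> p + peval \<phi> \<rho> q"
proof -
  let ?S = "ks p \<union> ks q"
  have "peval \<phi> \<rho> (p + q) = (\<Sum>t\<in>?S. \<phi> (lk (p + q) t) * mono_val t \<rho>)"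
    by (rule peval_superset) (auto dest: subsetD[OF Poly_Mapping.keys_add])
  also have "\<dots> = (\<Sum>t\<in>?S. \<phi> (lk p t) * mono_val t \<rho>) + (\<Sum>t\<in>?S. \<phi> (lk q t) * mono_val t \<rho>)"
    unfolding sum.distrib[symmetric] using assms
    by (intro sum.cong refl) (simp add: lookup_add over_def rhom_onD(2)[OF \<phi>] distrib_right)
  also have "\<dots> = peval \<phi> \<rho> p + peval \<phi> \<rho> q"
    by (simp add: peval_superset[of ?S])
  finally show ?thesis .
qed

lemma peval_sum:
  assumes "\<And>i. i \<in> I \<Longrightarrow> f i \<in> over R" shows "peval \<phi> \<rho> (sum f I) = (\<Sum>i\<in>I. peval \<phi> \<rho> (f i))"
  using assms by (induction I rule: infinite_finite_induct) (auto simp: peval_add overI R)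

lemma peval_mult:
  assumes "p \<in> over R" "q \<in> over R" shows "peval \<phi> \<rho> (p * q) = peval \<phi> \<rho> p * peval \<phi> \<rho> q"
proof -
  have l: "lk p s \<in> R" "lk q s \<in> R" for s using assms by (auto simp: over_def)
  have "p * q = (\<Sum>s\<in>ks p. \<Sum>t\<in>ks q. sg (s + t) (lk p s * lk q t))"
    by (subst (1) sum_single[of p], subst (1) sum_single[of q]) (simp add: sum_product single_mult)
  then have "peval \<phi> \<rho> (p * q) = (\<Sum>s\<in>ks p. \<Sum>t\<in>ks q. peval \<phi> \<rho> (sg (s + t) (lk p s * lk q t)))"
    using R l by (simp add: peval_sum overI over_single subringD)
  also have "\<dots> = (\<Sum>s\<in>ks p. \<Sum>t\<in>ks q. (\<phi> (lk p s) * mono_val s \<rho>) * (\<phi> (lk q t) * mono_val t \<rho>))"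
    using l by (simp add: rhom_onD(3)[OF \<phi>] mono_val_add algebra_simps)
  also have "\<dots> = peval \<phi> \<rho> p * peval \<phi> \<rho> q" by (simp add: peval_def sum_product)
  finally show ?thesis .
qed

lemma peval_dconst [simp]: "peval \<phi> \<rho> (dconst c) = \<phi> c"
  by (simp add: dconst_def mono_val_def)

lemma peval_dv [simp]: "peval \<phi> \<rho> (dv w) = \<rho> w"
  by (simp add: dv_def mono_val_def rhom_onD(1)[OF \<phi>])

lemma peval_1 [simp]: "peval \<phi> \<rho> 1 = 1"
  using peval_dconst[of 1] rhom_onD(1)[OF \<phi>] by simp

lemma rhom_peval: "rhom_on (over R) (peval \<phi> \<rho>)"
  by (simp add: rhom_on_def peval_add peval_mult)

lemma peval_uminus: "p \<in> over R \<Longrightarrow> peval \<phi> \<rho> (- p) = - peval \<phi> \<rho> p"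
  by (rule rhom_on_uminus[OF subring_over[OF R] rhom_peval])

lemma peval_diff: "p \<in> over R \<Longrightarrow> q \<in> over R \<Longrightarrow> peval \<phi> \<rho> (p - q) = peval \<phi> \<rho> p - peval \<phi> \<rho> q"
  using peval_add[of p "- q"] peval_uminus[of q] overI(3)[OF R, of q] by simp

lemma peval_power: "p \<in> over R \<Longrightarrow> peval \<phi> \<rho> (p ^ n) = peval \<phi> \<rho> p ^ n"
  by (induction n) (auto simp: peval_mult overI R)

lemma peval_prod:
  assumes "\<And>i. i \<in> I \<Longrightarrow> f i \<in> over R" shows "peval \<phi> \<rho> (prod f I) = (\<Prod>i\<in>I. peval \<phi> \<rho> (f i))"
  using assms by (induction I rule: infinite_finite_induct) (auto simp: peval_mult overI R)

lemma peval_in: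
  assumes "p \<in> over R" "subring S" "\<And>c. c \<in> R \<Longrightarrow> \<phi> c \<in> S" "\<And>w. w \<in> derivs p \<Longrightarrow> \<rho> w \<in> S"
  shows "peval \<phi> \<rho> p \<in> S"
  unfolding peval_def mono_val_def
  by (intro subring_sum subringD subring_prod subring_power) (use assms in \<open>blast intro: derivsI dest: overD\<close>)+

end

lemma peval_cong:
  assumes "\<And>t. t \<in> ks p \<Longrightarrow> \<phi> (lk p t) = \<phi>' (lk p t)" "\<And>w. w \<in> derivs p \<Longrightarrow> \<rho> w = \<rho>' w"
  shows "peval \<phi> \<rho> p = peval \<phi>' \<rho>' p"
  unfolding peval_def mono_val_def using assms
  by (intro sum.cong prod.cong arg_cong2[of _ _ _ _ "(*)"] arg_cong2[of _ _ _ _ "(^)"])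
     (auto simp: derivs_def)

lemma peval_dconst_dv [simp]: "peval dconst dv p = (p :: ('m,'v,'a::comm_ring_1) dpoly)"
  using sum_single[of p]
  by (simp add: peval_def mono_val_def single_eq_prod_dv)

lemma peval_peval:
  assumes "subring R" "rhom_on R \<phi>" "subring S" "rhom_on S \<psi>" "p \<in> over R"
    "\<And>c. c \<in> R \<Longrightarrow> \<phi> c \<in> over S" "\<And>w. w \<in> derivs p \<Longrightarrow> \<rho> w \<in> over S"
  shows "peval \<psi> \<sigma> (peval \<phi> \<rho> p) = peval (\<lambda>c. peval \<psi> \<sigma> (\<phi> c)) (\<lambda>w. peval \<psi> \<sigma> (\<rho> w)) p"
proof -
  have "peval \<psi> \<sigma> (peval \<phi> \<rho> p) = (\<Sum>t\<in>ks p. peval \<psi> \<sigma> (\<phi> (lk p t) * (\<Prod>w\<in>ks t. \<rho> w ^ lk t w)))"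
    unfolding peval_def[of \<phi>] mono_val_def using assms
    by (intro peval_sum[OF assms(3,4)] overI[OF assms(3)]) (use assms in \<open>blast intro: derivsI dest: overD\<close>)+
  also have "\<dots> = (\<Sum>t\<in>ks p. peval \<psi> \<sigma> (\<phi> (lk p t)) * (\<Prod>w\<in>ks t. peval \<psi> \<sigma> (\<rho> w) ^ lk t w))"
  proof (rule sum.cong[OF refl])
    fix t assume t: "t \<in> ks p"
    have r: "\<rho> w \<in> over S" if "w \<in> ks t" for w using that t assms(7) by (blast intro: derivsI)
    have "peval \<psi> \<sigma> (\<phi> (lk p t) * (\<Prod>w\<in>ks t. \<rho> w ^ lk t w)) =
      peval \<psi> \<sigma> (\<phi> (lk p t)) * peval \<psi> \<sigma> (\<Prod>w\<in>ks t. \<rho> w ^ lk t w)"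
      using assms(5,6) r by (intro peval_mult[OF assms(3,4)] overI[OF assms(3)]) (auto simp: over_def)
    also have "peval \<psi> \<sigma> (\<Prod>w\<in>ks t. \<rho> w ^ lk t w) = (\<Prod>w\<in>ks t. peval \<psi> \<sigma> (\<rho> w) ^ lk t w)"
      using r by (subst peval_prod[OF assms(3,4)]) (auto simp: peval_power[OF assms(3,4)] overI[OF assms(3)])
    finally show "peval \<psi> \<sigma> (\<phi> (lk p t) * (\<Prod>w\<in>ks t. \<rho> w ^ lk t w)) =
      peval \<psi> \<sigma> (\<phi> (lk p t)) * (\<Prod>w\<in>ks t. peval \<psi> \<sigma> (\<rho> w) ^ lk t w)" .
  qed
  finally show ?thesis by (simp add: peval_def mono_val_def)
qed

subsection \<open>Derivations of polynomial rings\<close>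

definition mono_der :: "(('m,'v) deriv \<Rightarrow>\<^sub>0 nat) \<Rightarrow> (('m,'v) deriv \<Rightarrow> ('m,'v,'a::comm_ring_1) dpoly) \<Rightarrow> 'a \<Rightarrow> ('m,'v,'a) dpoly"
  where "mono_der t \<xi> c = (\<Sum>w\<in>ks t. sg (t - sg w 1) (of_nat (lk t w) * c) * \<xi> w)"

text \<open>The derivation that acts by d on coefficients and sends the derivative w to
  \<open>\<xi> w\<close>. The derivations of the ring, the formal partial derivatives
  \<open>pder\<close> and the coefficientwise action \<open>cder\<close> are instances.\<close>

definition mder :: "('a \<Rightarrow> 'a) \<Rightarrow> (('m,'v) deriv \<Rightarrow> ('m,'v,'a::comm_ring_1) dpoly) \<Rightarrow> ('m,'v,'a) dpoly \<Rightarrow> ('m,'v,'a) dpoly"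
  where "mder d \<xi> p = (\<Sum>t\<in>ks p. sg t (d (lk p t)) + mono_der t \<xi> (lk p t))"

definition cder :: "('a \<Rightarrow> 'a) \<Rightarrow> ('m,'v,'a::comm_ring_1) dpoly \<Rightarrow> ('m,'v,'a) dpoly"
  where "cder d = mder d (\<lambda>_. 0)"

definition pder :: "('m,'v) deriv \<Rightarrow> ('m,'v,'a::comm_ring_1) dpoly \<Rightarrow> ('m,'v,'a) dpoly"
  where "pder w = mder (\<lambda>_. 0) (\<lambda>v. if v = w then 1 else 0)"

lemma dpoly_deriv_eq_mder: "dpoly_deriv \<delta> i = mder (\<delta> i) (\<lambda>w. dv (deriv_shift i w))"
  by (simp add: fun_eq_iff dpoly_deriv_def mder_def mono_der_def dv_def single_mult)

lemma mono_der_superset: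
  assumes "finite W" "ks t \<subseteq> W"
  shows "mono_der t \<xi> c = (\<Sum>w\<in>W. sg (t - sg w 1) (of_nat (lk t w) * c) * \<xi> w)"
  unfolding mono_der_def using assms by (intro sum.mono_neutral_left) (auto simp: in_keys_iff)

lemma mono_der_add: "mono_der t \<xi> (a + b) = mono_der t \<xi> a + mono_der t \<xi> b"
  by (simp add: mono_der_def algebra_simps single_add sum.distrib)

lemma mono_der_0 [simp]: "mono_der t \<xi> 0 = 0" "mono_der 0 \<xi> c = 0"
  by (simp_all add: mono_der_def)

lemma minus_single_add:
  fixes s t :: "'w \<Rightarrow>\<^sub>0 nat"
  assumes "0 < lk s w" shows "s + t - sg w 1 = (s - sg w 1) + t"
  using assms by (intro poly_mapping_eqI) (auto simp: lookup_add lookup_minus lookup_single when_def)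

lemma mono_der_mult:
  "mono_der (s + t) \<xi> (a * b) = mono_der s \<xi> a * sg t b + sg s a * mono_der t \<xi> b"
proof -
  let ?W = "ks s \<union> ks t"
  have "sg (s + t - sg w 1) (of_nat (lk (s + t) w) * (a * b)) =
    sg (s - sg w 1) (of_nat (lk s w) * a) * sg t b + sg s a * sg (t - sg w 1) (of_nat (lk t w) * b)" for w
  proof -
    have "sg (s + t - sg w 1) (of_nat (lk s w) * (a * b)) = sg (s - sg w 1) (of_nat (lk s w) * a) * sg t b"
      by (cases "lk s w = 0") (simp_all add: minus_single_add single_mult mult.assoc del: One_nat_def)
    moreover have "sg (s + t - sg w 1) (of_nat (lk t w) * (a * b)) = sg s a * sg (t - sg w 1) (of_nat (lk t w) * b)"
      using minus_single_add[of t w s]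
      by (cases "lk t w = 0") (simp_all add: single_mult add.commute mult.left_commute del: One_nat_def)
    ultimately show ?thesis
      by (simp add: lookup_add single_add distrib_right del: One_nat_def)
  qed
  then have "(\<Sum>w\<in>?W. sg (s + t - sg w 1) (of_nat (lk (s + t) w) * (a * b)) * \<xi> w) =
    (\<Sum>w\<in>?W. sg (s - sg w 1) (of_nat (lk s w) * a) * \<xi> w) * sg t b +
    sg s a * (\<Sum>w\<in>?W. sg (t - sg w 1) (of_nat (lk t w) * b) * \<xi> w)"
    by (simp add: sum_distrib_left sum_distrib_right sum.distrib algebra_simps del: One_nat_def)
  then show ?thesis
    by (subst (1 2 3) mono_der_superset[of ?W]) (auto dest: subsetD[OF Poly_Mapping.keys_add])
qed

context
  fixes R :: "'a::comm_ring_1 set" and d :: "'a \<Rightarrow> 'a"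
    and \<xi> :: "('m,'v) deriv \<Rightarrow> ('m,'v,'a) dpoly"
  assumes R: "subring R" and d: "deriv_on R d"
begin

lemma mder_superset:
  assumes "finite S" "ks p \<subseteq> S"
  shows "mder d \<xi> p = (\<Sum>t\<in>S. sg t (d (lk p t)) + mono_der t \<xi> (lk p t))"
  unfolding mder_def using assms deriv_on_0[OF R d]
  by (intro sum.mono_neutral_left) (auto simp: in_keys_iff)

lemma mder_single: "mder d \<xi> (sg t c) = sg t (d c) + mono_der t \<xi> c"
  by (subst mder_superset[of "{t}"]) auto

lemma mder_add:
  assumes "p \<in> over R" "q \<in> over R" shows "mder d \<xi> (p + q) = mder d \<xi> p + mder d \<xi> q"
proof -
  let ?S = "ks p \<union> ks q"
  have "mder d \<xi> (p + q) = (\<Sum>t\<in>?S. sg t (d (lk (p + q) t)) + mono_der t \<xi> (lk (p + q) t))"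
    by (rule mder_superset) (auto dest: subsetD[OF Poly_Mapping.keys_add])
  also have "\<dots> = (\<Sum>t\<in>?S. sg t (d (lk p t)) + mono_der t \<xi> (lk p t)) + (\<Sum>t\<in>?S. sg t (d (lk q t)) + mono_der t \<xi> (lk q t))"
    unfolding sum.distrib[symmetric] using assms
    by (intro sum.cong refl) (simp add: lookup_add over_def deriv_onD(1)[OF d] single_add mono_der_add)
  also have "\<dots> = mder d \<xi> p + mder d \<xi> q" by (simp add: mder_superset[of ?S])
  finally show ?thesis .
qed

lemma mder_0 [simp]: "mder d \<xi> 0 = 0" by (simp add: mder_def)

lemma mder_sum:
  assumes "\<And>i. i \<in> I \<Longrightarrow> f i \<in> over R" shows "mder d \<xi> (sum f I) = (\<Sum>i\<in>I. mder d \<xi> (f i))"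
  using assms by (induction I rule: infinite_finite_induct) (auto simp: mder_add overI R)

lemma mder_mult:
  assumes "p \<in> over R" "q \<in> over R" shows "mder d \<xi> (p * q) = mder d \<xi> p * q + p * mder d \<xi> q"
proof -
  have l: "lk p s \<in> R" "lk q s \<in> R" for s using assms by (auto simp: over_def)
  have "p * q = (\<Sum>s\<in>ks p. \<Sum>t\<in>ks q. sg (s + t) (lk p s * lk q t))"
    by (subst (1) sum_single[of p], subst (1) sum_single[of q]) (simp add: sum_product single_mult)
  then have "mder d \<xi> (p * q) = (\<Sum>s\<in>ks p. \<Sum>t\<in>ks q. mder d \<xi> (sg (s + t) (lk p s * lk q t)))"
    using R l by (simp add: mder_sum overI over_single subringD)
  also have "\<dots> = (\<Sum>s\<in>ks p. \<Sum>t\<in>ks q. mder d \<xi> (sg s (lk p s)) * sg t (lk q t) + sg s (lk p s) * mder d \<xi> (sg t (lk q t)))"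
    using l by (simp add: mder_single deriv_onD(2)[OF d] mono_der_mult single_add single_mult algebra_simps)
  also have "\<dots> = (\<Sum>s\<in>ks p. mder d \<xi> (sg s (lk p s))) * (\<Sum>t\<in>ks q. sg t (lk q t)) +
     (\<Sum>s\<in>ks p. sg s (lk p s)) * (\<Sum>t\<in>ks q. mder d \<xi> (sg t (lk q t)))"
    by (simp add: sum_product sum.distrib)
  also have "\<dots> = mder d \<xi> p * q + p * mder d \<xi> q"
    using l R by (simp add: mder_sum[symmetric] over_single sum_single[symmetric])
  finally show ?thesis .
qed

lemma mder_dconst [simp]: "mder d \<xi> (dconst c) = dconst (d c)"
  by (simp add: dconst_def mder_single)

lemma mder_dv [simp]: "mder d \<xi> (dv w) = \<xi> w"
  by (simp add: dv_def mder_single deriv_on_1[OF R d] mono_der_def)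

lemma deriv_on_mder: "deriv_on (over R) (mder d \<xi>)"
  by (simp add: deriv_on_def mder_add mder_mult)

lemma mder_over:
  assumes "p \<in> over R" "\<And>c. c \<in> R \<Longrightarrow> d c \<in> R" "\<And>w. w \<in> derivs p \<Longrightarrow> \<xi> w \<in> over R"
  shows "mder d \<xi> p \<in> over R"
  unfolding mder_def mono_der_def
  by (intro overI(4,5,7) over_single R subringD subring_of_nat)
     (use assms in \<open>blast intro: derivsI dest: overD\<close>)+

end

text \<open>Both sides are derivations along \<open>peval \<phi> \<rho>\<close>, compared on
  constants and on derivatives. The induction carries membership in \<open>over R\<close> and S
  along, since the rules for d and E hold only there.\<close>

lemma deriv_peval:
  assumes "subring R" "rhom_on R \<phi>" "subring S" "deriv_on S E" "deriv_on R d"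
    and "\<And>c. c \<in> R \<Longrightarrow> \<phi> c \<in> S \<and> d c \<in> R \<and> E (\<phi> c) = \<phi> (d c)"
    and "\<And>w. w \<in> W \<Longrightarrow> \<rho> w \<in> S \<and> \<xi> w \<in> over R \<and> E (\<rho> w) = peval \<phi> \<rho> (\<xi> w)"
    and "p \<in> over R" "derivs p \<subseteq> W"
  shows "E (peval \<phi> \<rho> p) = peval \<phi> \<rho> (mder d \<xi> p)"
proof -
  have "p \<in> over R \<and> peval \<phi> \<rho> p \<in> S \<and> mder d \<xi> p \<in> over R \<and> E (peval \<phi> \<rho> p) = peval \<phi> \<rho> (mder d \<xi> p)"
    using assms(8,9)
  proof (induction rule: dpoly_induct)
    case (const c)
    then show ?case using assms by (simp add: overI)
  next
    case (var w)
    then show ?case using assms by (simp add: overI)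
  next
    case (add p q)
    then show ?case using assms(1-5)
      by (simp add: overI subringD peval_add[of R] mder_add[of R] deriv_onD[of S])
  next
    case (mult p q)
    then show ?case using assms(1-5)
      by (simp add: overI subringD peval_add[of R] peval_mult[of R] mder_mult[of R] deriv_onD[of S])
  qed (fact assms)
  then show ?thesis by blast
qed

lemma deriv_on_zero [simp]: "deriv_on R (\<lambda>_. 0)" by (simp add: deriv_on_def)

lemmas pder_rules = mder_add[of UNIV "\<lambda>_. 0"] mder_mult[of UNIV "\<lambda>_. 0"] mder_dconst[of UNIV "\<lambda>_. 0"]
  mder_dv[of UNIV "\<lambda>_. 0"] mder_sum[of UNIV "\<lambda>_. 0"]

lemma pder_add: "pder w (p + q) = pder w p + pder w q"
  and pder_mult: "pder w (p * q) = pder w p * q + p * pder w q"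
  and pder_dconst [simp]: "pder w (dconst c) = 0"
  and pder_dv: "pder w (dv v) = (if v = w then 1 else 0)"
  and pder_sum: "pder w (sum f I) = (\<Sum>i\<in>I. pder w (f i))"
  by (simp_all add: pder_def pder_rules)

lemma deriv_on_pder: "deriv_on R (pder w)"
  by (simp add: deriv_on_def pder_add pder_mult)

lemma pder_diff: "pder w (p - q) = pder w p - pder w q"
  by (rule deriv_on_diff[OF subring_UNIV deriv_on_pder]) auto

lemma lookup_cder: "d 0 = 0 \<Longrightarrow> lk (cder d p) t = d (lk p t)"
  by (auto simp: cder_def mder_def mono_der_def lookup_sum lookup_single when_def sum.delta' in_keys_iff)

lemma lookup_times_single:
  fixes q :: "('m,'v,'a::comm_ring_1) dpoly"
  shows "lk (q * sg (sg w k) c) t = (if k \<le> lk t w then lk q (t - sg w k) * c else 0)"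
proof -
  have "q * sg (sg w k) c = (\<Sum>s\<in>ks q. sg (s + sg w k) (lk q s * c))"
    by (subst (1) sum_single[of q]) (simp add: sum_distrib_right single_mult)
  then have *: "lk (q * sg (sg w k) c) t = (\<Sum>s\<in>ks q. if s + sg w k = t then lk q s * c else 0)"
    by (simp add: lookup_sum lookup_single when_def)
  show ?thesis
  proof (cases "k \<le> lk t w")
    case True
    have "s + sg w k = t \<longleftrightarrow> s = t - sg w k" for s
    proof
      assume "s = t - sg w k"
      then show "s + sg w k = t"
        using True by (auto intro!: poly_mapping_eqI simp: lookup_add lookup_minus lookup_single when_def)
    qed auto
    with True show ?thesis by (simp add: * sum.delta in_keys_iff)
  next
    case False
    have "s + sg w k \<noteq> t" for s
    proof
      assume "s + sg w k = t"
      then have "lk t w = lk s w + k" by (auto simp: lookup_add)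
      with False show False by simp
    qed
    with False show ?thesis by (simp add: *)
  qed
qed

lemma dv_power: "dv w ^ n = (sg (sg w n) 1 :: ('m,'v,'a::comm_ring_1) dpoly)"
  by (induction n) (auto simp: dv_def single_mult single_add[symmetric])

lemma lookup_times_dv_power:
  "lk (q * dv w ^ k) t = (if k \<le> lk t w then lk q (t - sg w k) else (0::'a::comm_ring_1))"
  by (simp add: dv_power lookup_times_single)

lemma lookup_pder:
  fixes p :: "('m,'v,'a::comm_ring_1) dpoly"
  shows "lk (pder w p) t = of_nat (Suc (lk t w)) * lk p (t + sg w 1)"
proof -
  have e: "sg (s - sg v 1) (of_nat (lk s v) * c) * (if v = w then 1 else 0) =
     (if v = w then sg (s - sg v 1) (of_nat (lk s v) * c) else 0)" for s v and c :: 'a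
    by simp
  have 1: "lk (mono_der s (\<lambda>v. if v = w then 1 else 0) c) t =
    (if s = t + sg w 1 then of_nat (Suc (lk t w)) * c else 0)" for s and c :: 'a
  proof -
    have "mono_der s (\<lambda>v. if v = w then 1 else 0) c = (if w \<in> ks s then sg (s - sg w 1) (of_nat (lk s w) * c) else 0)"
      unfolding mono_der_def e by (simp add: sum.delta')
    moreover have "w \<in> ks s \<and> s - sg w 1 = t \<longleftrightarrow> s = t + sg w 1"
    proof
      assume *: "w \<in> ks s \<and> s - sg w 1 = t"
      then have "s = (s - sg w 1) + sg w 1"
        by (intro poly_mapping_eqI) (auto simp: lookup_add lookup_minus lookup_single when_def in_keys_iff)
      with * show "s = t + sg w 1" by simp
    next
      assume "s = t + sg w 1"
      then show "w \<in> ks s \<and> s - sg w 1 = t" by (auto simp: in_keys_iff lookup_add)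
    qed
    ultimately show ?thesis by (auto simp: lookup_single when_def lookup_add)
  qed
  have "lk (pder w p) t = (\<Sum>s\<in>ks p. if s = t + sg w 1 then of_nat (Suc (lk t w)) * lk p s else 0)"
    by (simp add: pder_def mder_def lookup_sum lookup_add 1 del: of_nat_Suc)
  then show ?thesis by (simp add: sum.delta in_keys_iff del: of_nat_Suc)
qed

text \<open>Chain rule: a derivation is its action on coefficients plus a combination of the formal
  partial derivatives. The gradients of values in \<open>pd_peval\<close> are read off from
  it.\<close>

lemma mder_expand:
  assumes "finite W" "derivs p \<subseteq> W" "d 0 = 0"
  shows "mder d \<xi> p = cder d p + (\<Sum>w\<in>W. pder w p * \<xi> w)"
proof -
  have m: "mono_der t \<xi> c = (\<Sum>w\<in>W. mono_der t (\<lambda>v. if v = w then 1 else 0) c * \<xi> w)" if "ks t \<subseteq> W" for t c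
  proof -
    have "(\<Sum>w\<in>W. mono_der t (\<lambda>v. if v = w then 1 else 0) c * \<xi> w) =
       (\<Sum>w\<in>W. if w \<in> ks t then sg (t - sg w 1) (of_nat (lk t w) * c) * \<xi> w else 0)"
      by (intro sum.cong refl) (simp add: mono_der_def if_distrib[of "\<lambda>x. _ * x"] sum.delta' cong: if_cong)
    also have "\<dots> = mono_der t \<xi> c"
      unfolding mono_der_def using that assms(1)
      by (subst sum.inter_restrict[symmetric]) (auto simp: Int_absorb1)
    finally show ?thesis by simp
  qed
  have kW: "ks t \<subseteq> W" if "t \<in> ks p" for t using that assms(2) by (auto simp: derivs_def)
  have c: "cder d p = (\<Sum>t\<in>ks p. sg t (d (lk p t)))"
    by (simp add: cder_def mder_def mono_der_def)
  have "(\<Sum>w\<in>W. pder w p * \<xi> w) = (\<Sum>t\<in>ks p. mono_der t \<xi> (lk p t))"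
    unfolding pder_def mder_def sum_distrib_right
    by (subst sum.swap) (simp add: m[OF kW, symmetric])
  then show ?thesis by (simp add: c mder_def sum.distrib)
qed

subsection \<open>Degrees and coefficients\<close>

lemma deg_in_le_iff: "deg_in p w \<le> n \<longleftrightarrow> (\<forall>t\<in>ks p. lk t w \<le> n)"
  by (auto simp: deg_in_def)

lemma deg_in_less_iff: "deg_in p w < n \<longleftrightarrow> 0 < n \<and> (\<forall>t\<in>ks p. lk t w < n)"
  by (auto simp: deg_in_def)

lemma lookup_le_deg_in: "t \<in> ks p \<Longrightarrow> lk t w \<le> deg_in p w"
  using deg_in_le_iff by blast

lemma deg_in_eq_0_iff: "deg_in p w = 0 \<longleftrightarrow> w \<notin> derivs p"
proof -
  have "deg_in p w = 0 \<longleftrightarrow> deg_in p w \<le> 0" by simp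
  also have "\<dots> \<longleftrightarrow> w \<notin> derivs p" unfolding deg_in_le_iff by (auto simp: derivs_def in_keys_iff)
  finally show ?thesis .
qed

lemma deg_in_add: "deg_in (p + q) w \<le> max (deg_in p w) (deg_in q w)"
  unfolding deg_in_le_iff
proof
  fix t assume "t \<in> ks (p + q)"
  then have "t \<in> ks p \<or> t \<in> ks q" using Poly_Mapping.keys_add[of p q] by blast
  then show "lk t w \<le> max (deg_in p w) (deg_in q w)"
    using lookup_le_deg_in[of t p w] lookup_le_deg_in[of t q w] by auto
qed

lemma deg_in_uminus [simp]: "deg_in (- p :: ('m,'v,'a::comm_ring_1) dpoly) w = deg_in p w"
proof -
  have "ks (- p) = ks p" by (auto simp: in_keys_iff)
  then show ?thesis by (simp add: deg_in_def)
qed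

lemma derivs_uminus [simp]: "derivs (- p :: ('m,'v,'a::comm_ring_1) dpoly) = derivs p"
proof -
  have "ks (- p) = ks p" by (auto simp: in_keys_iff)
  then show ?thesis by (simp add: derivs_def)
qed

lemma deg_in_diff: "deg_in (p - q) w \<le> max (deg_in p w) (deg_in (q::('m,'v,'a::comm_ring_1) dpoly) w)"
  using deg_in_add[of p "- q" w] by simp

lemma deg_in_sum:
  assumes "\<And>i. i \<in> I \<Longrightarrow> deg_in (f i) w \<le> n"
  shows "deg_in (sum f I) w \<le> n"
  using assms
proof (induction I rule: infinite_finite_induct)
  case (insert i I)
  then show ?case using deg_in_add[of "f i" "sum f I" w] by fastforce
qed (auto simp: deg_in_def)

lemma deg_in_mult: "deg_in (p * q) w \<le> deg_in p w + deg_in (q::('m,'v,'a::comm_ring_1) dpoly) w"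
  unfolding deg_in_le_iff
proof
  fix t assume "t \<in> ks (p * q)"
  then obtain a b where "t = a + b" "a \<in> ks p" "b \<in> ks q" using keys_mult[of p q] by blast
  then show "lk t w \<le> deg_in p w + deg_in q w"
    using lookup_le_deg_in[of a p w] lookup_le_deg_in[of b q w] by (simp add: lookup_add)
qed

lemma deg_in_dv: "deg_in (dv v :: ('m,'v,'a::comm_ring_1) dpoly) w = (if v = w then 1 else 0)"
  by (simp add: deg_in_def dv_def lookup_single)

lemma deg_in_dconst [simp]: "deg_in (dconst c) w = 0"
  by (simp add: deg_in_def dconst_def)

lemma deg_in_0 [simp]: "deg_in 0 w = 0" by (simp add: deg_in_def)

lemma deg_in_1 [simp]: "deg_in (1 :: ('m,'v,'a::comm_ring_1) dpoly) w = 0"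
  unfolding dconst_1[symmetric] by (rule deg_in_dconst)

lemma deg_in_power: "deg_in (p ^ n) w \<le> n * deg_in (p::('m,'v,'a::comm_ring_1) dpoly) w"
proof (induction n)
  case (Suc n)
  then show ?case using deg_in_mult[of p "p ^ n" w] by simp
qed simp

lemma deg_in_prod: "deg_in (prod f I) w \<le> (\<Sum>i\<in>I. deg_in (f i :: ('m,'v,'a::comm_ring_1) dpoly) w)"
proof (induction I rule: infinite_finite_induct)
  case (insert i I)
  then show ?case using deg_in_mult[of "f i" "prod f I" w] by simp
qed simp_all

lemma derivs_add: "derivs (p + q) \<subseteq> derivs p \<union> derivs q"
  unfolding derivs_def using Poly_Mapping.keys_add[of p q] by blast

lemma derivs_diff: "derivs (p - q) \<subseteq> derivs p \<union> derivs (q::('m,'v,'a::comm_ring_1) dpoly)"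
  using derivs_add[of p "- q"] by simp

lemma derivs_mult: "derivs (p * q) \<subseteq> derivs p \<union> derivs (q::('m,'v,'a::comm_ring_1) dpoly)"
proof
  fix w assume "w \<in> derivs (p * q)"
  then have "deg_in (p * q) w \<noteq> 0" by (simp add: deg_in_eq_0_iff)
  then have "deg_in p w \<noteq> 0 \<or> deg_in q w \<noteq> 0" using deg_in_mult[of p q w] by linarith
  then show "w \<in> derivs p \<union> derivs q" by (simp add: deg_in_eq_0_iff)
qed

lemma derivs_dconst [simp]: "derivs (dconst c) = {}" by (simp add: derivs_def dconst_def)
lemma derivs_0 [simp]: "derivs 0 = {}" by (simp add: derivs_def)
lemma derivs_1 [simp]: "derivs (1 :: ('m,'v,'a::comm_ring_1) dpoly) = {}" unfolding dconst_1[symmetric] by (rule derivs_dconst)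
lemma derivs_dv [simp]: "derivs (dv w :: ('m,'v,'a::comm_ring_1) dpoly) = {w}" by (simp add: derivs_def dv_def)

lemma derivs_sum: "derivs (sum f I) \<subseteq> (\<Union>i\<in>I. derivs (f i))"
  by (induction I rule: infinite_finite_induct) (auto dest: subsetD[OF derivs_add])

lemma derivs_power: "derivs (p ^ n) \<subseteq> derivs (p::('m,'v,'a::comm_ring_1) dpoly)"
  by (induction n) (auto dest: subsetD[OF derivs_mult])

lemma derivs_prod: "derivs (prod f I) \<subseteq> (\<Union>i\<in>I. derivs (f i :: ('m,'v,'a::comm_ring_1) dpoly))"
  by (induction I rule: infinite_finite_induct) (auto dest: subsetD[OF derivs_mult])

lemma derivs_empty: assumes "derivs p = {}" shows "p = dconst (lk p 0)"
proof (rule poly_mapping_eqI)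
  fix t
  have "t \<in> ks p \<Longrightarrow> t = 0" using assms by (auto simp: derivs_def)
  then show "lk p t = lk (dconst (lk p 0)) t"
    by (auto simp: lookup_dconst in_keys_iff)
qed

lemma peval_no_derivs: "derivs p = {} \<Longrightarrow> \<phi> 0 = 0 \<Longrightarrow> peval \<phi> \<rho> p = \<phi> (lk p 0)"
  by (subst derivs_empty) (auto simp: peval_def dconst_def mono_val_def)

lemma pder_keys: "t \<in> ks (pder w p) \<Longrightarrow> t + sg w 1 \<in> ks p"
  by (auto simp: in_keys_iff lookup_pder)

lemma derivs_pder: "derivs (pder w p) \<subseteq> derivs p"
proof
  fix v assume "v \<in> derivs (pder w p)"
  then obtain t where "t \<in> ks (pder w p)" "v \<in> ks t" by (auto simp: derivs_def)
  then show "v \<in> derivs p"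
    by (intro derivsI[OF pder_keys]) (auto simp: in_keys_iff lookup_add)
qed

lemma deg_in_pder: "deg_in (pder w p) v \<le> deg_in p v"
  unfolding deg_in_le_iff
proof
  fix t assume "t \<in> ks (pder w p)"
  then have "lk (t + sg w 1) v \<le> deg_in p v" by (intro lookup_le_deg_in pder_keys)
  then show "lk t v \<le> deg_in p v" by (simp add: lookup_add)
qed

lemma deg_in_pder_same: "w \<in> derivs p \<Longrightarrow> deg_in (pder w p) w < deg_in p w"
  unfolding deg_in_less_iff
proof (intro conjI ballI)
  fix t assume "t \<in> ks (pder w p)"
  then have "lk (t + sg w 1) w \<le> deg_in p w" by (intro lookup_le_deg_in pder_keys)
  then show "lk t w < deg_in p w" by (simp add: lookup_add)
qed (use deg_in_eq_0_iff in blast)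

lemma pder_eq_0: "w \<notin> derivs (p :: ('m,'v,'a::comm_ring_1) dpoly) \<Longrightarrow> pder w p = 0"
proof (rule poly_mapping_eqI)
  fix t :: "('m,'v) deriv \<Rightarrow>\<^sub>0 nat" assume "w \<notin> derivs p"
  moreover have "w \<in> ks (t + sg w 1)" by (simp add: in_keys_iff lookup_add)
  ultimately have "t + sg w 1 \<notin> ks p" by (auto simp: derivs_def)
  then show "lk (pder w p) t = lk 0 t" by (simp add: lookup_pder in_keys_iff)
qed

text \<open>A predicate instead of a sort: the extension is only known to be a field, and its
  characteristic is deduced from the embedding of F.\<close>

definition char0 :: "'a::comm_ring_1 itself \<Rightarrow> bool" where
  "char0 _ \<longleftrightarrow> (\<forall>n>0. (of_nat n :: 'a) \<noteq> 0)"

lemma char0D: "char0 TYPE('a::comm_ring_1) \<Longrightarrow> n > 0 \<Longrightarrow> (of_nat n :: 'a) \<noteq> 0"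
  unfolding char0_def by blast

lemma char0_field_char_0: "char0 TYPE('a::{field_char_0})"
  by (simp add: char0_def)

text \<open>The exponent of w appears as a factor and is nonzero in characteristic 0. So a vanishing
  partial derivative means that w does not occur, which is how leaders are located later.\<close>

lemma pder_neq_0:
  fixes p :: "('m,'v,'a::idom) dpoly"
  assumes "char0 TYPE('a)" "w \<in> derivs p" shows "pder w p \<noteq> 0"
proof
  assume 0: "pder w p = 0"
  obtain t where t: "t \<in> ks p" "w \<in> ks t" using assms(2) by (auto simp: derivs_def)
  have "t = (t - sg w 1) + sg w 1"
    using t(2) by (intro poly_mapping_eqI) (auto simp: lookup_add lookup_minus lookup_single when_def in_keys_iff)
  then have "lk (pder w p) (t - sg w 1) = of_nat (Suc (lk (t - sg w 1) w)) * lk p t"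
    by (simp add: lookup_pder)
  moreover have "lk p t \<noteq> 0" using t by (simp add: in_keys_iff)
  moreover have "(of_nat (Suc (lk (t - sg w 1) w)) :: 'a) \<noteq> 0" using assms(1) by (intro char0D) auto
  ultimately show False using 0 by (metis lookup_zero mult_eq_0_iff)
qed

lemma over_pder: "subring R \<Longrightarrow> p \<in> over R \<Longrightarrow> pder w p \<in> over R"
  unfolding over_def by (auto simp: lookup_pder simp del: of_nat_Suc intro!: subringD(5) subring_of_nat)

text \<open>Total degree, the measure of the inductions that replace a polynomial by one of its
  partial derivatives.\<close>

definition tdeg :: "('m,'v,'a::zero) dpoly \<Rightarrow> nat" where
  "tdeg p = Max (insert 0 ((\<lambda>t. \<Sum>w\<in>ks t. lk t w) ` ks p))"

lemma tdeg_pder: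
  fixes p :: "('m,'v,'a::comm_ring_1) dpoly"
  assumes "pder w p \<noteq> 0" shows "tdeg (pder w p) < tdeg p"
proof -
  have s: "(\<Sum>v\<in>ks (t + sg w 1). lk (t + sg w 1) v) = Suc (\<Sum>v\<in>ks t. lk t v)" for t :: "('m,'v) deriv \<Rightarrow>\<^sub>0 nat"
  proof -
    let ?W = "insert w (ks t)"
    have "ks (t + sg w 1) = ?W" by (auto simp: in_keys_iff lookup_add lookup_single when_def split: if_split_asm)
    then have "(\<Sum>v\<in>ks (t + sg w 1). lk (t + sg w 1) v) = (\<Sum>v\<in>?W. lk t v) + (\<Sum>v\<in>?W. if v = w then 1 else 0)"
      by (simp add: lookup_add lookup_single when_def sum.distrib eq_commute)
    also have "(\<Sum>v\<in>?W. lk t v) = (\<Sum>v\<in>ks t. lk t v)"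
      by (rule sum.mono_neutral_right) (auto simp: in_keys_iff)
    finally show ?thesis by (simp add: sum.delta)
  qed
  have *: "Suc (\<Sum>v\<in>ks t. lk t v) \<le> tdeg p" if "t \<in> ks (pder w p)" for t
    unfolding s[symmetric] tdeg_def using pder_keys[OF that] by (intro Max_ge) auto
  have "0 < tdeg p"
  proof -
    obtain t where "t \<in> ks (pder w p)" using assms by (metis all_not_in_conv keys_eq_empty)
    then show ?thesis using * by fastforce
  qed
  then show ?thesis unfolding tdeg_def[of "pder w p"] using * by (auto simp: Suc_le_eq)
qed

section \<open>Coefficients with respect to one derivative\<close>

definition coef_in :: "('m,'v) deriv \<Rightarrow> nat \<Rightarrow> ('m,'v,'a::comm_ring_1) dpoly \<Rightarrow> ('m,'v,'a) dpoly" where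
  "coef_in w k p = (\<Sum>t\<in>{t \<in> ks p. lk t w = k}. sg (t - sg w k) (lk p t))"

lemma lookup_coef_in: "lk (coef_in w k p) t = (if lk t w = 0 then lk p (t + sg w k) else 0)"
proof -
  have *: "lk s w = k \<Longrightarrow> s - sg w k = t \<longleftrightarrow> lk t w = 0 \<and> s = t + sg w k" for s
  proof -
    assume k: "lk s w = k"
    then have "s = (s - sg w k) + sg w k"
      by (intro poly_mapping_eqI) (auto simp: lookup_add lookup_minus lookup_single when_def)
    moreover have "lk (s - sg w k) w = 0" using k by (simp add: lookup_minus)
    ultimately show ?thesis by auto
  qed
  have "lk (coef_in w k p) t = (\<Sum>s\<in>{s \<in> ks p. lk s w = k}. if s - sg w k = t then lk p s else 0)"
    by (simp add: coef_in_def lookup_sum lookup_single when_def)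
  also have "\<dots> = (\<Sum>s\<in>{s \<in> ks p. lk s w = k}. if s = t + sg w k then (if lk t w = 0 then lk p s else 0) else 0)"
    by (intro sum.cong refl) (simp add: *)
  also have "\<dots> = (if lk t w = 0 then lk p (t + sg w k) else 0)"
    by (auto simp: sum.delta lookup_add in_keys_iff)
  finally show ?thesis .
qed

lemma coef_in_expand:
  assumes "deg_in p w \<le> n" shows "p = (\<Sum>k\<le>n. coef_in w k p * dv w ^ k)"
proof (rule poly_mapping_eqI)
  fix t
  have "lk (coef_in w k p * dv w ^ k) t = (if k = lk t w then lk p t else 0)" for k
  proof (cases "k \<le> lk t w")
    case True
    then have "t - sg w k + sg w k = t"
      by (intro poly_mapping_eqI) (auto simp: lookup_add lookup_minus lookup_single when_def)
    with True show ?thesis by (auto simp: lookup_times_dv_power lookup_coef_in lookup_minus)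
  qed (auto simp: lookup_times_dv_power)
  then have "lk (\<Sum>k\<le>n. coef_in w k p * dv w ^ k) t = (if lk t w \<le> n then lk p t else 0)"
    by (simp add: lookup_sum sum.delta)
  also have "\<dots> = lk p t" using assms by (auto simp: deg_in_le_iff in_keys_iff)
  finally show "lk p t = lk (\<Sum>k\<le>n. coef_in w k p * dv w ^ k) t" by simp
qed

lemma coef_in_keys: "t \<in> ks (coef_in w k p) \<Longrightarrow> t + sg w k \<in> ks p \<and> lk t w = 0"
  by (auto simp: in_keys_iff lookup_coef_in split: if_splits)

lemma derivs_coef_in: "derivs (coef_in w k p) \<subseteq> derivs p - {w}"
proof
  fix v assume "v \<in> derivs (coef_in w k p)"
  then obtain t where t: "t \<in> ks (coef_in w k p)" "v \<in> ks t" by (auto simp: derivs_def)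
  with coef_in_keys[OF t(1)] show "v \<in> derivs p - {w}"
    by (auto intro!: derivsI[of "t + sg w k"] simp: in_keys_iff lookup_add)
qed

lemma deg_in_coef_in: "deg_in (coef_in w k p) v \<le> deg_in p v"
  unfolding deg_in_le_iff
proof
  fix t assume "t \<in> ks (coef_in w k p)"
  then have "lk (t + sg w k) v \<le> deg_in p v" by (intro lookup_le_deg_in) (simp add: coef_in_keys)
  then show "lk t v \<le> deg_in p v" by (simp add: lookup_add)
qed

lemma over_coef_in: "subring R \<Longrightarrow> p \<in> over R \<Longrightarrow> coef_in w k p \<in> over R"
  unfolding over_def by (auto simp: lookup_coef_in subringD)

lemma coef_in_deg_neq_0:
  assumes "p \<noteq> 0" shows "coef_in w (deg_in p w) p \<noteq> 0"
proof -
  obtain t where t: "t \<in> ks p" "lk t w = deg_in p w"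
  proof -
    have "ks p \<noteq> {}" using assms by simp
    then have "deg_in p w \<in> (\<lambda>t. lk t w) ` ks p"
      unfolding deg_in_def by (subst Max_insert) (auto simp: max_def)
    then show ?thesis using that by auto
  qed
  have "t - sg w (deg_in p w) + sg w (deg_in p w) = t"
    using t by (intro poly_mapping_eqI) (auto simp: lookup_add lookup_minus lookup_single when_def)
  then have "lk (coef_in w (deg_in p w) p) (t - sg w (deg_in p w)) = lk p t"
    using t by (simp add: lookup_coef_in lookup_minus)
  then show ?thesis using t(1) by (auto simp: in_keys_iff)
qed

subsection \<open>Iterated derivatives and rankings\<close>

lemma derivation_deriv_on: "derivation D \<longleftrightarrow> deriv_on UNIV D"
  by (auto simp: derivation_def deriv_on_def)

lemma delta_ringD:
  assumes "delta_ring D" shows "deriv_on R (D i)" "D i (D j a) = D j (D i a)"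
  using assms by (auto simp: delta_ring_def derivation_def deriv_on_def)

lemma theta_0 [simp]: "theta D (\<lambda>_. 0) a = a" for D :: "'m::{finite,linorder} \<Rightarrow> _"
proof -
  have "foldr (\<lambda>i x. x) xs a = a" for xs :: "'m list" by (induction xs) auto
  then show ?thesis by (simp add: theta_def id_def)
qed

text \<open>\<open>theta\<close> applies the derivations in the order of their indices, so a further
  one has to be moved past the others to its place.\<close>

lemma theta_Suc:
  assumes comm: "\<And>i j a. D i (D j a) = D j (D i a)"
  shows "theta D (e(i := Suc (e i))) a = D i (theta D e a)"
proof -
  have pw: "D i ((D j ^^ n) a) = (D j ^^ n) (D i a)" for j n a
    by (induction n) (auto simp: comm[of i j])
  have notin: "foldr (\<lambda>j. D j ^^ (e(i := Suc (e i))) j) xs b = foldr (\<lambda>j. D j ^^ e j) xs b" if "i \<notin> set xs" for xs b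
    using that by (induction xs) auto
  have "foldr (\<lambda>j. D j ^^ (e(i := Suc (e i))) j) xs a = D i (foldr (\<lambda>j. D j ^^ e j) xs a)"
    if "distinct xs" "i \<in> set xs" for xs
    using that
  proof (induction xs)
    case (Cons j xs)
    show ?case
    proof (cases "j = i")
      case True
      then show ?thesis using Cons notin[of xs a] by simp
    next
      case False
      then show ?thesis using Cons by (simp add: pw)
    qed
  qed simp
  then show ?thesis by (simp add: theta_def)
qed

lemma sum_fun_upd_Suc:
  fixes e :: "'m::finite \<Rightarrow> nat"
  shows "sum (e(i := Suc (e i))) UNIV = Suc (sum e UNIV)"
proof -
  have "sum (e(i := Suc (e i))) (UNIV - {i}) = sum e (UNIV - {i})" by (rule sum.cong) auto
  then show ?thesis using sum.remove[of UNIV i e] sum.remove[of UNIV i "e(i := Suc (e i))"] by simp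
qed

lemma exponent_induct [case_names zero Suc]:
  fixes e :: "'m::finite \<Rightarrow> nat"
  assumes "P (\<lambda>_. 0)" "\<And>e i. P e \<Longrightarrow> P (e(i := Suc (e i)))"
  shows "P e"
proof (induction "sum e UNIV" arbitrary: e)
  case 0
  then have "e = (\<lambda>_. 0)" by auto
  then show ?case using assms(1) by simp
next
  case (Suc n)
  then obtain i where i: "e i \<noteq> 0" by fastforce
  let ?e = "e(i := e i - 1)"
  have e: "e = ?e(i := Suc (?e i))" using i by auto
  have "sum e UNIV = Suc (sum ?e UNIV)" by (subst e) (rule sum_fun_upd_Suc)
  then have "n = sum ?e UNIV" using Suc(2) by simp
  then have "P (?e(i := Suc (?e i)))" by (intro assms(2) Suc(1))
  then show ?case using e by metis
qed

definition dmult :: "('m \<Rightarrow> nat) \<Rightarrow> ('m,'v) deriv \<Rightarrow> ('m,'v) deriv" where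
  "dmult e w = (fst w, \<lambda>i. snd w i + e i)"

lemma dmult_0 [simp]: "dmult (\<lambda>_. 0) w = w" by (simp add: dmult_def)
lemma dmult_Suc: "dmult (e(i := Suc (e i))) w = deriv_shift i (dmult e w)"
  by (auto simp: dmult_def deriv_shift_def)
lemma deriv_shift_inject [simp]: "deriv_shift i v = deriv_shift i w \<longleftrightarrow> v = w"
proof
  assume *: "deriv_shift i v = deriv_shift i w"
  then have "fst v = fst w" and f: "(snd v)(i := Suc (snd v i)) = (snd w)(i := Suc (snd w i))"
    by (auto simp: deriv_shift_def)
  moreover have "snd v j = snd w j" for j using fun_cong[OF f, of j] by (cases "j = i") auto
  ultimately show "v = w" by (auto simp: prod_eq_iff fun_eq_iff)
qed auto

lemma proper_derivative_iff: "proper_derivative v w \<longleftrightarrow> (\<exists>e. e \<noteq> (\<lambda>_. 0) \<and> v = dmult e w)"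
proof
  assume "proper_derivative v w"
  then have 1: "fst v = fst w" and l: "snd w < snd v" by (auto simp: proper_derivative_def)
  then have "snd w i \<le> snd v i" for i by (simp add: le_fun_def less_le)
  then have "v = dmult (\<lambda>i. snd v i - snd w i) w" using 1 by (auto simp: dmult_def prod_eq_iff)
  moreover have "(\<lambda>i. snd v i - snd w i) \<noteq> (\<lambda>_. 0)"
  proof
    assume "(\<lambda>i. snd v i - snd w i) = (\<lambda>_. 0)"
    then have "snd v \<le> snd w" by (auto simp: le_fun_def fun_eq_iff)
    with l show False by simp
  qed
  ultimately show "\<exists>e. e \<noteq> (\<lambda>_. 0) \<and> v = dmult e w" by blast
next
  assume "\<exists>e. e \<noteq> (\<lambda>_. 0) \<and> v = dmult e w"
  then obtain e where e: "e \<noteq> (\<lambda>_. 0)" "v = dmult e w" by blast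
  have "snd w \<le> snd v" by (simp add: e dmult_def le_fun_def)
  moreover have "snd w \<noteq> snd v"
  proof
    assume eq: "snd w = snd v"
    have "e i = 0" for i using fun_cong[OF eq, of i] by (simp add: e dmult_def)
    then show False using e(1) by blast
  qed
  ultimately show "proper_derivative v w"
    unfolding proper_derivative_def less_le by (simp add: e dmult_def)
qed

section \<open>Well-founded rankings, leading operators and reduction\<close>

locale wf_ranking =
  fixes lt :: "('m::{finite,linorder},'v) deriv \<Rightarrow> ('m,'v) deriv \<Rightarrow> bool"
  assumes ranking: "ranking lt" and wf: "wfP lt"
begin

abbreviation le where "le v w \<equiv> v = w \<or> lt v w"

lemma irrefl [simp]: "\<not> lt w w" using ranking unfolding ranking_def by blast
lemma trans: "lt a b \<Longrightarrow> lt b c \<Longrightarrow> lt a c" using ranking unfolding ranking_def by blast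
lemma total: "a \<noteq> b \<Longrightarrow> lt a b \<or> lt b a" using ranking unfolding ranking_def by blast
lemma shift_gt: "lt w (deriv_shift i w)" using ranking unfolding ranking_def by blast
lemma shift_mono: "lt a b \<Longrightarrow> lt (deriv_shift i a) (deriv_shift i b)" using ranking unfolding ranking_def by blast
lemma not_lt: "\<not> lt a b \<longleftrightarrow> le b a" using total trans irrefl by metis

lemma shift_lt_iff: "lt (deriv_shift i a) (deriv_shift i b) \<longleftrightarrow> lt a b"
  using shift_mono not_lt by (metis irrefl trans)

lemma dmult_mono: "lt a b \<Longrightarrow> lt (dmult e a) (dmult e b)"
  by (induction e rule: exponent_induct) (auto simp: dmult_Suc shift_mono)

lemma dmult_ge: "le w (dmult e w)"
proof (induction e rule: exponent_induct)
  case (Suc e i)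
  then show ?case unfolding dmult_Suc using shift_gt[of "dmult e w" i] trans by metis
qed simp

lemma dmult_inject [simp]: "dmult e w = dmult e' w \<longleftrightarrow> e = e'"
  by (auto simp: dmult_def fun_eq_iff)

lemma dmult_gt: "e \<noteq> (\<lambda>_. 0) \<Longrightarrow> lt w (dmult e w)"
  using dmult_ge[of w e] dmult_inject[of e w "\<lambda>_. 0"] by auto

lemma ex_max:
  assumes "finite S" "S \<noteq> {}" obtains w where "w \<in> S" "\<And>v. v \<in> S \<Longrightarrow> le v w"
proof -
  have "\<exists>w\<in>S. \<forall>v\<in>S. le v w" using assms
  proof (induction S rule: finite_ne_induct)
    case (insert a S)
    then obtain w where w: "w \<in> S" "\<forall>v\<in>S. le v w" by blast
    show ?case
    proof (cases "lt w a")
      case True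
      have "le v a" if "v \<in> insert a S" for v
        using that w(2) True trans[of v w a] by auto
      then show ?thesis by blast
    next
      case False
      then have "le a w" by (simp add: not_lt)
      then show ?thesis using w by auto
    qed
  qed simp
  then show ?thesis using that by blast
qed

text \<open>\<open>E \<psi>\<close> behaves like the partial derivative with respect to \<psi>:
  moving it past \<open>D i\<close> produces only the partial derivative with respect to the
  preimage of \<psi> under the shift. So if x has none beyond w0, then \<open>D i x\<close> has none
  beyond the shift of w0, and the top one is passed on unchanged. It is applied to formal partial
  derivatives, to those on the field \<open>FU\<close>, and to those acting on coefficients.\<close>

lemma leading_operator:
  fixes D :: "'m \<Rightarrow> 'x::ab_group_add \<Rightarrow> 'x" and E :: "('m,'v) deriv \<Rightarrow> 'x \<Rightarrow> 'x"
  assumes comm: "\<And>i j a. D i (D j a) = D j (D i a)" and D0: "\<And>i. D i 0 = 0"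
    and S: "\<And>i x. x \<in> S \<Longrightarrow> D i x \<in> S"
    and E1: "\<And>\<psi> i x. x \<in> S \<Longrightarrow> E (deriv_shift i \<psi>) (D i x) = D i (E (deriv_shift i \<psi>) x) + E \<psi> x"
    and E2: "\<And>\<psi> i x. x \<in> S \<Longrightarrow> \<psi> \<notin> range (deriv_shift i) \<Longrightarrow> E \<psi> (D i x) = D i (E \<psi> x)"
    and x: "x \<in> S" "\<And>\<psi>. lt w0 \<psi> \<Longrightarrow> E \<psi> x = 0"
  shows "(\<forall>\<psi>. lt (dmult e w0) \<psi> \<longrightarrow> E \<psi> (theta D e x) = 0) \<and> E (dmult e w0) (theta D e x) = E w0 x"
proof -
  have "theta D e x \<in> S \<and> (\<forall>\<psi>. lt (dmult e w0) \<psi> \<longrightarrow> E \<psi> (theta D e x) = 0) \<and> E (dmult e w0) (theta D e x) = E w0 x"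
  proof (induction e rule: exponent_induct)
    case zero
    then show ?case using x by simp
  next
    case (Suc e i)
    let ?y = "theta D e x" and ?l = "dmult e w0"
    have y: "?y \<in> S" and yz: "\<And>\<psi>. lt ?l \<psi> \<Longrightarrow> E \<psi> ?y = 0" and yl: "E ?l ?y = E w0 x" using Suc by auto
    have "E \<psi> (D i ?y) = 0" if "lt (deriv_shift i ?l) \<psi>" for \<psi>
    proof (cases "\<psi> \<in> range (deriv_shift i)")
      case True
      then obtain \<psi>' where p: "\<psi> = deriv_shift i \<psi>'" by blast
      then have "lt ?l \<psi>'" using that shift_lt_iff by blast
      moreover have "lt ?l \<psi>" using trans[OF shift_gt that] .
      ultimately show ?thesis using E1[OF y] yz by (simp add: p D0)
    next
      case False
      moreover have "lt ?l \<psi>" using trans[OF shift_gt that] .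
      ultimately show ?thesis using E2[OF y] yz by (simp add: D0)
    qed
    moreover have "E (deriv_shift i ?l) (D i ?y) = E w0 x"
      using E1[OF y] yz[OF shift_gt] yl by (simp add: D0)
    ultimately show ?case unfolding theta_Suc[of D, OF comm] dmult_Suc using S[OF y] by blast
  qed
  then show ?thesis by blast
qed

text \<open>Pseudo-division with respect to the leading derivative \<open>w\<close> first, then recursion on the
  coefficients, all of whose derivatives are smaller.\<close>

lemma ritt_reduction:
  fixes R :: "'a::comm_ring_1 set" and I M :: "('m,'v,'a) dpoly set" and bd :: "('m,'v) deriv \<Rightarrow> nat option"
  assumes R: "subring R"
    and I: "0 \<in> I" "\<And>a b. a \<in> I \<Longrightarrow> b \<in> I \<Longrightarrow> a + b \<in> I" "\<And>c a. c \<in> over R \<Longrightarrow> a \<in> I \<Longrightarrow> c * a \<in> I"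
    and M: "1 \<in> M" "\<And>a b. a \<in> M \<Longrightarrow> b \<in> M \<Longrightarrow> a * b \<in> M" "M \<subseteq> over R"
    and rel: "\<And>w k. bd w = Some k \<Longrightarrow> \<exists>s\<in>M. \<exists>r\<in>over R. (\<forall>v\<in>derivs s. lt v w) \<and>
      (\<forall>v\<in>derivs r. le v w) \<and> deg_in r w < k \<and> s * dv w ^ k - r \<in> I"
    and A: "finite A" "A \<subseteq> over R"
  shows "\<exists>b\<in>M. \<exists>r. \<forall>a\<in>A. r a \<in> over R \<and> b * a - r a \<in> I \<and> (\<forall>w k. bd w = Some k \<longrightarrow> deg_in (r a) w < k) \<and>
    (\<forall>v\<in>derivs (r a). \<exists>w\<in>(\<Union>a\<in>A. derivs a). le v w)"
proof -
  have kpos: "0 < k" if "bd w = Some k" for w k using rel[OF that] by auto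
  have const: "\<exists>b\<in>M. \<exists>r. \<forall>a\<in>A. r a \<in> over R \<and> b * a - r a \<in> I \<and> (\<forall>w k. bd w = Some k \<longrightarrow> deg_in (r a) w < k) \<and>
     derivs (r a) = {}" if "A \<subseteq> over R" "\<And>a. a \<in> A \<Longrightarrow> derivs a = {}" for A
  proof (intro bexI[of _ 1] exI[of _ "\<lambda>a. a"] ballI conjI allI impI)
    fix a w k assume "a \<in> A" "bd w = Some k"
    then show "deg_in a w < k" using that(2)[of a] kpos deg_in_eq_0_iff[of a w] by auto
  qed (use that M(1) I(1) in auto)
  \<comment> \<open>Lowers the degree in w alone, one unit at a time, with the same multiplier for
    all elements of A.\<close>
  have degred: "\<exists>b\<in>M. \<exists>r. \<forall>a\<in>A. r a \<in> over R \<and> b * a - r a \<in> I \<and> (\<forall>v\<in>derivs (r a). le v w) \<and> deg_in (r a) w < k"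
    if bdw: "bd w = Some k" and "A \<subseteq> over R" "\<And>a. a \<in> A \<Longrightarrow> (\<forall>v\<in>derivs a. le v w) \<and> deg_in a w \<le> n" for w k n A
    using that(2,3)
  proof (induction n arbitrary: A)
    case 0
    then show ?case using kpos[OF bdw] M(1) I(1)
      by (intro bexI[of _ 1] exI[of _ "\<lambda>a. a"] ballI conjI) auto
  next
    case (Suc n)
    show ?case
    proof (cases "Suc n < k")
      case True
      show ?thesis
      proof (intro bexI[of _ 1] exI[of _ "\<lambda>a. a"] ballI conjI)
        fix a assume "a \<in> A"
        then have "deg_in a w \<le> Suc n" using Suc.prems(2) by blast
        then show "deg_in a w < k" using True by linarith
      qed (use Suc.prems M(1) I(1) in auto)
    next
      case False
      obtain s r where s: "s \<in> M" "\<forall>v\<in>derivs s. lt v w" and r: "r \<in> over R" "\<forall>v\<in>derivs r. le v w" "deg_in r w < k"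
        and sr: "s * dv w ^ k - r \<in> I" using rel[OF bdw] by blast
      define c :: "('m,'v,'a) dpoly \<Rightarrow> ('m,'v,'a) dpoly" where "c = coef_in w (Suc n)"
      \<comment> \<open>This is \<open>s * a\<close> with \<open>s * dv w ^ k\<close> replaced by r
        in its top term; the difference is a multiple of an element of I.\<close>
      define f where "f a = s * (a - c a * dv w ^ Suc n) + c a * dv w ^ (Suc n - k) * r" for a
      have f: "f a \<in> over R \<and> s * a - f a \<in> I \<and> (\<forall>v\<in>derivs (f a). le v w) \<and> deg_in (f a) w \<le> n" if "a \<in> A" for a
      proof (intro conjI)
        have a: "a \<in> over R" and dega: "deg_in a w \<le> Suc n" and dera: "\<forall>v\<in>derivs a. le v w"
          using that Suc.prems by auto
        have ca: "c a \<in> over R" unfolding c_def using over_coef_in[OF R a] by blast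
        show "f a \<in> over R" unfolding f_def using a ca r s M(3) by (intro overI R) auto
        have "s * a - f a = (c a * dv w ^ (Suc n - k)) * (s * dv w ^ k - r)"
        proof -
          have "dv w ^ Suc n = (dv w ^ (Suc n - k) * dv w ^ k :: ('m,'v,'a) dpoly)"
            using False by (simp flip: power_add)
          then show ?thesis unfolding f_def by (simp only:) (simp add: algebra_simps)
        qed
        then show "s * a - f a \<in> I" using sr ca R by (simp add: I(3) overI)
        have dc: "derivs (c a) \<subseteq> derivs a - {w}" unfolding c_def by (rule derivs_coef_in)
        have "derivs (f a) \<subseteq> derivs s \<union> derivs a \<union> {w} \<union> derivs r"
          unfolding f_def using dc derivs_power[of "dv w :: ('m,'v,'a) dpoly"]
          by (auto dest!: subsetD[OF derivs_add] subsetD[OF derivs_mult] subsetD[OF derivs_diff])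
        then show "\<forall>v\<in>derivs (f a). le v w" using s r dera by blast
        have cw: "deg_in (coef_in w j a) w = 0" for j using derivs_coef_in[of w j a] by (auto simp: deg_in_eq_0_iff)
        have sw: "deg_in s w = 0" using s(2) by (auto simp: deg_in_eq_0_iff)
        have pw: "deg_in (dv w ^ j :: ('m,'v,'a) dpoly) w \<le> j" for j
          using deg_in_power[of "dv w :: ('m,'v,'a) dpoly" j w] by (simp add: deg_in_dv)
        have ex: "a - c a * dv w ^ Suc n = (\<Sum>j\<le>n. coef_in w j a * dv w ^ j)"
          unfolding c_def by (subst coef_in_expand[OF dega]) (simp del: power_Suc)
        have "deg_in (coef_in w j a * dv w ^ j) w \<le> n" if "j \<le> n" for j
          using deg_in_mult[of "coef_in w j a" "dv w ^ j" w] cw[of j] pw[of j] that by linarith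
        then have 1: "deg_in (a - c a * dv w ^ Suc n) w \<le> n"
          unfolding ex by (intro deg_in_sum) auto
        have "deg_in (c a * dv w ^ (Suc n - k)) w \<le> Suc n - k"
          using deg_in_mult[of "c a" "dv w ^ (Suc n - k)" w] cw[of "Suc n"] pw[of "Suc n - k"] by (simp add: c_def)
        then have 2: "deg_in (c a * dv w ^ (Suc n - k) * r) w \<le> n"
          using deg_in_mult[of "c a * dv w ^ (Suc n - k)" r w] r(3) False by linarith
        show "deg_in (f a) w \<le> n"
          unfolding f_def using 1 2 sw deg_in_mult[of s "a - c a * dv w ^ Suc n" w]
            deg_in_add[of "s * (a - c a * dv w ^ Suc n)" "c a * dv w ^ (Suc n - k) * r" w] by linarith
      qed
      then have "f ` A \<subseteq> over R" "\<And>a. a \<in> f ` A \<Longrightarrow> (\<forall>v\<in>derivs a. le v w) \<and> deg_in a w \<le> n" by auto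
      from Suc.IH[OF this] obtain b r' where b: "b \<in> M" and r': "\<And>a. a \<in> A \<Longrightarrow> r' (f a) \<in> over R \<and> b * f a - r' (f a) \<in> I \<and>
        (\<forall>v\<in>derivs (r' (f a)). le v w) \<and> deg_in (r' (f a)) w < k" by blast
      have "b * s * a - r' (f a) \<in> I" if "a \<in> A" for a
      proof -
        have "b * s * a - r' (f a) = b * (s * a - f a) + (b * f a - r' (f a))" by (simp add: algebra_simps)
        moreover have "b * (s * a - f a) + (b * f a - r' (f a)) \<in> I"
          using f[OF that] r'[OF that] b M(3) by (intro I(2) I(3)) auto
        ultimately show ?thesis by (simp only:)
      qed
      then show ?thesis using b s(1) M(2) r' by (intro bexI[of _ "b * s"] exI[of _ "\<lambda>a. r' (f a)"]) auto
    qed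
  qed
  \<comment> \<open>A is a set because the coefficients of a single polynomial must be reduced with
    a common multiplier before they can be put together again.\<close>
  have main: "\<forall>A. finite A \<longrightarrow> A \<subseteq> over R \<longrightarrow> (\<forall>a\<in>A. \<forall>v\<in>derivs a. le v w) \<longrightarrow> (\<exists>b\<in>M. \<exists>r. \<forall>a\<in>A. r a \<in> over R \<and> b * a - r a \<in> I \<and>
     (\<forall>v k. bd v = Some k \<longrightarrow> deg_in (r a) v < k) \<and> (\<forall>v\<in>derivs (r a). le v w))" for w
  proof (induction w rule: wfp_induct_rule[OF wf])
    case (1 w)
    show ?case
    proof (intro allI impI)
      fix A assume A: "finite A" "A \<subseteq> over R" "\<forall>a\<in>A. \<forall>v\<in>derivs a. le v w"
      define n where "n = Max (insert 0 ((\<lambda>a. deg_in a w) ` A))"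
      have n: "deg_in a w \<le> n" if "a \<in> A" for a using that A(1) by (auto simp: n_def)
      have "\<exists>b\<in>M. \<exists>r. \<forall>a\<in>A. r a \<in> over R \<and> b * a - r a \<in> I \<and> (\<forall>v\<in>derivs (r a). le v w) \<and>
         (\<forall>k. bd w = Some k \<longrightarrow> deg_in (r a) w < k) \<and> deg_in (r a) w \<le> (case bd w of None \<Rightarrow> n | Some k \<Rightarrow> k)"
      proof (cases "bd w")
        case None
        then show ?thesis using A n M(1) I(1) by (intro bexI[of _ 1] exI[of _ "\<lambda>a. a"]) auto
      next
        case (Some k)
        have "(\<forall>v\<in>derivs a. le v w) \<and> deg_in a w \<le> n" if "a \<in> A" for a using that A(3) n by blast
        from degred[OF Some A(2) this] obtain b r where "b \<in> M" and r: "\<And>a. a \<in> A \<Longrightarrow> r a \<in> over R \<and> b * a - r a \<in> I \<and>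
          (\<forall>v\<in>derivs (r a). le v w) \<and> deg_in (r a) w < k" by blast
        then show ?thesis using Some
          by (intro bexI[of _ b] exI[of _ r]) (auto simp: less_imp_le)
      qed
      then obtain b r N where b: "b \<in> M" and r: "\<And>a. a \<in> A \<Longrightarrow> r a \<in> over R \<and> b * a - r a \<in> I \<and> (\<forall>v\<in>derivs (r a). le v w) \<and>
         (\<forall>k. bd w = Some k \<longrightarrow> deg_in (r a) w < k) \<and> deg_in (r a) w \<le> N" by blast
      \<comment> \<open>All coefficients of all elements with respect to w, with N a common bound of
        the degrees in w. They involve only derivatives below w, so the induction hypothesis applies
        to them.\<close>
      define B where "B = (\<lambda>(j, a). coef_in w j (r a)) ` ({..N} \<times> A)"
      have finB: "finite B" using A(1) by (simp add: B_def)
      have BR: "B \<subseteq> over R" unfolding B_def using r by (auto intro!: over_coef_in[OF R])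
      have Blt: "lt v w" if "a \<in> B" "v \<in> derivs a" for a v
      proof -
        obtain j a' where "a = coef_in w j (r a')" "a' \<in> A" using \<open>a \<in> B\<close> by (auto simp: B_def)
        then show ?thesis using derivs_coef_in[of w j "r a'"] r[of a'] that(2) by blast
      qed
      have "\<exists>b\<in>M. \<exists>r. \<forall>a\<in>B. r a \<in> over R \<and> b * a - r a \<in> I \<and>
        (\<forall>v k. bd v = Some k \<longrightarrow> deg_in (r a) v < k) \<and> (\<forall>v\<in>derivs (r a). lt v w)"
      proof (cases "(\<Union>a\<in>B. derivs a) = {}")
        case True
        then obtain b r where "b \<in> M" "\<forall>a\<in>B. r a \<in> over R \<and> b * a - r a \<in> I \<and>
          (\<forall>w k. bd w = Some k \<longrightarrow> deg_in (r a) w < k) \<and> derivs (r a) = {}" using const[OF BR] by auto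
        then show ?thesis by (intro bexI[of _ b] exI[of _ r]) auto
      next
        case False
        obtain w' where w': "w' \<in> (\<Union>a\<in>B. derivs a)" "\<And>v. v \<in> (\<Union>a\<in>B. derivs a) \<Longrightarrow> le v w'"
          using ex_max[OF _ False] finB by auto
        have ww: "lt w' w" using w'(1) Blt by blast
        have "\<forall>a\<in>B. \<forall>v\<in>derivs a. le v w'" using w'(2) by blast
        from 1[OF ww, THEN spec, THEN mp, THEN mp, THEN mp, OF finB BR this]
        obtain b r where br: "b \<in> M" "\<forall>a\<in>B. r a \<in> over R \<and> b * a - r a \<in> I \<and>
          (\<forall>v k. bd v = Some k \<longrightarrow> deg_in (r a) v < k) \<and> (\<forall>v\<in>derivs (r a). le v w')"
          by blast
        have lw: "le v w' \<Longrightarrow> lt v w" for v using ww trans[of v w' w] by blast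
        show ?thesis
          by (intro bexI[of _ b] exI[of _ r]) (use br lw in blast)+
      qed
      then obtain b' r' where b': "b' \<in> M" and r': "\<And>a. a \<in> B \<Longrightarrow> r' a \<in> over R \<and> b' * a - r' a \<in> I \<and>
        (\<forall>v k. bd v = Some k \<longrightarrow> deg_in (r' a) v < k) \<and> (\<forall>v\<in>derivs (r' a). lt v w)" by blast
      define q where "q a = (\<Sum>j\<le>deg_in (r a) w. r' (coef_in w j (r a)) * dv w ^ j)" for a
      have Bin: "coef_in w j (r a) \<in> B" if "a \<in> A" "j \<le> deg_in (r a) w" for a j
        using that r[of a] by (force simp: B_def)
      have "q a \<in> over R \<and> b' * b * a - q a \<in> I \<and> (\<forall>v k. bd v = Some k \<longrightarrow> deg_in (q a) v < k) \<and> (\<forall>v\<in>derivs (q a). le v w)"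
        if a: "a \<in> A" for a
      proof (intro conjI)
        note Ba = r'[OF Bin[OF a]]
        show "q a \<in> over R" unfolding q_def using Ba by (intro overI R) auto
        have "b' * r a - q a = (\<Sum>j\<le>deg_in (r a) w. dv w ^ j * (b' * coef_in w j (r a) - r' (coef_in w j (r a))))"
          unfolding q_def by (subst (1) coef_in_expand[of "r a" w, OF order_refl])
            (simp add: sum_distrib_left sum_subtractf algebra_simps)
        moreover have sumI: "sum g J \<in> I" if "\<And>j. j \<in> J \<Longrightarrow> g j \<in> I" for g and J :: "nat set"
          using that by (induction J rule: infinite_finite_induct) (auto intro: I)
        moreover have "(\<Sum>j\<le>deg_in (r a) w. dv w ^ j * (b' * coef_in w j (r a) - r' (coef_in w j (r a)))) \<in> I"
          by (rule sumI, rule I(3)) (use Ba in \<open>auto intro!: overI R\<close>)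
        ultimately have "b' * r a - q a \<in> I" by simp
        moreover have "b' * (b * a - r a) \<in> I" using r[OF a] b' M(3) I(3) by blast
        ultimately have "b' * (b * a - r a) + (b' * r a - q a) \<in> I" by (rule I(2)[rotated])
        then show "b' * b * a - q a \<in> I" by (simp add: algebra_simps)
        show "\<forall>v k. bd v = Some k \<longrightarrow> deg_in (q a) v < k"
        proof (intro allI impI)
          fix v k assume bv: "bd v = Some k"
          have "deg_in (r' (coef_in w j (r a)) * dv w ^ j) v \<le> k - 1" if j: "j \<le> deg_in (r a) w" for j
          proof -
            have 1: "deg_in (r' (coef_in w j (r a))) v < k" using Ba[OF j] bv by blast
            have 2: "deg_in (dv w ^ j :: ('m,'v,'a) dpoly) v \<le> (if v = w then j else 0)"
              using deg_in_power[of "dv w :: ('m,'v,'a) dpoly" j v] by (auto simp: deg_in_dv)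
            show ?thesis
            proof (cases "v = w")
              case True
              then have "deg_in (r' (coef_in w j (r a))) v = 0" using Ba[OF j] by (auto simp: deg_in_eq_0_iff)
              moreover have "j < k" using r[OF a] True bv j by auto
              ultimately show ?thesis using 2 True deg_in_mult[of "r' (coef_in w j (r a))" "dv w ^ j" v] by simp
            next
              case False
              then show ?thesis using 1 2 deg_in_mult[of "r' (coef_in w j (r a))" "dv w ^ j" v] by simp
            qed
          qed
          then have "deg_in (q a) v \<le> k - 1" unfolding q_def by (intro deg_in_sum) auto
          then show "deg_in (q a) v < k" using kpos[OF bv] by linarith
        qed
        show "\<forall>v\<in>derivs (q a). le v w"
        proof
          fix v assume "v \<in> derivs (q a)"
          then obtain j where j: "j \<le> deg_in (r a) w" "v \<in> derivs (r' (coef_in w j (r a)) * dv w ^ j)"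
            unfolding q_def using derivs_sum by blast
          then have "v \<in> derivs (r' (coef_in w j (r a))) \<or> v \<in> derivs (dv w ^ j :: ('m,'v,'a) dpoly)"
            using derivs_mult by blast
          then show "le v w"
            using Ba[OF j(1)] derivs_power[of "dv w :: ('m,'v,'a) dpoly" j] by auto
        qed
      qed
      then show "\<exists>b\<in>M. \<exists>r. \<forall>a\<in>A. r a \<in> over R \<and> b * a - r a \<in> I \<and>
        (\<forall>v k. bd v = Some k \<longrightarrow> deg_in (r a) v < k) \<and> (\<forall>v\<in>derivs (r a). le v w)"
        using M(2)[OF b' b] by (intro bexI[of _ "b' * b"] exI[of _ q]) auto
    qed
  qed
  show ?thesis
  proof (cases "(\<Union>a\<in>A. derivs a) = {}")
    case True
    then obtain b r where "b \<in> M" "\<forall>a\<in>A. r a \<in> over R \<and> b * a - r a \<in> I \<and>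
      (\<forall>w k. bd w = Some k \<longrightarrow> deg_in (r a) w < k) \<and> derivs (r a) = {}" using const[OF A(2)] by auto
    then show ?thesis by (intro bexI[of _ b] exI[of _ r]) auto
  next
    case False
    obtain w where w: "w \<in> (\<Union>a\<in>A. derivs a)" "\<And>v. v \<in> (\<Union>a\<in>A. derivs a) \<Longrightarrow> le v w"
      using ex_max[OF _ False] A(1) by auto
    then have "\<forall>a\<in>A. \<forall>v\<in>derivs a. le v w" by blast
    from main[THEN spec, THEN mp, THEN mp, THEN mp, OF A this] obtain b r where "b \<in> M" "\<forall>a\<in>A. r a \<in> over R \<and> b * a - r a \<in> I \<and>
        (\<forall>v k. bd v = Some k \<longrightarrow> deg_in (r a) v < k) \<and> (\<forall>v\<in>derivs (r a). le v w)"
      by blast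
    then show ?thesis using w(1) by (intro bexI[of _ b] exI[of _ r]) blast+
  qed
qed

end

subsection \<open>Linear algebra, specialization and Gauss's lemma\<close>

text \<open>Gaussian elimination: with a pivot a0 for the equation b, the modified coefficients c'
  carry the remaining equations on \<open>A - {a0}\<close>, and the value at a0 is then determined
  by b.\<close>

lemma linear_dependence:
  fixes c :: "'i \<Rightarrow> 'j \<Rightarrow> 'f::field"
  assumes "finite B" "finite A" "card B < card A"
  shows "\<exists>l. (\<exists>a\<in>A. l a \<noteq> 0) \<and> (\<forall>b\<in>B. (\<Sum>a\<in>A. l a * c a b) = 0)"
  using assms
proof (induction B arbitrary: A c rule: finite_induct)
  case empty
  then obtain a where "a \<in> A" by fastforce
  then show ?case by (intro exI[of _ "\<lambda>_. 1"]) auto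
next
  case (insert b B)
  show ?case
  proof (cases "\<forall>a\<in>A. c a b = 0")
    case True
    have "card B < card A" using insert by simp
    from insert.IH[OF insert.prems(1) this, of c] True show ?thesis by auto
  next
    case False
    then obtain a0 where a0: "a0 \<in> A" "c a0 b \<noteq> 0" by blast
    define c' where "c' a b' = c a b' - c a b / c a0 b * c a0 b'" for a b'
    have "card B < card (A - {a0})" using insert a0 by simp
    from insert.IH[OF _ this, of c'] insert.prems(1) obtain l where
      l: "\<exists>a\<in>A - {a0}. l a \<noteq> 0" "\<forall>b\<in>B. (\<Sum>a\<in>A - {a0}. l a * c' a b) = 0" by auto
    define l' where "l' = l(a0 := - (\<Sum>a\<in>A - {a0}. l a * (c a b / c a0 b)))"
    have eq: "(\<Sum>a\<in>A. l' a * c a b') = (\<Sum>a\<in>A - {a0}. l a * c' a b')" for b'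
    proof -
      have "(\<Sum>a\<in>A. l' a * c a b') = l' a0 * c a0 b' + (\<Sum>a\<in>A - {a0}. l a * c a b')"
        by (subst sum.remove[OF insert.prems(1) a0(1)]) (auto simp: l'_def intro!: sum.cong)
      also have "\<dots> = (\<Sum>a\<in>A - {a0}. l a * c' a b')"
        by (simp add: l'_def c'_def sum_subtractf sum_distrib_left sum_distrib_right right_diff_distrib mult_ac)
      finally show ?thesis .
    qed
    have "(\<Sum>a\<in>A. l' a * c a b) = 0" unfolding eq using a0 by (simp add: c'_def)
    moreover have "\<forall>b\<in>B. (\<Sum>a\<in>A. l' a * c a b) = 0" using l(2) by (simp add: eq)
    moreover have "\<exists>a\<in>A. l' a \<noteq> 0" using l(1) by (auto simp: l'_def)
    ultimately show ?thesis by (intro exI[of _ l']) auto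
  qed
qed

section \<open>Subfields and linear functionals over them\<close>

definition subfield :: "'k::field set \<Rightarrow> bool" where
  "subfield G \<longleftrightarrow> subring G \<and> (\<forall>a\<in>G. inverse a \<in> G)"

lemma subfield_subring: "subfield G \<Longrightarrow> subring G" by (simp add: subfield_def)
lemma subfield_inverse: "subfield G \<Longrightarrow> a \<in> G \<Longrightarrow> inverse a \<in> G" by (simp add: subfield_def)
lemma subfield_divide: "subfield G \<Longrightarrow> a \<in> G \<Longrightarrow> b \<in> G \<Longrightarrow> a / b \<in> G"
  unfolding divide_inverse using subfield_inverse[of G b] subringD(5)[of G a "inverse b"] subfield_subring[of G] by blast

text \<open>A G-subspace V that is maximal among those avoiding \<kappa> is a complement of the line
  spanned by \<kappa>, and the functional is the coordinate along that line.\<close>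

lemma subfield_functional:
  fixes G :: "'k::field set"
  assumes G: "subfield G" and \<kappa>: "\<kappa> \<noteq> 0"
  shows "\<exists>\<pi>. \<pi> \<kappa> = 1 \<and> (\<forall>x. \<pi> x \<in> G) \<and> (\<forall>x y. \<pi> (x + y) = \<pi> x + \<pi> y) \<and> (\<forall>g\<in>G. \<forall>x. \<pi> (g * x) = g * \<pi> x)"
proof -
  note R = subringD[OF subfield_subring[OF G]]
  define \<V> where "\<V> = {V. 0 \<in> V \<and> (\<forall>x\<in>V. \<forall>y\<in>V. x + y \<in> V) \<and> (\<forall>g\<in>G. \<forall>x\<in>V. g * x \<in> V) \<and> \<kappa> \<notin> V}"
  have "{0} \<in> \<V>" using \<kappa> by (auto simp: \<V>_def)
  then have ne: "\<V> \<noteq> {}" by blast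
  have "\<exists>V\<in>\<V>. \<forall>W\<in>\<V>. V \<subseteq> W \<longrightarrow> W = V"
  proof (rule subset_Zorn_nonempty[OF ne])
    fix \<C> assume c: "\<C> \<noteq> {}" "subset.chain \<V> \<C>"
    then have cV: "\<C> \<subseteq> \<V>" and tot: "\<And>X Y. X \<in> \<C> \<Longrightarrow> Y \<in> \<C> \<Longrightarrow> X \<subseteq> Y \<or> Y \<subseteq> X"
      by (auto simp: subset.chain_def)
    have "x + y \<in> \<Union>\<C>" if "x \<in> \<Union>\<C>" "y \<in> \<Union>\<C>" for x y
    proof -
      from that obtain X Y where XY: "X \<in> \<C>" "x \<in> X" "Y \<in> \<C>" "y \<in> Y" by blast
      have "x + y \<in> X \<union> Y"
        using tot[OF XY(1,3)] XY cV unfolding \<V>_def by blast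
      then show ?thesis using XY by blast
    qed
    moreover have "0 \<in> \<Union>\<C>" using c(1) cV unfolding \<V>_def by blast
    ultimately show "\<Union>\<C> \<in> \<V>" using cV unfolding \<V>_def by blast
  qed
  then obtain V where V: "V \<in> \<V>" and max: "\<And>W. W \<in> \<V> \<Longrightarrow> V \<subseteq> W \<Longrightarrow> W = V" by blast
  have V0: "0 \<in> V" and Va: "\<And>x y. x \<in> V \<Longrightarrow> y \<in> V \<Longrightarrow> x + y \<in> V" and Vm: "\<And>g x. g \<in> G \<Longrightarrow> x \<in> V \<Longrightarrow> g * x \<in> V"
    and Vk: "\<kappa> \<notin> V" using V by (auto simp: \<V>_def)
  \<comment> \<open>Adjoining x to V must bring in \<kappa> by maximality, and the resulting
    expression for \<kappa> can be solved for x.\<close>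
  have ex: "\<exists>g\<in>G. x - g * \<kappa> \<in> V" for x
  proof (cases "x \<in> V")
    case True
    then show ?thesis using R(1) by (intro bexI[of _ 0]) auto
  next
    case False
    define W where "W = {y + g * x |y g. y \<in> V \<and> g \<in> G}"
    have VW: "V \<subseteq> W" using R(1) by (force simp: W_def)
    have xW: "x \<in> W" using V0 R(2) by (force simp: W_def)
    have "\<kappa> \<in> W"
    proof (rule ccontr)
      assume "\<kappa> \<notin> W"
      have "a + b \<in> W" if "a \<in> W" "b \<in> W" for a b
      proof -
        from that obtain y g y' g' where "a = y + g * x" "b = y' + g' * x" "y \<in> V" "y' \<in> V" "g \<in> G" "g' \<in> G" by (auto simp: W_def)
        then have "a + b = (y + y') + (g + g') * x" "y + y' \<in> V" "g + g' \<in> G" using Va R by (auto simp: algebra_simps)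
        then show ?thesis unfolding W_def by blast
      qed
      moreover have "h * a \<in> W" if "a \<in> W" "h \<in> G" for a h
      proof -
        from that obtain y g where "a = y + g * x" "y \<in> V" "g \<in> G" by (auto simp: W_def)
        then have "h * a = h * y + (h * g) * x" "h * y \<in> V" "h * g \<in> G" using Vm R that by (auto simp: algebra_simps)
        then show ?thesis unfolding W_def by blast
      qed
      ultimately have "W \<in> \<V>" using \<open>\<kappa> \<notin> W\<close> VW V0 unfolding \<V>_def by blast
      from max[OF this VW] xW False show False by blast
    qed
    then obtain y g where yg: "\<kappa> = y + g * x" "y \<in> V" "g \<in> G" by (auto simp: W_def)
    then have "g \<noteq> 0" using Vk by auto
    have "x - inverse g * \<kappa> = (- inverse g) * y" using \<open>g \<noteq> 0\<close> by (simp add: yg(1) algebra_simps)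
    moreover have "(- inverse g) * y \<in> V" using Vm[OF R(3)[OF subfield_inverse[OF G yg(3)]] yg(2)] .
    ultimately show ?thesis using subfield_inverse[OF G yg(3)] by (intro bexI[of _ "inverse g"]) auto
  qed
  have uniq: "g = h" if "g \<in> G" "h \<in> G" "x - g * \<kappa> \<in> V" "x - h * \<kappa> \<in> V" for g h x
  proof (rule ccontr)
    assume "g \<noteq> h"
    have "- 1 * (x - h * \<kappa>) \<in> V" using that R by (intro Vm) auto
    then have "(x - g * \<kappa>) + - 1 * (x - h * \<kappa>) \<in> V" using that by (intro Va)
    then have "(h - g) * \<kappa> \<in> V" by (simp add: algebra_simps)
    then have "inverse (h - g) * ((h - g) * \<kappa>) \<in> V"
      by (rule Vm[rotated]) (use that R(6) subfield_inverse[OF G] in blast)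
    then show False using Vk \<open>g \<noteq> h\<close> by (simp flip: mult.assoc)
  qed
  define \<pi> where "\<pi> x = (SOME g. g \<in> G \<and> x - g * \<kappa> \<in> V)" for x
  have \<pi>: "\<pi> x \<in> G \<and> x - \<pi> x * \<kappa> \<in> V" for x
    unfolding \<pi>_def by (rule someI_ex) (use ex[of x] in blast)
  have \<pi>I: "\<pi> x = g" if "g \<in> G" "x - g * \<kappa> \<in> V" for x g using uniq \<pi> that by blast
  show ?thesis
  proof (intro exI[of _ \<pi>] conjI allI ballI)
    show "\<pi> \<kappa> = 1" using V0 R(2) by (intro \<pi>I) auto
    show "\<pi> x \<in> G" for x using \<pi> by blast
    show "\<pi> (x + y) = \<pi> x + \<pi> y" for x y
    proof (rule \<pi>I)
      have "(x - \<pi> x * \<kappa>) + (y - \<pi> y * \<kappa>) \<in> V" using \<pi> Va by blast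
      then show "x + y - (\<pi> x + \<pi> y) * \<kappa> \<in> V" by (simp add: algebra_simps)
    qed (use \<pi> R in auto)
    show "\<pi> (g * x) = g * \<pi> x" if "g \<in> G" for g x
    proof (rule \<pi>I)
      have "g * (x - \<pi> x * \<kappa>) \<in> V" using \<pi> Vm that by blast
      then show "g * x - g * \<pi> x * \<kappa> \<in> V" by (simp add: algebra_simps)
    qed (use \<pi> R that in auto)
  qed
qed

section \<open>Points with natural coordinates off finitely many zero sets\<close>

lemma char0_of_nat_inj: "char0 TYPE('a::idom) \<Longrightarrow> inj (of_nat :: nat \<Rightarrow> 'a)"
proof (rule injI)
  fix m n assume c: "char0 TYPE('a)" and eq: "of_nat m = (of_nat n :: 'a)"
  have *: False if "a < b" "of_nat a = (of_nat b :: 'a)" for a b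
    using char0D[OF c, of "b - a"] that by (simp add: of_nat_diff)
  show "m = n" using *[of m n] *[of n m] eq by (metis linorder_neqE_nat)
qed

text \<open>Induction on the derivatives that occur: first the leading coefficients with respect to
  w are made nonzero; the finitely many polynomials left in w then have finitely many roots. Natural
  coordinates are wanted because they lie in every subfield and are killed by the partial
  derivatives.\<close>

lemma ex_nonvanishing_point:
  fixes S :: "('m,'v,'a::idom) dpoly set"
  assumes c0: "char0 TYPE('a)" and "finite S" "0 \<notin> S"
  shows "\<exists>c :: ('m,'v) deriv \<Rightarrow> nat. \<forall>p\<in>S. peval (\<lambda>x. x) (\<lambda>w. of_nat (c w)) p \<noteq> 0"
proof -
  have "\<forall>S :: ('m,'v,'a) dpoly set. finite S \<longrightarrow> 0 \<notin> S \<longrightarrow> (\<forall>p\<in>S. derivs p \<subseteq> W) \<longrightarrow>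
     (\<exists>c :: ('m,'v) deriv \<Rightarrow> nat. \<forall>p\<in>S. peval (\<lambda>x. x) (\<lambda>w. of_nat (c w)) p \<noteq> 0)" if "finite W" for W
    using that
  proof (induction W rule: finite_induct)
    case empty
    show ?case
    proof (intro allI impI exI[of _ "\<lambda>_. 0"] ballI)
      fix S :: "('m,'v,'a) dpoly set" and p assume "0 \<notin> S" "\<forall>p\<in>S. derivs p \<subseteq> {}" "p \<in> S"
      then have "derivs p = {}" "p \<noteq> 0" by auto
      then show "peval (\<lambda>x. x) (\<lambda>w. of_nat 0) p \<noteq> 0"
        using derivs_empty[of p] by (subst peval_no_derivs) (auto)
    qed
  next
    case (insert w W)
    show ?case
    proof (intro allI impI)
      fix S :: "('m,'v,'a) dpoly set" assume S: "finite S" "0 \<notin> S" "\<forall>p\<in>S. derivs p \<subseteq> insert w W"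
      let ?l = "\<lambda>p. coef_in w (deg_in p w) p"
      have "finite (?l ` S)" using S by simp
      moreover have "0 \<notin> ?l ` S"
      proof
        assume "0 \<in> ?l ` S"
        then obtain p where "p \<in> S" "?l p = 0" by auto
        then show False using S(2) coef_in_deg_neq_0[of p w] by auto
      qed
      moreover have "\<forall>p\<in>?l ` S. derivs p \<subseteq> W" using S(3) derivs_coef_in by fastforce
      ultimately obtain c :: "('m,'v) deriv \<Rightarrow> nat" where c: "\<forall>p\<in>?l ` S. peval (\<lambda>x. x) (\<lambda>w. of_nat (c w)) p \<noteq> 0"
        using insert.IH by blast
      define g where "g p = (\<Sum>k\<le>deg_in p w. monom (peval (\<lambda>x. x) (\<lambda>w. of_nat (c w)) (coef_in w k p)) k)"
        for p :: "('m,'v,'a) dpoly"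
      have "coeff (g p) (deg_in p w) = peval (\<lambda>x. x) (\<lambda>w. of_nat (c w)) (?l p)" for p
        by (simp add: g_def coeff_sum sum.delta)
      then have "coeff (g p) (deg_in p w) \<noteq> 0" if "p \<in> S" for p using c that by simp
      then have "g p \<noteq> 0" if "p \<in> S" for p using that by (metis coeff_0)
      then have "finite (\<Union>p\<in>S. {x. poly (g p) x = 0})" using S(1) poly_roots_finite by auto
      moreover have "infinite (range (of_nat :: nat \<Rightarrow> 'a))" using char0_of_nat_inj[OF c0] by (rule range_inj_infinite)
      ultimately obtain n where n: "of_nat n \<notin> (\<Union>p\<in>S. {x. poly (g p) x = 0})"
        by (meson finite_subset image_subsetI)
      define c' where "c' = c(w := n)"
      have "peval (\<lambda>x. x) (\<lambda>w. of_nat (c' w)) p = poly (g p) (of_nat n)" for p :: "('m,'v,'a) dpoly"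
      proof -
        have e: "peval (\<lambda>x. x) (\<lambda>w. of_nat (c' w)) (coef_in w k p) = peval (\<lambda>x. x) (\<lambda>w. of_nat (c w)) (coef_in w k p)" for k
          using derivs_coef_in[of w k p] by (intro peval_cong) (auto simp: c'_def)
        have "peval (\<lambda>x. x) (\<lambda>w. of_nat (c' w)) p =
          peval (\<lambda>x. x) (\<lambda>w. of_nat (c' w)) (\<Sum>k\<le>deg_in p w. coef_in w k p * dv w ^ k)"
          by (subst coef_in_expand[of p w "deg_in p w"]) auto
        also have "\<dots> = (\<Sum>k\<le>deg_in p w. peval (\<lambda>x. x) (\<lambda>w. of_nat (c w)) (coef_in w k p) * of_nat n ^ k)"
          by (simp add: peval_sum[of UNIV] peval_mult[of UNIV] peval_power[of UNIV] peval_dv[of UNIV] e) (simp add: c'_def)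
        also have "\<dots> = poly (g p) (of_nat n)" by (simp add: g_def poly_sum poly_monom)
        finally show ?thesis .
      qed
      then show "\<exists>c :: ('m,'v) deriv \<Rightarrow> nat. \<forall>p\<in>S. peval (\<lambda>x. x) (\<lambda>w. of_nat (c w)) p \<noteq> 0"
        using n by (intro exI[of _ c']) auto
    qed
  qed
  from this[of "\<Union>p\<in>S. derivs p"] show ?thesis using assms derivs_finite by auto
qed

text \<open>At a point where neither factor vanishes the product has a nonzero value.\<close>

lemma dpoly_no_zero_divisors:
  fixes p q :: "('m,'v,'a::idom) dpoly"
  assumes "char0 TYPE('a)" "p * q = 0" shows "p = 0 \<or> q = 0"
proof (rule ccontr)
  assume "\<not> (p = 0 \<or> q = 0)"
  then have "finite {p, q}" "0 \<notin> {p, q}" by auto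
  from ex_nonvanishing_point[OF assms(1) this] obtain c :: "('m,'v) deriv \<Rightarrow> nat"
    where "\<forall>p\<in>{p,q}. peval (\<lambda>x. x) (\<lambda>w. of_nat (c w)) p \<noteq> 0" by blast
  then show False using peval_mult[of UNIV "\<lambda>x. x" p q "\<lambda>w. of_nat (c w)"] assms(2) by simp
qed

section \<open>Gauss's lemma for polynomials in two variables over a field\<close>

lemma ex_prime_factor:
  fixes g :: "'k::field poly"
  assumes "degree g > 0" shows "\<exists>\<pi>. prime_elem \<pi> \<and> \<pi> dvd g"
proof -
  obtain p where p: "p dvd g" "degree p > 0" and min: "\<And>q. q dvd g \<Longrightarrow> degree q > 0 \<Longrightarrow> degree p \<le> degree q"
    using ex_has_least_nat[of "\<lambda>p. p dvd g \<and> degree p > 0" g degree] assms by auto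
  have unit: "q dvd 1" if "degree q = 0" "q \<noteq> 0" for q :: "'k poly"
    using that by (simp add: is_unit_iff_degree)
  have "irreducible p"
  proof (rule irreducibleI)
    show "p \<noteq> 0" using p by auto
    show "\<not> p dvd 1"
    proof
      assume "p dvd 1"
      then have "degree p = 0" using is_unit_iff_degree[of p] p by fastforce
      with p show False by simp
    qed
    fix a b assume ab: "p = a * b"
    then have nz: "a \<noteq> 0" "b \<noteq> 0" using p by auto
    then have deg: "degree p = degree a + degree b" using ab degree_mult_eq by blast
    have "a dvd g" "b dvd g" using p(1) ab by (auto intro: dvd_trans)
    then have "degree a = 0 \<or> degree b = 0" using min[of a] min[of b] deg by linarith
    then show "a dvd 1 \<or> b dvd 1" using unit nz by blast
  qed
  then show ?thesis using p field_poly_irreducible_imp_prime by blast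
qed

lemma coeff_mult_bounds:
  fixes p q :: "'k::comm_ring_1 poly"
  assumes "degree p \<le> a" "degree q \<le> b" shows "coeff (p * q) (a + b) = coeff p a * coeff q b"
proof -
  have "coeff (p * q) (a + b) = (\<Sum>i\<le>a + b. coeff p i * coeff q (a + b - i))" by (rule coeff_mult)
  also have "\<dots> = (\<Sum>i\<le>a + b. if i = a then coeff p a * coeff q b else 0)"
  proof (intro sum.cong refl)
    fix i assume "i \<in> {..a + b}"
    show "coeff p i * coeff q (a + b - i) = (if i = a then coeff p a * coeff q b else 0)"
      using assms by (cases i a rule: linorder_cases) (auto simp: coeff_eq_0)
  qed
  finally show ?thesis by (simp add: sum.delta)
qed

text \<open>Degrees in the inner variable add up: the coefficients of top inner degree form nonzero
  polynomials \<open>L a P\<close> and \<open>L b Q\<close> over a domain, so their product, the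
  coefficient of inner degree a + b, is nonzero.\<close>

lemma coeff_degree_mult_le:
  fixes P Q :: "'k::idom poly poly"
  assumes "Q \<noteq> 0" "\<And>j. degree (coeff (P * Q) j) \<le> e"
  shows "degree (coeff P j) \<le> e"
proof (rule ccontr)
  assume "\<not> degree (coeff P j) \<le> e"
  define a where "a = Max ((\<lambda>j. degree (coeff P j)) ` {..degree P})"
  define b where "b = Max ((\<lambda>j. degree (coeff Q j)) ` {..degree Q})"
  have le: "degree (coeff P j) \<le> a" for j
  proof (cases "j \<le> degree P")
    case True then show ?thesis unfolding a_def by (intro Max_ge) auto
  qed (auto simp: coeff_eq_0)
  have leq: "degree (coeff Q j) \<le> b" for j
  proof (cases "j \<le> degree Q")
    case True then show ?thesis unfolding b_def by (intro Max_ge) auto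
  qed (auto simp: coeff_eq_0)
  have "a > e" using \<open>\<not> degree (coeff P j) \<le> e\<close> le[of j] by linarith
  define L where "L n R = map_poly (\<lambda>c. coeff c n) R" for n and R :: "'k poly poly"
  have L: "coeff (L n R) j = coeff (coeff R j) n" for n R j by (simp add: L_def coeff_map_poly)
  have "L (a + b) (P * Q) = L a P * L b Q"
    by (rule poly_eqI) (simp only: L coeff_mult[of P Q] coeff_mult[of "L a P" "L b Q"] coeff_sum coeff_mult_bounds[OF le leq])
  moreover have "L a P \<noteq> 0"
  proof -
    have "a \<in> (\<lambda>j. degree (coeff P j)) ` {..degree P}" unfolding a_def by (intro Max_in) auto
    then obtain j where j: "degree (coeff P j) = a" by auto
    then have "coeff P j \<noteq> 0" using \<open>a > e\<close> by auto
    then have "coeff (L a P) j \<noteq> 0" using j by (auto simp: L)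
    then show ?thesis by auto
  qed
  moreover have "L b Q \<noteq> 0"
  proof -
    have "\<exists>j. degree (coeff Q j) = b \<and> coeff Q j \<noteq> 0"
    proof (cases "b = 0")
      case True
      then show ?thesis using leq[of "degree Q"] assms(1) by (intro exI[of _ "degree Q"]) auto
    next
      case False
      have "b \<in> (\<lambda>j. degree (coeff Q j)) ` {..degree Q}" unfolding b_def by (intro Max_in) auto
      then obtain j where "degree (coeff Q j) = b" by auto
      then show ?thesis using False by (intro exI[of _ j]) auto
    qed
    then obtain j where "degree (coeff Q j) = b" "coeff Q j \<noteq> 0" by blast
    then have "coeff (L b Q) j \<noteq> 0" by (auto simp: L)
    then show ?thesis by auto
  qed
  ultimately have "L (a + b) (P * Q) \<noteq> 0" by simp
  then obtain j where "coeff (coeff (P * Q) j) (a + b) \<noteq> 0" using L by (metis leading_coeff_0_iff)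
  then have "a + b \<le> degree (coeff (P * Q) j)" by (rule le_degree)
  then show False using assms(2)[of j] \<open>a > e\<close> by linarith
qed

text \<open>Dividing A by a constant factor g of greatest degree leaves a primitive A0. By Gauss's
  lemma each prime factor of \<gamma> divides the cofactor, so \<gamma> can be cancelled prime by
  prime; then A0 divides Z, and the inner degrees of Z bound those of A0.\<close>

lemma gauss_degree:
  fixes A Z H :: "'k::field poly poly"
  assumes "smult \<gamma> Z = A * H" "\<gamma> \<noteq> 0" "Z \<noteq> 0" "\<And>j. degree (coeff Z j) \<le> e"
  shows "\<exists>g A0. g \<noteq> 0 \<and> A = smult g A0 \<and> (\<forall>j. degree (coeff A0 j) \<le> e)"
proof -
  have nz: "A \<noteq> 0" "H \<noteq> 0" using assms(1-3) by auto
  define D where "D g \<longleftrightarrow> g \<noteq> 0 \<and> [:g:] dvd A" for g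
  have "D 1" by (simp add: D_def flip: one_pCons)
  obtain j0 where j0: "coeff A j0 \<noteq> 0" using nz(1) by (metis leading_coeff_0_iff)
  have "degree g \<le> degree (coeff A j0)" if "D g" for g
    using that j0 unfolding D_def const_poly_dvd_iff by (meson dvd_imp_degree_le)
  then have "\<forall>h. D h \<longrightarrow> degree h < Suc (degree (coeff A j0))" by (simp add: less_Suc_eq_le)
  from ex_has_greatest_nat[of D 1 degree, OF \<open>D 1\<close> this]
  have "\<exists>g. D g \<and> (\<forall>h. D h \<longrightarrow> degree h \<le> degree g)" .
  then obtain g where g: "D g" and max: "\<And>h. D h \<Longrightarrow> degree h \<le> degree g" by blast
  obtain A0 where A0: "A = smult g A0" using g by (auto simp: D_def elim!: dvdE)
  have prim: "\<not> [:\<pi>:] dvd A0" if "prime_elem \<pi>" for \<pi>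
  proof
    assume "[:\<pi>:] dvd A0"
    then obtain B where "A0 = smult \<pi> B" by (auto elim!: dvdE)
    then have "A = [:g * \<pi>:] * B" using A0 by simp
    then have "[:g * \<pi>:] dvd A" by (rule dvdI)
    then have "D (g * \<pi>)" using g that unfolding D_def by auto
    moreover have "degree \<pi> > 0" using that is_unit_iff_degree[of \<pi>] by (auto simp: prime_elem_def)
    moreover have "g \<noteq> 0" "\<pi> \<noteq> 0" using g that by (auto simp: D_def)
    ultimately show False using max[of "g * \<pi>"] by (simp add: degree_mult_eq)
  qed
  have "\<exists>H'. Z = A0 * H'" if "smult \<gamma> Z = A0 * H" "\<gamma> \<noteq> 0" for \<gamma> H
    using that
  proof (induction "degree \<gamma>" arbitrary: \<gamma> H rule: less_induct)
    case less
    show ?case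
    proof (cases "degree \<gamma> = 0")
      case True
      then obtain c where c: "\<gamma> = [:c:]" by (metis degree_eq_zeroE)
      then have "c \<noteq> 0" using less by auto
      have "Z = smult ([:inverse c:] * \<gamma>) Z" using \<open>c \<noteq> 0\<close> c by (simp flip: one_pCons)
      also have "\<dots> = A0 * smult [:inverse c:] H" using less(2) by (metis mult_smult_right smult_smult)
      finally show ?thesis by blast
    next
      case False
      then obtain \<pi> where \<pi>: "prime_elem \<pi>" "\<pi> dvd \<gamma>" using ex_prime_factor by blast
      then obtain \<gamma>' where \<gamma>': "\<gamma> = \<pi> * \<gamma>'" by blast
      have "[:\<pi>:] dvd smult \<gamma> Z" by (simp add: \<gamma>' const_poly_dvd_iff)
      then have "[:\<pi>:] dvd A0 * H" using less(2) by simp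
      then have "[:\<pi>:] dvd H" using lift_prime_elem_poly[OF \<pi>(1)] prim[OF \<pi>(1)] prime_elem_dvd_mult_iff by blast
      then obtain H' where H': "H = smult \<pi> H'" by (auto elim!: dvdE)
      have p0: "\<pi> \<noteq> 0" using \<pi> by auto
      have "smult \<pi> (smult \<gamma>' Z) = smult \<pi> (A0 * H')" using less(2) by (simp add: \<gamma>' H')
      then have "smult \<gamma>' Z = A0 * H'" using p0 by (metis smult_cancel)
      moreover have "\<gamma>' \<noteq> 0" using less(3) \<gamma>' by auto
      moreover have "degree \<gamma>' < degree \<gamma>"
      proof -
        have "degree \<pi> > 0" using \<pi> is_unit_iff_degree[of \<pi>] by (auto simp: prime_elem_def)
        then show ?thesis using \<open>\<gamma>' \<noteq> 0\<close> p0 by (simp add: \<gamma>' degree_mult_eq)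
      qed
      ultimately show ?thesis using less(1) by blast
    qed
  qed
  then obtain H' where Z: "Z = A0 * H'" using assms(1,2) A0 by (metis mult_smult_left mult_smult_right)
  then have "H' \<noteq> 0" using assms(3) by auto
  then have "degree (coeff A0 j) \<le> e" for j
    using assms(4)[unfolded Z] by (rule coeff_degree_mult_le)
  then show ?thesis using A0 g by (auto simp: D_def)
qed

text \<open>A pair of minimal degree among those proportional to it generates all of them; this replaces
  coprimality.\<close>

definition min_pair :: "'k::field poly \<Rightarrow> 'k poly \<Rightarrow> bool" where
  "min_pair p q \<longleftrightarrow> q \<noteq> 0 \<and> (\<forall>p' q'. q' \<noteq> 0 \<longrightarrow> p' * q = q' * p \<longrightarrow> max (degree p) (degree q) \<le> max (degree p') (degree q'))"

lemma min_pair_exists: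
  assumes "(Q :: 'k::field poly) \<noteq> 0" shows "\<exists>p q. min_pair p q \<and> p * Q = q * P"
proof -
  define T where "T x \<longleftrightarrow> snd x \<noteq> 0 \<and> fst x * Q = snd x * P" for x
  have "T (P, Q)" using assms by (simp add: T_def)
  then obtain x where x: "T x" and min: "\<And>y. T y \<Longrightarrow> max (degree (fst x)) (degree (snd x)) \<le> max (degree (fst y)) (degree (snd y))"
    using ex_has_least_nat[of T "(P, Q)" "\<lambda>x. max (degree (fst x)) (degree (snd x))"] by auto
  have "min_pair (fst x) (snd x)" unfolding min_pair_def
  proof (intro conjI allI impI)
    fix p' q' assume *: "q' \<noteq> 0" "p' * snd x = q' * fst x"
    have "snd x * (p' * Q) = snd x * (q' * P)" using * x unfolding T_def
      by (metis mult.assoc mult.commute)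
    then have "T (p', q')" using * x by (auto simp: T_def)
    from min[OF this] show "max (degree (fst x)) (degree (snd x)) \<le> max (degree p') (degree q')" by simp
  qed (use x T_def in auto)
  then show ?thesis using x by (auto simp: T_def)
qed

text \<open>Euclidean division by the member of greater degree leaves a pair that is still
  proportional to (p, q) but of smaller degree, so it vanishes by minimality.\<close>

lemma min_pair_generates:
  assumes pq: "min_pair p q" and eq: "p' * q = q' * (p::'k::field poly)"
  shows "\<exists>c. p' = c * p \<and> q' = c * q"
proof -
  have q0: "q \<noteq> 0" using pq by (simp add: min_pair_def)
  define c where "c = (if degree p \<le> degree q then q' div q else p' div p)"
  define r s where "r = p' - c * p" and "s = q' - c * q"
  have rs: "r * q = s * p" using eq by (simp add: r_def s_def algebra_simps)
  have "s = 0"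
  proof (rule ccontr)
    assume "s \<noteq> 0"
    then have le: "max (degree p) (degree q) \<le> max (degree r) (degree s)" using pq rs unfolding min_pair_def by blast
    have "degree r + degree q = degree s + degree p" if "r \<noteq> 0" "p \<noteq> 0"
      using rs that \<open>s \<noteq> 0\<close> q0 by (metis degree_mult_eq)
    moreover have r0: "r = 0 \<longleftrightarrow> p = 0" using rs q0 \<open>s \<noteq> 0\<close> by (metis mult_eq_0_iff)
    show False
    proof (cases "degree p \<le> degree q")
      case True
      then have "s = q' mod q" by (simp add: s_def c_def minus_div_mult_eq_mod)
      then have "degree s < degree q \<or> s = 0" using degree_mod_less[OF q0] by auto
      then have "degree s < degree q" using \<open>s \<noteq> 0\<close> by simp
      then show False using le True calculation r0 by (cases "p = 0") auto
    next
      case False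
      then have "p \<noteq> 0" by auto
      have "r = p' mod p" using False by (simp add: r_def c_def minus_div_mult_eq_mod)
      then have "degree r < degree p \<or> r = 0" using degree_mod_less[OF \<open>p \<noteq> 0\<close>] by auto
      then show False using le False calculation r0 \<open>p \<noteq> 0\<close> by auto
    qed
  qed
  then have "r = 0" using rs q0 by auto
  then show ?thesis using \<open>s = 0\<close> by (auto simp: r_def s_def)
qed

text \<open>Stands for coprimality: if p f = h q, then (h, f) is a multiple of (p, q), so q already
  divides f.\<close>

lemma min_pair_dvd:
  assumes "min_pair p q" shows "q dvd p ^ j * f \<Longrightarrow> q dvd (f::'k::field poly)"
proof (induction j)
  case (Suc j)
  then obtain h where "p ^ Suc j * f = q * h" by blast
  then have "h * q = (p ^ j * f) * p" by (simp add: algebra_simps)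
  from min_pair_generates[OF assms this] have "q dvd p ^ j * f" by (auto simp: dvd_def mult.commute)
  then show ?case using Suc.IH by blast
qed simp

lemma min_pair_dvd':
  assumes "min_pair p q" "p \<noteq> 0" shows "p dvd q ^ j * f \<Longrightarrow> p dvd (f::'k::field poly)"
proof (induction j)
  case (Suc j)
  then obtain h where "q ^ Suc j * f = p * h" by blast
  then have "(q ^ j * f) * q = h * p" by (simp add: algebra_simps)
  from min_pair_generates[OF assms(1) this] have "p dvd q ^ j * f" by (auto simp: dvd_def mult.commute)
  then show ?case using Suc.IH by blast
qed simp

text \<open>The powers of p / q satisfy no nontrivial relation with coefficients of degree below
  max(deg p, deg q): modulo the member of greater degree only one end of the sum remains, so its
  coefficient is divisible by that member and hence 0. In field terms, this maximum is the degree of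
  the variable over the field generated by p / q.\<close>

lemma min_pair_independent:
  fixes f :: "nat \<Rightarrow> 'k::field poly"
  assumes "min_pair p q" and "\<And>j. j \<le> J \<Longrightarrow> degree (f j) < max (degree p) (degree q)"
    and "(\<Sum>j\<le>J. f j * p ^ j * q ^ (J - j)) = 0" "j \<le> J"
  shows "f j = 0"
  using assms(2-4)
proof (induction J arbitrary: f j)
  case 0
  then show ?case by simp
next
  case (Suc J)
  have q0: "q \<noteq> 0" using assms(1) by (simp add: min_pair_def)
  show ?case
  proof (cases "degree p \<le> degree q")
    case True
    have "(\<Sum>j\<le>J. f j * p ^ j * q ^ (Suc J - j)) = q * (\<Sum>j\<le>J. f j * p ^ j * q ^ (J - j))"
      by (simp add: sum_distrib_left Suc_diff_le algebra_simps)
    then have e: "q * (\<Sum>j\<le>J. f j * p ^ j * q ^ (J - j)) + p ^ Suc J * f (Suc J) = 0"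
      using Suc.prems(2) by (simp add: algebra_simps)
    then have "p ^ Suc J * f (Suc J) = q * - (\<Sum>j\<le>J. f j * p ^ j * q ^ (J - j))"
      unfolding add_eq_0_iff by (simp only: mult_minus_right)
    then have "q dvd p ^ Suc J * f (Suc J)" by (rule dvdI)
    then have "q dvd f (Suc J)" using min_pair_dvd[OF assms(1)] by blast
    moreover have "degree (f (Suc J)) < degree q" using Suc.prems(1)[of "Suc J"] True by simp
    ultimately have last: "f (Suc J) = 0" using dvd_imp_degree_le[of q "f (Suc J)"] by auto
    then have "(\<Sum>j\<le>J. f j * p ^ j * q ^ (J - j)) = 0" using e q0 by simp
    then show ?thesis using Suc.IH[of f j] Suc.prems(1,3) last by (cases "j = Suc J") auto
  next
    case False
    then have p0: "p \<noteq> 0" by auto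
    have "(\<Sum>j\<le>Suc J. f j * p ^ j * q ^ (Suc J - j)) = f 0 * q ^ Suc J + (\<Sum>j\<le>J. f (Suc j) * p ^ Suc j * q ^ (J - j))"
      by (subst sum.atMost_Suc_shift) simp
    also have "(\<Sum>j\<le>J. f (Suc j) * p ^ Suc j * q ^ (J - j)) = p * (\<Sum>j\<le>J. f (Suc j) * p ^ j * q ^ (J - j))"
      by (simp add: sum_distrib_left algebra_simps)
    finally have e: "p * (\<Sum>j\<le>J. f (Suc j) * p ^ j * q ^ (J - j)) + q ^ Suc J * f 0 = 0"
      using Suc.prems(2) by (simp add: algebra_simps)
    then have "q ^ Suc J * f 0 = p * - (\<Sum>j\<le>J. f (Suc j) * p ^ j * q ^ (J - j))"
      unfolding add_eq_0_iff by (simp only: mult_minus_right)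
    then have "p dvd q ^ Suc J * f 0" by (rule dvdI)
    then have "p dvd f 0" using min_pair_dvd'[OF assms(1) p0] by blast
    moreover have "degree (f 0) < degree p" using Suc.prems(1)[of 0] False by simp
    ultimately have first: "f 0 = 0" using dvd_imp_degree_le[of p "f 0"] by auto
    then have "(\<Sum>j\<le>J. f (Suc j) * p ^ j * q ^ (J - j)) = 0" using e p0 by simp
    then have "f (Suc i) = 0" if "i \<le> J" for i using Suc.IH[of "\<lambda>j. f (Suc j)" i] Suc.prems(1) that by auto
    then show ?thesis using first Suc.prems(3) by (cases j) auto
  qed
qed

subsection \<open>Differential polynomial rings\<close>

lemma dpoly_eqI_derivations:
  fixes D E :: "('m,'v,'a::comm_ring_1) dpoly \<Rightarrow> ('m,'v,'a) dpoly"
  assumes "deriv_on UNIV D" "deriv_on UNIV E" "\<And>c. D (dconst c) = E (dconst c)" "\<And>w. D (dv w) = E (dv w)"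
  shows "D p = E p"
proof -
  have "p \<in> over UNIV" "derivs p \<subseteq> UNIV" by auto
  then show ?thesis
  proof (induction rule: dpoly_induct)
    case (add p q)
    then show ?case using deriv_onD(1)[OF assms(1)] deriv_onD(1)[OF assms(2)] by simp
  next
    case (mult p q)
    then show ?case using deriv_onD(2)[OF assms(1)] deriv_onD(2)[OF assms(2)] by simp
  qed (use assms in auto)
qed

lemma deriv_on_commutator:
  assumes "deriv_on UNIV D" "deriv_on UNIV E"
  shows "deriv_on UNIV (\<lambda>x. D (E x) - E (D x))"
proof -
  note D = deriv_onD[OF assms(1) UNIV_I UNIV_I] and E = deriv_onD[OF assms(2) UNIV_I UNIV_I]
  show ?thesis unfolding deriv_on_def by (simp only: D E) (simp add: algebra_simps)
qed

lemma deriv_on_dpoly_deriv: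
  assumes "delta_ring \<delta>" shows "deriv_on R (dpoly_deriv \<delta> i)"
proof -
  have "deriv_on (over UNIV) (dpoly_deriv \<delta> i)"
    unfolding dpoly_deriv_eq_mder by (rule deriv_on_mder) (use assms in \<open>auto simp: delta_ringD\<close>)
  then show ?thesis unfolding deriv_on_def by (meson over_UNIV)
qed

lemma dpoly_deriv_dconst [simp]: "delta_ring \<delta> \<Longrightarrow> dpoly_deriv \<delta> i (dconst c) = dconst (\<delta> i c)"
  unfolding dpoly_deriv_eq_mder by (rule mder_dconst[of UNIV]) (auto simp: delta_ringD)

lemma dpoly_deriv_dv [simp]: "delta_ring \<delta> \<Longrightarrow> dpoly_deriv \<delta> i (dv w) = dv (deriv_shift i w)"
  unfolding dpoly_deriv_eq_mder by (rule mder_dv[of UNIV]) (auto simp: delta_ringD)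

lemma delta_ring_0: "delta_ring \<delta> \<Longrightarrow> \<delta> i 0 = 0"
  by (rule deriv_on_0[OF subring_UNIV delta_ringD(1)])
lemma delta_ring_1: "delta_ring \<delta> \<Longrightarrow> \<delta> i 1 = 0"
  by (rule deriv_on_1[OF subring_UNIV delta_ringD(1)])

lemma deriv_shift_commute: "deriv_shift i (deriv_shift j w) = deriv_shift j (deriv_shift i w)"
  by (simp add: deriv_shift_def fun_eq_iff)

lemma delta_ring_dpoly_deriv:
  assumes "delta_ring \<delta>" shows "delta_ring (dpoly_deriv \<delta> :: 'm \<Rightarrow> ('m,'v,'a::comm_ring_1) dpoly \<Rightarrow> _)"
  unfolding delta_ring_def
proof (intro conjI allI)
  show "derivation (dpoly_deriv \<delta> i)" for i
    unfolding derivation_deriv_on by (rule deriv_on_dpoly_deriv[OF assms])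
  fix i j and p :: "('m,'v,'a) dpoly"
  have "dpoly_deriv \<delta> i (dpoly_deriv \<delta> j p) - dpoly_deriv \<delta> j (dpoly_deriv \<delta> i p) = (\<lambda>_. 0) p"
    by (rule dpoly_eqI_derivations, rule deriv_on_commutator)
       (auto simp: assms deriv_on_dpoly_deriv delta_ringD(2)[OF assms, of i j] deriv_shift_commute[of i j])
  then show "dpoly_deriv \<delta> i (dpoly_deriv \<delta> j p) = dpoly_deriv \<delta> j (dpoly_deriv \<delta> i p)" by simp
qed

lemma theta_dv:
  assumes "delta_ring \<delta>" shows "theta (dpoly_deriv \<delta>) e (dv w) = dv (dmult e w)"
proof (induction e rule: exponent_induct)
  case (Suc e i)
  show ?case
    unfolding theta_Suc[of "dpoly_deriv \<delta>", OF delta_ringD(2)[OF delta_ring_dpoly_deriv[OF assms]]] Suc dmult_Suc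
    using assms by simp
qed simp

lemma dvar_eq_dv: "dvar v = (dv (v, \<lambda>_. 0) :: ('m,'v,'a::comm_ring_1) dpoly)"
  by (simp add: dvar_def dv_def)

lemma theta_dvar:
  assumes "delta_ring \<delta>" shows "theta (dpoly_deriv \<delta>) e (dvar v) = dv (v, e)"
  by (simp add: dvar_eq_dv theta_dv[OF assms] dmult_def)

text \<open>Commutators of derivations are derivations, so the rules need only be checked on
  constants and derivatives. They are the hypotheses \<open>E1\<close> and \<open>E2\<close> of
  \<open>leading_operator\<close>.\<close>

lemma pder_dpoly_deriv:
  assumes d: "delta_ring \<delta>"
  shows "pder (deriv_shift i \<psi>) (dpoly_deriv \<delta> i p) = dpoly_deriv \<delta> i (pder (deriv_shift i \<psi>) p) + pder \<psi> p"
    and "\<psi>' \<notin> range (deriv_shift i) \<Longrightarrow> pder \<psi>' (dpoly_deriv \<delta> i p) = dpoly_deriv \<delta> i (pder \<psi>' p)"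
proof -
  note dd = deriv_on_dpoly_deriv[OF d, of UNIV] and dp = deriv_on_pder[of UNIV]
  note dd0 = delta_ring_0[OF delta_ring_dpoly_deriv[OF d]] delta_ring_1[OF delta_ring_dpoly_deriv[OF d]]
  have "pder (deriv_shift i \<psi>) (dpoly_deriv \<delta> i p) - dpoly_deriv \<delta> i (pder (deriv_shift i \<psi>) p) = pder \<psi> p"
    by (rule dpoly_eqI_derivations, rule deriv_on_commutator) (auto simp: d dd dp dd0 pder_dv)
  then show "pder (deriv_shift i \<psi>) (dpoly_deriv \<delta> i p) = dpoly_deriv \<delta> i (pder (deriv_shift i \<psi>) p) + pder \<psi> p"
    by (simp add: algebra_simps)
  assume *: "\<psi>' \<notin> range (deriv_shift i)"
  then have ne: "deriv_shift i w \<noteq> \<psi>'" for w by blast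
  have "pder \<psi>' (dpoly_deriv \<delta> i p) - dpoly_deriv \<delta> i (pder \<psi>' p) = (\<lambda>_. 0) p"
    by (rule dpoly_eqI_derivations, rule deriv_on_commutator) (auto simp: d dd dp dd0 pder_dv ne)
  then show "pder \<psi>' (dpoly_deriv \<delta> i p) = dpoly_deriv \<delta> i (pder \<psi>' p)" by simp
qed

lemma over_dpoly_deriv:
  assumes "delta_ring \<delta>" "subring R" "\<And>i c. c \<in> R \<Longrightarrow> \<delta> i c \<in> R" "p \<in> over R"
  shows "dpoly_deriv \<delta> i p \<in> over R"
  unfolding dpoly_deriv_eq_mder
  by (rule mder_over[OF assms(2) delta_ringD(1)[OF assms(1)] assms(4)]) (use assms in \<open>auto intro: over_dv\<close>)

lemma theta_closed:
  assumes "\<And>i j a. D i (D j a) = D j (D i a)" "\<And>i x. x \<in> S \<Longrightarrow> D i x \<in> S" "x \<in> S"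
  shows "theta D e x \<in> S"
proof (induction e rule: exponent_induct)
  case (Suc e i)
  then show ?case unfolding theta_Suc[of D, OF assms(1)] by (rule assms(2))
qed (use assms in simp)

lemma theta_hom:
  assumes "\<And>i j a. D i (D j a) = D j (D i a)" "\<And>i j a. E i (E j a) = E j (E i a)" "\<And>i x. f (D i x) = E i (f x)"
  shows "f (theta D e x) = theta E e (f x)"
proof (induction e rule: exponent_induct)
  case (Suc e i)
  then show ?case unfolding theta_Suc[of D, OF assms(1)] theta_Suc[of E, OF assms(2)] assms(3) by simp
qed simp

lemma theta_zero: "delta_ring \<delta> \<Longrightarrow> theta \<delta> e 0 = 0"
  using theta_closed[of \<delta> "{0}" 0 e, OF delta_ringD(2)[of \<delta>]] delta_ring_0[of \<delta>] by simp

section \<open>Derivatives of a polynomial and their leaders\<close>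

context wf_ranking
begin

lemma leading_pder:
  fixes f :: "('m,'v,'a::comm_ring_1) dpoly"
  assumes d: "delta_ring \<delta>" and f: "\<And>v. v \<in> derivs f \<Longrightarrow> le v w"
  shows "lt (dmult e w) \<psi> \<Longrightarrow> pder \<psi> (theta (dpoly_deriv \<delta>) e f) = 0"
    and "pder (dmult e w) (theta (dpoly_deriv \<delta>) e f) = pder w f"
proof -
  have "pder \<psi> f = 0" if "lt w \<psi>" for \<psi>
  proof (rule pder_eq_0)
    show "\<psi> \<notin> derivs f" using f[of \<psi>] that trans[of w \<psi> w] by auto
  qed
  then have *: "(\<forall>\<psi>. lt (dmult e w) \<psi> \<longrightarrow> pder \<psi> (theta (dpoly_deriv \<delta>) e f) = 0) \<and>
    pder (dmult e w) (theta (dpoly_deriv \<delta>) e f) = pder w f"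
    by (intro leading_operator[where S = UNIV] delta_ringD(2)[OF delta_ring_dpoly_deriv[OF d]]
        delta_ring_0[OF delta_ring_dpoly_deriv[OF d]] pder_dpoly_deriv[OF d] UNIV_I)
  show "lt (dmult e w) \<psi> \<Longrightarrow> pder \<psi> (theta (dpoly_deriv \<delta>) e f) = 0" using * by blast
  show "pder (dmult e w) (theta (dpoly_deriv \<delta>) e f) = pder w f" using * by blast
qed

lemma derivs_theta:
  fixes f :: "('m,'v,'a::idom) dpoly"
  assumes "char0 TYPE('a)" "delta_ring \<delta>" "\<And>v. v \<in> derivs f \<Longrightarrow> le v w" "v \<in> derivs (theta (dpoly_deriv \<delta>) e f)"
  shows "le v (dmult e w)"
proof (rule ccontr)
  assume "\<not> le v (dmult e w)"
  then have "lt (dmult e w) v" using total by blast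
  then have "pder v (theta (dpoly_deriv \<delta>) e f) = 0" using leading_pder(1)[OF assms(2,3)] by blast
  then show False using pder_neq_0[OF assms(1,4)] by blast
qed

text \<open>A proper derivative of f is linear in \<open>dmult e w\<close>, with the separant
  \<open>pder w f\<close> as coefficient. This is read off from partial derivatives: the one of r
  with respect to \<open>dmult e w\<close> is 0, so in characteristic 0 that derivative does not
  occur in r.\<close>

lemma theta_relation:
  fixes f :: "('m,'v,'a::idom) dpoly"
  assumes c: "char0 TYPE('a)" and d: "delta_ring \<delta>" and f: "\<And>v. v \<in> derivs f \<Longrightarrow> le v w"
    and e: "e \<noteq> (\<lambda>_. 0)"
  defines "s \<equiv> pder w f" and "r \<equiv> pder w f * dv (dmult e w) ^ 1 - theta (dpoly_deriv \<delta>) e f"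
  shows "\<forall>v\<in>derivs s. lt v (dmult e w)" "\<forall>v\<in>derivs r. le v (dmult e w)" "deg_in r (dmult e w) < 1"
proof -
  let ?w = "dmult e w" and ?g = "theta (dpoly_deriv \<delta>) e f"
  have lw: "lt w ?w" by (rule dmult_gt[OF e])
  show s: "\<forall>v\<in>derivs s. lt v ?w"
  proof
    fix v assume "v \<in> derivs s"
    then have "v \<in> derivs f" using derivs_pder[of w f] by (auto simp: s_def)
    then have "le v w" by (rule f)
    then show "lt v ?w" using lw trans[of v w ?w] by blast
  qed
  show "\<forall>v\<in>derivs r. le v ?w"
  proof
    fix v assume "v \<in> derivs r"
    then have "v \<in> derivs (s * dv ?w) \<or> v \<in> derivs ?g" using derivs_diff by (auto simp: r_def s_def)
    then show "le v ?w"
    proof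
      assume "v \<in> derivs (s * dv ?w)"
      then have "v \<in> derivs s \<or> v = ?w" using derivs_mult[of s "dv ?w"] by auto
      then show ?thesis using s by blast
    qed (rule derivs_theta[OF c d f])
  qed
  have "?w \<notin> derivs s" using s by auto
  then have "pder ?w r = 0"
    using leading_pder(2)[OF d f] by (simp add: r_def s_def pder_diff pder_mult pder_eq_0 pder_dv)
  then have "?w \<notin> derivs r" using pder_neq_0[OF c] by blast
  then show "deg_in r ?w < 1" by (simp add: deg_in_eq_0_iff)
qed

text \<open>Pseudo-division by f at its leader, with the initial as multiplier. Together with
  \<open>theta_relation\<close> it supplies the hypothesis \<open>rel\<close> of
  \<open>ritt_reduction\<close>.\<close>

lemma leader_relation:
  fixes f :: "('m,'v,'a::idom) dpoly"
  assumes f: "\<And>v. v \<in> derivs f \<Longrightarrow> le v w" and w: "w \<in> derivs f"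
  defines "n \<equiv> deg_in f w" 
  defines "s \<equiv> coef_in w n f" and "r \<equiv> coef_in w n f * dv w ^ n - f"
  shows "\<forall>v\<in>derivs s. lt v w" "\<forall>v\<in>derivs r. le v w" "deg_in r w < n"
proof -
  show s: "\<forall>v\<in>derivs s. lt v w"
  proof
    fix v assume "v \<in> derivs s"
    then have "v \<in> derivs f" "v \<noteq> w" using derivs_coef_in[of w n f] by (auto simp: s_def)
    then show "lt v w" using f by blast
  qed
  show "\<forall>v\<in>derivs r. le v w"
  proof
    fix v assume "v \<in> derivs r"
    then have "v \<in> derivs s \<or> v \<in> derivs (dv w ^ n :: ('m,'v,'a) dpoly) \<or> v \<in> derivs f"
      using derivs_diff[of "s * dv w ^ n" f] derivs_mult[of s "dv w ^ n"] by (auto simp: r_def s_def)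
    moreover have "derivs (dv w ^ n :: ('m,'v,'a) dpoly) \<subseteq> {w}" using derivs_power[of "dv w" n] by simp
    ultimately show "le v w" using s f by blast
  qed
  have n: "n > 0" using w deg_in_eq_0_iff[of f w] by (simp add: n_def)
  have "{..n} = insert n {..n - 1}" using n by auto
  moreover have "n \<notin> {..n - 1}" using n by simp
  ultimately have e: "(\<Sum>k\<le>n. coef_in w k f * dv w ^ k) = s * dv w ^ n + (\<Sum>k\<le>n - 1. coef_in w k f * dv w ^ k)"
    unfolding s_def by simp
  have fe: "f = s * dv w ^ n + (\<Sum>k\<le>n - 1. coef_in w k f * dv w ^ k)"
    by (rule HOL.trans[OF coef_in_expand[of f w n] e]) (simp add: n_def)
  have "a - b = - x" if "b = a + x" for a b x :: "('m,'v,'a) dpoly" using that by simp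
  from this[OF fe] have "r = - (\<Sum>k\<le>n - 1. coef_in w k f * dv w ^ k)" unfolding r_def s_def .
  moreover have "deg_in (coef_in w k f * dv w ^ k) w \<le> n - 1" if "k \<le> n - 1" for k
  proof -
    have "deg_in (coef_in w k f) w = 0" using derivs_coef_in[of w k f] by (auto simp: deg_in_eq_0_iff)
    moreover have "deg_in (dv w ^ k :: ('m,'v,'a) dpoly) w \<le> k"
      using deg_in_power[of "dv w :: ('m,'v,'a) dpoly" k w] by (simp add: deg_in_dv)
    ultimately show ?thesis using deg_in_mult[of "coef_in w k f" "dv w ^ k" w] that by linarith
  qed
  ultimately have "deg_in r w \<le> n - 1" by (simp only: deg_in_uminus) (rule deg_in_sum, simp)
  then show "deg_in r w < n" using n by linarith
qed

end

subsection \<open>The field of differential rational functions\<close>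

abbreviation pe :: "(('m,'v) deriv \<Rightarrow> 'a::comm_ring_1) \<Rightarrow> ('m,'v,'a) dpoly \<Rightarrow> 'a" where
  "pe \<equiv> peval (\<lambda>x. x)"

lemma pe_add: "pe \<rho> (p + q) = pe \<rho> p + pe \<rho> q"
  and pe_mult: "pe \<rho> (p * q) = pe \<rho> p * pe \<rho> q"
  and pe_diff: "pe \<rho> (p - q) = pe \<rho> p - pe \<rho> q"
  and pe_uminus: "pe \<rho> (- p) = - pe \<rho> p"
  and pe_power: "pe \<rho> (p ^ n) = pe \<rho> p ^ n"
  and pe_sum: "pe \<rho> (sum f I) = (\<Sum>i\<in>I. pe \<rho> (f i))"
  and pe_prod: "pe \<rho> (prod f J) = (\<Prod>j\<in>J. pe \<rho> (f j))"
  and pe_dconst: "pe \<rho> (dconst c) = c"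
  and pe_dv: "pe \<rho> (dv w) = \<rho> w"
  and pe_1: "pe \<rho> 1 = 1"
  by (auto intro: peval_add[of UNIV] peval_mult[of UNIV] peval_diff[of UNIV] peval_uminus[of UNIV] peval_power[of UNIV]
    peval_sum[of UNIV] peval_prod[of UNIV] peval_dconst[of UNIV] peval_dv[of UNIV] peval_1[of UNIV])

lemmas pe_simps = pe_add pe_mult pe_diff pe_uminus pe_power pe_sum pe_prod pe_dconst pe_dv pe_1

lemma pe_dpoly_deriv:
  assumes "delta_ring \<delta>" "\<And>i w. \<delta> i (\<rho> w) = \<rho> (deriv_shift i w)"
  shows "pe \<rho> (dpoly_deriv \<delta> i p) = \<delta> i (pe \<rho> p)"
  unfolding dpoly_deriv_eq_mder
  by (rule deriv_peval[symmetric, of UNIV _ UNIV _ _ UNIV])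
     (use assms in \<open>auto simp: delta_ringD pe_dv\<close>)

lemma delta_subfield_subfield: "delta_subfield D G \<Longrightarrow> subfield G"
proof -
  assume G: "delta_subfield D G"
  then have 1: "1 \<in> G" and diff: "\<And>a b. a \<in> G \<Longrightarrow> b \<in> G \<Longrightarrow> a - b \<in> G"
    and mult: "\<And>a b. a \<in> G \<Longrightarrow> b \<in> G \<Longrightarrow> a * b \<in> G" and inv: "\<And>a. a \<in> G \<Longrightarrow> inverse a \<in> G"
    unfolding delta_subfield_def by blast+
  have 0: "0 \<in> G" using diff[OF 1 1] by simp
  have um: "- a \<in> G" if "a \<in> G" for a using diff[OF 0 that] by simp
  have "a + b \<in> G" if "a \<in> G" "b \<in> G" for a b using diff[OF that(1) um[OF that(2)]] by simp
  then show ?thesis using 0 1 um mult inv by (simp add: subfield_def subring_def)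
qed

lemma delta_subfield_iff:
  "delta_subfield D G \<longleftrightarrow> subfield G \<and> (\<forall>i. \<forall>a\<in>G. D i a \<in> G)"
  using delta_subfield_subfield[of D G]
  by (auto simp: delta_subfield_def subfield_def dest: subringD)

text \<open>F is a subset of the large field, so that polynomials over F, over intermediate fields
  and over \<open>FU\<close> lie in one ring, told apart only by \<open>over\<close>.\<close>

locale dext = wf_ranking lt
  for lt :: "('m::{finite,linorder},'n) deriv \<Rightarrow> ('m,'n) deriv \<Rightarrow> bool" +
  fixes \<delta> :: "'m \<Rightarrow> 'k::field \<Rightarrow> 'k" and F :: "'k set" and u :: "'n \<Rightarrow> 'k"
  assumes dr: "delta_ring \<delta>" and Fsub: "delta_subfield \<delta> F" and c0: "char0 TYPE('k)"
    and indep: "\<And>p :: ('m,'n,'k) dpoly. p \<in> over F \<Longrightarrow> peval (\<lambda>x. x) (\<lambda>w. theta \<delta> (snd w) (u (fst w))) p = 0 \<Longrightarrow> p = 0"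
begin

definition val :: "('m,'n) deriv \<Rightarrow> 'k" where "val w = theta \<delta> (snd w) (u (fst w))"
abbreviation ev :: "('m,'n,'k) dpoly \<Rightarrow> 'k" where "ev \<equiv> pe val"
abbreviation dd :: "'m \<Rightarrow> ('m,'n,'k) dpoly \<Rightarrow> ('m,'n,'k) dpoly" where "dd \<equiv> dpoly_deriv \<delta>"

lemma ev_eq_0: "p \<in> over F \<Longrightarrow> ev p = 0 \<Longrightarrow> p = 0"
  using indep[of p] by (simp add: val_def[abs_def])

lemma ev_inj: "p \<in> over F \<Longrightarrow> q \<in> over F \<Longrightarrow> ev p = ev q \<Longrightarrow> p = q"
  using ev_eq_0[of "p - q"] overI(6)[OF subfield_subring[OF delta_subfield_subfield[OF Fsub]], of p q] by (simp add: pe_diff)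

lemma FR: "subring F" using subfield_subring[OF delta_subfield_subfield[OF Fsub]] .
lemma F_delta: "c \<in> F \<Longrightarrow> \<delta> i c \<in> F" using Fsub by (simp add: delta_subfield_def)
lemma dcomm: "\<delta> i (\<delta> j a) = \<delta> j (\<delta> i a)" by (rule delta_ringD(2)[OF dr])
lemma d0: "\<delta> i 0 = 0" by (rule delta_ring_0[OF dr])
lemma d1: "\<delta> i 1 = 0" by (rule delta_ring_1[OF dr])

lemma val_shift: "\<delta> i (val w) = val (deriv_shift i w)"
  unfolding val_def deriv_shift_def fst_conv snd_conv theta_Suc[of \<delta>, OF dcomm] ..

lemma ev_dd: "ev (dd i p) = \<delta> i (ev p)"
  by (rule pe_dpoly_deriv[OF dr val_shift])

lemma ev_theta: "ev (theta dd e p) = theta \<delta> e (ev p)"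
  by (rule theta_hom[where D = dd and E = \<delta> and f = ev, OF delta_ringD(2)[OF delta_ring_dpoly_deriv[OF dr]] dcomm ev_dd])

lemma over_theta:
  assumes "subring R" "\<And>i c. c \<in> R \<Longrightarrow> \<delta> i c \<in> R" "p \<in> over R"
  shows "theta dd e p \<in> over R"
  by (rule theta_closed[where D = dd, OF delta_ringD(2)[OF delta_ring_dpoly_deriv[OF dr]] _ assms(3)])
     (rule over_dpoly_deriv[OF dr assms(1,2)])

definition FU :: "'k set" where "FU = {ev p / ev q |p q. p \<in> over F \<and> q \<in> over F}"

lemma FU_E:
  assumes "a \<in> FU" obtains p q where "p \<in> over F" "q \<in> over F" "q \<noteq> 0" "ev q \<noteq> 0" "a = ev p / ev q"
proof -
  obtain p q where pq: "p \<in> over F" "q \<in> over F" "a = ev p / ev q" using assms by (auto simp: FU_def)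
  show ?thesis
  proof (cases "q = 0")
    case True
    then show ?thesis using pq by (intro that[of 0 1]) (auto simp: FR pe_1)
  next
    case False
    then show ?thesis using pq ev_eq_0[OF pq(2)] by (intro that[of p q]) auto
  qed
qed

lemma FU_I: "p \<in> over F \<Longrightarrow> q \<in> over F \<Longrightarrow> ev p / ev q \<in> FU" by (auto simp: FU_def)

lemma FU_ev: "p \<in> over F \<Longrightarrow> ev p \<in> FU" using FU_I[of p 1] by (simp add: FR pe_1)
lemma F_FU: "F \<subseteq> FU" using FU_ev[OF over_dconst[OF FR]] by (auto simp: pe_dconst)
lemma val_FU: "val w \<in> FU" using FU_ev[OF over_dv[OF FR, of w]] by (simp add: pe_dv)

lemma FU_subfield: "subfield FU"
  unfolding subfield_def subring_def
proof (intro conjI ballI)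
  show "0 \<in> FU" "1 \<in> FU" using F_FU subringD(1,2)[OF FR] by auto
  fix a assume a: "a \<in> FU"
  then obtain p q where p: "p \<in> over F" "q \<in> over F" "ev q \<noteq> 0" "a = ev p / ev q" by (rule FU_E)
  show "- a \<in> FU" using FU_I[OF overI(3)[OF FR p(1)] p(2)] p by (simp add: pe_uminus)
  show "inverse a \<in> FU" using FU_I[OF p(2,1)] p by simp
  fix b assume "b \<in> FU"
  then obtain p' q' where p': "p' \<in> over F" "q' \<in> over F" "ev q' \<noteq> 0" "b = ev p' / ev q'" by (rule FU_E)
  have "a + b = ev (p * q' + p' * q) / ev (q * q')"
    unfolding p(4) p'(4) using p(3) p'(3) by (simp add: pe_simps field_simps)
  then show "a + b \<in> FU" using p p' by (auto intro!: FU_I overI FR)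
  have "a * b = ev (p * p') / ev (q * q')" using p p' by (simp add: pe_simps)
  then show "a * b \<in> FU" using p p' by (auto intro!: FU_I overI FR)
qed

lemmas FUR = subfield_subring[OF FU_subfield]

section \<open>Partial derivatives on the field of differential rational functions\<close>

definition pd :: "('m,'n) deriv \<Rightarrow> 'k \<Rightarrow> 'k" where
  "pd w a = (let (p, q) = SOME (p, q). p \<in> over F \<and> q \<in> over F \<and> q \<noteq> 0 \<and> a = ev p / ev q
             in (ev (pder w p) * ev q - ev p * ev (pder w q)) / (ev q) ^ 2)"

text \<open>The definition picks some fraction. Two fractions for one element satisfy p q' = p' q as
  polynomials, because u is independent over F; differentiating this identity shows that the
  quotient rule gives the same result for both.\<close>

lemma pd_eq:
  assumes p: "p \<in> over F" "q \<in> over F" "q \<noteq> 0"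
  shows "pd w (ev p / ev q) = (ev (pder w p) * ev q - ev p * ev (pder w q)) / (ev q) ^ 2"
proof -
  obtain p' q' where e: "(SOME (p', q'). p' \<in> over F \<and> q' \<in> over F \<and> q' \<noteq> 0 \<and> ev p / ev q = ev p' / ev q') = (p', q')"
    by fastforce
  have "(case (SOME (p', q'). p' \<in> over F \<and> q' \<in> over F \<and> q' \<noteq> 0 \<and> ev p / ev q = ev p' / ev q') of
     (p', q') \<Rightarrow> p' \<in> over F \<and> q' \<in> over F \<and> q' \<noteq> 0 \<and> ev p / ev q = ev p' / ev q')"
    by (rule someI[of _ "(p, q)"]) (use p in auto)
  then have p': "p' \<in> over F" "q' \<in> over F" "q' \<noteq> 0" "ev p / ev q = ev p' / ev q'" unfolding e by auto
  have nz: "ev q \<noteq> 0" "ev q' \<noteq> 0" using p p' ev_eq_0 by blast+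
  have "ev (p * q') = ev (p' * q)" using p'(4) nz by (simp add: pe_mult field_simps)
  then have eq: "p * q' = p' * q" by (rule ev_inj[rotated 2]) (use p p' in \<open>auto intro!: overI FR\<close>)
  have "ev (pder w (p * q')) = ev (pder w (p' * q))" by (simp add: eq)
  then have d: "ev (pder w p) * ev q' + ev p * ev (pder w q') = ev (pder w p') * ev q + ev p' * ev (pder w q)"
    by (simp add: pder_mult pe_simps)
  define r where "r = ev p / ev q"
  have r: "ev p = r * ev q" "ev p' = r * ev q'"
    unfolding r_def using nz by (simp, simp add: p'(4))
  have "(ev (pder w p) - r * ev (pder w q)) * ev q' = (ev (pder w p') - r * ev (pder w q')) * ev q"
    using d unfolding r by (simp add: algebra_simps)
  then have "(ev (pder w p') - r * ev (pder w q')) / ev q' = (ev (pder w p) - r * ev (pder w q)) / ev q"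
    using nz by (simp add: field_simps)
  moreover have "(ev (pder w p') * ev q' - ev p' * ev (pder w q')) / (ev q') ^ 2 = (ev (pder w p') - r * ev (pder w q')) / ev q'"
    using nz unfolding r by (simp add: field_simps power2_eq_square)
  moreover have "(ev (pder w p) * ev q - ev p * ev (pder w q)) / (ev q) ^ 2 = (ev (pder w p) - r * ev (pder w q)) / ev q"
    using nz unfolding r by (simp add: field_simps power2_eq_square)
  ultimately show ?thesis unfolding pd_def e Let_def by simp
qed

lemma pd_ev: "p \<in> over F \<Longrightarrow> pd w (ev p) = ev (pder w p)"
  using pd_eq[of p 1 w] pder_dconst[of w "1::'k"] by (simp add: FR pe_1)

lemma pd_F: "c \<in> F \<Longrightarrow> pd w c = 0"
  using pd_ev[OF over_dconst[OF FR], of c w] by (simp add: pe_dconst)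

lemma pd_val: "pd w (val v) = (if v = w then 1 else 0)"
  using pd_ev[OF over_dv[OF FR], of w v] by (simp add: pe_dv pder_dv pe_1)

lemma pd_FU: assumes "a \<in> FU" shows "pd w a \<in> FU"
proof -
  obtain p q where p: "p \<in> over F" "q \<in> over F" "q \<noteq> 0" "a = ev p / ev q" using assms by (rule FU_E)
  have "pd w a = ev (pder w p * q - p * pder w q) / ev (q ^ 2)" unfolding p(4) pd_eq[OF p(1-3)] by (simp add: pe_simps)
  then show ?thesis using p by (auto intro!: FU_I overI FR over_pder)
qed

lemma pd_deriv: "deriv_on FU (pd w)"
  unfolding deriv_on_def
proof (intro ballI conjI)
  fix a b assume "a \<in> FU" "b \<in> FU"
  obtain p q where p: "p \<in> over F" "q \<in> over F" "q \<noteq> 0" "ev q \<noteq> 0" "a = ev p / ev q" using \<open>a \<in> FU\<close> by (rule FU_E)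
  obtain p' q' where p': "p' \<in> over F" "q' \<in> over F" "q' \<noteq> 0" "ev q' \<noteq> 0" "b = ev p' / ev q'" using \<open>b \<in> FU\<close> by (rule FU_E)
  have qq: "q * q' \<in> over F" "q * q' \<noteq> 0" using p p' by (auto intro!: overI FR) (metis pe_mult mult_eq_0_iff peval_0)
  have s: "a + b = ev (p * q' + p' * q) / ev (q * q')"
    unfolding p(5) p'(5) using p(4) p'(4) by (simp add: pe_simps field_simps)
  have ps: "p * q' + p' * q \<in> over F" "p * p' \<in> over F" using p p' by (auto intro!: overI FR)
  show "pd w (a + b) = pd w a + pd w b"
    unfolding s pd_eq[OF ps(1) qq] unfolding p(5) p'(5) pd_eq[OF p(1-3)] pd_eq[OF p'(1-3)]
    using p(4) p'(4) by (simp add: pe_simps pder_mult pder_add field_simps power2_eq_square)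
  have m: "a * b = ev (p * p') / ev (q * q')" using p p' by (simp add: pe_simps)
  show "pd w (a * b) = pd w a * b + a * pd w b"
    unfolding m pd_eq[OF ps(2) qq] unfolding p(5) p'(5) pd_eq[OF p(1-3)] pd_eq[OF p'(1-3)]
    using p(4) p'(4) by (simp add: pe_simps pder_mult pder_add field_simps power2_eq_square)
qed

lemmas pd_add = deriv_onD(1)[OF pd_deriv] and pd_mult = deriv_onD(2)[OF pd_deriv]
lemmas pd_diff = deriv_on_diff[OF FUR pd_deriv] and pd_0 = deriv_on_0[OF FUR pd_deriv]
  and pd_1 = deriv_on_1[OF FUR pd_deriv]

lemma mder_zero [simp]: "mder (\<lambda>_. 0) (\<lambda>_. 0) p = 0"
  by (simp add: mder_def mono_der_def)

lemma FU_derivation_unique: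
  assumes E: "deriv_on FU E" "\<And>c. c \<in> F \<Longrightarrow> E c = 0" "\<And>w. E (val w) = 0" and a: "a \<in> FU"
  shows "E a = 0"
proof -
  have Ee: "E (ev p) = 0" if "p \<in> over F" for p
  proof -
    have "E (ev p) = ev (mder (\<lambda>_. 0) (\<lambda>_. 0) p)"
      by (rule deriv_peval[OF FR rhom_on_id FUR E(1), where W = UNIV])
         (use that E F_FU val_FU FR in \<open>auto simp: subringD\<close>)
    then show ?thesis by simp
  qed
  obtain p q where p: "p \<in> over F" "q \<in> over F" "ev q \<noteq> 0" "a = ev p / ev q" using a by (rule FU_E)
  have "E (a * ev q) = E a * ev q + a * E (ev q)" using a FU_ev[OF p(2)] deriv_onD(2)[OF E(1)] by blast
  moreover have "a * ev q = ev p" using p by simp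
  ultimately show ?thesis using Ee[OF p(1)] Ee[OF p(2)] p(3) by simp
qed

lemma FU_delta: assumes "a \<in> FU" shows "\<delta> i a \<in> FU"
proof -
  have dp: "\<delta> i (ev p) \<in> FU" if "p \<in> over F" for p
    using FU_ev[OF over_dpoly_deriv[OF dr FR F_delta that]] by (simp add: ev_dd)
  obtain p q where p: "p \<in> over F" "q \<in> over F" "ev q \<noteq> 0" "a = ev p / ev q" using assms by (rule FU_E)
  have "\<delta> i (a * ev q) = \<delta> i a * ev q + a * \<delta> i (ev q)" using deriv_onD(2)[OF delta_ringD(1)[OF dr, of UNIV]] by blast
  moreover have "a * ev q = ev p" using p by simp
  ultimately have "\<delta> i (ev p) = \<delta> i a * ev q + a * \<delta> i (ev q)" by simp
  then have "\<delta> i a = (\<delta> i (ev p) - a * \<delta> i (ev q)) / ev q" using p(3) by (simp add: field_simps)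
  then show ?thesis using dp[OF p(1)] dp[OF p(2)] FU_ev[OF p(2)] assms
    by (auto intro!: subfield_divide[OF FU_subfield] subringD[OF FUR])
qed

lemma FU_delta_subfield: "delta_subfield \<delta> FU"
  using FU_subfield FU_delta by (simp add: delta_subfield_iff)

text \<open>The difference of the two sides is a derivation on \<open>FU\<close>, so by
  \<open>FU_derivation_unique\<close> it suffices that it is 0 on F and on the derivatives of
  u.\<close>

lemma pd_delta:
  assumes a: "a \<in> FU"
  shows "pd (deriv_shift i \<psi>) (\<delta> i a) = \<delta> i (pd (deriv_shift i \<psi>) a) + pd \<psi> a"
    and "\<psi>' \<notin> range (deriv_shift i) \<Longrightarrow> pd \<psi>' (\<delta> i a) = \<delta> i (pd \<psi>' a)"
proof -
  note dd = deriv_onD[OF delta_ringD(1)[OF dr, of UNIV] UNIV_I UNIV_I]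
  have comm: "deriv_on FU (\<lambda>a. pd w (\<delta> i a) - \<delta> i (pd w a))" for w
    unfolding deriv_on_def
    using FU_delta pd_FU by (auto simp: dd pd_add pd_mult subringD[OF FUR] algebra_simps)
  have c2: "deriv_on FU (\<lambda>a. pd (deriv_shift i \<psi>) (\<delta> i a) - \<delta> i (pd (deriv_shift i \<psi>) a) - pd \<psi> a)"
    using comm[of "deriv_shift i \<psi>"] pd_deriv[of \<psi>] unfolding deriv_on_def by (simp add: algebra_simps)
  have "pd (deriv_shift i \<psi>) (\<delta> i a) - \<delta> i (pd (deriv_shift i \<psi>) a) - pd \<psi> a = 0"
    by (rule FU_derivation_unique[OF c2 _ _ a]) (auto simp: pd_F F_delta d0 d1 val_shift pd_val)
  then show "pd (deriv_shift i \<psi>) (\<delta> i a) = \<delta> i (pd (deriv_shift i \<psi>) a) + pd \<psi> a" by (simp add: algebra_simps)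
  assume "\<psi>' \<notin> range (deriv_shift i)"
  then have ne: "deriv_shift i w \<noteq> \<psi>'" for w by blast
  have "pd \<psi>' (\<delta> i a) - \<delta> i (pd \<psi>' a) = 0"
    by (rule FU_derivation_unique[OF comm _ _ a]) (auto simp: pd_F F_delta d0 d1 val_shift pd_val ne)
  then show "pd \<psi>' (\<delta> i a) = \<delta> i (pd \<psi>' a)" by simp
qed

lemma leading_pd:
  assumes "a \<in> FU" "\<And>\<psi>. lt w \<psi> \<Longrightarrow> pd \<psi> a = 0"
  shows "lt (dmult e w) \<psi> \<Longrightarrow> pd \<psi> (theta \<delta> e a) = 0" "pd (dmult e w) (theta \<delta> e a) = pd w a"
proof -
  have *: "(\<forall>\<psi>. lt (dmult e w) \<psi> \<longrightarrow> pd \<psi> (theta \<delta> e a) = 0) \<and> pd (dmult e w) (theta \<delta> e a) = pd w a"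
    by (intro leading_operator[where S = FU] dcomm d0 FU_delta pd_delta assms)
  then show "lt (dmult e w) \<psi> \<Longrightarrow> pd \<psi> (theta \<delta> e a) = 0" "pd (dmult e w) (theta \<delta> e a) = pd w a" by blast+
qed

section \<open>Partial derivatives acting on coefficients\<close>

lemma cder_props:
  shows cder_deriv: "deriv_on (over FU) (cder (pd \<psi>))"
    and cder_dconst: "cder (pd \<psi>) (dconst c) = dconst (pd \<psi> c)"
    and cder_dv: "cder (pd \<psi>) (dv w) = 0"
  unfolding cder_def by (rule deriv_on_mder[OF FUR pd_deriv] mder_dconst[OF FUR pd_deriv] mder_dv[OF FUR pd_deriv])+

lemma over_cder: "p \<in> over FU \<Longrightarrow> cder (pd \<psi>) p \<in> over FU"
  by (simp add: over_def lookup_cder pd_0 pd_FU)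

lemma cder_dd:
  assumes p: "p \<in> over FU"
  shows "cder (pd (deriv_shift i \<psi>)) (dd i p) = dd i (cder (pd (deriv_shift i \<psi>)) p) + cder (pd \<psi>) p"
    and "\<psi>' \<notin> range (deriv_shift i) \<Longrightarrow> cder (pd \<psi>') (dd i p) = dd i (cder (pd \<psi>') p)"
proof -
  note D = deriv_onD[OF deriv_on_dpoly_deriv[OF dr, of UNIV] UNIV_I UNIV_I]
  note C = deriv_onD[OF cder_deriv] and O = subringD[OF subring_over[OF FUR]] over_dpoly_deriv[OF dr FUR FU_delta] over_cder
  have "p \<in> over FU \<and> cder (pd (deriv_shift i \<psi>)) (dd i p) = dd i (cder (pd (deriv_shift i \<psi>)) p) + cder (pd \<psi>) p"
    using p subset_UNIV
  proof (induction rule: dpoly_induct)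
    case (const c)
    then show ?case using pd_delta(1)[OF const] by (simp add: cder_dconst dr over_dconst FUR dconst_add)
  next
    case (var w)
    then show ?case by (simp add: cder_dv dr over_dv FUR delta_ring_0[OF delta_ring_dpoly_deriv[OF dr]])
  next
    case (add p q)
    then show ?case by (simp add: C D O)
  next
    case (mult p q)
    then show ?case by (simp add: C D O algebra_simps)
  qed (rule FUR)
  then show "cder (pd (deriv_shift i \<psi>)) (dd i p) = dd i (cder (pd (deriv_shift i \<psi>)) p) + cder (pd \<psi>) p" by blast
  assume ne: "\<psi>' \<notin> range (deriv_shift i)"
  have "p \<in> over FU \<and> cder (pd \<psi>') (dd i p) = dd i (cder (pd \<psi>') p)"
    using p subset_UNIV
  proof (induction rule: dpoly_induct)
    case (const c)
    then show ?case using pd_delta(2)[OF const ne] by (simp add: cder_dconst dr over_dconst FUR)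
  next
    case (var w)
    then show ?case by (simp add: cder_dv dr over_dv FUR delta_ring_0[OF delta_ring_dpoly_deriv[OF dr]])
  next
    case (add p q)
    then show ?case by (simp add: C D O)
  next
    case (mult p q)
    then show ?case by (simp add: C D O algebra_simps)
  qed (rule FUR)
  then show "cder (pd \<psi>') (dd i p) = dd i (cder (pd \<psi>') p)" by blast
qed

lemma leading_cder:
  assumes "f \<in> over FU" "\<And>\<psi>. lt w \<psi> \<Longrightarrow> cder (pd \<psi>) f = 0"
  shows "lt (dmult e w) \<psi> \<Longrightarrow> cder (pd \<psi>) (theta dd e f) = 0" "cder (pd (dmult e w)) (theta dd e f) = cder (pd w) f"
proof -
  have *: "(\<forall>\<psi>. lt (dmult e w) \<psi> \<longrightarrow> cder (pd \<psi>) (theta dd e f) = 0) \<and> cder (pd (dmult e w)) (theta dd e f) = cder (pd w) f"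
    by (intro leading_operator[where S = "over FU"] delta_ringD(2)[OF delta_ring_dpoly_deriv[OF dr]]
      delta_ring_0[OF delta_ring_dpoly_deriv[OF dr]] over_dpoly_deriv[OF dr FUR FU_delta] cder_dd assms)
  then show "lt (dmult e w) \<psi> \<Longrightarrow> cder (pd \<psi>) (theta dd e f) = 0" "cder (pd (dmult e w)) (theta dd e f) = cder (pd w) f" by blast+
qed

lemma pd_peval:
  assumes "p \<in> over F" "\<And>w. w \<in> derivs p \<Longrightarrow> \<rho> w \<in> FU"
  shows "pd \<psi> (pe \<rho> p) = (\<Sum>w\<in>derivs p. pe \<rho> (pder w p) * pd \<psi> (\<rho> w))"
proof -
  have p': "p \<in> over FU" using over_mono[OF assms(1) F_FU] .
  have "pd \<psi> (pe \<rho> p) = pe \<rho> (mder (pd \<psi>) (\<lambda>w. dconst (pd \<psi> (\<rho> w))) p)"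
    by (rule deriv_peval[OF FUR rhom_on_id FUR pd_deriv pd_deriv _ _ p' order_refl])
       (use assms pd_FU in \<open>auto simp: over_dconst FUR pe_dconst\<close>)
  also have "mder (pd \<psi>) (\<lambda>w. dconst (pd \<psi> (\<rho> w))) p = cder (pd \<psi>) p + (\<Sum>w\<in>derivs p. pder w p * dconst (pd \<psi> (\<rho> w)))"
    by (rule mder_expand) (auto simp: pd_0)
  also have "cder (pd \<psi>) p = 0"
    by (rule poly_mapping_eqI) (simp add: lookup_cder pd_0 pd_F overD[OF assms(1)])
  finally show ?thesis by (simp add: pe_simps)
qed

lemma finite_pd: assumes "a \<in> FU" shows "finite {w. pd w a \<noteq> 0}"
proof -
  obtain p q where p: "p \<in> over F" "q \<in> over F" "q \<noteq> 0" "a = ev p / ev q" using assms by (rule FU_E)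
  have "{w. pd w a \<noteq> 0} \<subseteq> derivs p \<union> derivs q"
  proof
    fix w assume "w \<in> {w. pd w a \<noteq> 0}"
    then have "pd w (ev p / ev q) \<noteq> 0" by (simp add: p(4))
    then have "pder w p \<noteq> 0 \<or> pder w q \<noteq> 0" unfolding pd_eq[OF p(1-3)] by auto
    then show "w \<in> derivs p \<union> derivs q" using pder_eq_0 by blast
  qed
  then show ?thesis by (rule finite_subset) simp
qed

text \<open>If a partial derivative of \<open>a = p / q\<close> vanishes, differentiating numerator and denominator
  gives another fraction for \<open>a\<close>.\<close>

lemma minimal_fraction:
  assumes p: "p \<in> over F" "q \<in> over F" "q \<noteq> 0" "ev p = a * ev q" "deg_in p t \<le> k" "deg_in q t \<le> k" and a: "a \<in> FU"
  shows "\<exists>p q. p \<in> over F \<and> q \<in> over F \<and> q \<noteq> 0 \<and> ev p = a * ev q \<and> deg_in p t \<le> k \<and> deg_in q t \<le> k \<and>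
    derivs p \<union> derivs q \<subseteq> {w. pd w a \<noteq> 0}"
  using p
proof (induction "tdeg p + tdeg q" arbitrary: p q rule: less_induct)
  case less
  show ?case
  proof (cases "derivs p \<union> derivs q \<subseteq> {w. pd w a \<noteq> 0}")
    case True
    then show ?thesis using less.prems by blast
  next
    case False
    then obtain w where w: "w \<in> derivs p \<union> derivs q" "pd w a = 0" by blast
    have "pd w (ev p) = pd w a * ev q + a * pd w (ev q)"
      using pd_mult[OF a FU_ev[OF less.prems(2)], folded less.prems(4)] .
    then have eq: "ev (pder w p) = a * ev (pder w q)"
      unfolding pd_ev[OF less.prems(1)] pd_ev[OF less.prems(2)] w(2) by simp
    have ne: "pder w q \<noteq> 0"
    proof
      assume z: "pder w q = 0"
      then have "ev (pder w p) = 0" using eq by simp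
      then have "pder w p = 0" using ev_eq_0 over_pder[OF FR less.prems(1)] by blast
      then show False using z w(1) pder_neq_0[OF c0] by blast
    qed
    have "tdeg (pder w p) \<le> tdeg p"
      using tdeg_pder[of w p] by (cases "pder w p = 0") (auto simp: tdeg_def)
    moreover have "tdeg (pder w q) < tdeg q" by (rule tdeg_pder[OF ne])
    ultimately have "tdeg (pder w p) + tdeg (pder w q) < tdeg p + tdeg q" by linarith
    from less.hyps[OF this over_pder[OF FR less.prems(1)] over_pder[OF FR less.prems(2)] ne eq
        order_trans[OF deg_in_pder less.prems(5)] order_trans[OF deg_in_pder less.prems(6)]]
    show ?thesis .
  qed
qed

lemma minimal_fraction':
  assumes a: "a \<in> FU"
  obtains p q where "p \<in> over F" "q \<in> over F" "q \<noteq> 0" "ev p = a * ev q" "derivs p \<union> derivs q \<subseteq> {w. pd w a \<noteq> 0}"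
proof -
  obtain p q where p: "p \<in> over F" "q \<in> over F" "q \<noteq> 0" "ev q \<noteq> 0" "a = ev p / ev q" using a by (rule FU_E)
  then have "ev p = a * ev q" by simp
  from minimal_fraction[OF p(1-3) this _ _ a, of undefined "deg_in p undefined + deg_in q undefined"] show ?thesis
    using that by auto
qed

lemma pd_all_0: assumes "a \<in> FU" "\<And>w. pd w a = 0" shows "a \<in> F"
proof -
  obtain p q where p: "p \<in> over F" "q \<in> over F" "q \<noteq> 0" "ev p = a * ev q" "derivs p \<union> derivs q \<subseteq> {w. pd w a \<noteq> 0}"
    using minimal_fraction'[OF assms(1)] by blast
  then have "derivs p = {}" "derivs q = {}" using assms(2) by auto
  then have pq: "p = dconst (lk p 0)" "q = dconst (lk q 0)" using derivs_empty by blast+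
  have "lk q 0 \<noteq> 0" using pq(2) p(3) by (metis dconst_0)
  moreover have "ev p = lk p 0" "ev q = lk q 0" using pq by (metis pe_dconst)+
  ultimately have "a = lk p 0 / lk q 0" using p(4) by (simp add: field_simps)
  then show ?thesis using p(1,2) subfield_divide[OF delta_subfield_subfield[OF Fsub]] by (auto dest: overD)
qed

section \<open>Leading pairs of an intermediate field\<close>

definition Red :: "'k set \<Rightarrow> ('m,'n) deriv \<Rightarrow> nat \<Rightarrow> bool" where
  "Red G t e \<longleftrightarrow> (\<forall>f\<in>over G. ev f = 0 \<longrightarrow> (\<forall>w\<in>derivs f. \<not> proper_derivative w t) \<longrightarrow> deg_in f t < e \<longrightarrow> f = 0)"

definition Alg :: "'k set \<Rightarrow> ('m,'n) deriv \<Rightarrow> nat \<Rightarrow> bool" where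
  "Alg G t e \<longleftrightarrow> 1 \<le> e \<and> (\<exists>A\<in>over G. ev A = 0 \<and> (\<forall>w\<in>derivs A. le w t) \<and> deg_in A t = e)"

lemma RedD: "Red G t e \<Longrightarrow> f \<in> over G \<Longrightarrow> ev f = 0 \<Longrightarrow> (\<And>w. w \<in> derivs f \<Longrightarrow> \<not> proper_derivative w t) \<Longrightarrow> deg_in f t < e \<Longrightarrow> f = 0"
  unfolding Red_def by blast

lemma le_not_proper: "le w t \<Longrightarrow> \<not> proper_derivative w t"
proof
  assume "le w t" "proper_derivative w t"
  then obtain e where "e \<noteq> (\<lambda>_. 0)" "w = dmult e t" unfolding proper_derivative_iff by blast
  then have "lt t w" using dmult_gt by simp
  with \<open>le w t\<close> show False using trans[of t w t] by auto
qed

text \<open>The initial and the separant of A are nonzero polynomials and reduced with respect to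
  (t, e), so \<open>Red\<close> forbids them to vanish at u. This makes them admissible multipliers
  in reductions.\<close>

lemma Red_initial_separant:
  assumes red: "Red G t e" and G: "subring G" and A: "A \<in> over G" "\<And>w. w \<in> derivs A \<Longrightarrow> le w t" "deg_in A t = e" "1 \<le> e"
  shows "ev (coef_in t e A) \<noteq> 0" "ev (pder t A) \<noteq> 0" "t \<in> derivs A"
proof -
  show t: "t \<in> derivs A" using A deg_in_eq_0_iff[of A t] by auto
  have "A \<noteq> 0" using t by auto
  show "ev (coef_in t e A) \<noteq> 0"
  proof
    assume "ev (coef_in t e A) = 0"
    moreover have "t \<notin> derivs (coef_in t e A)" using derivs_coef_in by blast
    then have "deg_in (coef_in t e A) t < e" using A(4) deg_in_eq_0_iff[of "coef_in t e A" t] by linarith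
    moreover have "\<not> proper_derivative w t" if "w \<in> derivs (coef_in t e A)" for w
      using that derivs_coef_in[of t e A] A(2) le_not_proper by blast
    ultimately have "coef_in t e A = 0" using RedD[OF red over_coef_in[OF G A(1)]] by blast
    then show False using coef_in_deg_neq_0[OF \<open>A \<noteq> 0\<close>, of t] A(3) by simp
  qed
  show "ev (pder t A) \<noteq> 0"
  proof
    assume "ev (pder t A) = 0"
    moreover have "\<not> proper_derivative w t" if "w \<in> derivs (pder t A)" for w
      using that derivs_pder[of t A] A(2) le_not_proper by blast
    moreover have "deg_in (pder t A) t < e" using deg_in_pder_same[OF t] A(3) by simp
    ultimately have "pder t A = 0" using RedD[OF red over_pder[OF G A(1)]] by blast
    then show False using pder_neq_0[OF c0 t] by blast
  qed
qed

text \<open>Write g in G as ev a / ev b and reduce a and b with one multiplier modulo A, whose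
  coefficients lie in the smaller field. Then \<open>r a - dconst g * r b\<close> vanishes at u and
  is reduced, hence it is 0, and g is a quotient of two coefficients from G'.\<close>

lemma field_eq_of_common_leader:
  assumes G': "delta_subfield \<delta> G'" and G: "subfield G" and sub: "G' \<subseteq> G" "F \<subseteq> G'" "G \<subseteq> FU"
    and alg: "Alg G' t e" and red: "Red G t e"
  shows "G = G'"
proof -
  note G'R = subfield_subring[OF delta_subfield_subfield[OF G']] and GR = subfield_subring[OF G]
  have G'd: "\<And>i c. c \<in> G' \<Longrightarrow> \<delta> i c \<in> G'" using G' by (simp add: delta_subfield_def)
  obtain A where A: "A \<in> over G'" "ev A = 0" "\<And>w. w \<in> derivs A \<Longrightarrow> le w t" "deg_in A t = e" and e: "1 \<le> e"
    using alg unfolding Alg_def by blast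
  have AG: "A \<in> over G" using over_mono[OF A(1) sub(1)] .
  note isep = Red_initial_separant[OF red GR AG A(3,4) e]
  define I where "I = {p \<in> over G'. ev p = 0}"
  define M where "M = {p \<in> over G'. ev p \<noteq> 0}"
  \<comment> \<open>Reducedness with respect to (t, e): degree below e in t, and degree below 1 in
    every proper derivative of t.\<close>
  define bd where "bd w = (if w = t then Some e else if proper_derivative w t then Some 1 else None)" for w
  have rel: "\<exists>s\<in>M. \<exists>r\<in>over G'. (\<forall>v\<in>derivs s. lt v w) \<and> (\<forall>v\<in>derivs r. le v w) \<and> deg_in r w < k \<and> s * dv w ^ k - r \<in> I"
    if bw: "bd w = Some k" for w k
  proof (cases "w = t")
    case True
    then have k: "k = e" using bw by (simp add: bd_def)
    note L = leader_relation[OF A(3) isep(3), unfolded A(4)]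
    let ?s = "coef_in t e A" and ?r = "coef_in t e A * dv t ^ e - A"
    have s: "?s \<in> over G'" by (rule over_coef_in[OF G'R A(1)])
    have "?s \<in> M" using s isep(1) by (simp add: M_def)
    moreover have "?r \<in> over G'" using s A(1) by (intro overI G'R)
    moreover have "?s * dv t ^ e - ?r \<in> I" using A by (simp add: I_def)
    ultimately show ?thesis using L unfolding True k by blast
  next
    case False
    then have k: "k = 1" and "proper_derivative w t" using bw by (auto simp: bd_def split: if_splits)
    then obtain e' where e': "e' \<noteq> (\<lambda>_. 0)" "w = dmult e' t" unfolding proper_derivative_iff by blast
    note L = theta_relation[OF c0 dr A(3) e'(1), folded e'(2)]
    let ?s = "pder t A" and ?g = "theta dd e' A" 
    let ?r = "?s * dv w ^ 1 - ?g"
    have s: "?s \<in> over G'" by (rule over_pder[OF G'R A(1)])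
    have g: "?g \<in> over G'" by (rule over_theta[OF G'R G'd A(1)])
    have "?s \<in> M" using s isep(2) by (simp add: M_def)
    moreover have "?r \<in> over G'" using s g by (intro overI G'R)
    moreover have "ev ?g = 0" unfolding ev_theta A(2) by (rule theta_zero[OF dr])
    then have "?s * dv w ^ 1 - ?r \<in> I" using g by (simp add: I_def)
    ultimately show ?thesis using L unfolding k by blast
  qed
  show ?thesis
  proof
    show "G \<subseteq> G'"
    proof
      fix g assume g: "g \<in> G"
      then obtain a b where ab: "a \<in> over F" "b \<in> over F" "ev b \<noteq> 0" "g = ev a / ev b" using sub(3) by (blast elim: FU_E)
      then have ab': "finite {a, b}" "{a, b} \<subseteq> over G'" using over_mono[OF _ sub(2)] by auto
      have "\<exists>c\<in>M. \<exists>r. \<forall>x\<in>{a, b}. r x \<in> over G' \<and> c * x - r x \<in> I \<and> (\<forall>w k. bd w = Some k \<longrightarrow> deg_in (r x) w < k) \<and>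
          (\<forall>v\<in>derivs (r x). \<exists>w\<in>(\<Union>a\<in>{a, b}. derivs a). le v w)"
        by (rule ritt_reduction[OF G'R _ _ _ _ _ _ rel ab'])
           (auto simp: I_def M_def pe_simps intro: overI[OF G'R] G'R)
      then obtain c r where c: "c \<in> M" and r0: "\<forall>x\<in>{a, b}. r x \<in> over G' \<and> c * x - r x \<in> I \<and> (\<forall>w k. bd w = Some k \<longrightarrow> deg_in (r x) w < k) \<and>
          (\<forall>v\<in>derivs (r x). \<exists>w\<in>(\<Union>a\<in>{a, b}. derivs a). le v w)" by (elim bexE exE)
      have r: "r x \<in> over G' \<and> c * x - r x \<in> I \<and> (\<forall>w k. bd w = Some k \<longrightarrow> deg_in (r x) w < k)" if "x \<in> {a, b}" for x
        using bspec[OF r0 that] by (elim conjE) (intro conjI)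
      have er: "ev (r x) = ev c * ev x" if "x \<in> {a, b}" for x using r[OF that] by (simp add: I_def pe_simps)
      have cz: "ev c \<noteq> 0" using c by (simp add: M_def)
      let ?f = "r a - dconst g * r b"
      have "r a \<in> over G" "r b \<in> over G" using r[of a] r[of b] over_mono[OF _ sub(1)] by auto
      then have fo: "?f \<in> over G" using g by (intro overI GR)
      have "ev ?f = ev c * (ev a - g * ev b)" using er[of a] er[of b] by (simp add: pe_simps algebra_simps)
      then have "ev ?f = 0" using ab(3,4) by simp
      moreover have np: "\<not> proper_derivative w t" if "w \<in> derivs (r x)" "x \<in> {a, b}" for w x
      proof
        assume pw: "proper_derivative w t"
        then have "w \<noteq> t" by (auto simp: proper_derivative_def)
        then have "bd w = Some 1" using pw by (simp add: bd_def)
        then have "deg_in (r x) w < 1" using r[OF that(2)] by blast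
        then show False using that(1) deg_in_eq_0_iff[of "r x" w] by simp
      qed
      have "\<not> proper_derivative w t" if "w \<in> derivs ?f" for w
      proof -
        have "w \<in> derivs (r a) \<or> w \<in> derivs (r b)"
          using that derivs_diff[of "r a" "dconst g * r b"] derivs_mult[of "dconst g" "r b"] by auto
        then show ?thesis using np[of w a] np[of w b] by blast
      qed
      moreover have "deg_in ?f t < e"
      proof -
        have "bd t = Some e" by (simp add: bd_def)
        then have "deg_in (r a) t < e" "deg_in (r b) t < e" using r[of a] r[of b] by blast+
        moreover have "deg_in (dconst g * r b) t \<le> deg_in (r b) t" using deg_in_mult[of "dconst g" "r b" t] by simp
        ultimately show ?thesis using deg_in_diff[of "r a" "dconst g * r b" t] by linarith
      qed
      ultimately have f0: "?f = 0" using RedD[OF red fo] by blast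
      have "r b \<noteq> 0" using er[of b] cz ab by auto
      then obtain m where m: "lk (r b) m \<noteq> 0" by (metis poly_mapping_eqI lookup_zero)
      have "lk (r a) m = g * lk (r b) m" using f0 lookup_dconst_mult[of g "r b" m] by simp
      then have "g = lk (r a) m / lk (r b) m" using m by (simp add: field_simps)
      moreover have "lk (r a) m \<in> G'" "lk (r b) m \<in> G'" using r[of a] r[of b] by (auto dest: overD)
      ultimately show "g \<in> G'" using subfield_divide[OF delta_subfield_subfield[OF G']] by simp
    qed
  qed (rule sub(1))
qed

end

subsection \<open>Polynomials in two groups of variables\<close>

definition gen :: "('r \<Rightarrow> ('m \<Rightarrow> nat) \<Rightarrow> 'b) \<Rightarrow> (('m,'n) deriv \<Rightarrow> 'b) \<Rightarrow> ('m, ('r,'n) xu) deriv \<Rightarrow> 'b" where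
  "gen \<xi> \<nu> w = (case fst w of X j \<Rightarrow> \<xi> j (snd w) | U i \<Rightarrow> \<nu> (i, snd w))"

lemma gen_simps [simp]: "gen \<xi> \<nu> (X j, e) = \<xi> j e" "gen \<xi> \<nu> (U i, e) = \<nu> (i, e)"
  by (simp_all add: gen_def)

definition toU :: "('m,'n) deriv \<Rightarrow> ('m, ('r,'n) xu) deriv" where "toU w = (U (fst w), snd w)"
definition isX :: "('m, ('r,'n) xu) deriv \<Rightarrow> bool" where "isX w \<longleftrightarrow> (\<exists>j. fst w = X j)"

lemma gen_toU [simp]: "gen \<xi> \<nu> (toU w) = \<nu> w" by (simp add: gen_def toU_def)
lemma toU_inject [simp]: "toU v = toU w \<longleftrightarrow> v = w" by (auto simp: toU_def prod_eq_iff)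
lemma isX_toU [simp]: "\<not> isX (toU w)" by (simp add: isX_def toU_def)
lemma isX_X [simp]: "isX (X j, e)" by (simp add: isX_def)
lemma toU_cases: obtains j e where "w = (X j, e)" | v where "w = toU v"
proof (cases "fst w")
  case (X j) then show ?thesis using that(1)[of j "snd w"] by (metis prod.collapse)
next
  case (U i) then show ?thesis using that(2)[of "(i, snd w)"] by (simp add: toU_def prod_eq_iff)
qed

definition emb :: "('m,'n,'a::comm_ring_1) dpoly \<Rightarrow> ('m,('r,'n) xu,'a) dpoly" where
  "emb = peval dconst (\<lambda>w. dv (toU w))"

definition unemb :: "('m,('r,'n) xu,'a::comm_ring_1) dpoly \<Rightarrow> ('m,'n,'a) dpoly" where
  "unemb = peval dconst (gen (\<lambda>_ _. 0) dv)"

text \<open>The x-derivatives are replaced by the values \<xi> and become part of the coefficients,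
  while the u-derivatives stay indeterminates.\<close>

definition psub :: "('a::comm_ring_1 \<Rightarrow> 'b::comm_ring_1) \<Rightarrow> ('r \<Rightarrow> ('m \<Rightarrow> nat) \<Rightarrow> 'b) \<Rightarrow> ('m,('r,'n) xu,'a) dpoly \<Rightarrow> ('m,'n,'b) dpoly" where
  "psub \<phi> \<xi> = peval (\<lambda>c. dconst (\<phi> c)) (gen (\<lambda>j e. dconst (\<xi> j e)) dv)"

lemma deg_in_peval_le:
  fixes p :: "('m,'v,'a::zero) dpoly" and \<rho> :: "('m,'v) deriv \<Rightarrow> ('l,'w,'b::comm_ring_1) dpoly"
  assumes "\<And>c. deg_in (\<phi> c) v = 0" "\<And>t. t \<in> ks p \<Longrightarrow> (\<Sum>w\<in>ks t. lk t w * deg_in (\<rho> w) v) \<le> n"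
  shows "deg_in (peval \<phi> \<rho> p) v \<le> n"
  unfolding peval_def mono_val_def
proof (rule deg_in_sum)
  fix t assume t: "t \<in> ks p"
  have "deg_in (\<Prod>w\<in>ks t. \<rho> w ^ lk t w) v \<le> (\<Sum>w\<in>ks t. deg_in (\<rho> w ^ lk t w) v)" by (rule deg_in_prod)
  also have "\<dots> \<le> (\<Sum>w\<in>ks t. lk t w * deg_in (\<rho> w) v)" by (intro sum_mono deg_in_power)
  also have "\<dots> \<le> n" by (rule assms(2)[OF t])
  finally show "deg_in (\<phi> (lk p t) * (\<Prod>w\<in>ks t. \<rho> w ^ lk t w)) v \<le> n"
    using deg_in_mult[of "\<phi> (lk p t)" "\<Prod>w\<in>ks t. \<rho> w ^ lk t w" v] assms(1)[of "lk p t"] by linarith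
qed

lemma deg_in_peval_var:
  fixes p :: "('m,'v,'a::zero) dpoly" and \<rho> :: "('m,'v) deriv \<Rightarrow> ('l,'w,'b::comm_ring_1) dpoly"
  assumes "\<And>c. deg_in (\<phi> c) v = 0" "\<And>w. w \<in> derivs p \<Longrightarrow> deg_in (\<rho> w) v \<le> (if w = w0 then 1 else 0)"
  shows "deg_in (peval \<phi> \<rho> p) v \<le> deg_in p w0"
proof (rule deg_in_peval_le[OF assms(1)])
  fix t assume t: "t \<in> ks p"
  have "(\<Sum>w\<in>ks t. lk t w * deg_in (\<rho> w) v) \<le> (\<Sum>w\<in>ks t. if w = w0 then lk t w else 0)"
  proof (rule sum_mono)
    fix w assume "w \<in> ks t"
    then have "deg_in (\<rho> w) v \<le> (if w = w0 then 1 else 0)" using assms(2) derivsI[OF t] by blast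
    then show "lk t w * deg_in (\<rho> w) v \<le> (if w = w0 then lk t w else 0)" by (cases "w = w0") auto
  qed
  also have "\<dots> \<le> lk t w0" by (simp add: sum.delta)
  also have "\<dots> \<le> deg_in p w0" by (rule lookup_le_deg_in[OF t])
  finally show "(\<Sum>w\<in>ks t. lk t w * deg_in (\<rho> w) v) \<le> deg_in p w0" .
qed

lemma deg_in_emb: "deg_in (emb p) (toU w) \<le> deg_in p w"
  unfolding emb_def by (rule deg_in_peval_var) (auto simp: deg_in_dv)

lemma emb_no_X: assumes "isX w" shows "w \<notin> derivs (emb p)"
proof -
  have "deg_in (emb p) w \<le> 0" unfolding emb_def
    by (rule deg_in_peval_le) (use assms in \<open>auto simp: deg_in_dv\<close>)
  then show ?thesis using deg_in_eq_0_iff[of "emb p" w] by simp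
qed

lemma deg_in_unemb:
  fixes p :: "('m,('r,'n) xu,'a::comm_ring_1) dpoly"
  shows "deg_in (unemb p) w \<le> deg_in p (toU w)"
  unfolding unemb_def
proof (rule deg_in_peval_var)
  fix v :: "('m,('r,'n) xu) deriv"
  show "deg_in (gen (\<lambda>_ _. 0) dv v :: ('m,'n,'a) dpoly) w \<le> (if v = toU w then 1 else 0)"
    by (cases v rule: toU_cases) (auto simp: deg_in_dv)
qed simp

lemma deg_in_psub:
  fixes p :: "('m,('r,'n) xu,'a::comm_ring_1) dpoly"
  shows "deg_in (psub \<phi> \<xi> p) w \<le> deg_in p (toU w)"
  unfolding psub_def
proof (rule deg_in_peval_var)
  fix v :: "('m,('r,'n) xu) deriv"
  show "deg_in (gen (\<lambda>j e. dconst (\<xi> j e)) dv v) w \<le> (if v = toU w then 1 else 0)"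
    by (cases v rule: toU_cases) (auto simp: deg_in_dv)
qed simp

lemma emb_unemb:
  fixes p :: "('m,('r,'n) xu,'a::comm_ring_1) dpoly"
  assumes "\<And>w. w \<in> derivs p \<Longrightarrow> \<not> isX w" shows "emb (unemb p) = p"
proof -
  have "emb (unemb p) = peval (\<lambda>c. emb (dconst c)) (\<lambda>w. emb (gen (\<lambda>_ _. 0) dv w)) p"
    unfolding unemb_def emb_def
    by (rule peval_peval[of UNIV _ UNIV]) (auto simp: rhom_dconst)
  also have "\<dots> = peval dconst dv p"
  proof (rule peval_cong)
    show "emb (dconst c) = dconst c" for c :: 'a
      unfolding emb_def by (rule peval_dconst[of UNIV]) (auto simp: rhom_dconst)
    fix w assume "w \<in> derivs p"
    then have "\<not> isX w" by (rule assms)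
    then obtain v where "w = toU v" by (cases w rule: toU_cases) auto
    then show "emb (gen (\<lambda>_ _. 0) dv w) = dv w"
      unfolding emb_def by (simp add: peval_dv[of UNIV] rhom_dconst)
  qed
  finally show ?thesis by simp
qed

lemma over_emb: "subring R \<Longrightarrow> p \<in> over R \<Longrightarrow> emb p \<in> over R"
  unfolding emb_def by (rule peval_in[of R dconst]) (auto simp: rhom_dconst subring_over over_dconst over_dv)

lemma over_unemb:
  fixes p :: "('m,('r,'n) xu,'a::comm_ring_1) dpoly"
  assumes "subring R" "p \<in> over R" shows "unemb p \<in> over R"
  unfolding unemb_def
proof (rule peval_in[of R dconst])
  fix w :: "('m,('r,'n) xu) deriv"
  show "gen (\<lambda>_ _. 0) dv w \<in> over R" using assms(1) by (cases w rule: toU_cases) (auto simp: over_dv)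
qed (use assms in \<open>auto simp: rhom_dconst subring_over over_dconst\<close>)

lemma peval_emb:
  assumes "subring R" "rhom_on R \<phi>" "p \<in> over R"
  shows "peval \<phi> \<rho> (emb p) = peval \<phi> (\<lambda>w. \<rho> (toU w)) p"
  unfolding emb_def
  by (subst peval_peval[OF assms(1) rhom_dconst assms(1,2,3)])
     (use assms in \<open>auto simp: over_dconst over_dv peval_dconst[OF assms(1,2)] peval_dv[OF assms(1,2)]\<close>)

lemma peval_psub:
  fixes p :: "('m,('r,'n) xu,'a::comm_ring_1) dpoly"
  assumes "rhom_on UNIV \<phi>"
  shows "pe \<nu> (psub \<phi> \<xi> p) = peval \<phi> (gen \<xi> \<nu>) p"
proof -
  have h: "rhom_on UNIV (\<lambda>c. dconst (\<phi> c))" using assms by (simp add: rhom_on_def dconst_add dconst_mult)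
  have "pe \<nu> (psub \<phi> \<xi> p) = peval (\<lambda>c. pe \<nu> (dconst (\<phi> c))) (\<lambda>w. pe \<nu> (gen (\<lambda>j e. dconst (\<xi> j e)) dv w)) p"
    unfolding psub_def by (rule peval_peval[of UNIV _ UNIV]) (auto simp: h)
  also have "\<dots> = peval \<phi> (gen \<xi> \<nu>) p"
  proof (rule peval_cong)
    fix w :: "('m, ('r,'n) xu) deriv"
    show "pe \<nu> (gen (\<lambda>j e. dconst (\<xi> j e)) dv w) = gen \<xi> \<nu> w"
      by (cases w rule: toU_cases) (auto simp: pe_dconst pe_dv)
  qed (simp add: pe_dconst)
  finally show ?thesis .
qed

lemma psub_X:
  assumes "rhom_on UNIV \<phi>" "\<And>w. w \<in> derivs p \<Longrightarrow> isX w"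
  shows "psub \<phi> \<xi> p = dconst (peval \<phi> (gen \<xi> \<nu>) p)"
proof -
  have h: "rhom_on UNIV (\<lambda>c. dconst (\<phi> c))" using assms by (simp add: rhom_on_def dconst_add dconst_mult)
  have 0: "\<phi> 0 = 0" using rhom_on_0[OF subring_UNIV assms(1)] .
  have "p \<in> over UNIV" "derivs p \<subseteq> {w. isX w}" using assms(2) by auto
  then show ?thesis
  proof (induction rule: dpoly_induct)
    case (const c)
    then show ?case unfolding psub_def by (simp add: peval_dconst[OF subring_UNIV h] peval_dconst[OF subring_UNIV assms(1)])
  next
    case (var w)
    then obtain j e where "w = (X j, e)" by (cases w rule: toU_cases) auto
    then show ?case unfolding psub_def by (simp add: peval_dv[OF subring_UNIV h] peval_dv[OF subring_UNIV assms(1)])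
  next
    case (add p q)
    then show ?case unfolding psub_def by (simp add: peval_add[OF subring_UNIV h] peval_add[OF subring_UNIV assms(1)] dconst_add)
  next
    case (mult p q)
    then show ?case unfolding psub_def by (simp add: peval_mult[OF subring_UNIV h] peval_mult[OF subring_UNIV assms(1)] dconst_mult)
  qed simp
qed

lemma psub_emb:
  fixes \<phi> :: "'a::comm_ring_1 \<Rightarrow> 'b::comm_ring_1"
  assumes "rhom_on UNIV \<phi>" shows "psub \<phi> \<xi> (emb (sg m 1)) = sg m 1"
proof -
  have h: "rhom_on UNIV (\<lambda>c. dconst (\<phi> c))" using assms by (simp add: rhom_on_def dconst_add dconst_mult)
  have "psub \<phi> \<xi> (emb (sg m 1)) = peval (\<lambda>c. dconst (\<phi> c)) dv (sg m 1)"
    unfolding psub_def by (subst peval_emb[of UNIV]) (auto simp: h)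
  also have "\<dots> = dconst (\<phi> 1) * (\<Prod>w\<in>ks m. dv w ^ lk m w)"
    by (simp add: peval_single[OF subring_UNIV h] mono_val_def)
  also have "\<dots> = sg m 1" using single_eq_prod_dv[of m "1::'b"] rhom_onD(1)[OF assms] by simp
  finally show ?thesis .
qed

text \<open>Inverse to \<open>psub\<close> up to a factor: if \<open>a m\<close> is a polynomial in
  the x-derivatives with value b times the coefficient of f at m, then \<open>lift a f\<close> goes
  to b f, see \<open>lift_psub\<close>. This is how denominators are cleared.\<close>

definition lift :: "((('m,'n) deriv \<Rightarrow>\<^sub>0 nat) \<Rightarrow> ('m,('r,'n) xu,'a) dpoly) \<Rightarrow> ('m,'n,'b::zero) dpoly \<Rightarrow> ('m,('r,'n) xu,'a::comm_ring_1) dpoly" where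
  "lift a f = (\<Sum>m\<in>ks f. a m * emb (sg m 1))"

lemma lift_psub:
  fixes f :: "('m,'n,'b::comm_ring_1) dpoly"
  assumes "rhom_on UNIV \<phi>" "\<And>m w. m \<in> ks f \<Longrightarrow> w \<in> derivs (a m) \<Longrightarrow> isX w"
    "\<And>m. m \<in> ks f \<Longrightarrow> peval \<phi> (gen \<xi> \<nu>) (a m) = b * lk f m"
  shows "psub \<phi> \<xi> (lift a f) = dconst b * f"
proof -
  have h: "rhom_on UNIV (\<lambda>c. dconst (\<phi> c))" using assms by (simp add: rhom_on_def dconst_add dconst_mult)
  have "psub \<phi> \<xi> (lift a f) = (\<Sum>m\<in>ks f. psub \<phi> \<xi> (a m) * psub \<phi> \<xi> (emb (sg m 1)))"
    unfolding lift_def psub_def by (simp add: peval_sum[OF subring_UNIV h] peval_mult[OF subring_UNIV h])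
  also have "\<dots> = (\<Sum>m\<in>ks f. dconst b * sg m (lk f m))"
  proof (rule sum.cong[OF refl])
    fix m assume m: "m \<in> ks f"
    have "psub \<phi> \<xi> (a m) = dconst (b * lk f m)" using psub_X[OF assms(1) assms(2)[OF m], of "a m" \<xi> \<nu>] assms(3)[OF m] by simp
    then show "psub \<phi> \<xi> (a m) * psub \<phi> \<xi> (emb (sg m 1)) = dconst b * sg m (lk f m)"
      by (simp add: psub_emb[OF assms(1)] dconst_def single_mult)
  qed
  also have "\<dots> = dconst b * f" by (simp only: sum_distrib_left[symmetric] sum_single[symmetric])
  finally show ?thesis .
qed

lemma deg_in_lift_U:
  fixes f :: "('m,'n,'b::zero) dpoly" and a :: "_ \<Rightarrow> ('m,('r,'n) xu,'a::comm_ring_1) dpoly"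
  assumes "\<And>m w. m \<in> ks f \<Longrightarrow> w \<in> derivs (a m) \<Longrightarrow> isX w"
  shows "deg_in (lift a f) (toU w) \<le> deg_in f w"
  unfolding lift_def
proof (rule deg_in_sum)
  fix m assume m: "m \<in> ks f"
  have "toU w \<notin> derivs (a m)" using assms[OF m] by fastforce
  then have 0: "deg_in (a m) (toU w) = 0" by (simp add: deg_in_eq_0_iff)
  have "deg_in (emb (sg m 1) :: ('m,('r,'n) xu,'a) dpoly) (toU w) \<le> deg_in (sg m (1::'a)) w" by (rule deg_in_emb)
  also have "\<dots> \<le> deg_in f w" using lookup_le_deg_in[OF m, of w] by (simp add: deg_in_def)
  finally show "deg_in (a m * emb (sg m 1)) (toU w) \<le> deg_in f w"
    using deg_in_mult[of "a m" "emb (sg m 1)" "toU w"] 0 by linarith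
qed

lemma deg_in_lift_X:
  fixes f :: "('m,'n,'b::zero) dpoly" and a :: "_ \<Rightarrow> ('m,('r,'n) xu,'a::comm_ring_1) dpoly"
  assumes "isX w" "\<And>m. m \<in> ks f \<Longrightarrow> deg_in (a m) w \<le> n"
  shows "deg_in (lift a f) w \<le> n"
  unfolding lift_def
proof (rule deg_in_sum)
  fix m assume m: "m \<in> ks f"
  have "deg_in (emb (sg m 1) :: ('m,('r,'n) xu,'a) dpoly) w = 0" using emb_no_X[OF assms(1)] by (simp add: deg_in_eq_0_iff)
  then show "deg_in (a m * emb (sg m 1)) w \<le> n"
    using deg_in_mult[of "a m" "emb (sg m 1)" w] assms(2)[OF m] by linarith
qed

section \<open>Common denominators, and fractions as quotients of univariate polynomials\<close>

context dext
begin

text \<open>The fractions come from \<open>minimal_fraction'\<close>, which uses only derivatives on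
  which the element depends; this keeps numerators and denominators inside W.\<close>

lemma common_denominator:
  assumes "finite S" "\<And>s. s \<in> S \<Longrightarrow> s \<in> FU \<and> {w. pd w s \<noteq> 0} \<subseteq> W"
  shows "\<exists>b\<in>over F. b \<noteq> 0 \<and> derivs b \<subseteq> W \<and> (\<exists>a. \<forall>s\<in>S. a s \<in> over F \<and> derivs (a s) \<subseteq> W \<and> ev (a s) = s * ev b)"
  using assms
proof (induction S rule: finite_induct)
  case empty
  then show ?case by (intro bexI[of _ 1]) (auto simp: FR)
next
  case (insert x S)
  have "\<And>s. s \<in> S \<Longrightarrow> s \<in> FU \<and> {w. pd w s \<noteq> 0} \<subseteq> W" using insert.prems by blast
  from insert.IH[OF this] obtain b where b: "b \<in> over F" "b \<noteq> 0" "derivs b \<subseteq> W"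
    and ex: "\<exists>a. \<forall>s\<in>S. a s \<in> over F \<and> derivs (a s) \<subseteq> W \<and> ev (a s) = s * ev b" by blast
  from ex obtain a where a: "\<forall>s\<in>S. a s \<in> over F \<and> derivs (a s) \<subseteq> W \<and> ev (a s) = s * ev b" by (elim exE)
  have "x \<in> FU" using insert.prems by blast
  then obtain p q where p: "p \<in> over F" "q \<in> over F" "q \<noteq> 0" "ev p = x * ev q" "derivs p \<union> derivs q \<subseteq> {w. pd w x \<noteq> 0}"
    by (rule minimal_fraction')
  have W: "derivs p \<subseteq> W" "derivs q \<subseteq> W" using p(5) insert.prems[of x] by blast+
  define a' where "a' s = (if s = x then p * b else a s * q)" for s
  have "a' s \<in> over F \<and> derivs (a' s) \<subseteq> W \<and> ev (a' s) = s * ev (b * q)" if "s \<in> insert x S" for s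
  proof (cases "s = x")
    case True
    then show ?thesis using p b W derivs_mult[of p b] by (auto simp: a'_def pe_mult intro: overI FR)
  next
    case False
    then have s: "a s \<in> over F" "derivs (a s) \<subseteq> W" "ev (a s) = s * ev b" using that bspec[OF a, of s] by blast+
    then show ?thesis using p W derivs_mult[of "a s" q] False by (auto simp: a'_def pe_mult intro: overI FR)
  qed
  moreover have "b * q \<noteq> 0" using dpoly_no_zero_divisors[OF c0] b(2) p(3) by blast
  moreover have "derivs (b * q) \<subseteq> W" using derivs_mult[of b q] b W by blast
  moreover have "b * q \<in> over F" using b p by (intro overI FR)
  ultimately show ?case by (intro bexI[of _ "b * q"] conjI exI[of _ a'] ballI) blast+
qed

text \<open>The image of p among the univariate polynomials over the large field: the indeterminate
  stands for t, every other derivative takes its value at u. By \<open>ph_eq_0\<close> nothing is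
  lost for p over F.\<close>

definition ph :: "('m,'n) deriv \<Rightarrow> ('m,'n,'k) dpoly \<Rightarrow> 'k poly" where
  "ph t = peval (\<lambda>c. [:c:]) (\<lambda>w. if w = t then [:0, 1:] else [:val w:])"

lemma rhom_const_poly: "rhom_on UNIV (\<lambda>c. [:c::'k:])"
  by (simp add: rhom_on_def one_pCons)

lemma ph_add: "ph t (p + q) = ph t p + ph t q"
  and ph_mult: "ph t (p * q) = ph t p * ph t q"
  and ph_power: "ph t (p ^ n) = ph t p ^ n"
  and ph_sum: "ph t (sum f I) = (\<Sum>i\<in>I. ph t (f i))"
  and ph_dconst: "ph t (dconst c) = [:c:]"
  and ph_dv: "ph t (dv w) = (if w = t then [:0, 1:] else [:val w:])"
  unfolding ph_def
  by (rule peval_add[OF subring_UNIV rhom_const_poly] peval_mult[OF subring_UNIV rhom_const_poly]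
    peval_power[OF subring_UNIV rhom_const_poly] peval_sum[OF subring_UNIV rhom_const_poly]
    peval_dconst[OF subring_UNIV rhom_const_poly] peval_dv[OF subring_UNIV rhom_const_poly], (rule over_UNIV)?, (rule over_UNIV)?)+

lemma ph_0 [simp]: "ph t 0 = 0" by (simp add: ph_def)

lemma poly_ph: "poly (ph t p) (val t) = ev p"
proof -
  have "p \<in> over UNIV" "derivs p \<subseteq> UNIV" by auto
  then show ?thesis
    by (induction rule: dpoly_induct) (auto simp: ph_add ph_mult ph_dconst ph_dv pe_simps)
qed

lemma ph_const: assumes "t \<notin> derivs p" shows "ph t p = [:ev p:]"
proof -
  have "p \<in> over UNIV" "derivs p \<subseteq> - {t}" using assms by auto
  then show ?thesis
    by (induction rule: dpoly_induct) (auto simp: ph_add ph_mult ph_dconst ph_dv pe_simps)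
qed

lemma ph_expand: assumes "deg_in p t \<le> n" shows "ph t p = (\<Sum>k\<le>n. monom (ev (coef_in t k p)) k)"
proof -
  have "ph t p = ph t (\<Sum>k\<le>n. coef_in t k p * dv t ^ k)" using coef_in_expand[OF assms] by simp
  also have "\<dots> = (\<Sum>k\<le>n. [:ev (coef_in t k p):] * [:0, 1:] ^ k)"
    unfolding ph_sum ph_mult ph_power ph_dv
  proof (intro sum.cong refl)
    fix k
    have "t \<notin> derivs (coef_in t k p)" using derivs_coef_in by blast
    then show "ph t (coef_in t k p) * (if t = t then [:0, 1:] else [:val t:]) ^ k = [:ev (coef_in t k p):] * [:0, 1:] ^ k"
      by (simp add: ph_const)
  qed
  also have "\<dots> = (\<Sum>k\<le>n. monom (ev (coef_in t k p)) k)" by (simp add: monom_altdef)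
  finally show ?thesis .
qed

lemma coeff_ph: "coeff (ph t p) k = (if k \<le> deg_in p t then ev (coef_in t k p) else 0)"
  unfolding ph_expand[OF order_refl] by (simp add: coeff_sum sum.delta)

lemma degree_ph: "degree (ph t p) \<le> deg_in p t"
  by (rule degree_le) (simp add: coeff_ph)

lemma ph_eq_0: "p \<in> over F \<Longrightarrow> ph t p = 0 \<Longrightarrow> p = 0"
  using poly_ph[of t p] ev_eq_0[of p] by simp

definition cfield :: "('m,'n) deriv \<Rightarrow> 'k set" where "cfield t = {a \<in> FU. pd t a = 0}"

lemma cfield_subfield: "subfield (cfield t)"
  unfolding subfield_def subring_def
proof (intro conjI ballI)
  note FUc = subringD[OF FUR]
  show "0 \<in> cfield t" "1 \<in> cfield t" using FUc by (auto simp: cfield_def pd_0 pd_1)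
  fix a assume a: "a \<in> cfield t"
  then have aF: "a \<in> FU" "pd t a = 0" by (auto simp: cfield_def)
  show "- a \<in> cfield t" using aF FUc deriv_on_uminus[OF FUR pd_deriv aF(1)] by (auto simp: cfield_def)
  show "inverse a \<in> cfield t"
  proof (cases "a = 0")
    case True then show ?thesis using FUc by (auto simp: cfield_def pd_0)
  next
    case False
    have i: "inverse a \<in> FU" by (rule subfield_inverse[OF FU_subfield aF(1)])
    have "pd t (a * inverse a) = pd t a * inverse a + a * pd t (inverse a)" by (rule pd_mult[OF aF(1) i])
    then have "pd t (inverse a) = 0" using False aF(2) by (simp add: pd_1)
    then show ?thesis using i by (simp add: cfield_def)
  qed
  fix b assume "b \<in> cfield t"
  then have bF: "b \<in> FU" "pd t b = 0" by (auto simp: cfield_def)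
  show "a + b \<in> cfield t" "a * b \<in> cfield t" using aF bF FUc by (auto simp: cfield_def pd_add pd_mult)
qed

lemma coeff_ph_cfield: assumes "p \<in> over F" shows "coeff (ph t p) k \<in> cfield t"
proof -
  have o: "coef_in t j p \<in> over F" for j by (rule over_coef_in[OF FR assms])
  have "pder t (coef_in t j p) = 0" for j by (rule pder_eq_0) (use derivs_coef_in in blast)
  then have "ev (coef_in t j p) \<in> cfield t" for j using FU_ev[OF o] pd_ev[OF o] by (simp add: cfield_def)
  then show ?thesis using subringD(1)[OF subfield_subring[OF cfield_subfield]] by (simp add: coeff_ph)
qed

text \<open>A fraction over the big field of small degree in \<open>t\<close> descends to one over \<open>F\<close>: apply
  coefficientwise a functional that is linear over the field of elements not involving \<open>t\<close>.\<close>

lemma fraction_descent: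
  assumes P: "P \<in> over F" "Q \<in> over F" "ev Q \<noteq> 0" "ev P = v * ev Q" and pq: "q \<noteq> 0" "p * ph t Q = q * ph t P"
    and deg: "degree p \<le> k" "degree q \<le> k"
  shows "\<exists>P' Q'. P' \<in> over F \<and> Q' \<in> over F \<and> Q' \<noteq> 0 \<and> ev P' = v * ev Q' \<and> deg_in P' t \<le> k \<and> deg_in Q' t \<le> k"
proof -
  note C = subfield_subring[OF cfield_subfield[of t]]
  \<comment> \<open>Normalizing \<pi> at the leading coefficient of q ensures that its
    coefficientwise application does not kill q.\<close>
  have "lead_coeff q \<noteq> 0" using pq by simp
  from subfield_functional[OF cfield_subfield[of t] this] obtain \<pi> where \<pi>: "\<pi> (lead_coeff q) = 1 \<and>
    (\<forall>x. \<pi> x \<in> cfield t) \<and> (\<forall>x y. \<pi> (x + y) = \<pi> x + \<pi> y) \<and> (\<forall>g\<in>cfield t. \<forall>x. \<pi> (g * x) = g * \<pi> x)" by (elim exE)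
  have \<pi>1: "\<pi> (lead_coeff q) = 1" and \<pi>C: "\<And>x. \<pi> x \<in> cfield t" and \<pi>a: "\<And>x y. \<pi> (x + y) = \<pi> x + \<pi> y"
    and \<pi>m: "\<And>g x. g \<in> cfield t \<Longrightarrow> \<pi> (g * x) = g * \<pi> x" using \<pi> by simp_all
  have \<pi>0: "\<pi> 0 = 0" using \<pi>m[OF subringD(1)[OF C], of 0] by simp
  have \<pi>s: "\<pi> (sum f I) = (\<Sum>i\<in>I. \<pi> (f i))" for f and I :: "nat set"
    by (induction I rule: infinite_finite_induct) (auto simp: \<pi>0 \<pi>a)
  define p1 q1 where "p1 = map_poly \<pi> p" and "q1 = map_poly \<pi> q"
  have cp: "coeff p1 i = \<pi> (coeff p i)" "coeff q1 i = \<pi> (coeff q i)" for i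
    by (auto simp: p1_def q1_def coeff_map_poly \<pi>0)
  \<comment> \<open>The factor \<open>ph t R\<close> has its coefficients in
    \<open>cfield t\<close>, so \<pi> passes through the product.\<close>
  have lin: "coeff (map_poly \<pi> a * ph t R) n = \<pi> (coeff (a * ph t R) n)" if "R \<in> over F" for a R n
    by (simp add: coeff_mult coeff_map_poly \<pi>0 \<pi>s mult.commute[of "coeff a _"] \<pi>m[OF coeff_ph_cfield[OF that]])
       (simp add: mult.commute)
  have eq1: "p1 * ph t Q = q1 * ph t P"
    by (rule poly_eqI) (simp add: p1_def q1_def lin[OF P(1)] lin[OF P(2)] pq(2))
  have "q1 \<noteq> 0" using cp(2)[of "degree q"] \<pi>1 by auto
  define S where "S = coeff p1 ` {..k} \<union> coeff q1 ` {..k}"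
  have "s \<in> FU \<and> {w. pd w s \<noteq> 0} \<subseteq> - {t}" if "s \<in> S" for s
    using that \<pi>C by (auto simp: S_def cp cfield_def)
  moreover have "finite S" by (simp add: S_def)
  ultimately have "\<exists>b\<in>over F. b \<noteq> 0 \<and> derivs b \<subseteq> - {t} \<and> (\<exists>a. \<forall>s\<in>S. a s \<in> over F \<and> derivs (a s) \<subseteq> - {t} \<and> ev (a s) = s * ev b)"
    using common_denominator by blast
  then obtain b where b: "b \<in> over F" "b \<noteq> 0" and ex: "\<exists>a. \<forall>s\<in>S. a s \<in> over F \<and> derivs (a s) \<subseteq> - {t} \<and> ev (a s) = s * ev b"
    by blast
  from ex obtain a where a': "\<forall>s\<in>S. a s \<in> over F \<and> derivs (a s) \<subseteq> - {t} \<and> ev (a s) = s * ev b" by (elim exE)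
  note a = bspec[OF a']
  have bz: "ev b \<noteq> 0" using ev_eq_0[OF b(1)] b(2) by blast
  \<comment> \<open>Turns a univariate polynomial with coefficients in S back into a differential
    polynomial over F, up to the factor \<open>ev b\<close>.\<close>
  define T where "T r = (\<Sum>i\<le>k. a (coeff r i) * dv t ^ i)" for r
  have T: "T r \<in> over F \<and> deg_in (T r) t \<le> k \<and> ev (T r) = ev b * poly r (val t)"
    if r: "\<And>i. i \<le> k \<Longrightarrow> coeff r i \<in> S" "degree r \<le> k" for r
  proof (intro conjI)
    show "T r \<in> over F" unfolding T_def using a r(1) by (intro overI FR) auto
    show "deg_in (T r) t \<le> k" unfolding T_def
    proof (rule deg_in_sum)
      fix i assume i: "i \<in> {..k}"
      then have "t \<notin> derivs (a (coeff r i))" using a[OF r(1), of i] by auto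
      then have "deg_in (a (coeff r i)) t = 0" by (simp add: deg_in_eq_0_iff)
      moreover have "deg_in (dv t ^ i :: ('m,'n,'k) dpoly) t \<le> i"
        using deg_in_power[of "dv t :: ('m,'n,'k) dpoly" i t] by (simp add: deg_in_dv)
      ultimately show "deg_in (a (coeff r i) * dv t ^ i) t \<le> k"
        using deg_in_mult[of "a (coeff r i)" "dv t ^ i" t] i by simp
    qed
    have "poly r (val t) = (\<Sum>i\<le>k. coeff r i * val t ^ i)"
      unfolding poly_altdef using r(2) by (intro sum.mono_neutral_left) (auto simp: coeff_eq_0)
    then show "ev (T r) = ev b * poly r (val t)"
      unfolding T_def pe_simps using a[OF r(1)] by (simp add: sum_distrib_left algebra_simps)
  qed
  have degs: "degree p1 \<le> k" "degree q1 \<le> k"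
    using deg by (auto intro!: degree_le simp: cp coeff_eq_0 \<pi>0)
  have T1: "T p1 \<in> over F \<and> deg_in (T p1) t \<le> k \<and> ev (T p1) = ev b * poly p1 (val t)"
    by (rule T) (use degs in \<open>auto simp: S_def\<close>)
  have T2: "T q1 \<in> over F \<and> deg_in (T q1) t \<le> k \<and> ev (T q1) = ev b * poly q1 (val t)"
    by (rule T) (use degs in \<open>auto simp: S_def\<close>)
  have "poly (p1 * ph t Q) (val t) = poly (q1 * ph t P) (val t)" by (simp only: eq1)
  then have "poly p1 (val t) * ev Q = poly q1 (val t) * (v * ev Q)" using P(4) by (simp add: poly_ph)
  then have ev1: "ev (T p1) = v * ev (T q1)" using P(3) T1 T2 by (simp add: algebra_simps)
  have "ph t (T q1) = smult (ev b) q1"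
  proof -
    have "ph t (T q1) = (\<Sum>i\<le>k. [:coeff q1 i * ev b:] * [:0, 1:] ^ i)"
      unfolding T_def ph_sum ph_mult ph_power ph_dv
    proof (intro sum.cong refl)
      fix i assume "i \<in> {..k}"
      then have s: "coeff q1 i \<in> S" by (auto simp: S_def)
      have "t \<notin> derivs (a (coeff q1 i))" using a[OF s] by blast
      then show "ph t (a (coeff q1 i)) * (if t = t then [:0, 1:] else [:val t:]) ^ i = [:coeff q1 i * ev b:] * [:0, 1:] ^ i"
        using a[OF s] by (simp add: ph_const)
    qed
    also have "\<dots> = (\<Sum>i\<le>k. monom (coeff q1 i * ev b) i)" by (simp add: monom_altdef)
    also have "\<dots> = smult (ev b) q1"
      by (rule poly_eqI) (use degs(2) in \<open>auto simp: coeff_sum sum.delta coeff_eq_0\<close>)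
    finally show ?thesis .
  qed
  then have "T q1 \<noteq> 0" using bz \<open>q1 \<noteq> 0\<close> by auto
  then show ?thesis using T1 T2 ev1 by blast
qed

text \<open>1 and v are linearly independent over F, so no coefficient of P cancels against one of v
  Q.\<close>

lemma fraction_poly:
  assumes "P \<in> over F" "Q \<in> over F" "v \<notin> F"
  shows "ks (P - dconst v * Q) = ks P \<union> ks Q"
proof -
  have "lk P m - v * lk Q m = 0 \<longleftrightarrow> lk P m = 0 \<and> lk Q m = 0" for m
  proof
    assume e: "lk P m - v * lk Q m = 0"
    have "lk Q m = 0"
    proof (rule ccontr)
      assume "lk Q m \<noteq> 0"
      then have "v = lk P m / lk Q m" using e by (simp add: field_simps)
      then show False using assms subfield_divide[OF delta_subfield_subfield[OF Fsub]] by (auto dest: overD)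
    qed
    then show "lk P m = 0 \<and> lk Q m = 0" using e by simp
  qed auto
  then show ?thesis
    by (intro set_eqI) (simp only: in_keys_iff lookup_minus lookup_dconst_mult Un_iff, blast)
qed

lemma fraction_poly_deg: "P \<in> over F \<Longrightarrow> Q \<in> over F \<Longrightarrow> v \<notin> F \<Longrightarrow> deg_in (P - dconst v * Q) w = max (deg_in P w) (deg_in Q w)"
proof -
  assume a: "P \<in> over F" "Q \<in> over F" "v \<notin> F"
  have "deg_in (P - dconst v * Q) w \<le> n \<longleftrightarrow> max (deg_in P w) (deg_in Q w) \<le> n" for n
    unfolding max.bounded_iff deg_in_le_iff fraction_poly[OF a] by auto
  from this[of "deg_in (P - dconst v * Q) w"] this[of "max (deg_in P w) (deg_in Q w)"] show ?thesis by linarith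
qed

lemma fraction_poly_derivs: "P \<in> over F \<Longrightarrow> Q \<in> over F \<Longrightarrow> v \<notin> F \<Longrightarrow> derivs (P - dconst v * Q) = derivs P \<union> derivs Q"
  unfolding derivs_def by (simp add: fraction_poly UN_Un)

lemma fraction_poly_Alg:
  assumes G: "subring G" "F \<subseteq> G" "v \<in> G" and P: "P \<in> over F" "Q \<in> over F" "v \<notin> F" "ev P = v * ev Q"
    "\<And>w. w \<in> derivs P \<union> derivs Q \<Longrightarrow> le w t" "max (deg_in P t) (deg_in Q t) = e" "1 \<le> e"
  shows "Alg G t e"
  unfolding Alg_def
proof (intro conjI bexI[of _ "P - dconst v * Q"] ballI)
  show "P - dconst v * Q \<in> over G" using over_mono[OF P(1) G(2)] over_mono[OF P(2) G(2)] G by (intro overI)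
qed (use P in \<open>auto simp: pe_simps fraction_poly_deg fraction_poly_derivs\<close>)

end

subsection \<open>Simple differential extensions\<close>

definition fracs :: "'k::field set \<Rightarrow> 'k set" where "fracs S = {a / b |a b. a \<in> S \<and> b \<in> S}"

lemma fracs_common_denominator:
  assumes "subring S" "finite T" "T \<subseteq> fracs S"
  shows "\<exists>b\<in>S. b \<noteq> 0 \<and> (\<forall>s\<in>T. b * s \<in> S)"
  using assms(2,3)
proof (induction T rule: finite_induct)
  case empty
  then show ?case using subringD(2)[OF assms(1)] by (intro bexI[of _ 1]) auto
next
  case (insert x T)
  then obtain b where b: "b \<in> S" "b \<noteq> 0" "\<forall>s\<in>T. b * s \<in> S" by blast
  obtain p q where p: "x = p / q" "p \<in> S" "q \<in> S" using insert.prems by (auto simp: fracs_def)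
  define q' where "q' = (if q = 0 then 1 else q)"
  have q': "q' \<in> S" "q' \<noteq> 0" "q' * x \<in> S" using p subringD(1,2)[OF assms(1)] by (auto simp: q'_def)
  have "b * q' * s \<in> S" if "s \<in> insert x T" for s
  proof (cases "s = x")
    case True
    then show ?thesis using subringD(5)[OF assms(1) b(1) q'(3)] by (simp add: mult.assoc)
  next
    case False
    then have "b * s \<in> S" using that b(3) by blast
    then show ?thesis using subringD(5)[OF assms(1) q'(1), of "b * s"] by (simp add: mult_ac)
  qed
  then show ?case using b q' subringD(5)[OF assms(1) b(1) q'(1)] by (intro bexI[of _ "b * q'"]) auto
qed

lemma delta_subfield_fracs:
  assumes S: "subring S" and d: "delta_ring \<delta>" and dS: "\<And>i a. a \<in> S \<Longrightarrow> \<delta> i a \<in> S"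
  shows "delta_subfield \<delta> (fracs S)"
  unfolding delta_subfield_def
proof (intro conjI ballI allI)
  note R = subringD[OF S]
  have E: "\<exists>p q. a = p / q \<and> p \<in> S \<and> q \<in> S \<and> q \<noteq> 0" if "a \<in> fracs S" for a
  proof -
    from that obtain p q where pq: "a = p / q" "p \<in> S" "q \<in> S" by (auto simp: fracs_def)
    show ?thesis
    proof (cases "q = 0")
      case True then show ?thesis using pq R(1,2) by (intro exI[of _ 0] exI[of _ 1]) auto
    qed (use pq in blast)
  qed
  show "1 \<in> fracs S" unfolding fracs_def using R(2) by (intro CollectI exI[of _ 1]) simp
  fix a assume "a \<in> fracs S"
  then obtain p q where p: "a = p / q" "p \<in> S" "q \<in> S" "q \<noteq> 0" using E by blast
  show "inverse a \<in> fracs S" unfolding fracs_def p(1) inverse_divide using p by blast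
  show "\<delta> i a \<in> fracs S" for i
  proof -
    have "\<delta> i (a * q) = \<delta> i a * q + a * \<delta> i q" using deriv_onD(2)[OF delta_ringD(1)[OF d, of UNIV]] by blast
    moreover have "a * q = p" using p by simp
    ultimately have "\<delta> i p = \<delta> i a * q + a * \<delta> i q" by simp
    then have "\<delta> i a = (\<delta> i p * q - p * \<delta> i q) / (q * q)" using p(4) unfolding p(1) by (simp add: field_simps)
    moreover have "\<delta> i p * q - p * \<delta> i q \<in> S" "q * q \<in> S" using p dS by (auto intro!: R)
    ultimately show ?thesis unfolding fracs_def by blast
  qed
  fix b assume "b \<in> fracs S"
  then obtain p' q' where p': "b = p' / q'" "p' \<in> S" "q' \<in> S" "q' \<noteq> 0" using E by blast
  have "a - b = (p * q' - p' * q) / (q * q')" using p p' by (simp add: diff_frac_eq)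
  moreover have "p * q' - p' * q \<in> S" "q * q' \<in> S" using p p' by (auto intro!: R)
  ultimately show "a - b \<in> fracs S" unfolding fracs_def by blast
  have "a * b = (p * p') / (q * q')" using p p' by simp
  moreover have "p * p' \<in> S" "q * q' \<in> S" using p p' by (auto intro!: R)
  ultimately show "a * b \<in> fracs S" unfolding fracs_def by blast
qed

text \<open>The u-part of the variable type is a dummy, \<open>unit\<close> with values 0;
  \<open>xring_lift\<close> moves the polynomials to any other type in its place.\<close>

definition xring :: "('a::comm_ring_1 \<Rightarrow> 'b::comm_ring_1) \<Rightarrow> 'a set \<Rightarrow> ('r \<Rightarrow> ('m \<Rightarrow> nat) \<Rightarrow> 'b) \<Rightarrow> 'r set \<Rightarrow> 'b set" where
  "xring \<phi> R \<xi> J = {peval \<phi> (gen \<xi> (\<lambda>_. 0)) p |p :: ('m,('r,unit) xu,'a) dpoly. p \<in> over R \<and> derivs p \<subseteq> {w. \<exists>j\<in>J. fst w = X j}}"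

lemma derivs_dpoly_deriv:
  assumes "delta_ring d" "\<And>w. w \<in> W \<Longrightarrow> deriv_shift i w \<in> W" "derivs p \<subseteq> W"
  shows "derivs (dpoly_deriv d i p) \<subseteq> W"
proof -
  note D = deriv_onD[OF deriv_on_dpoly_deriv[OF assms(1), of UNIV] UNIV_I UNIV_I]
  have "p \<in> over UNIV" by simp
  from this assms(3) have "derivs p \<subseteq> W \<and> derivs (dpoly_deriv d i p) \<subseteq> W"
  proof (induction rule: dpoly_induct)
    case (add p q)
    then show ?case unfolding D using derivs_add[of p q] derivs_add[of "dpoly_deriv d i p" "dpoly_deriv d i q"] by blast
  next
    case (mult p q)
    then show ?case unfolding D
      using derivs_mult[of p q] derivs_add[of "dpoly_deriv d i p * q" "p * dpoly_deriv d i q"]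
        derivs_mult[of "dpoly_deriv d i p" q] derivs_mult[of p "dpoly_deriv d i q"] by blast
  qed (use assms(1,2) in auto)
  then show ?thesis by blast
qed

lemma peval_dpoly_deriv:
  assumes "delta_ring d" "delta_ring \<delta>" "subring R" "rhom_on R \<phi>" "\<And>c i. c \<in> R \<Longrightarrow> d i c \<in> R \<and> \<delta> i (\<phi> c) = \<phi> (d i c)"
    "\<And>w i. w \<in> derivs p \<Longrightarrow> \<delta> i (\<rho> w) = \<rho> (deriv_shift i w)" "p \<in> over R"
  shows "peval \<phi> \<rho> (dpoly_deriv d i p) = \<delta> i (peval \<phi> \<rho> p)"
  unfolding dpoly_deriv_eq_mder
  by (rule deriv_peval[symmetric, OF assms(3,4) subring_UNIV delta_ringD(1)[OF assms(2)] delta_ringD(1)[OF assms(1)] _ _ assms(7) order_refl])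
     (use assms in \<open>auto simp: over_dv peval_dv[OF assms(3,4)]\<close>)

lemma subring_xring:
  fixes \<phi> :: "'a::comm_ring_1 \<Rightarrow> 'b::comm_ring_1" and \<xi> :: "'r \<Rightarrow> ('m \<Rightarrow> nat) \<Rightarrow> 'b"
  assumes "subring R" "rhom_on R \<phi>" shows "subring (xring \<phi> R \<xi> J)"
  unfolding subring_def
proof (intro conjI ballI)
  let ?W = "{w. \<exists>j\<in>J. fst w = X j}" and ?e = "peval \<phi> (gen \<xi> (\<lambda>_. 0))"
  have I: "?e p \<in> xring \<phi> R \<xi> J" if "p \<in> over R" "derivs p \<subseteq> ?W" for p :: "('m,('r,unit) xu,'a) dpoly"
    unfolding xring_def using that by blast
  show "0 \<in> xring \<phi> R \<xi> J" using I[of 0] assms(1) by simp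
  show "1 \<in> xring \<phi> R \<xi> J" using I[of 1] assms by (simp add: peval_1[OF assms])
  fix a assume "a \<in> xring \<phi> R \<xi> J"
  then obtain p :: "('m,('r,unit) xu,'a) dpoly" where p: "a = ?e p" "p \<in> over R" "derivs p \<subseteq> ?W" by (auto simp: xring_def)
  show "- a \<in> xring \<phi> R \<xi> J" using I[of "- p"] p overI(3)[OF assms(1) p(2)] by (simp add: peval_uminus[OF assms])
  fix b assume "b \<in> xring \<phi> R \<xi> J"
  then obtain q :: "('m,('r,unit) xu,'a) dpoly" where q: "b = ?e q" "q \<in> over R" "derivs q \<subseteq> ?W" by (auto simp: xring_def)
  have "?e (p + q) \<in> xring \<phi> R \<xi> J"
    by (rule I) (use p q overI(4)[OF assms(1) p(2) q(2)] derivs_add[of p q] in blast)+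
  then show "a + b \<in> xring \<phi> R \<xi> J" using p q by (simp add: peval_add[OF assms])
  have "?e (p * q) \<in> xring \<phi> R \<xi> J"
    by (rule I) (use p q overI(5)[OF assms(1) p(2) q(2)] derivs_mult[of p q] in blast)+
  then show "a * b \<in> xring \<phi> R \<xi> J" using p q by (simp add: peval_mult[OF assms])
qed

lemma xring_delta:
  fixes \<phi> :: "'a::comm_ring_1 \<Rightarrow> 'b::comm_ring_1" and x :: "'r \<Rightarrow> 'b" and \<delta> :: "'m::{finite,linorder} \<Rightarrow> 'b \<Rightarrow> 'b"
  assumes "delta_ring d" "delta_ring \<delta>" "subring R" "rhom_on R \<phi>" "\<And>c i. c \<in> R \<Longrightarrow> d i c \<in> R \<and> \<delta> i (\<phi> c) = \<phi> (d i c)"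
    "a \<in> xring \<phi> R (\<lambda>j e. theta \<delta> e (x j)) J"
  shows "\<delta> i a \<in> xring \<phi> R (\<lambda>j e. theta \<delta> e (x j)) J"
proof -
  let ?W = "{w. \<exists>j\<in>J. fst w = X j}" and ?e = "peval \<phi> (gen (\<lambda>j e. theta \<delta> e (x j)) (\<lambda>_. 0))"
  obtain p :: "('m, ('r,unit) xu, 'a) dpoly" where p: "a = ?e p" "p \<in> over R" "derivs p \<subseteq> ?W" using assms(6) by (auto simp: xring_def)
  have "?e (dpoly_deriv d i p) = \<delta> i (?e p)"
  proof (rule peval_dpoly_deriv[OF assms(1-5) _ p(2)])
    fix w i assume "w \<in> derivs p"
    then obtain j where "fst w = X j" using p(3) by blast
    then show "\<delta> i (gen (\<lambda>j e. theta \<delta> e (x j)) (\<lambda>_. 0) w) = gen (\<lambda>j e. theta \<delta> e (x j)) (\<lambda>_. 0) (deriv_shift i w)"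
      by (simp add: gen_def deriv_shift_def theta_Suc[of \<delta>, OF delta_ringD(2)[OF assms(2)]] del: fun_upd_apply)
  qed auto
  moreover have "derivs (dpoly_deriv d i p) \<subseteq> ?W"
    by (rule derivs_dpoly_deriv[OF assms(1) _ p(3)]) (auto simp: deriv_shift_def)
  moreover have "dpoly_deriv d i p \<in> over R"
    by (rule over_dpoly_deriv[OF assms(1,3) _ p(2)]) (use assms(5) in blast)
  ultimately show ?thesis unfolding xring_def p(1) by (intro CollectI exI[of _ "dpoly_deriv d i p"]) simp
qed

lemma xring_lift:
  assumes "subring R" "rhom_on R \<phi>" "a \<in> xring \<phi> R \<xi> J"
  shows "\<exists>p :: ('m,('r,'n) xu,'a::comm_ring_1) dpoly. p \<in> over R \<and> derivs p \<subseteq> {w. \<exists>j\<in>J. fst w = X j} \<and> a = peval \<phi> (gen \<xi> \<nu>) p"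
proof -
  obtain p :: "('m,('r,unit) xu,'a) dpoly" where p: "a = peval \<phi> (gen \<xi> (\<lambda>_. 0)) p" "p \<in> over R" "derivs p \<subseteq> {w. \<exists>j\<in>J. fst w = X j}"
    using assms(3) by (auto simp: xring_def)
  define \<rho> :: "('m,('r,unit) xu) deriv \<Rightarrow> ('m,('r,'n) xu,'a) dpoly" where "\<rho> = gen (\<lambda>j e. dv (X j, e)) (\<lambda>_. 0)"
  have \<rho>: "\<exists>j\<in>J. \<rho> w = dv (X j, snd w) \<and> gen \<xi> (\<lambda>_. 0) w = \<xi> j (snd w)" if "w \<in> derivs p" for w
    using that p(3) by (fastforce simp: \<rho>_def gen_def)
  have ov: "\<rho> w \<in> over R" if "w \<in> derivs p" for w using \<rho>[OF that] assms(1) by (auto simp: over_dv)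
  define q where "q = peval dconst \<rho> p"
  have "q \<in> over R" unfolding q_def
    by (rule peval_in[OF assms(1) rhom_dconst p(2) subring_over[OF assms(1)]]) (use ov assms(1) over_dconst in auto)
  moreover have "q \<in> {q. derivs q \<subseteq> {w. \<exists>j\<in>J. fst w = X j}}" unfolding q_def
  proof (rule peval_in[OF assms(1) rhom_dconst p(2)])
    show "subring {q :: ('m,('r,'n) xu,'a) dpoly. derivs q \<subseteq> {w. \<exists>j\<in>J. fst w = X j}}"
      unfolding subring_def by (auto dest!: subsetD[OF derivs_add] subsetD[OF derivs_mult])
  qed (use \<rho> in fastforce)+
  moreover have "peval \<phi> (gen \<xi> \<nu>) q = a"
  proof -
    have "peval \<phi> (gen \<xi> \<nu>) q = peval (\<lambda>c. peval \<phi> (gen \<xi> \<nu>) (dconst c :: ('m,('r,'n) xu,'a) dpoly)) (\<lambda>w. peval \<phi> (gen \<xi> \<nu>) (\<rho> w)) p"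
      unfolding q_def by (rule peval_peval[OF assms(1) rhom_dconst assms(1,2) p(2)]) (use ov assms(1) over_dconst in auto)
    also have "\<dots> = a" unfolding p(1)
    proof (rule peval_cong)
      fix w assume "w \<in> derivs p"
      then show "peval \<phi> (gen \<xi> \<nu>) (\<rho> w) = gen \<xi> (\<lambda>_. 0) w" using \<rho>[of w] by (auto simp: peval_dv[OF assms(1,2)])
    qed (simp add: peval_dconst[OF assms(1,2)])
    finally show ?thesis .
  qed
  ultimately show ?thesis by blast
qed

lemma (in wf_ranking) ex_max_ball: "finite S \<Longrightarrow> S \<noteq> {} \<Longrightarrow> \<exists>w\<in>S. \<forall>v\<in>S. le v w"
  by (rule ex_max[of S]) blast+

section \<open>The leading pair of a simple extension\<close>

context dext
begin

definition FG :: "'k set \<Rightarrow> 'k set" where "FG A = (\<lambda>K. delta_subfield \<delta> K \<and> F \<subseteq> K) hull A"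

lemma FG_delta_subfield: "delta_subfield \<delta> (FG A)" "F \<subseteq> FG A" "A \<subseteq> FG A"
proof -
  have "delta_subfield \<delta> (\<Inter>T) \<and> F \<subseteq> \<Inter>T" if "\<forall>s\<in>T. delta_subfield \<delta> s \<and> F \<subseteq> s" for T
    using that by (auto simp: delta_subfield_def)
  then have "delta_subfield \<delta> (FG A) \<and> F \<subseteq> FG A"
    unfolding FG_def by (rule hull_in)
  then show "delta_subfield \<delta> (FG A)" "F \<subseteq> FG A" by blast+
  show "A \<subseteq> FG A" unfolding FG_def by (rule hull_subset)
qed

lemma FG_least: "delta_subfield \<delta> K \<Longrightarrow> F \<subseteq> K \<Longrightarrow> A \<subseteq> K \<Longrightarrow> FG A \<subseteq> K"
  unfolding FG_def by (rule hull_minimal) auto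

text \<open>e is the degree of a minimal pair for v as a rational function of t.
  \<open>fraction_descent\<close> turns it into a fraction over F of degree at most e in t, and
  \<open>minimal_fraction\<close> then removes the derivatives on which v does not depend, without
  raising that degree.\<close>

lemma fraction_leader:
  assumes v: "v \<in> FU" "v \<notin> F"
  obtains t e P Q p q c where "pd t v \<noteq> 0" "\<forall>\<psi>. lt t \<psi> \<longrightarrow> pd \<psi> v = 0" "1 \<le> e" "P \<in> over F" "Q \<in> over F" "ev Q \<noteq> 0" "ev P = v * ev Q"
    "\<forall>w\<in>derivs P \<union> derivs Q. le w t" "max (deg_in P t) (deg_in Q t) = e" "min_pair p q" "max (degree p) (degree q) = e"
    "ph t P = c * p" "ph t Q = c * q" "c \<noteq> 0"
proof -
  have "{w. pd w v \<noteq> 0} \<noteq> {}" using pd_all_0[OF v(1)] v(2) by blast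
  from ex_max_ball[OF finite_pd[OF v(1)] this] obtain t where t': "t \<in> {w. pd w v \<noteq> 0}" "\<forall>w\<in>{w. pd w v \<noteq> 0}. le w t"
    by (elim bexE)
  have t: "pd t v \<noteq> 0" using t'(1) by simp
  have tmax: "le w t" if "pd w v \<noteq> 0" for w using bspec[OF t'(2), of w] that by simp
  have gt: "pd \<psi> v = 0" if "lt t \<psi>" for \<psi> using tmax[of \<psi>] that trans[of t \<psi> t] by auto
  obtain P0 Q0 where P0: "P0 \<in> over F" "Q0 \<in> over F" "Q0 \<noteq> 0" "ev Q0 \<noteq> 0" "v = ev P0 / ev Q0" using v(1) by (rule FU_E)
  have ev0: "ev P0 = v * ev Q0" using P0 by simp
  have "ph t Q0 \<noteq> 0" using ph_eq_0 P0 by blast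
  from min_pair_exists[OF this, of "ph t P0"] obtain p q where pq: "min_pair p q" "p * ph t Q0 = q * ph t P0" by blast
  have q0: "q \<noteq> 0" using pq(1) by (simp add: min_pair_def)
  define e where "e = max (degree p) (degree q)"
  have dg: "degree p \<le> e" "degree q \<le> e" by (auto simp: e_def)
  from fraction_descent[OF P0(1,2,4) ev0 q0 pq(2) dg]
  obtain P1 Q1 where P1: "P1 \<in> over F" "Q1 \<in> over F" "Q1 \<noteq> 0" "ev P1 = v * ev Q1" "deg_in P1 t \<le> e" "deg_in Q1 t \<le> e" by blast
  obtain P Q where P: "P \<in> over F" "Q \<in> over F" "Q \<noteq> 0" "ev P = v * ev Q" "deg_in P t \<le> e" "deg_in Q t \<le> e"
    "derivs P \<union> derivs Q \<subseteq> {w. pd w v \<noteq> 0}" using minimal_fraction[OF P1 v(1)] by blast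
  have evQ: "ev Q \<noteq> 0" using ev_eq_0 P by blast
  \<comment> \<open>The new fraction is still proportional to the minimal pair; this yields the
    factor c and bounds the degrees from below by e.\<close>
  have "P * Q0 = P0 * Q"
  proof (rule ev_inj)
    show "P * Q0 \<in> over F" "P0 * Q \<in> over F" using P P0 by (auto intro: overI FR)
    show "ev (P * Q0) = ev (P0 * Q)" using P(4) ev0 by (simp add: pe_mult)
  qed
  then have PQ0: "ph t P * ph t Q0 = ph t P0 * ph t Q" by (simp flip: ph_mult)
  have "(ph t P * q) * ph t Q0 = (ph t Q * p) * ph t Q0"
  proof -
    have "(ph t P * q) * ph t Q0 = q * (ph t P * ph t Q0)" by (simp add: mult_ac)
    also have "\<dots> = (q * ph t P0) * ph t Q" unfolding PQ0 by (simp add: mult_ac)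
    also have "\<dots> = (ph t Q * p) * ph t Q0" unfolding pq(2)[symmetric] by (simp add: mult_ac)
    finally show ?thesis .
  qed
  then have "ph t P * q = ph t Q * p" using \<open>ph t Q0 \<noteq> 0\<close> by simp
  from min_pair_generates[OF pq(1) this] obtain c where c: "ph t P = c * p" "ph t Q = c * q" by blast
  have cz: "c \<noteq> 0" using c(2) ph_eq_0[OF P(2), of t] P(3) by auto
  have me: "max (deg_in P t) (deg_in Q t) = e"
  proof (rule antisym)
    show "max (deg_in P t) (deg_in Q t) \<le> e" using P by simp
    have "degree q \<le> deg_in Q t" using degree_ph[of t Q] c(2) cz q0 by (simp add: degree_mult_eq)
    moreover have "degree p \<le> deg_in P t" using degree_ph[of t P] c(1) cz by (cases "p = 0") (simp_all add: degree_mult_eq)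
    ultimately show "e \<le> max (deg_in P t) (deg_in Q t)" unfolding e_def by linarith
  qed
  have e1: "1 \<le> e"
  proof (rule ccontr)
    assume "\<not> 1 \<le> e"
    then have "deg_in P t = 0" "deg_in Q t = 0" using P(5,6) by linarith+
    then have "pder t P = 0" "pder t Q = 0" by (simp_all add: deg_in_eq_0_iff pder_eq_0)
    then have "pd t (ev P) = 0" "pd t (ev Q) = 0" using pd_ev[OF P(1), of t] pd_ev[OF P(2), of t] by simp_all
    moreover have "pd t (v * ev Q) = pd t v * ev Q + v * pd t (ev Q)" by (rule pd_mult[OF v(1) FU_ev[OF P(2)]])
    ultimately have "pd t v * ev Q = 0" using P(4) by simp
    then show False using t evQ by simp
  qed
  have lew: "le w t" if "w \<in> derivs P \<union> derivs Q" for w using that P(7) tmax by blast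
  have gt': "\<forall>\<psi>. lt t \<psi> \<longrightarrow> pd \<psi> v = 0" and lew': "\<forall>w\<in>derivs P \<union> derivs Q. le w t"
    using gt lew by blast+
  show ?thesis by (rule that[OF t gt' e1 P(1,2) evQ P(4) lew' me pq(1) e_def[symmetric] c cz])
qed

text \<open>Differentiating a relation of minimal degree with respect to \<open>dmult e1 t\<close>, where \<open>e1\<close> is the
  largest exponent with which \<open>v\<close> is differentiated in it, leaves only \<open>v\<close> itself.\<close>

lemma generic_relation:
  fixes f :: "('m,('r,'n) xu,'k) dpoly"
  assumes v: "v \<in> FU" "pd t v \<noteq> 0" "\<And>\<psi>. lt t \<psi> \<Longrightarrow> pd \<psi> v = 0"
    and P: "P \<in> over F" "Q \<in> over F" "ev Q \<noteq> 0" "ev P = v * ev Q"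
    and pq: "min_pair p q" "max (degree p) (degree q) = e" "ph t P = c * p" "ph t Q = c * q" "c \<noteq> 0"
    and \<xi>: "\<And>e. \<xi> j0 e = theta \<delta> e v"
    and f: "f \<in> over F" "pe (gen \<xi> val) f = 0" "\<And>w. w \<in> derivs f \<Longrightarrow> isX w \<Longrightarrow> fst w = X j0"
      "\<And>w. toU w \<in> derivs f \<Longrightarrow> \<not> proper_derivative w t" "deg_in f (toU t) < e"
  shows "f = 0"
  using f
proof (induction "tdeg f" arbitrary: f rule: less_induct)
  case less
  note f = less.prems
  have thv: "theta \<delta> e' v \<in> FU" for e' using theta_closed[of \<delta> FU v e', OF dcomm FU_delta v(1)] .
  have genX: "w \<in> derivs f \<Longrightarrow> isX w \<Longrightarrow> gen \<xi> val w = theta \<delta> (snd w) v" for w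
    using f(3)[of w] by (simp add: gen_def \<xi>)
  have genFU: "gen \<xi> val w \<in> FU" if "w \<in> derivs f" for w
    using genX[OF that] thv val_FU by (cases w rule: toU_cases) auto
  show ?case
  proof (cases "\<exists>e1. e1 \<noteq> (\<lambda>_. 0) \<and> (X j0, e1) \<in> derivs f")
    case True
    define S where "S = (\<lambda>w. dmult (snd w) t) ` {w \<in> derivs f. isX w}"
    from True obtain e0 where "(X j0, e0) \<in> derivs f" by blast
    then have "dmult e0 t \<in> S" unfolding S_def by (intro image_eqI[of _ _ "(X j0, e0)"]) auto
    then have "finite S" "S \<noteq> {}" by (auto simp: S_def)
    from ex_max_ball[OF this] obtain s where s: "s \<in> S" and s': "\<forall>s'\<in>S. le s' s" by (elim bexE)
    from s obtain w1 where w1: "w1 \<in> derivs f" "isX w1" "s = dmult (snd w1) t" by (auto simp: S_def)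
    define e1 where "e1 = snd w1"
    have w1e: "w1 = (X j0, e1)" using f(3)[OF w1(1,2)] by (simp add: e1_def prod_eq_iff)
    have others: "lt (dmult (snd w) t) s" if "w \<in> derivs f" "isX w" "w \<noteq> w1" for w
    proof -
      have "fst w = X j0" by (rule f(3)[OF that(1,2)])
      then have "snd w \<noteq> e1" using that(3) w1e by (auto simp: prod_eq_iff)
      then have "dmult (snd w) t \<noteq> s" using w1(3) by (simp add: e1_def)
      moreover have "dmult (snd w) t \<in> S" using that by (auto simp: S_def)
      ultimately show ?thesis using bspec[OF s'] by blast
    qed
    have e1: "e1 \<noteq> (\<lambda>_. 0)"
    proof
      assume z: "e1 = (\<lambda>_. 0)"
      obtain e2 where e2: "e2 \<noteq> (\<lambda>_. 0)" "(X j0, e2) \<in> derivs f" using True by blast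
      then have "lt (dmult e2 t) s" using others[of "(X j0, e2)"] w1e z by auto
      moreover have "s = t" using w1(3) z by (simp add: e1_def[symmetric])
      ultimately show False using dmult_gt[OF e2(1), of t] trans[of t "dmult e2 t" t] by simp
    qed
    \<comment> \<open>s is a proper derivative of t, so it is not among the u-derivatives in f, and
      the other derivatives of v in f depend only on derivatives below s.\<close>
    have z: "pe (gen \<xi> val) (pder w f) * pd s (gen \<xi> val w) = 0" if "w \<in> derivs f" "w \<noteq> w1" for w
    proof (cases w rule: toU_cases)
      case (1 j e')
      then have X: "isX w" by simp
      have "pd s (theta \<delta> (snd w) v) = 0" by (rule leading_pd(1)[OF v(1,3) others[OF that(1) X that(2)]])
      then show ?thesis using genX[OF that(1) X] by simp
    next
      case (2 w')
      have "\<not> proper_derivative w' t" using f(4) that(1) 2 by blast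
      then have "w' \<noteq> s" using e1 w1(3) unfolding proper_derivative_iff e1_def by blast
      then show ?thesis using 2 by (simp add: pd_val)
    qed
    have "pd s (pe (gen \<xi> val) f) = (\<Sum>w\<in>derivs f. pe (gen \<xi> val) (pder w f) * pd s (gen \<xi> val w))"
      by (rule pd_peval[OF f(1) genFU])
    also have "\<dots> = pe (gen \<xi> val) (pder w1 f) * pd s (gen \<xi> val w1)"
      by (subst sum.remove[OF derivs_finite w1(1)]) (use z in \<open>simp add: sum.neutral\<close>)
    also have "pd s (gen \<xi> val w1) = pd t v"
      unfolding genX[OF w1(1,2)] w1(3) by (rule leading_pd(2)[OF v(1,3)])
    finally have pz: "pe (gen \<xi> val) (pder w1 f) = 0" using f(2) v(2) by (simp add: pd_0)
    have ne: "pder w1 f \<noteq> 0" by (rule pder_neq_0[OF c0 w1(1)])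
    have "pder w1 f = 0"
    proof (rule less.hyps[OF tdeg_pder[OF ne] over_pder[OF FR f(1)] pz])
      show "deg_in (pder w1 f) (toU t) < e" using deg_in_pder[of w1 f "toU t"] f(5) by linarith
    qed (use f(3,4) derivs_pder[of w1 f] in blast)+
    then show ?thesis using ne by blast
  next
    case False
    \<comment> \<open>Only v itself occurs, so f is a polynomial in z whose coefficients
      \<open>g j\<close> involve u alone. Clearing the denominator of v gives h over F, which
      vanishes at u and is therefore 0; \<open>min_pair_independent\<close> applies to its image
      under \<open>ph t\<close>.\<close>
    define z :: "('m,('r,'n) xu) deriv" where "z = (X j0, \<lambda>_. 0)"
    have Xz: "w = z" if "w \<in> derivs f" "isX w" for w
      using f(3)[OF that] False that(1) by (metis prod.collapse z_def)
    define J where "J = deg_in f z"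
    define g where "g j = unemb (coef_in z j f)" for j
    have noX: "\<not> isX w" if "w \<in> derivs (coef_in z j f)" for w j
      using that derivs_coef_in[of z j f] Xz by blast
    have eg: "emb (g j) = coef_in z j f" for j unfolding g_def by (rule emb_unemb[OF noX])
    have go: "g j \<in> over F" for j unfolding g_def by (intro over_unemb over_coef_in FR f(1))
    have gd: "deg_in (g j) t < e" for j
      using deg_in_unemb[of "coef_in z j f" t] deg_in_coef_in[of z j f "toU t"] f(5) by (simp add: g_def)
    have evg: "pe (gen \<xi> val) (coef_in z j f) = ev (g j)" for j
      unfolding eg[symmetric] by (subst peval_emb[OF FR rhom_on_id go]) simp
    have "pe (gen \<xi> val) f = pe (gen \<xi> val) (\<Sum>j\<le>J. coef_in z j f * dv z ^ j)"
      using coef_in_expand[of f z J] by (simp add: J_def)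
    also have "\<dots> = (\<Sum>j\<le>J. ev (g j) * v ^ j)"
      by (simp add: pe_simps evg) (simp add: z_def \<xi>)
    finally have s0: "(\<Sum>j\<le>J. ev (g j) * v ^ j) = 0" using f(2) by simp
    define h where "h = (\<Sum>j\<le>J. g j * P ^ j * Q ^ (J - j))"
    have "h \<in> over F" unfolding h_def using go P by (intro overI FR) auto
    moreover have "ev h = 0"
    proof -
      have "ev h = (\<Sum>j\<le>J. ev Q ^ J * (ev (g j) * v ^ j))" unfolding h_def pe_simps
      proof (intro sum.cong refl)
        fix j assume "j \<in> {..J}"
        then have "ev Q ^ J = ev Q ^ j * ev Q ^ (J - j)" by (simp flip: power_add)
        then show "ev (g j) * ev P ^ j * ev Q ^ (J - j) = ev Q ^ J * (ev (g j) * v ^ j)"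
          using P(4) by (simp add: power_mult_distrib)
      qed
      then show ?thesis using s0 by (simp flip: sum_distrib_left)
    qed
    ultimately have "h = 0" by (rule ev_eq_0)
    then have "ph t h = 0" by simp
    then have "(\<Sum>j\<le>J. ph t (g j) * (c * p) ^ j * (c * q) ^ (J - j)) = 0"
      by (simp add: h_def ph_sum ph_mult ph_power pq(3,4))
    moreover have "(\<Sum>j\<le>J. ph t (g j) * (c * p) ^ j * (c * q) ^ (J - j)) = c ^ J * (\<Sum>j\<le>J. ph t (g j) * p ^ j * q ^ (J - j))"
      unfolding sum_distrib_left
    proof (intro sum.cong refl)
      fix j assume "j \<in> {..J}"
      then have "c ^ J = c ^ j * c ^ (J - j)" by (simp flip: power_add)
      then show "ph t (g j) * (c * p) ^ j * (c * q) ^ (J - j) = c ^ J * (ph t (g j) * p ^ j * q ^ (J - j))"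
        by (simp add: power_mult_distrib)
    qed
    ultimately have sp: "(\<Sum>j\<le>J. ph t (g j) * p ^ j * q ^ (J - j)) = 0" using pq(5) by simp
    have "coef_in z j f = 0" if "j \<le> J" for j
    proof -
      have "ph t (g j) = 0"
      proof (rule min_pair_independent[OF pq(1) _ sp that])
        show "degree (ph t (g j)) < max (degree p) (degree q)" for j
          unfolding pq(2) using degree_ph[of t "g j"] gd[of j] by linarith
      qed
      then have "g j = 0" by (rule ph_eq_0[OF go])
      then show ?thesis using eg[of j] by (simp add: emb_def)
    qed
    then have "(\<Sum>j\<le>J. coef_in z j f * dv z ^ j) = 0" by simp
    then show ?thesis using coef_in_expand[of f z J] by (simp add: J_def)
  qed
qed

lemma Fhom: "delta_ring \<delta>" "delta_ring \<delta>" "subring F" "rhom_on F (\<lambda>x. x)" "\<And>c i. c \<in> F \<Longrightarrow> \<delta> i c \<in> F \<and> \<delta> i c = \<delta> i c"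
  using dr FR F_delta by auto

lemma FG_subset_fracs:
  fixes x :: "'r \<Rightarrow> 'k"
  shows "FG (range x) \<subseteq> fracs (xring (\<lambda>x. x) F (\<lambda>j e. theta \<delta> e (x j)) UNIV)"
proof (rule FG_least)
  let ?S = "xring (\<lambda>x. x) F (\<lambda>j e. theta \<delta> e (x j)) UNIV"
  have S: "subring ?S" by (rule subring_xring[OF FR rhom_on_id])
  show "delta_subfield \<delta> (fracs ?S)"
    by (rule delta_subfield_fracs[OF S dr]) (rule xring_delta[OF Fhom])
  have sub: "?S \<subseteq> fracs ?S"
  proof
    fix a assume "a \<in> ?S"
    then show "a \<in> fracs ?S" unfolding fracs_def using subringD(2)[OF S] by (intro CollectI exI[of _ a] exI[of _ "1::'k"]) simp
  qed
  have "c \<in> ?S" if "c \<in> F" for c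
    unfolding xring_def using that
    by (intro CollectI exI[of _ "dconst c :: ('m,('r,unit) xu,'k) dpoly"]) (simp add: pe_dconst over_dconst FR)
  then show "F \<subseteq> fracs ?S" using sub by blast
  have "x j \<in> ?S" for j
    unfolding xring_def
    by (intro CollectI exI[of _ "dv (X j, \<lambda>_. 0) :: ('m,('r,unit) xu,'k) dpoly"]) (simp add: pe_dv over_dv FR)
  then show "range x \<subseteq> fracs ?S" using sub by blast
qed

text \<open>Cleared of denominators, a relation over F<v> is a relation over F between derivatives
  of v and of u, and \<open>generic_relation\<close> applies with a single variable standing for
  v.\<close>

lemma simple_extension:
  assumes v: "v \<in> FU" "v \<notin> F"
  shows "\<exists>t e. Red (FG {v}) t e \<and> Alg (FG {v}) t e"
proof -
  obtain t e P Q p q c where t: "pd t v \<noteq> 0" "\<forall>\<psi>. lt t \<psi> \<longrightarrow> pd \<psi> v = 0" "1 \<le> e"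
    and P: "P \<in> over F" "Q \<in> over F" "ev Q \<noteq> 0" "ev P = v * ev Q"
    and le: "\<forall>w\<in>derivs P \<union> derivs Q. le w t" and me: "max (deg_in P t) (deg_in Q t) = e" 
    and pq: "min_pair p q" "max (degree p) (degree q) = e" "ph t P = c * p" "ph t Q = c * q" "c \<noteq> 0" by (rule fraction_leader[OF v])
  have alg: "Alg (FG {v}) t e"
    using fraction_poly_Alg[OF subfield_subring[OF delta_subfield_subfield[OF FG_delta_subfield(1)]] FG_delta_subfield(2) _ P(1,2) v(2) P(4) bspec[OF le] me t(3)]
      FG_delta_subfield(3)[of "{v}"] by blast
  define \<xi> :: "unit \<Rightarrow> ('m \<Rightarrow> nat) \<Rightarrow> 'k" where "\<xi> = (\<lambda>j e. theta \<delta> e v)"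
  let ?S = "xring (\<lambda>x. x) F \<xi> UNIV"
  have S: "subring ?S" by (rule subring_xring[OF FR rhom_on_id])
  have FGS: "FG {v} \<subseteq> fracs ?S" using FG_subset_fracs[of "\<lambda>_::unit. v"] by (simp add: \<xi>_def)
  have "Red (FG {v}) t e"
    unfolding Red_def
  proof (intro ballI impI)
    fix f assume f: "f \<in> over (FG {v})" "ev f = 0" "\<forall>w\<in>derivs f. \<not> proper_derivative w t" "deg_in f t < e"
    have "finite (lk f ` ks f)" "lk f ` ks f \<subseteq> fracs ?S" using f(1) FGS by (auto simp: over_def)
    from fracs_common_denominator[OF S this] obtain b where b: "b \<noteq> 0" "\<And>m. m \<in> ks f \<Longrightarrow> b * lk f m \<in> ?S" by blast
    have "\<exists>p :: ('m,(unit,'n) xu,'k) dpoly. p \<in> over F \<and> derivs p \<subseteq> {w. \<exists>j\<in>UNIV. fst w = X j} \<and> b * lk f m = pe (gen \<xi> val) p" if "m \<in> ks f" for m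
      by (rule xring_lift[OF FR rhom_on_id b(2)[OF that]])
    then have "\<forall>m\<in>ks f. \<exists>p :: ('m,(unit,'n) xu,'k) dpoly. p \<in> over F \<and> derivs p \<subseteq> {w. \<exists>j\<in>UNIV. fst w = X j} \<and> b * lk f m = pe (gen \<xi> val) p" by blast
    from bchoice[OF this] obtain a :: "_ \<Rightarrow> ('m,(unit,'n) xu,'k) dpoly" where a': "\<forall>m\<in>ks f. a m \<in> over F \<and> derivs (a m) \<subseteq> {w. \<exists>j\<in>UNIV. fst w = X j} \<and> b * lk f m = pe (gen \<xi> val) (a m)"
      by (elim exE)
    note a = bspec[OF a']
    have aX: "isX w" if "m \<in> ks f" "w \<in> derivs (a m)" for m w using a[OF that(1)] that(2) by (auto simp: isX_def)
    have ps: "psub (\<lambda>x. x) \<xi> (lift a f) = dconst b * f"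
      by (rule lift_psub[where \<nu> = val]) (use aX a in auto)
    have "lift a f = 0"
    proof (rule generic_relation[OF v(1) t(1) t(2)[rule_format] P pq, of \<xi> "()"])
      show "lift a f \<in> over F" unfolding lift_def using a
        by (intro overI FR over_emb over_single) (auto simp: FR subringD)
      have "pe (gen \<xi> val) (lift a f) = ev (psub (\<lambda>x. x) \<xi> (lift a f))" by (rule peval_psub[symmetric]) simp
      then show "pe (gen \<xi> val) (lift a f) = 0" unfolding ps by (simp add: pe_simps f(2))
      show "deg_in (lift a f) (toU t) < e"
        using deg_in_lift_U[where f = f and a = a and w = t] aX f(4) by fastforce
      show "\<not> proper_derivative w t" if "toU w \<in> derivs (lift a f)" for w
      proof -
        have "deg_in (lift a f) (toU w) \<noteq> 0" using that by (simp add: deg_in_eq_0_iff)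
        then have "deg_in f w \<noteq> 0" using deg_in_lift_U[where f = f and a = a and w = w] aX by fastforce
        then show ?thesis using f(3) by (simp add: deg_in_eq_0_iff)
      qed
      show "fst w = X ()" if "isX w" for w :: "('m,(unit,'n) xu) deriv" using that by (auto simp: isX_def)
    qed (simp_all add: \<xi>_def)
    then have "dconst b * f = 0" using ps by (simp add: psub_def)
    then show "f = 0" using dpoly_no_zero_divisors[OF c0, of "dconst b" f] b(1) by simp
  qed
  with alg show ?thesis by blast
qed

end

subsection \<open>Descent of the coefficients of the minimal polynomial\<close>

text \<open>Here \<open>cder \<pi>\<close> merely applies \<pi> to each coefficient, and \<pi> is a
  G-linear functional rather than a derivation.\<close>

lemma cder_linear:
  fixes p q :: "('m,'v,'a::comm_ring_1) dpoly"
  assumes "\<pi> 0 = 0" "\<And>x y. \<pi> (x + y) = \<pi> x + \<pi> y" "\<And>g x. g \<in> G \<Longrightarrow> \<pi> (g * x) = g * \<pi> x" "q \<in> over G"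
  shows "cder \<pi> (p * q) = cder \<pi> p * q"
proof -
  have sum: "cder \<pi> (sum f I) = (\<Sum>i\<in>I. cder \<pi> (f i))" for f :: "_ \<Rightarrow> ('m,'v,'a) dpoly" and I :: "(('m,'v) deriv \<Rightarrow>\<^sub>0 nat) set"
  proof -
    have "cder \<pi> (x + y) = cder \<pi> x + cder \<pi> y" for x y :: "('m,'v,'a) dpoly"
      by (rule poly_mapping_eqI) (simp add: lookup_cder[of \<pi>, OF assms(1)] lookup_add assms(2))
    moreover have "cder \<pi> (0 :: ('m,'v,'a) dpoly) = 0"
      by (rule poly_mapping_eqI) (simp add: lookup_cder[of \<pi>, OF assms(1)] assms(1))
    ultimately show ?thesis by (induction I rule: infinite_finite_induct) simp_all
  qed
  have single: "cder \<pi> (sg t c) = sg t (\<pi> c)" for t c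
    by (rule poly_mapping_eqI) (simp add: lookup_cder[of \<pi>, OF assms(1)] lookup_single when_def assms(1))
  have "p * q = (\<Sum>s\<in>ks p. \<Sum>t\<in>ks q. sg (s + t) (lk p s * lk q t))"
    by (subst (1) sum_single[of p], subst (1) sum_single[of q]) (simp add: sum_product single_mult)
  then have "cder \<pi> (p * q) = (\<Sum>s\<in>ks p. \<Sum>t\<in>ks q. sg (s + t) (\<pi> (lk p s * lk q t)))" by (simp add: sum single)
  also have "\<dots> = (\<Sum>s\<in>ks p. \<Sum>t\<in>ks q. cder \<pi> (sg s (lk p s)) * sg t (lk q t))"
    using assms(3)[OF overD[OF assms(4)]] by (simp add: single single_mult mult.commute[of _ "lk q _"])
  also have "\<dots> = cder \<pi> (\<Sum>s\<in>ks p. sg s (lk p s)) * (\<Sum>t\<in>ks q. sg t (lk q t))"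
    unfolding sum by (simp add: sum_product)
  also have "\<dots> = cder \<pi> p * q" by (simp only: sum_single[symmetric])
  finally show ?thesis .
qed

lemma coef_in_eq_0: "deg_in p w < k \<Longrightarrow> coef_in w k p = 0"
proof (rule poly_mapping_eqI)
  fix t assume "deg_in p w < k"
  then have "t + sg w k \<notin> ks p" using lookup_le_deg_in[of "t + sg w k" p w] by (auto simp: lookup_add)
  then show "lk (coef_in w k p) t = lk 0 t" by (simp add: lookup_coef_in in_keys_iff)
qed

lemma coeff_peval_poly:
  fixes p :: "('m,'v,'a::comm_ring_1) dpoly" and \<phi> :: "'a \<Rightarrow> 'b::comm_ring_1"
  assumes R: "subring R" and \<phi>: "rhom_on R \<phi>" and p: "p \<in> over R"
  shows "coeff (peval (\<lambda>x. [:\<phi> x:]) (\<lambda>w. if w = t then [:0, 1:] else [:\<rho> w:]) p) k = peval \<phi> \<rho> (coef_in t k p)"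
proof -
  let ?P = "peval (\<lambda>x. [:\<phi> x:]) (\<lambda>w. if w = t then [:0, 1:] else [:\<rho> w:]) :: ('m,'v,'a) dpoly \<Rightarrow> _"
  have h: "rhom_on R (\<lambda>x. [:\<phi> x:])" using \<phi> by (simp add: rhom_on_def one_pCons)
  have const: "?P q = [:peval \<phi> \<rho> q:]" if "q \<in> over R" "t \<notin> derivs q" for q
  proof -
    have "derivs q \<subseteq> - {t}" using that by auto
    with that(1) have "q \<in> over R \<and> ?P q = [:peval \<phi> \<rho> q:]"
    proof (induction rule: dpoly_induct)
      case (const c)
      then show ?case by (simp add: over_dconst R peval_dconst[OF R h] peval_dconst[OF R \<phi>])
    next
      case (var w)
      then show ?case by (simp add: over_dv R peval_dv[OF R h] peval_dv[OF R \<phi>])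
    next
      case (add p q)
      then show ?case by (simp add: overI R peval_add[OF R h] peval_add[OF R \<phi>])
    next
      case (mult p q)
      then show ?case by (simp add: overI R peval_mult[OF R h] peval_mult[OF R \<phi>])
    qed (rule R)
    then show ?thesis by blast
  qed
  have co: "coef_in t j p \<in> over R" for j by (rule over_coef_in[OF R p])
  have ct: "t \<notin> derivs (coef_in t j p)" for j using derivs_coef_in by blast
  define n where "n = deg_in p t"
  have "?P p = ?P (\<Sum>j\<le>n. coef_in t j p * dv t ^ j)" using coef_in_expand[of p t n] by (simp add: n_def)
  also have "\<dots> = (\<Sum>j\<le>n. ?P (coef_in t j p * dv t ^ j))"
    by (rule peval_sum[OF R h]) (auto intro!: overI R co)
  also have "\<dots> = (\<Sum>j\<le>n. monom (peval \<phi> \<rho> (coef_in t j p)) j)"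
  proof (rule sum.cong[OF refl])
    fix j
    have "?P (coef_in t j p * dv t ^ j) = ?P (coef_in t j p) * ?P (dv t) ^ j"
      by (simp only: peval_mult[OF R h co overI(8)[OF R over_dv[OF R]]] peval_power[OF R h over_dv[OF R]])
    also have "\<dots> = [:peval \<phi> \<rho> (coef_in t j p):] * [:0, 1:] ^ j"
      by (simp add: const[OF co ct] peval_dv[OF R h])
    finally show "?P (coef_in t j p * dv t ^ j) = monom (peval \<phi> \<rho> (coef_in t j p)) j" by (simp add: monom_altdef)
  qed
  finally have "coeff (?P p) k = (if k \<le> n then peval \<phi> \<rho> (coef_in t k p) else 0)"
    by (simp add: coeff_sum sum.delta)
  then show ?thesis using coef_in_eq_0[of p t k] by (auto simp: n_def)
qed

lemma rhom_pe:
  assumes R: "subring R" and \<phi>: "rhom_on R \<phi>" and p: "p \<in> over R" and \<rho>: "\<And>w. \<rho> w \<in> R"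
  shows "\<phi> (pe \<rho> p) = peval \<phi> (\<lambda>w. \<phi> (\<rho> w)) p"
proof -
  have "p \<in> over R \<and> pe \<rho> p \<in> R \<and> \<phi> (pe \<rho> p) = peval \<phi> (\<lambda>w. \<phi> (\<rho> w)) p"
    using p subset_UNIV
  proof (induction rule: dpoly_induct)
    case (const c)
    then show ?case by (simp add: over_dconst R pe_dconst peval_dconst[OF R \<phi>])
  next
    case (var w)
    then show ?case by (simp add: over_dv R pe_dv peval_dv[OF R \<phi>] \<rho>)
  next
    case (add p q)
    then show ?case by (simp add: overI R pe_add peval_add[OF R \<phi>] subringD[OF R] rhom_onD[OF \<phi>])
  next
    case (mult p q)
    then show ?case by (simp add: overI R pe_mult peval_mult[OF R \<phi>] subringD[OF R] rhom_onD[OF \<phi>])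
  qed (rule R)
  then show ?thesis by blast
qed

section \<open>Coefficients of an annihilating polynomial of minimal support\<close>

context dext
begin

context
  fixes G :: "'k set" and t :: "('m,'n) deriv" and e :: nat and A :: "('m,'n,'k) dpoly" and m0 :: "('m,'n) deriv \<Rightarrow>\<^sub>0 nat"
  assumes G: "delta_subfield \<delta> G" "F \<subseteq> G" "G \<subseteq> FU" and red: "Red G t e" and e1: "1 \<le> e"
    and A: "A \<in> over G" "ev A = 0" "\<And>w. w \<in> derivs A \<Longrightarrow> le w t" "deg_in A t = e" "lk A m0 = 1"
    and minsupp: "\<And>f. f \<in> over G \<Longrightarrow> ev f = 0 \<Longrightarrow> ks f \<subseteq> ks A - {m0} \<Longrightarrow> f = 0"
begin

lemma Gf: "subfield G" and GR: "subring G" and Gd: "\<And>i c. c \<in> G \<Longrightarrow> \<delta> i c \<in> G"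
  using G(1) delta_subfield_subfield subfield_subring by (auto simp: delta_subfield_iff)

lemma A_FU: "A \<in> over FU" using over_mono[OF A(1) G(3)] .
lemma lkA_FU: "lk A m \<in> FU" using overD[OF A_FU] .

lemmas isep = Red_initial_separant[OF red GR A(1,3,4) e1]

text \<open>Differentiating the coefficients kills the 1 at m0, so \<open>cder (pd w) A\<close> has
  smaller support, but its coefficients have left G. A G-linear functional brings them back without
  killing the one at m1, and a value 0 at u would contradict the minimality of the support.\<close>

lemma coefficient_functional:
  assumes \<kappa>: "pd w (lk A m1) \<noteq> 0"
  obtains \<pi> where "\<pi> 0 = 0" "\<forall>x y. \<pi> (x + y) = \<pi> x + \<pi> y" "\<forall>g\<in>G. \<forall>x. \<pi> (g * x) = g * \<pi> x" "ev (cder \<pi> (cder (pd w) A)) \<noteq> 0"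
proof -
  obtain \<pi> where \<pi>: "\<pi> (pd w (lk A m1)) = 1 \<and> (\<forall>x. \<pi> x \<in> G) \<and> (\<forall>x y. \<pi> (x + y) = \<pi> x + \<pi> y) \<and> (\<forall>g\<in>G. \<forall>x. \<pi> (g * x) = g * \<pi> x)"
    using subfield_functional[OF Gf \<kappa>] by (elim exE)
  have \<pi>0: "\<pi> 0 = 0" using \<pi> subringD(1)[OF GR] by (metis mult_zero_left)
  let ?f = "cder \<pi> (cder (pd w) A)"
  have lkf: "lk ?f m = \<pi> (pd w (lk A m))" for m by (simp add: lookup_cder \<pi>0 pd_0)
  have "ev ?f \<noteq> 0"
  proof
    assume z: "ev ?f = 0"
    have "?f \<in> over G" using \<pi> by (simp add: over_def lkf)
    moreover have "ks ?f \<subseteq> ks A - {m0}"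
    proof
      fix m assume "m \<in> ks ?f"
      then have n: "\<pi> (pd w (lk A m)) \<noteq> 0" by (simp add: in_keys_iff lkf)
      have "lk A m \<noteq> 0" using n by (auto simp: pd_0 \<pi>0)
      moreover have "m \<noteq> m0" using n A(5) by (auto simp: pd_1 \<pi>0)
      ultimately show "m \<in> ks A - {m0}" by (simp add: in_keys_iff)
    qed
    ultimately have "?f = 0" using minsupp z by blast
    then have "lk ?f m1 = 0" by simp
    then show False using \<pi> by (simp add: lkf)
  qed
  then show ?thesis using that[of \<pi>] \<pi> \<pi>0 by blast
qed

lemma dmult_comm: "dmult a (dmult b w) = dmult b (dmult a w)"
  by (auto simp: dmult_def)

lemma pd_of_nat_mult: "c \<in> FU \<Longrightarrow> pd w (of_nat n * c) = of_nat n * pd w c"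
proof -
  assume c: "c \<in> FU"
  have n: "(of_nat n :: 'k) \<in> F" by (rule subring_of_nat[OF FR])
  then have "(of_nat n :: 'k) \<in> FU" using F_FU by blast
  from pd_mult[OF this c] show ?thesis using pd_F[OF n] by simp
qed

text \<open>Otherwise let \<tau> be the greatest derivative beyond t in a coefficient, and a = P / Q
  a coefficient involving it. A multiple of P - a Q is a combination of derivatives \<theta> A with
  \<theta> t \<le> \<tau>, and since it involves \<tau>, some \<theta> t equals \<tau>. The partial
  derivative of all coefficients with respect to \<theta> \<tau> kills the left side and, among the
  derivatives of A, all but \<theta> A; the terms where it hits the cofactors still vanish at u.
  What remains is the partial derivative of A with respect to \<tau>, which
  \<open>coefficient_functional\<close> shows to be nonzero there.\<close>

lemma coefficient_leader: assumes "lt t \<phi>" shows "pd \<phi> (lk A m) = 0"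
proof (rule ccontr)
  assume "pd \<phi> (lk A m) \<noteq> 0"
  define B where "B = {\<phi>. lt t \<phi> \<and> (\<exists>m\<in>ks A. pd \<phi> (lk A m) \<noteq> 0)}"
  have "m \<in> ks A" using \<open>pd \<phi> (lk A m) \<noteq> 0\<close> by (auto simp: in_keys_iff pd_0)
  then have "\<phi> \<in> B" using assms \<open>pd \<phi> (lk A m) \<noteq> 0\<close> by (auto simp: B_def)
  moreover have "finite B"
  proof (rule finite_subset)
    show "B \<subseteq> (\<Union>m\<in>ks A. {w. pd w (lk A m) \<noteq> 0})" by (auto simp: B_def)
    show "finite (\<Union>m\<in>ks A. {w. pd w (lk A m) \<noteq> 0})" using finite_pd[OF lkA_FU] by auto
  qed
  ultimately have "\<exists>w\<in>B. \<forall>v\<in>B. le v w" by (intro ex_max_ball) auto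
  then obtain \<tau> where \<tau>B: "\<tau> \<in> B" and \<tau>max: "\<forall>v\<in>B. le v \<tau>" by (elim bexE)
  have t\<tau>: "lt t \<tau>" using \<tau>B by (simp add: B_def)
  have big: "pd \<psi> (lk A m) = 0" if "lt \<tau> \<psi>" for \<psi> m
  proof (rule ccontr)
    assume n: "pd \<psi> (lk A m) \<noteq> 0"
    then have "m \<in> ks A" by (auto simp: in_keys_iff pd_0)
    then have "\<psi> \<in> B" using n trans[OF t\<tau> that] by (auto simp: B_def)
    then have "le \<psi> \<tau>" using \<tau>max by blast
    then show False using that trans[of \<tau> \<psi> \<tau>] by auto
  qed
  have cA: "cder (pd \<psi>) A = 0" if "lt \<tau> \<psi>" for \<psi>
    by (rule poly_mapping_eqI) (simp add: lookup_cder pd_0 big[OF that])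
  obtain i0 where i0: "i0 \<in> ks A" "pd \<tau> (lk A i0) \<noteq> 0" using \<tau>B by (auto simp: B_def)
  define a where "a = lk A i0"
  have aG: "a \<in> G" "a \<in> FU" using A(1) lkA_FU by (auto simp: a_def dest: overD)
  obtain P Q where P: "P \<in> over F" "Q \<in> over F" "Q \<noteq> 0" "ev P = a * ev Q" "derivs P \<union> derivs Q \<subseteq> {w. pd w a \<noteq> 0}"
    by (rule minimal_fraction'[OF aG(2)])
  have PQle: "le w \<tau>" if "w \<in> derivs P \<union> derivs Q" for w
  proof -
    have n: "pd w a \<noteq> 0" using that P(5) by blast
    show ?thesis
    proof (rule ccontr)
      assume "\<not> le w \<tau>"
      then have "lt \<tau> w" using total by blast
      then show False using big[of w i0] n by (simp add: a_def)
    qed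
  qed
  \<comment> \<open>Vanishes at u and involves \<tau> genuinely: its partial derivative with respect
    to \<tau> does not vanish at u.\<close>
  define Bp where "Bp = P - dconst a * Q"
  have BpG: "Bp \<in> over G" unfolding Bp_def using over_mono[OF P(1) G(2)] over_mono[OF P(2) G(2)] aG by (intro overI GR)
  have evB: "ev Bp = 0" using P(4) by (simp add: Bp_def pe_simps)
  have "derivs Bp \<subseteq> derivs P \<union> derivs Q"
    using derivs_diff[of P "dconst a * Q"] derivs_mult[of "dconst a" Q] unfolding Bp_def by auto
  then have Bple: "le w \<tau>" if "w \<in> derivs Bp" for w using that PQle by blast
  have evQ: "ev Q \<noteq> 0" using ev_eq_0 P by blast
  have pB: "ev (pder \<tau> Bp) \<noteq> 0"
  proof -
    have "pd \<tau> (ev P) = pd \<tau> a * ev Q + a * pd \<tau> (ev Q)"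
      using pd_mult[OF aG(2) FU_ev[OF P(2)], folded P(4)] .
    then have "ev (pder \<tau> P) = pd \<tau> a * ev Q + a * ev (pder \<tau> Q)" unfolding pd_ev[OF P(1)] pd_ev[OF P(2)] .
    then have "ev (pder \<tau> Bp) = pd \<tau> a * ev Q" by (simp add: Bp_def pder_diff pder_mult pe_simps)
    then show ?thesis using i0(2) evQ by (simp add: a_def)
  qed
  define gA where "gA e' = theta dd e' A" for e'
  have gAG: "gA e' \<in> over G" for e' unfolding gA_def by (rule over_theta[OF GR Gd A(1)])
  have evg: "ev (gA e') = 0" for e' unfolding gA_def ev_theta A(2) by (rule theta_zero[OF dr])
  define \<Theta> where "\<Theta> = {e'. le (dmult e' t) \<tau>}"
  define I where "I = {x. \<exists>T h. finite T \<and> T \<subseteq> \<Theta> \<and> (\<forall>e'. h e' \<in> over G) \<and> x = (\<Sum>e'\<in>T. h e' * gA e')}"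
  define M where "M = {b \<in> over G. ev b \<noteq> 0 \<and> (\<forall>\<psi>. lt \<tau> \<psi> \<longrightarrow> cder (pd \<psi>) b = 0)}"
  define bd where "bd w = (if w = t then Some e else if proper_derivative w t \<and> le w \<tau> then Some 1 else None)" for w
  have gI: "gA e' \<in> I" if "e' \<in> \<Theta>" for e'
    unfolding I_def by (rule CollectI, rule exI[of _ "{e'}"], rule exI[of _ "\<lambda>_. 1"]) (use that GR in auto)
  have I0: "0 \<in> I" unfolding I_def by (rule CollectI, rule exI[of _ "{}"], rule exI[of _ "\<lambda>_. 1"]) (use GR in auto)
  have Iadd: "x + y \<in> I" if "x \<in> I" "y \<in> I" for x y
  proof -
    from that(1) obtain T h where T: "finite T" "T \<subseteq> \<Theta>" "\<forall>e'. h e' \<in> over G" "x = (\<Sum>e'\<in>T. h e' * gA e')" unfolding I_def by blast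
    from that(2) obtain T' h' where T': "finite T'" "T' \<subseteq> \<Theta>" "\<forall>e'. h' e' \<in> over G" "y = (\<Sum>e'\<in>T'. h' e' * gA e')" unfolding I_def by blast
    let ?h = "\<lambda>e'. (if e' \<in> T then h e' else 0) + (if e' \<in> T' then h' e' else 0)"
    have "(\<Sum>e'\<in>T \<union> T'. ?h e' * gA e') = (\<Sum>e'\<in>T \<union> T'. if e' \<in> T then h e' * gA e' else 0) + (\<Sum>e'\<in>T \<union> T'. if e' \<in> T' then h' e' * gA e' else 0)"
      unfolding sum.distrib[symmetric] by (intro sum.cong refl) (simp add: distrib_right)
    also have "\<dots> = x + y" using T(1) T'(1) unfolding T(4) T'(4)
      by (subst (1 2) sum.inter_restrict[symmetric]) (auto simp: Int_absorb1 Int_commute)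
    finally have 1: "x + y = (\<Sum>e'\<in>T \<union> T'. ?h e' * gA e')" by (rule sym)
    have 2: "\<forall>e'. ?h e' \<in> over G" using T(3) T'(3) GR by (auto intro!: overI)
    have 3: "finite (T \<union> T')" "T \<union> T' \<subseteq> \<Theta>" using T T' by auto
    show ?thesis unfolding I_def
      by (rule CollectI, rule exI[of _ "T \<union> T'"], rule exI[of _ ?h], intro conjI 1 2 3)
  qed
  have Imult: "c * x \<in> I" if "c \<in> over G" "x \<in> I" for c x
  proof -
    from that(2) obtain T h where T: "finite T" "T \<subseteq> \<Theta>" "\<forall>e'. h e' \<in> over G" "x = (\<Sum>e'\<in>T. h e' * gA e')" unfolding I_def by blast
    have "c * x = (\<Sum>e'\<in>T. (c * h e') * gA e')" unfolding T(4) by (simp add: sum_distrib_left mult.assoc)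
    moreover have "\<forall>e'. c * h e' \<in> over G" using T(3) that(1) overI(5)[OF GR] by blast
    ultimately show ?thesis unfolding I_def using T(1,2)
      by (intro CollectI exI[of _ T] exI[of _ "\<lambda>e'. c * h e'"]) blast
  qed
  have GFU: "p \<in> over G \<Longrightarrow> p \<in> over FU" for p :: "('m,'n,'k) dpoly" using over_mono[OF _ G(3)] .
  have cder1: "cder (pd \<psi>) 1 = 0" for \<psi>
    by (rule poly_mapping_eqI) (simp add: lookup_cder pd_0 lookup_one when_def pd_1)
  have M1: "1 \<in> M" unfolding M_def by (rule CollectI, intro conjI allI impI cder1) (simp_all add: pe_1 GR)
  have Mm: "x * y \<in> M" if "x \<in> M" "y \<in> M" for x y
  proof -
    have xy: "x \<in> over G" "y \<in> over G" "ev x \<noteq> 0" "ev y \<noteq> 0" using that by (auto simp: M_def)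
    have "cder (pd \<psi>) (x * y) = 0" if l: "lt \<tau> \<psi>" for \<psi>
    proof -
      have "cder (pd \<psi>) x = 0" "cder (pd \<psi>) y = 0" using \<open>x \<in> M\<close> \<open>y \<in> M\<close> l unfolding M_def by blast+
      then show ?thesis using deriv_onD(2)[OF cder_deriv GFU[OF xy(1)] GFU[OF xy(2)], of \<psi>] by simp
    qed
    then show ?thesis unfolding M_def using xy overI(5)[OF GR xy(1,2)] by (simp add: pe_mult)
  qed
  have MG: "M \<subseteq> over G" by (auto simp: M_def)
  have rel: "\<exists>s\<in>M. \<exists>r\<in>over G. (\<forall>v\<in>derivs s. lt v w) \<and> (\<forall>v\<in>derivs r. le v w) \<and> deg_in r w < k \<and> s * dv w ^ k - r \<in> I"
    if bw: "bd w = Some k" for w k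
  proof (cases "w = t")
    case True
    then have k: "k = e" using bw by (simp add: bd_def)
    note L = leader_relation[OF A(3) isep(3), unfolded A(4)]
    let ?s = "coef_in t e A" and ?r = "coef_in t e A * dv t ^ e - A"
    have s: "?s \<in> over G" by (rule over_coef_in[OF GR A(1)])
    have "cder (pd \<psi>) ?s = 0" if "lt \<tau> \<psi>" for \<psi>
      by (rule poly_mapping_eqI) (simp add: lookup_cder pd_0 lookup_coef_in big[OF that])
    then have "?s \<in> M" using s isep(1) by (simp add: M_def)
    moreover have "?r \<in> over G" using s A(1) by (intro overI GR)
    moreover have "gA (\<lambda>_. 0) \<in> I" by (rule gI) (simp add: \<Theta>_def t\<tau>)
    then have "?s * dv t ^ e - ?r \<in> I" by (simp add: gA_def)
    ultimately show ?thesis using L unfolding True k by blast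
  next
    case False
    then have k: "k = 1" and pw: "proper_derivative w t" "le w \<tau>" using bw by (auto simp: bd_def split: if_splits)
    then obtain e' where e': "e' \<noteq> (\<lambda>_. 0)" "w = dmult e' t" unfolding proper_derivative_iff by blast
    note L = theta_relation[OF c0 dr A(3) e'(1), folded e'(2)]
    let ?s = "pder t A" and ?r = "pder t A * dv w ^ 1 - theta dd e' A"
    have s: "?s \<in> over G" by (rule over_pder[OF GR A(1)])
    have "cder (pd \<psi>) ?s = 0" if "lt \<tau> \<psi>" for \<psi>
      by (rule poly_mapping_eqI)
         (simp add: lookup_cder pd_0 lookup_pder pd_of_nat_mult[OF lkA_FU] big[OF that] del: of_nat_Suc)
    then have "?s \<in> M" using s isep(2) by (simp add: M_def)
    moreover have "?r \<in> over G" using s gAG[of e'] unfolding gA_def by (intro overI GR)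
    moreover have "gA e' \<in> I" by (rule gI) (use pw(2) e'(2) in \<open>simp add: \<Theta>_def\<close>)
    then have "?s * dv w ^ 1 - ?r \<in> I" by (simp add: gA_def)
    ultimately show ?thesis using L unfolding k by blast
  qed
  have "\<exists>b\<in>M. \<exists>r. \<forall>x\<in>{Bp}. r x \<in> over G \<and> b * x - r x \<in> I \<and> (\<forall>w k. bd w = Some k \<longrightarrow> deg_in (r x) w < k) \<and>
     (\<forall>v\<in>derivs (r x). \<exists>w\<in>(\<Union>a\<in>{Bp}. derivs a). le v w)"
    by (rule ritt_reduction[OF GR I0 Iadd Imult M1 Mm MG rel]) (use BpG in auto)
  then obtain b r where b: "b \<in> M" and r0: "\<forall>x\<in>{Bp}. r x \<in> over G \<and> b * x - r x \<in> I \<and> (\<forall>w k. bd w = Some k \<longrightarrow> deg_in (r x) w < k) \<and>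
     (\<forall>v\<in>derivs (r x). \<exists>w\<in>(\<Union>a\<in>{Bp}. derivs a). le v w)" by (elim bexE exE)
  define r1 where "r1 = r Bp"
  have r: "r1 \<in> over G" "b * Bp - r1 \<in> I" "\<And>w k. bd w = Some k \<Longrightarrow> deg_in r1 w < k" "\<forall>v\<in>derivs r1. \<exists>w\<in>derivs Bp. le v w"
  proof -
    note * = bspec[OF r0 singletonI, folded r1_def]
    show "r1 \<in> over G" "b * Bp - r1 \<in> I" "\<forall>v\<in>derivs r1. \<exists>w\<in>derivs Bp. le v w" using * by blast+
    show "deg_in r1 w < k" if "bd w = Some k" for w k using * that by blast
  qed
  from r(2) obtain T h where T: "finite T" "T \<subseteq> \<Theta>" "\<forall>e'. h e' \<in> over G" "b * Bp - r1 = (\<Sum>e'\<in>T. h e' * gA e')" unfolding I_def by blast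
  have "r1 = 0"
  proof (rule RedD[OF red r(1)])
    have "ev (b * Bp - r1) = 0" unfolding T(4) by (simp add: pe_simps evg)
    then show "ev r1 = 0" by (simp add: pe_simps evB)
    show "deg_in r1 t < e" using r(3)[of t e] by (simp add: bd_def)
    fix w assume w: "w \<in> derivs r1"
    show "\<not> proper_derivative w t"
    proof
      assume pw: "proper_derivative w t"
      then have "w \<noteq> t" by (auto simp: proper_derivative_def)
      obtain w' where "w' \<in> derivs Bp" "le w w'" using r(4) w by blast
      then have "le w \<tau>" using Bple[of w'] trans[of w w' \<tau>] by blast
      then have "bd w = Some 1" using pw \<open>w \<noteq> t\<close> by (simp add: bd_def)
      then show False using r(3) w deg_in_eq_0_iff[of r1 w] by fastforce
    qed
  qed
  then have id: "b * Bp = (\<Sum>e'\<in>T. h e' * gA e')" using T(4) by simp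
  have evb: "ev b \<noteq> 0" using b by (simp add: M_def)
  have pg: "pder \<tau> (gA e') = 0" if "lt (dmult e' t) \<tau>" for e'
    unfolding gA_def using leading_pder(1)[OF dr A(3) that] .
  \<comment> \<open>The factors \<open>gA e'\<close> vanish at u, so only their partial derivatives
    with respect to \<tau> count, and these are 0 if \<open>dmult e' t\<close> lies below
    \<tau>.\<close>
  have "ev (pder \<tau> (b * Bp)) = (\<Sum>e'\<in>T. ev (h e') * ev (pder \<tau> (gA e')))"
    unfolding id by (simp add: pder_sum pder_mult pe_simps evg)
  moreover have "ev (pder \<tau> (b * Bp)) \<noteq> 0" using evb pB by (simp add: pder_mult pe_simps evB)
  ultimately have "(\<Sum>e'\<in>T. ev (h e') * ev (pder \<tau> (gA e'))) \<noteq> 0" by argo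
  then obtain e2 where e2: "e2 \<in> T" "ev (h e2) * ev (pder \<tau> (gA e2)) \<noteq> 0" by (meson sum.neutral)
  have e2\<tau>: "dmult e2 t = \<tau>"
  proof (rule ccontr)
    assume "dmult e2 t \<noteq> \<tau>"
    then have "lt (dmult e2 t) \<tau>" using e2(1) T(2) by (auto simp: \<Theta>_def)
    then show False using pg e2(2) by simp
  qed
  have he2: "ev (h e2) \<noteq> 0" using e2(2) by auto
  have e2z: "e2 \<noteq> (\<lambda>_. 0)" using e2\<tau> t\<tau> by auto
  \<comment> \<open>The coefficients of \<open>gA e'\<close> depend on nothing beyond
    \<open>dmult e' \<tau>\<close>. For e2 this bound is \<phi>; for the other elements of T it is
    smaller.\<close>
  define \<phi> where "\<phi> = dmult e2 \<tau>"
  have \<tau>\<phi>: "lt \<tau> \<phi>" unfolding \<phi>_def by (rule dmult_gt[OF e2z])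
  have cg: "cder (pd \<phi>) (gA e') = 0" if "e' \<in> T" "e' \<noteq> e2" for e'
  proof -
    have "dmult e' t \<noteq> \<tau>" using that(2) e2\<tau> by auto
    then have "lt (dmult e' t) \<tau>" using that(1) T(2) by (auto simp: \<Theta>_def)
    then have "lt (dmult e2 (dmult e' t)) (dmult e2 \<tau>)" by (rule dmult_mono)
    moreover have "dmult e2 (dmult e' t) = dmult e' \<tau>" unfolding e2\<tau>[symmetric] by (rule dmult_comm)
    ultimately have "lt (dmult e' \<tau>) \<phi>" by (simp add: \<phi>_def)
    then show ?thesis unfolding gA_def using leading_cder(1)[OF A_FU cA] by blast
  qed
  have cg2: "cder (pd \<phi>) (gA e2) = cder (pd \<tau>) A" unfolding gA_def \<phi>_def using leading_cder(2)[OF A_FU cA] by blast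
  have cB: "cder (pd \<phi>) Bp = 0"
  proof (rule poly_mapping_eqI)
    fix m
    have l: "lk P m \<in> F" "lk Q m \<in> F" using P by (auto dest: overD)
    then have lF: "lk P m \<in> FU" "lk Q m \<in> FU" using F_FU by auto
    have "pd \<phi> (lk P m - a * lk Q m) = pd \<phi> (lk P m) - (pd \<phi> a * lk Q m + a * pd \<phi> (lk Q m))"
      using pd_diff[OF lF(1) subringD(5)[OF FUR aG(2) lF(2)]] pd_mult[OF aG(2) lF(2)] by simp
    also have "\<dots> = 0" using pd_F[OF l(1)] pd_F[OF l(2)] big[OF \<tau>\<phi>, of i0] by (simp add: a_def)
    finally show "lk (cder (pd \<phi>) Bp) m = lk 0 m"
      by (simp add: lookup_cder pd_0 Bp_def lookup_minus lookup_dconst_mult)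
  qed
  have cb: "cder (pd \<phi>) b = 0" using b \<tau>\<phi> unfolding M_def by blast
  have hFU: "h e' \<in> over FU" "gA e' \<in> over FU" for e' using T(3) gAG GFU by auto
  have "cder (pd \<phi>) (b * Bp) = cder (pd \<phi>) b * Bp + b * cder (pd \<phi>) Bp"
    by (rule deriv_onD(2)[OF cder_deriv GFU GFU[OF BpG]]) (use b MG in blast)
  then have z1: "cder (pd \<phi>) (b * Bp) = 0" by (simp add: cb cB)
  have "cder (pd \<phi>) (b * Bp) = (\<Sum>e'\<in>T. cder (pd \<phi>) (h e' * gA e'))"
    unfolding id by (rule deriv_on_sum[OF subring_over[OF FUR] cder_deriv]) (use hFU in \<open>auto intro!: overI FUR\<close>)
  also have "\<dots> = (\<Sum>e'\<in>T. cder (pd \<phi>) (h e') * gA e' + h e' * cder (pd \<phi>) (gA e'))"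
    by (intro sum.cong refl deriv_onD(2)[OF cder_deriv] hFU)
  also have "\<dots> = (\<Sum>e'\<in>T. cder (pd \<phi>) (h e') * gA e') + h e2 * cder (pd \<tau>) A"
  proof -
    have "(\<Sum>e'\<in>T. h e' * cder (pd \<phi>) (gA e')) = h e2 * cder (pd \<tau>) A"
      by (subst sum.remove[OF T(1) e2(1)]) (simp add: cg cg2)
    then show ?thesis by (simp add: sum.distrib)
  qed
  finally have z2: "(\<Sum>e'\<in>T. cder (pd \<phi>) (h e') * gA e') + cder (pd \<tau>) A * h e2 = 0" using z1 by (simp add: mult.commute)
  \<comment> \<open>\<pi> is G-linear and \<open>gA\<close>, \<open>h\<close> are over G, so it acts
    only on the differentiated factors; evaluation at u then removes the sum.\<close>
  obtain \<pi> where \<pi>: "\<pi> 0 = 0" "\<forall>x y. \<pi> (x + y) = \<pi> x + \<pi> y" "\<forall>g\<in>G. \<forall>x. \<pi> (g * x) = g * \<pi> x" "ev (cder \<pi> (cder (pd \<tau>) A)) \<noteq> 0"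
    by (rule coefficient_functional[OF i0(2)])
  note lin = cder_linear[OF \<pi>(1) \<pi>(2)[rule_format] \<pi>(3)[rule_format]]
  have cadd: "cder \<pi> (x + y) = cder \<pi> x + cder \<pi> y" for x y :: "('m,'n,'k) dpoly"
    by (rule poly_mapping_eqI) (simp add: lookup_cder \<pi>(1,2) lookup_add)
  have csum: "cder \<pi> (\<Sum>e'\<in>T. x e') = (\<Sum>e'\<in>T. cder \<pi> (x e'))" for x :: "('m \<Rightarrow> nat) \<Rightarrow> ('m,'n,'k) dpoly"
    using T(1) by (induction T rule: finite_induct) (auto simp: cadd intro!: poly_mapping_eqI simp: lookup_cder \<pi>(1))
  have "cder \<pi> ((\<Sum>e'\<in>T. cder (pd \<phi>) (h e') * gA e') + cder (pd \<tau>) A * h e2) = 0"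
    unfolding z2 by (rule poly_mapping_eqI) (simp add: lookup_cder \<pi>(1))
  then have "(\<Sum>e'\<in>T. cder \<pi> (cder (pd \<phi>) (h e')) * gA e') + cder \<pi> (cder (pd \<tau>) A) * h e2 = 0"
    using T(3) by (simp add: cadd csum lin[OF _ gAG] lin)
  then have "ev ((\<Sum>e'\<in>T. cder \<pi> (cder (pd \<phi>) (h e')) * gA e') + cder \<pi> (cder (pd \<tau>) A) * h e2) = 0" by simp
  then have "ev (cder \<pi> (cder (pd \<tau>) A)) * ev (h e2) = 0" by (simp add: pe_simps evg)
  then show False using \<pi>(4) he2 by simp
qed

text \<open>By Gauss's lemma over \<open>K[T]\<close>, with \<open>T\<close> standing for \<open>t\<close> in the coefficients of \<open>A\<close> and all other
  indeterminates of \<open>A\<close> specialized to natural numbers, the coefficients have small degree in \<open>t\<close>.\<close>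

lemma small_generator: "\<exists>v\<in>G. v \<notin> F \<and> Alg (FG {v}) t e"
proof -
  define \<mu> where "\<mu> m = mono_val m val" for m
  have ev_sg: "ev (sg m c) = c * \<mu> m" for m c by (simp add: peval_single[OF subring_UNIV rhom_on_id] \<mu>_def)
  have evA: "(\<Sum>m\<in>ks A. lk A m * \<mu> m) = 0" using A(2) by (simp add: peval_def \<mu>_def)
  have Ane: "A \<noteq> 0" using A(5) by auto
  have supp: "{w. pd w (lk A m) \<noteq> 0} \<subseteq> {w. le w t}" for m
  proof
    fix w assume "w \<in> {w. pd w (lk A m) \<noteq> 0}"
    then have "\<not> lt t w" using coefficient_leader[of w m] by blast
    then show "w \<in> {w. le w t}" using not_lt by blast
  qed
  have "\<exists>b\<in>over F. b \<noteq> 0 \<and> derivs b \<subseteq> {w. le w t} \<and> (\<exists>a. \<forall>s\<in>lk A ` ks A. a s \<in> over F \<and> derivs (a s) \<subseteq> {w. le w t} \<and> ev (a s) = s * ev b)"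
    by (rule common_denominator) (use lkA_FU supp in auto)
  then obtain b a where b: "b \<in> over F" "b \<noteq> 0" "derivs b \<subseteq> {w. le w t}"
    and a: "\<forall>s\<in>lk A ` ks A. a s \<in> over F \<and> derivs (a s) \<subseteq> {w. le w t} \<and> ev (a s) = s * ev b" by (elim bexE conjE exE)
  define bb where "bb m = a (lk A m)" for m
  have bb: "bb m \<in> over F" "derivs (bb m) \<subseteq> {w. le w t}" "ev (bb m) = lk A m * ev b" if "m \<in> ks A" for m
    using bspec[OF a imageI[OF that]] by (simp_all add: bb_def)
  have evb: "ev b \<noteq> 0" using ev_eq_0[OF b(1)] b(2) by blast
  have m0: "m0 \<in> ks A" using A(5) by (simp add: in_keys_iff)
  have bbm0: "bb m0 = b" by (rule ev_inj[OF bb(1)[OF m0] b(1)]) (simp add: bb(3)[OF m0] A(5))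
  \<comment> \<open>The relation expressing \<open>lk A m\<close> by a fraction, as a polynomial in
    y. It vanishes at u and has no derivative beyond t, so a power of the initial of A makes it a
    multiple of A, without derivatives of A.\<close>
  define B where "B m = bb m - dconst (lk A m) * b" for m
  have bG: "b \<in> over G" using over_mono[OF b(1) G(2)] .
  have lG: "lk A m \<in> G" for m using overD[OF A(1)] .
  have BG: "B m \<in> over G" if "m \<in> ks A" for m
    unfolding B_def using over_mono[OF bb(1)[OF that] G(2)] bG lG by (intro overI GR)
  have evB: "ev (B m) = 0" if "m \<in> ks A" for m unfolding B_def by (simp add: pe_simps bb(3)[OF that])
  have Ble: "le w t" if "m \<in> ks A" "w \<in> derivs (B m)" for m w
  proof -
    have "w \<in> derivs (bb m) \<union> derivs b"
      using that(2) derivs_diff[of "bb m" "dconst (lk A m) * b"] derivs_mult[of "dconst (lk A m)" b] unfolding B_def by auto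
    then show ?thesis using bb(2)[OF that(1)] b(3) by blast
  qed
  define Ia where "Ia = coef_in t e A"
  have IaG: "Ia \<in> over G" unfolding Ia_def by (rule over_coef_in[OF GR A(1)])
  have evIa: "ev Ia \<noteq> 0" unfolding Ia_def by (rule isep(1))
  define I where "I = {x * A |x. x \<in> over G}"
  define M where "M = range (\<lambda>n. Ia ^ n)"
  define bd where "bd w = (if w = t then Some e else None)" for w
  have rel: "\<exists>s\<in>M. \<exists>r\<in>over G. (\<forall>v\<in>derivs s. lt v w) \<and> (\<forall>v\<in>derivs r. le v w) \<and> deg_in r w < k \<and> s * dv w ^ k - r \<in> I"
    if bw: "bd w = Some k" for w k
  proof -
    have k: "w = t" "k = e" using bw by (auto simp: bd_def split: if_splits)
    note L = leader_relation[OF A(3) isep(3), unfolded A(4), folded Ia_def]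
    have "Ia ^ 1 \<in> M" unfolding M_def by (rule rangeI)
    then have "Ia \<in> M" by simp
    moreover have "Ia * dv t ^ e - A \<in> over G" using IaG A(1) by (intro overI GR)
    moreover have "1 * A \<in> I" unfolding I_def using over_1[OF GR] by blast
    then have "Ia * dv t ^ e - (Ia * dv t ^ e - A) \<in> I" by simp
    ultimately show ?thesis using L unfolding k by blast
  qed
  have I0: "0 \<in> I" unfolding I_def using over_0[OF GR] by force
  have Iadd: "x + y \<in> I" if "x \<in> I" "y \<in> I" for x y
  proof -
    from that obtain x' y' where "x = x' * A" "y = y' * A" "x' \<in> over G" "y' \<in> over G" unfolding I_def by blast
    then have "x + y = (x' + y') * A" "x' + y' \<in> over G" using overI(4)[OF GR] by (auto simp: distrib_right)
    then show ?thesis unfolding I_def by blast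
  qed
  have Imult: "c * x \<in> I" if "c \<in> over G" "x \<in> I" for c x
  proof -
    from that obtain x' where "x = x' * A" "x' \<in> over G" unfolding I_def by blast
    then have "c * x = (c * x') * A" "c * x' \<in> over G" using overI(5)[OF GR that(1)] by (auto simp: mult.assoc)
    then show ?thesis unfolding I_def by blast
  qed
  have M1: "1 \<in> M" unfolding M_def by (rule range_eqI[of _ _ 0]) simp
  have Mm: "x * y \<in> M" if "x \<in> M" "y \<in> M" for x y
  proof -
    from that obtain n n' where "x = Ia ^ n" "y = Ia ^ n'" unfolding M_def by blast
    then have "x * y = Ia ^ (n + n')" by (simp add: power_add)
    then show ?thesis unfolding M_def by blast
  qed
  have MG: "M \<subseteq> over G" unfolding M_def using IaG overI(8)[OF GR] by blast
  have "\<exists>s\<in>M. \<exists>r. \<forall>x\<in>B ` ks A. r x \<in> over G \<and> s * x - r x \<in> I \<and> (\<forall>w k. bd w = Some k \<longrightarrow> deg_in (r x) w < k) \<and>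
     (\<forall>v\<in>derivs (r x). \<exists>w\<in>(\<Union>a\<in>B ` ks A. derivs a). le v w)"
    by (rule ritt_reduction[OF GR I0 Iadd Imult M1 Mm MG rel]) (use BG in auto)
  then obtain s r where s: "s \<in> M" and r: "\<forall>x\<in>B ` ks A. r x \<in> over G \<and> s * x - r x \<in> I \<and> (\<forall>w k. bd w = Some k \<longrightarrow> deg_in (r x) w < k) \<and>
     (\<forall>v\<in>derivs (r x). \<exists>w\<in>(\<Union>a\<in>B ` ks A. derivs a). le v w)" by (elim bexE exE)
  obtain n where n: "s = Ia ^ n" using s unfolding M_def by blast
  have sB: "\<exists>x\<in>over G. s * B m = x * A" if m: "m \<in> ks A" for m
  proof -
    note rm = bspec[OF r imageI[OF m]]
    obtain x where x: "x \<in> over G" "s * B m - r (B m) = x * A" using rm unfolding I_def by blast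
    have "r (B m) = 0"
    proof (rule RedD[OF red])
      show "r (B m) \<in> over G" using rm by blast
      have "ev (s * B m - r (B m)) = 0" unfolding x(2) by (simp add: pe_simps A(2))
      then show "ev (r (B m)) = 0" by (simp add: pe_simps evB[OF m])
      have "bd t = Some e" by (simp add: bd_def)
      then show "deg_in (r (B m)) t < e" using rm by blast
      fix w assume "w \<in> derivs (r (B m))"
      then obtain w' where "w' \<in> (\<Union>a\<in>B ` ks A. derivs a)" and ww: "le w w'" using rm by blast
      then have "le w' t" using Ble by blast
      then have "le w t" using ww trans[of w w' t] by blast
      then show "\<not> proper_derivative w t" by (rule le_not_proper)
    qed
    then show ?thesis using x by auto
  qed
  have "\<forall>m\<in>ks A. \<exists>x. x \<in> over G \<and> s * B m = x * A" using sB by blast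
  from bchoice[OF this] obtain x where x: "\<forall>m\<in>ks A. x m \<in> over G \<and> s * B m = x m * A" by (elim exE)
  \<comment> \<open>Z is \<Sum> m(u) b_m(y). Because A vanishes at u, the terms with the
    coefficients of A cancel and \<open>bb\<close> may be replaced by B, so a power of the initial
    times Z is a multiple of A. In the u of its coefficients, Z has only the monomials m of
    A.\<close>
  define Z where "Z = (\<Sum>m\<in>ks A. dconst (\<mu> m) * bb m)"
  define H where "H = (\<Sum>m\<in>ks A. dconst (\<mu> m) * x m)"
  have ZB: "Z = (\<Sum>m\<in>ks A. dconst (\<mu> m) * B m)"
  proof -
    have "(\<Sum>m\<in>ks A. dconst (\<mu> m) * (dconst (lk A m) * b)) = dconst (\<Sum>m\<in>ks A. lk A m * \<mu> m) * b"
      by (simp add: rhom_on_sum[OF subring_UNIV rhom_dconst] sum_distrib_left sum_distrib_right dconst_mult mult_ac)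
    then have "(\<Sum>m\<in>ks A. dconst (\<mu> m) * (dconst (lk A m) * b)) = 0" unfolding evA by simp
    then show ?thesis unfolding Z_def B_def by (simp add: right_diff_distrib sum_subtractf)
  qed
  have sZ: "Ia ^ n * Z = A * H"
  proof -
    have "Ia ^ n * Z = (\<Sum>m\<in>ks A. dconst (\<mu> m) * (s * B m))" unfolding ZB n by (simp add: sum_distrib_left mult_ac)
    also have "\<dots> = (\<Sum>m\<in>ks A. dconst (\<mu> m) * (x m * A))" by (rule sum.cong) (use x in auto)
    also have "\<dots> = A * H" unfolding H_def by (simp add: sum_distrib_left mult_ac)
    finally show ?thesis .
  qed
  \<comment> \<open>The ring F{u} inside the large field. By independence each value comes from
    exactly one polynomial, so \<Psi> can read it as a polynomial in T.\<close>
  define \<R> where "\<R> = ev ` over F"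
  have \<R>: "subring \<R>" unfolding subring_def \<R>_def
  proof (intro conjI ballI)
    show "0 \<in> ev ` over F" "1 \<in> ev ` over F" using imageI[OF over_0[OF FR], of ev] imageI[OF over_1[OF FR], of ev] by (simp_all add: pe_1)
    fix y assume "y \<in> ev ` over F"
    then obtain p where p: "y = ev p" "p \<in> over F" by blast
    show "- y \<in> ev ` over F" using p overI(3)[OF FR p(2)] by (auto intro!: image_eqI[of _ ev "- p"] simp: pe_uminus)
    fix z assume "z \<in> ev ` over F"
    then obtain q where q: "z = ev q" "q \<in> over F" by blast
    show "y + z \<in> ev ` over F" using p q overI(4)[OF FR p(2) q(2)] by (auto intro!: image_eqI[of _ ev "p + q"] simp: pe_add)
    show "y * z \<in> ev ` over F" using p q overI(5)[OF FR p(2) q(2)] by (auto intro!: image_eqI[of _ ev "p * q"] simp: pe_mult)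
  qed
  define \<Psi> where "\<Psi> y = ph t (SOME p. p \<in> over F \<and> ev p = y)" for y
  have \<Psi>: "\<Psi> (ev p) = ph t p" if "p \<in> over F" for p
  proof -
    have "(SOME q. q \<in> over F \<and> ev q = ev p) \<in> over F \<and> ev (SOME q. q \<in> over F \<and> ev q = ev p) = ev p"
      by (rule someI[of _ p]) (use that in simp)
    then have "(SOME q. q \<in> over F \<and> ev q = ev p) = p" using ev_inj[OF _ that] by blast
    then show ?thesis by (simp add: \<Psi>_def)
  qed
  have rh\<Psi>: "rhom_on \<R> \<Psi>" unfolding rhom_on_def
  proof (intro conjI ballI)
    have "\<Psi> (ev 1) = ph t 1" by (rule \<Psi>[OF over_1[OF FR]])
    moreover have "ph t 1 = 1" using ph_dconst[of t 1] by (simp add: one_pCons)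
    ultimately show "\<Psi> 1 = 1" by (simp add: pe_1)
    fix y z assume "y \<in> \<R>" "z \<in> \<R>"
    then obtain p q where p: "y = ev p" "p \<in> over F" "z = ev q" "q \<in> over F" unfolding \<R>_def by blast
    show "\<Psi> (y + z) = \<Psi> y + \<Psi> z" "\<Psi> (y * z) = \<Psi> y * \<Psi> z"
      using \<Psi>[OF p(2)] \<Psi>[OF p(4)] \<Psi>[OF overI(4)[OF FR p(2,4)]] \<Psi>[OF overI(5)[OF FR p(2,4)]]
      by (simp_all add: p(1,3) pe_add pe_mult ph_add ph_mult)
  qed
  have poly\<Psi>: "poly (\<Psi> y) (val t) = y" if "y \<in> \<R>" for y
  proof -
    from that obtain p where p: "y = ev p" "p \<in> over F" unfolding \<R>_def by blast
    show ?thesis unfolding p(1) \<Psi>[OF p(2)] by (rule poly_ph)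
  qed
  have F\<R>: "F \<subseteq> \<R>" unfolding \<R>_def by (auto intro!: image_eqI[of _ ev "dconst _"] simp: pe_dconst over_dconst FR)
  have \<mu>\<R>: "\<mu> m \<in> \<R>" for m unfolding \<R>_def
    by (rule image_eqI[of _ ev "sg m 1"]) (auto simp: ev_sg over_single FR subringD)
  have ZR: "Z \<in> over \<R>" unfolding Z_def using bb(1) \<mu>\<R> by (intro overI \<R>) (auto intro: over_mono[OF _ F\<R>])
  have bR: "ev b \<in> \<R>" unfolding \<R>_def using b(1) by blast
  define A' where "A' = dconst (ev b) * A"
  have A'R: "A' \<in> over \<R>" unfolding over_def
  proof (intro CollectI allI)
    fix m show "lk A' m \<in> \<R>"
    proof (cases "m \<in> ks A")
      case True
      have "lk A' m = ev (bb m)" unfolding A'_def lookup_dconst_mult bb(3)[OF True] by (rule mult.commute)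
      then show ?thesis unfolding \<R>_def using bb(1)[OF True] by blast
    next
      case False
      then show ?thesis using subringD(1)[OF \<R>] by (simp add: A'_def lookup_dconst_mult in_keys_iff)
    qed
  qed
  have HFU: "H \<in> over FU"
  proof -
    have "\<mu> m \<in> FU" for m using FU_ev[OF over_single[OF FR subringD(2)[OF FR]], of m] by (simp add: ev_sg)
    then show ?thesis unfolding H_def using x by (intro overI FUR) (auto intro: over_mono[OF _ G(3)])
  qed
  have "FU = fracs \<R>" unfolding FU_def fracs_def \<R>_def by blast
  then have "lk H ` ks H \<subseteq> fracs \<R>" using HFU by (auto dest: overD)
  from fracs_common_denominator[OF \<R> _ this] obtain \<gamma> where \<gamma>: "\<gamma> \<in> \<R>" "\<gamma> \<noteq> 0" "\<forall>s\<in>lk H ` ks H. \<gamma> * s \<in> \<R>" by auto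
  have \<gamma>H: "dconst \<gamma> * H \<in> over \<R>" unfolding over_def
  proof (intro CollectI allI)
    fix m show "lk (dconst \<gamma> * H) m \<in> \<R>"
      using \<gamma>(3) subringD(1)[OF \<R>] by (cases "m \<in> ks H") (auto simp: lookup_dconst_mult in_keys_iff)
  qed
  define I' where "I' = coef_in t e A'"
  have I'eq: "I' = dconst (ev b) * Ia"
    unfolding I'_def Ia_def A'_def by (rule poly_mapping_eqI) (simp add: lookup_coef_in lookup_dconst_mult)
  have I'R: "I' \<in> over \<R>" unfolding I'_def by (rule over_coef_in[OF \<R> A'R])
  define \<gamma>1 where "\<gamma>1 = \<gamma> * ev b"
  define H1 where "H1 = dconst (ev b ^ n) * (dconst \<gamma> * H)"
  have H1R: "H1 \<in> over \<R>" unfolding H1_def by (rule overI(5)[OF \<R> over_dconst[OF \<R> subring_power[OF \<R> bR]] \<gamma>H])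
  have \<gamma>1R: "\<gamma>1 \<in> \<R>" unfolding \<gamma>1_def using \<gamma>(1) bR by (rule subringD(5)[OF \<R>])
  have dpow: "dconst (y ^ n) = (dconst y ^ n :: ('m,'n,'k) dpoly)" for y by (induction n) (auto simp: dconst_mult)
  have main_eq: "dconst \<gamma>1 * I' ^ n * Z = A' * H1"
  proof -
    have "dconst \<gamma>1 * I' ^ n * Z = dconst \<gamma>1 * dconst (ev b ^ n) * (Ia ^ n * Z)"
      unfolding I'eq by (simp add: power_mult_distrib dpow mult_ac)
    also have "\<dots> = A' * H1" unfolding sZ H1_def A'_def \<gamma>1_def by (simp add: dconst_mult mult_ac)
    finally show ?thesis .
  qed
  have "\<exists>m\<in>ks A. lk A m \<notin> F"
  proof (rule ccontr)
    assume "\<not> ?thesis"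
    then have "A \<in> over F" using subringD(1)[OF FR] unfolding over_def by (auto simp: in_keys_iff)
    then show False using ev_eq_0 A(2) Ane by blast
  qed
  then obtain m1 where m1: "lk A m1 \<notin> F" by blast
  then obtain w where w: "pd w (lk A m1) \<noteq> 0" using pd_all_0[OF lkA_FU] by blast
  define Al where "Al l = coef_in t l A" for l
  have AlG: "Al l \<in> over G" for l unfolding Al_def by (rule over_coef_in[OF GR A(1)])
  have AlFU: "Al l \<in> over FU" for l using over_mono[OF AlG G(3)] .
  \<comment> \<open>The numerator of the partial derivative of the quotient of the coefficients l
    and e of A with respect to t. If it vanished for all l, the partial derivative of A would be
    proportional to A, and after applying a functional it would vanish at u.\<close>
  define V where "V l = cder (pd w) (Al l) * Al e - Al l * cder (pd w) (Al e)" for l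
  have "\<exists>l. V l \<noteq> 0"
  proof (rule ccontr)
    assume "\<not> ?thesis"
    then have V: "cder (pd w) (Al l) * Al e = Al l * cder (pd w) (Al e)" for l unfolding V_def by simp
    have Aex: "A = (\<Sum>l\<le>e. Al l * dv t ^ l)" unfolding Al_def by (rule coef_in_expand) (simp add: A(4))
    have cdv: "cder (pd w) (p * dv t ^ l) = cder (pd w) p * dv t ^ l" if "p \<in> over FU" for p l
    proof (induction l)
      case (Suc l)
      have po: "p * dv t ^ l \<in> over FU" using that by (intro overI FUR)
      have "cder (pd w) (p * dv t ^ l * dv t) = cder (pd w) (p * dv t ^ l) * dv t + (p * dv t ^ l) * cder (pd w) (dv t)"
        by (rule deriv_onD(2)[OF cder_deriv po over_dv[OF FUR]])
      then show ?case using Suc by (simp add: cder_dv mult_ac)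
    qed simp
    have "cder (pd w) A = (\<Sum>l\<le>e. cder (pd w) (Al l * dv t ^ l))"
      by (subst Aex, rule deriv_on_sum[OF subring_over[OF FUR] cder_deriv]) (auto intro!: overI FUR AlFU)
    then have cA: "cder (pd w) A = (\<Sum>l\<le>e. cder (pd w) (Al l) * dv t ^ l)" by (simp add: cdv[OF AlFU])
    have "cder (pd w) A * Al e = (\<Sum>l\<le>e. (cder (pd w) (Al l) * Al e) * dv t ^ l)" unfolding cA by (simp add: sum_distrib_right sum_distrib_left mult_ac)
    also have "\<dots> = (\<Sum>l\<le>e. Al l * dv t ^ l) * cder (pd w) (Al e)" unfolding V by (simp add: sum_distrib_right sum_distrib_left mult_ac)
    finally have eq: "cder (pd w) A * Al e = cder (pd w) (Al e) * A" unfolding Aex[symmetric] by (simp add: mult.commute)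
    obtain \<pi> where \<pi>: "\<pi> 0 = 0" "\<forall>x y. \<pi> (x + y) = \<pi> x + \<pi> y" "\<forall>g\<in>G. \<forall>x. \<pi> (g * x) = g * \<pi> x" "ev (cder \<pi> (cder (pd w) A)) \<noteq> 0"
      by (rule coefficient_functional[OF w])
    note lin = cder_linear[OF \<pi>(1) \<pi>(2)[rule_format] \<pi>(3)[rule_format]]
    have "cder \<pi> (cder (pd w) A) * Al e = cder \<pi> (cder (pd w) (Al e)) * A"
      using arg_cong[OF eq, of "cder \<pi>"] by (simp add: lin[OF _ AlG] lin[OF _ A(1)])
    then have "ev (cder \<pi> (cder (pd w) A) * Al e) = ev (cder \<pi> (cder (pd w) (Al e)) * A)" by simp
    then have "ev (cder \<pi> (cder (pd w) A)) * ev (Al e) = 0" by (simp add: pe_simps A(2))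
    then show False using \<pi>(4) evIa by (simp add: Al_def Ia_def)
  qed
  then obtain l where l: "V l \<noteq> 0" by blast
  have lkZ: "lk Z k = ev (\<Sum>m\<in>ks A. sg m (lk (bb m) k))" for k
    unfolding Z_def by (simp add: lookup_sum lookup_dconst_mult pe_simps ev_sg mult.commute[of "lk _ _"])
  have "Z \<noteq> 0"
  proof
    assume Z0: "Z = 0"
    have "lk b k = 0" for k
    proof -
      have "(\<Sum>m\<in>ks A. sg m (lk (bb m) k)) \<in> over F" using bb(1) by (intro overI FR over_single) (auto dest: overD)
      then have "(\<Sum>m\<in>ks A. sg m (lk (bb m) k)) = 0" using ev_eq_0 lkZ[of k] Z0 by simp
      then have "lk (\<Sum>m\<in>ks A. sg m (lk (bb m) k)) m0 = 0" by simp
      then show ?thesis using m0 bbm0 by (simp add: lookup_sum lookup_single when_def sum.delta')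
    qed
    then have "b = 0" by (intro poly_mapping_eqI) simp
    then show False using b(2) by blast
  qed
  then have Zj: "coef_in t (deg_in Z t) Z \<noteq> 0" by (rule coef_in_deg_neq_0)
  have Iane: "Al e \<noteq> 0" using coef_in_deg_neq_0[OF Ane, of t] by (simp add: Al_def A(4))
  \<comment> \<open>The specialization must keep three things nonzero: the initial of A, the leading
    coefficient of Z, and \<open>V l\<close>. The last one makes the resulting quotient v depend on
    w, so that it is not in F.\<close>
  define S where "S = {Al e, coef_in t (deg_in Z t) Z, V l}"
  have "finite S" "0 \<notin> S" using Zj Iane l by (auto simp: S_def)
  from ex_nonvanishing_point[OF c0 this] obtain c :: "('m,'n) deriv \<Rightarrow> nat" where c: "\<forall>p\<in>S. pe (\<lambda>w. of_nat (c w)) p \<noteq> 0" by (elim exE)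
  define sp where "sp = pe (\<lambda>w. of_nat (c w) :: 'k)"
  have spne: "sp (Al e) \<noteq> 0" "sp (coef_in t (deg_in Z t) Z) \<noteq> 0" "sp (V l) \<noteq> 0"
    using c unfolding S_def sp_def by simp_all
  have spin: "sp p \<in> K" if "subring K" "p \<in> over K" for p :: "('m,'n,'k) dpoly" and K
    unfolding sp_def by (rule peval_in[OF that(1) rhom_on_id that(2) that(1)]) (use that subring_of_nat in auto)
  \<comment> \<open>The outer indeterminate is the t of y, the inner one stands for the value of t
    in the coefficients; the other indeterminates become natural numbers.\<close>
  define \<Phi> where "\<Phi> = peval (\<lambda>y. [:\<Psi> y:]) (\<lambda>w. if w = t then [:0, 1:] else [:\<Psi> (of_nat (c w)):])"
  have h: "rhom_on \<R> (\<lambda>y. [:\<Psi> y:])" using rh\<Psi> by (simp add: rhom_on_def one_pCons)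
  have co: "coeff (\<Phi> p) k = \<Psi> (sp (coef_in t k p))" if "p \<in> over \<R>" for p k
    unfolding \<Phi>_def coeff_peval_poly[OF \<R> rh\<Psi> that] sp_def
    by (rule rhom_pe[OF \<R> rh\<Psi> over_coef_in[OF \<R> that], symmetric]) (rule subring_of_nat[OF \<R>])
  have spR: "sp (coef_in t k p) \<in> \<R>" if "p \<in> over \<R>" for p k by (rule spin[OF \<R> over_coef_in[OF \<R> that]])
  have \<Psi>0: "\<Psi> 0 = 0" by (rule rhom_on_0[OF \<R> rh\<Psi>])
  have \<Psi>ne: "\<Psi> y \<noteq> 0" if "y \<in> \<R>" "y \<noteq> 0" for y using poly\<Psi>[OF that(1)] that(2) by auto
  have "\<Phi> (dconst \<gamma>1) = [:\<Psi> \<gamma>1:]" unfolding \<Phi>_def by (rule peval_dconst[OF \<R> h])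
  moreover have I'const: "\<Phi> I' = [:\<Psi> (sp I'):]"
  proof (rule poly_eqI)
    fix k
    have tn: "t \<notin> derivs I'" unfolding I'_def using derivs_coef_in by blast
    have "coef_in t k I' = (if k = 0 then I' else 0)"
    proof (cases "k = 0")
      case True
      have "I' = (\<Sum>k\<le>0. coef_in t k I' * dv t ^ k)" by (rule coef_in_expand) (use tn in \<open>simp add: deg_in_eq_0_iff\<close>)
      then show ?thesis using True by simp
    next
      case False
      then show ?thesis using coef_in_eq_0[of I' t k] tn by (simp add: deg_in_eq_0_iff[THEN iffD2])
    qed
    then show "coeff (\<Phi> I') k = coeff [:\<Psi> (sp I'):] k" unfolding co[OF I'R] by (auto simp: coeff_pCons \<Psi>0 sp_def split: nat.split)
  qed
  moreover have "\<Phi> (dconst \<gamma>1 * I' ^ n * Z) = \<Phi> (dconst \<gamma>1) * \<Phi> I' ^ n * \<Phi> Z"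
    unfolding \<Phi>_def
    by (simp only: peval_mult[OF \<R> h overI(5)[OF \<R> over_dconst[OF \<R> \<gamma>1R] overI(8)[OF \<R> I'R]] ZR]
      peval_mult[OF \<R> h over_dconst[OF \<R> \<gamma>1R] overI(8)[OF \<R> I'R]] peval_power[OF \<R> h I'R])
  moreover have "\<Phi> (A' * H1) = \<Phi> A' * \<Phi> H1" unfolding \<Phi>_def by (rule peval_mult[OF \<R> h A'R H1R])
  ultimately have "[:\<Psi> \<gamma>1:] * [:\<Psi> (sp I'):] ^ n * \<Phi> Z = \<Phi> A' * \<Phi> H1" using main_eq by simp
  moreover have "[:\<Psi> \<gamma>1:] * [:\<Psi> (sp I'):] ^ n = [:\<Psi> \<gamma>1 * \<Psi> (sp I') ^ n:]" by (simp add: poly_const_pow)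
  ultimately have "[:\<Psi> \<gamma>1 * \<Psi> (sp I') ^ n:] * \<Phi> Z = \<Phi> A' * \<Phi> H1" by argo
  then have gauss: "smult (\<Psi> \<gamma>1 * \<Psi> (sp I') ^ n) (\<Phi> Z) = \<Phi> A' * \<Phi> H1" by simp
  have spI': "sp I' = ev b * sp (Al e)" unfolding I'eq Al_def Ia_def sp_def by (simp add: pe_simps)
  have "\<Psi> \<gamma>1 * \<Psi> (sp I') ^ n \<noteq> 0"
    using \<Psi>ne[OF \<gamma>1R] \<Psi>ne[OF spin[OF \<R> I'R]] \<gamma>(2) evb spne(1) by (simp add: spI' \<gamma>1_def)
  moreover have "\<Phi> Z \<noteq> 0"
  proof
    assume "\<Phi> Z = 0"
    then have "\<Psi> (sp (coef_in t (deg_in Z t) Z)) = 0" using co[OF ZR, of "deg_in Z t"] by simp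
    then show False using \<Psi>ne[OF spR[OF ZR] spne(2)] by blast
  qed
  \<comment> \<open>The inner degree comes only from the monomials m of A, whose exponent at t is at
    most e: the factors from \<open>bb\<close> are specialized to elements of F.\<close>
  moreover have "degree (coeff (\<Phi> Z) j) \<le> e" for j
  proof -
    define y where "y m = sp (coef_in t j (bb m))" for m
    have yF: "y m \<in> F" if "m \<in> ks A" for m unfolding y_def by (rule spin[OF FR over_coef_in[OF FR bb(1)[OF that]]])
    have "coef_in t j Z = (\<Sum>m\<in>ks A. dconst (\<mu> m) * coef_in t j (bb m))"
      unfolding Z_def by (rule poly_mapping_eqI) (simp add: lookup_coef_in lookup_sum lookup_dconst_mult)
    then have "sp (coef_in t j Z) = (\<Sum>m\<in>ks A. \<mu> m * y m)" unfolding sp_def y_def by (simp add: pe_simps)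
    also have "\<dots> = ev (\<Sum>m\<in>ks A. sg m (y m))" by (simp add: pe_simps ev_sg mult.commute)
    finally have "coeff (\<Phi> Z) j = \<Psi> (ev (\<Sum>m\<in>ks A. sg m (y m)))" unfolding co[OF ZR] by simp
    also have "\<dots> = ph t (\<Sum>m\<in>ks A. sg m (y m))" by (rule \<Psi>) (use yF in \<open>auto intro!: overI over_single FR\<close>)
    finally have "degree (coeff (\<Phi> Z) j) \<le> deg_in (\<Sum>m\<in>ks A. sg m (y m)) t" using degree_ph by simp
    also have "\<dots> \<le> e"
    proof (rule deg_in_sum)
      fix m assume "m \<in> ks A"
      then show "deg_in (sg m (y m)) t \<le> e" using lookup_le_deg_in[of m A t] A(4) by (simp add: deg_in_le_iff)
    qed
    finally show ?thesis .
  qed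
  ultimately obtain g A0 where g: "g \<noteq> 0" "\<Phi> A' = smult g A0" and degA0: "\<forall>j. degree (coeff A0 j) \<le> e"
    using gauss_degree[OF gauss] by blast
  define p q where "p = coeff A0 l" and "q = coeff A0 e"
  define \<alpha> where "\<alpha> j = sp (Al j)" for j
  have spA': "sp (coef_in t j A') = ev b * \<alpha> j" for j
  proof -
    have "coef_in t j A' = dconst (ev b) * Al j" unfolding Al_def A'_def by (rule poly_mapping_eqI) (simp add: lookup_coef_in lookup_dconst_mult)
    then show ?thesis by (simp add: \<alpha>_def sp_def pe_simps)
  qed
  have \<Psi>\<alpha>: "\<Psi> (ev b * \<alpha> j) = g * coeff A0 j" for j using co[OF A'R, of j] unfolding g(2) spA' by simp
  have b\<alpha>R: "ev b * \<alpha> j \<in> \<R>" for j using spR[OF A'R, of j] unfolding spA' .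
  have \<alpha>e: "\<alpha> e \<noteq> 0" using spne(1) by (simp add: \<alpha>_def)
  obtain P where P: "P \<in> over F" "ev P = ev b * \<alpha> l" using b\<alpha>R[of l] unfolding \<R>_def by fastforce
  obtain Q where Q: "Q \<in> over F" "ev Q = ev b * \<alpha> e" using b\<alpha>R[of e] unfolding \<R>_def by fastforce
  \<comment> \<open>The unknown common factor g of the coefficients of \<open>\<Phi> A'\<close>
    cancels in this quotient, leaving numerator and denominator of degree at most e.\<close>
  define v where "v = \<alpha> l / \<alpha> e"
  have \<alpha>G: "\<alpha> j \<in> G" for j unfolding \<alpha>_def by (rule spin[OF GR AlG])
  have vG: "v \<in> G" unfolding v_def by (rule subfield_divide[OF Gf \<alpha>G \<alpha>G])
  have vFU: "v \<in> FU" using vG G(3) by blast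
  have evQ: "ev Q \<noteq> 0" using Q(2) evb \<alpha>e by simp
  have evPQ: "ev P = v * ev Q" using P Q \<alpha>e by (simp add: v_def)
  have ph1: "ph t P = g * p" "ph t Q = g * q" using \<Psi>[OF P(1)] \<Psi>[OF Q(1)] \<Psi>\<alpha> P Q by (simp_all add: p_def q_def)
  have "q \<noteq> 0"
  proof
    assume "q = 0"
    then have "ph t Q = 0" using ph1(2) by simp
    then show False using poly_ph[of t Q] evQ by simp
  qed
  have ph2: "p * ph t Q = q * ph t P" unfolding ph1 by (simp add: mult_ac)
  have dg: "degree p \<le> e" "degree q \<le> e" using degA0 by (simp_all add: p_def q_def)
  obtain P1 Q1 where P1: "P1 \<in> over F" "Q1 \<in> over F" "Q1 \<noteq> 0" "ev P1 = v * ev Q1" "deg_in P1 t \<le> e" "deg_in Q1 t \<le> e"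
    using fraction_descent[OF P(1) Q(1) evQ evPQ \<open>q \<noteq> 0\<close> ph2 dg] by blast
  obtain P2 Q2 where P2: "P2 \<in> over F" "Q2 \<in> over F" "Q2 \<noteq> 0" "ev P2 = v * ev Q2" "deg_in P2 t \<le> e" "deg_in Q2 t \<le> e"
    "derivs P2 \<union> derivs Q2 \<subseteq> {w. pd w v \<noteq> 0}" using minimal_fraction[OF P1 vFU] by blast
  have P2le: "le w t" if "w \<in> derivs P2 \<union> derivs Q2" for w
  proof (rule ccontr)
    assume "\<not> le w t"
    then have "lt t w" using total by blast
    then have "Al j \<in> over (cfield w)" for j unfolding over_def Al_def
      using coefficient_leader[of w] lkA_FU subringD(1)[OF subfield_subring[OF cfield_subfield[of w]]]
      by (auto simp: lookup_coef_in cfield_def)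
    then have "\<alpha> j \<in> cfield w" for j unfolding \<alpha>_def by (rule spin[OF subfield_subring[OF cfield_subfield]])
    then have "v \<in> cfield w" unfolding v_def by (intro subfield_divide[OF cfield_subfield])
    then show False using that P2(7) by (auto simp: cfield_def)
  qed
  have vF: "v \<notin> F"
  proof
    assume "v \<in> F"
    then have v0: "pd w v = 0" by (rule pd_F)
    have spd: "pd w (sp x) = sp (cder (pd w) x)" if "x \<in> over FU" for x
    proof -
      have F: "(of_nat k :: 'k) \<in> F" for k by (rule subring_of_nat[OF FR])
      have "pd w (pe (\<lambda>v. of_nat (c v)) x) = pe (\<lambda>v. of_nat (c v)) (mder (pd w) (\<lambda>_. 0) x)"
        by (rule deriv_peval[OF FUR rhom_on_id FUR pd_deriv pd_deriv _ _ that order_refl])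
           (use pd_FU F_FU F pd_F FUR in auto)
      then show ?thesis by (simp add: sp_def cder_def)
    qed
    have \<alpha>FU: "\<alpha> j \<in> FU" for j using \<alpha>G G(3) by blast
    have "\<alpha> l = v * \<alpha> e" using \<alpha>e by (simp add: v_def)
    then have "pd w (\<alpha> l) = v * pd w (\<alpha> e)" using pd_mult[OF vFU \<alpha>FU[of e], of w] v0 by simp
    then have "pd w (\<alpha> l) * \<alpha> e = \<alpha> l * pd w (\<alpha> e)" using \<open>\<alpha> l = v * \<alpha> e\<close> by simp
    moreover have "sp (V l) = pd w (\<alpha> l) * \<alpha> e - \<alpha> l * pd w (\<alpha> e)"
      unfolding \<alpha>_def spd[OF AlFU] by (simp add: V_def sp_def pe_simps)
    ultimately show False using spne(3) by simp
  qed
  \<comment> \<open>With smaller degree, \<open>P2 - dconst v * Q2\<close> would be reduced and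
    vanish at u, hence be 0.\<close>
  have "max (deg_in P2 t) (deg_in Q2 t) = e"
  proof (rule antisym)
    show "max (deg_in P2 t) (deg_in Q2 t) \<le> e" using P2 by simp
    show "e \<le> max (deg_in P2 t) (deg_in Q2 t)"
    proof (rule ccontr)
      assume "\<not> e \<le> max (deg_in P2 t) (deg_in Q2 t)"
      let ?B = "P2 - dconst v * Q2"
      have "?B \<in> over G" using over_mono[OF P2(1) G(2)] over_mono[OF P2(2) G(2)] vG by (intro overI GR)
      moreover have "ev ?B = 0" using P2(4) by (simp add: pe_simps)
      moreover have "deg_in ?B t < e" unfolding fraction_poly_deg[OF P2(1,2) vF] using \<open>\<not> e \<le> _\<close> by linarith
      moreover have "\<not> proper_derivative w t" if "w \<in> derivs ?B" for w
        using that P2le le_not_proper unfolding fraction_poly_derivs[OF P2(1,2) vF] by blast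
      ultimately have "?B = 0" using RedD[OF red] by blast
      then have "ks P2 \<union> ks Q2 = {}" using fraction_poly[OF P2(1,2) vF] by simp
      then show False using P2(3) by simp
    qed
  qed
  then have "Alg (FG {v}) t e"
    using fraction_poly_Alg[OF subfield_subring[OF delta_subfield_subfield[OF FG_delta_subfield(1)]] FG_delta_subfield(2) _ P2(1,2) vF P2(4) P2le _ e1]
      FG_delta_subfield(3)[of "{v}"] by blast
  then show ?thesis using vG vF by blast
qed

end

text \<open>The support is minimized among polynomials of degree at most e, so that those with fewer
  monomials still compete; \<open>Red\<close> forces the minimal one to have degree exactly
  e.\<close>

lemma minimal_support:
  assumes G: "delta_subfield \<delta> G" and red: "Red G t e" and alg: "Alg G t e"
  shows "\<exists>A m0. A \<in> over G \<and> ev A = 0 \<and> (\<forall>w\<in>derivs A. le w t) \<and> deg_in A t = e \<and> lk A m0 = 1 \<and>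
    (\<forall>f\<in>over G. ev f = 0 \<longrightarrow> ks f \<subseteq> ks A - {m0} \<longrightarrow> f = 0)"
proof -
  note Gf = delta_subfield_subfield[OF G]
  note GR = subfield_subring[OF Gf]
  define T where "T A \<longleftrightarrow> A \<in> over G \<and> A \<noteq> 0 \<and> ev A = 0 \<and> (\<forall>w\<in>derivs A. le w t) \<and> deg_in A t \<le> e" for A
  obtain A1 where A1: "A1 \<in> over G" "ev A1 = 0" "\<forall>w\<in>derivs A1. le w t" "deg_in A1 t = e" and e1: "1 \<le> e" using alg unfolding Alg_def by blast
  then have "T A1" unfolding T_def by auto
  from ex_has_least_nat[of T A1 "\<lambda>A. card (ks A)", OF this] obtain A0 where A0: "T A0" and min: "\<forall>f. T f \<longrightarrow> card (ks A0) \<le> card (ks f)" by blast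
  have A0G: "A0 \<in> over G" "A0 \<noteq> 0" "ev A0 = 0" "\<forall>w\<in>derivs A0. le w t" "deg_in A0 t \<le> e" using A0 by (auto simp: T_def)
  have dA0: "deg_in A0 t = e"
  proof (rule ccontr)
    assume "deg_in A0 t \<noteq> e"
    then have "deg_in A0 t < e" using A0G(5) by simp
    then have "A0 = 0" using RedD[OF red A0G(1,3)] A0G(4) le_not_proper by blast
    then show False using A0G(2) by blast
  qed
  obtain m0 where m0: "m0 \<in> ks A0" using A0G(2) by (metis all_not_in_conv keys_eq_empty)
  define c where "c = inverse (lk A0 m0)"
  have cz: "c \<noteq> 0" using m0 by (simp add: c_def in_keys_iff)
  have cG: "c \<in> G" unfolding c_def using subfield_inverse[OF Gf] overD[OF A0G(1)] by blast
  define A where "A = dconst c * A0"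
  have lkA: "lk A m = c * lk A0 m" for m by (simp add: A_def lookup_dconst_mult)
  have ksA: "ks A = ks A0" using cz by (auto simp: in_keys_iff lkA)
  have "A \<in> over G" unfolding A_def using cG A0G(1) by (intro overI GR)
  moreover have "ev A = 0" by (simp add: A_def pe_simps A0G(3))
  moreover have "\<forall>w\<in>derivs A. le w t" using A0G(4) by (simp add: derivs_def ksA)
  moreover have "deg_in A t = e" using dA0 by (simp add: deg_in_def ksA)
  moreover have "lk A m0 = 1" using m0 by (simp add: lkA c_def in_keys_iff)
  moreover have "f = 0" if f: "f \<in> over G" "ev f = 0" "ks f \<subseteq> ks A - {m0}" for f
  proof (rule ccontr)
    assume "f \<noteq> 0"
    have "derivs f \<subseteq> derivs A0" unfolding derivs_def using f(3) ksA by blast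
    moreover have "deg_in f t \<le> e" unfolding deg_in_le_iff using f(3) ksA lookup_le_deg_in[of _ A0 t] dA0 by blast
    ultimately have "T f" unfolding T_def using f A0G(4) \<open>f \<noteq> 0\<close> by blast
    then have "card (ks A0) \<le> card (ks f)" using min by blast
    moreover have "card (ks f) < card (ks A0)" using f(3) m0 ksA by (intro psubset_card_mono) auto
    ultimately show False by simp
  qed
  ultimately show ?thesis by blast
qed

theorem lueroth_generator:
  assumes G: "delta_subfield \<delta> G" "F \<subseteq> G" "G \<subseteq> FU" and red: "Red G t e" and alg: "Alg G t e"
  shows "\<exists>v\<in>G. G = FG {v}"
proof -
  obtain A m0 where A: "A \<in> over G" "ev A = 0" "\<forall>w\<in>derivs A. le w t" "deg_in A t = e" "lk A m0 = 1"
    "\<forall>f\<in>over G. ev f = 0 \<longrightarrow> ks f \<subseteq> ks A - {m0} \<longrightarrow> f = 0" using minimal_support[OF G(1) red alg] by blast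
  have e1: "1 \<le> e" using alg by (simp add: Alg_def)
  have "\<exists>v\<in>G. v \<notin> F \<and> Alg (FG {v}) t e"
    by (rule small_generator[OF G red e1 A(1,2) _ A(4,5)]) (use A(3,6) in blast)+
  then obtain v where v: "v \<in> G" "Alg (FG {v}) t e" by blast
  have "FG {v} \<subseteq> G" by (rule FG_least[OF G(1,2)]) (use v in auto)
  then have "G = FG {v}"
    using field_eq_of_common_leader[OF FG_delta_subfield(1) delta_subfield_subfield[OF G(1)] _ FG_delta_subfield(2) G(3) v(2) red] by blast
  then show ?thesis using v(1) by blast
qed

end

subsection \<open>Well-foundedness of the elimination ranking\<close>

lemma finite_exponents: "finite {e :: 'm::finite \<Rightarrow> nat. sum e UNIV \<le> s}"
proof (rule finite_subset)
  show "{e :: 'm \<Rightarrow> nat. sum e UNIV \<le> s} \<subseteq> PiE UNIV (\<lambda>_. {..s})"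
  proof
    fix e :: "'m \<Rightarrow> nat" assume "e \<in> {e. sum e UNIV \<le> s}"
    then have "e i \<le> s" for i using member_le_sum[of i UNIV e] by simp
    then show "e \<in> PiE UNIV (\<lambda>_. {..s})" by auto
  qed
qed (simp add: finite_PiE)

lemma elim_less_same: "elim_less (v, k) (v, l) \<longleftrightarrow> theta_less k l"
proof -
  have "\<not> xu_less v v" by (cases v) auto
  then show ?thesis by (simp add: elim_less_def)
qed

text \<open>The order of the operator is compared first, so only finitely many exponents precede a
  given one; counting them gives a rank in the natural numbers.\<close>

lemma theta_less_rank:
  fixes k l :: "'m::{finite,linorder} \<Rightarrow> nat"
  assumes "theta_less k l" shows "card {e. theta_less e k} < card {e. theta_less e l}"
proof (rule psubset_card_mono)
  let ?v = "X (0::nat) :: (nat, nat) xu"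
  have rk: "ranking (elim_less :: ('m, (nat, nat) xu) deriv \<Rightarrow> _)" by (rule ranking_elim_less)
  have tr: "theta_less a c" if "theta_less a b" "theta_less b c" for a b c :: "'m \<Rightarrow> nat"
    using that rk unfolding ranking_def elim_less_same[of ?v, symmetric] by blast
  have irr: "\<not> theta_less a a" for a :: "'m \<Rightarrow> nat"
    using rk unfolding ranking_def elim_less_same[of ?v, symmetric] by blast
  show "{e. theta_less e k} \<subset> {e. theta_less e l}" using assms tr irr by blast
  have "{e. theta_less e l} \<subseteq> {e. sum e UNIV \<le> sum l UNIV}" by (auto simp: theta_less_def)
  then show "finite {e. theta_less e l}" using finite_exponents finite_subset by blast
qed

text \<open>Position of a variable in the elimination order. Besides well-foundedness it provides
  the weight in \<open>card_parametric_ge\<close>.\<close>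

fun xu_pos :: "('r::{finite,linorder}, 'n::{finite,linorder}) xu \<Rightarrow> nat" where
  "xu_pos (X j) = card {k. k < j}"
| "xu_pos (U i) = CARD('r) + card {k. k < i}"

lemma xu_pos_less: assumes "xu_less v v'" shows "xu_pos v < xu_pos v'"
proof -
  have c: "card {k. k < a} < card {k. k < b}" if "a < b" for a b :: "'x::{finite,linorder}"
    by (rule psubset_card_mono) (use that in auto)
  have "card {k. k < a} < CARD('x)" for a :: "'x::{finite,linorder}"
    by (rule psubset_card_mono) auto
  then show ?thesis using assms c by (cases v; cases v') (auto intro: trans_less_add1)
qed

lemma wf_ranking_elim_less:
  "wf_ranking (elim_less :: ('m::{finite,linorder}, ('r::{finite,linorder}, 'n::{finite,linorder}) xu) deriv \<Rightarrow> _)"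
proof
  let ?f = "\<lambda>w :: ('m, ('r, 'n) xu) deriv. (xu_pos (fst w), card {e. theta_less e (snd w)})"
  have "{(x, y). elim_less x y} \<subseteq> inv_image (less_than <*lex*> less_than) ?f"
    by (auto simp: elim_less_def dest: xu_pos_less theta_less_rank)
  then have "wf {(x, y :: ('m, ('r, 'n) xu) deriv). elim_less x y}"
    using wf_subset[OF wf_inv_image[OF wf_lex_prod[OF wf_less_than wf_less_than]]] by blast
  then show "wfP (elim_less :: ('m, ('r, 'n) xu) deriv \<Rightarrow> _)"
    using wfp_wf_eq[of "{(x, y :: ('m, ('r, 'n) xu) deriv). elim_less x y}"] by simp
qed (rule ranking_elim_less)

definition nless :: "('m::{finite,linorder}, 'n::linorder) deriv \<Rightarrow> ('m, 'n) deriv \<Rightarrow> bool" where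
  "nless v w \<longleftrightarrow> fst v < fst w \<or> fst v = fst w \<and> theta_less (snd v) (snd w)"

lemma elim_less_toU: "elim_less (toU v) (toU w) \<longleftrightarrow> nless v w"
  by (simp add: elim_less_def toU_def nless_def)

lemma deriv_shift_toU: "deriv_shift i (toU v) = toU (deriv_shift i v)"
  by (simp add: deriv_shift_def toU_def)

text \<open>The ranking is the restriction of an elimination ranking to the derivatives of u; the
  index type \<open>bool\<close> of the x is a dummy.\<close>

lemma wf_ranking_nless: "wf_ranking (nless :: ('m::{finite,linorder}, 'n::{finite,linorder}) deriv \<Rightarrow> _)"
proof -
  interpret E: wf_ranking "elim_less :: ('m, (bool, 'n) xu) deriv \<Rightarrow> _" by (rule wf_ranking_elim_less)
  let ?t = "toU :: ('m, 'n) deriv \<Rightarrow> ('m, (bool, 'n) xu) deriv"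
  have n: "nless v w \<longleftrightarrow> elim_less (?t v) (?t w)" for v w by (simp add: elim_less_toU)
  show ?thesis
  proof
    show "ranking (nless :: ('m, 'n) deriv \<Rightarrow> _)" unfolding ranking_def n
    proof (intro conjI allI impI)
      fix w w' w'' :: "('m, 'n) deriv" and i
      show "\<not> elim_less (?t w) (?t w)" by simp
      show "elim_less (?t w) (?t w'')" if "elim_less (?t w) (?t w')" "elim_less (?t w') (?t w'')"
        using E.trans that by blast
      show "elim_less (?t w) (?t w') \<or> elim_less (?t w') (?t w)" if "w \<noteq> w'"
        using E.total[of "?t w" "?t w'"] that by simp
      show "elim_less (?t w) (?t (deriv_shift i w))" using E.shift_gt[of "?t w" i] by (simp add: deriv_shift_toU)
      show "elim_less (?t (deriv_shift i w)) (?t (deriv_shift i w'))" if "elim_less (?t w) (?t w')"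
        using E.shift_mono[OF that, of i] by (simp add: deriv_shift_toU)
    qed
    have "wf {(x, y :: ('m, (bool, 'n) xu) deriv). elim_less x y}"
      using E.wf wfp_wf_eq[of "{(x, y :: ('m, (bool, 'n) xu) deriv). elim_less x y}"] by simp
    from wf_inv_image[OF this, of ?t] have "wf {(x, y). elim_less (?t x) (?t y)}"
      by (simp add: inv_image_def)
    then show "wfP (nless :: ('m, 'n) deriv \<Rightarrow> _)"
      using wfp_wf_eq[of "{(x, y :: ('m, 'n) deriv). nless x y}"] by (simp add: elim_less_toU)
  qed
qed

subsection \<open>Change of coefficients\<close>

definition mapc :: "('a::zero \<Rightarrow> 'b::comm_monoid_add) \<Rightarrow> ('m,'v,'a) dpoly \<Rightarrow> ('m,'v,'b) dpoly" where
  "mapc \<phi> p = (\<Sum>t\<in>ks p. sg t (\<phi> (lk p t)))"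

lemma lookup_mapc: assumes "\<phi> 0 = 0" shows "lk (mapc \<phi> p) t = \<phi> (lk p t)"
  unfolding mapc_def using assms
  by (cases "t \<in> ks p") (auto simp: lookup_sum lookup_single when_def sum.delta' in_keys_iff)

text \<open>Passes from polynomials over the subset \<open>range \<iota>\<close>, where the field
  theory takes place, to polynomials over the coefficient field itself, where the ideal
  lives.\<close>

lemma over_range_descend:
  fixes p :: "('m,'v,'b::comm_ring_1) dpoly" and \<iota> :: "'a::comm_ring_1 \<Rightarrow> 'b"
  assumes \<iota>: "inj \<iota>" "\<iota> 0 = 0" and p: "p \<in> over (range \<iota>)"
  shows "\<exists>p'. ks p' = ks p \<and> derivs p' = derivs p \<and> (\<forall>\<rho>. peval \<iota> \<rho> p' = peval (\<lambda>x. x) \<rho> p)"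
proof -
  define p' where "p' = mapc (inv \<iota>) p"
  have "inv \<iota> 0 = 0" using inv_f_f[OF \<iota>(1), of 0] \<iota>(2) by simp
  then have l: "\<iota> (lk p' t) = lk p t" for t
    unfolding p'_def using overD[OF p, of t] by (simp add: lookup_mapc f_inv_into_f)
  have k: "ks p' = ks p"
  proof (intro set_eqI)
    fix t show "t \<in> ks p' \<longleftrightarrow> t \<in> ks p" using l[of t] \<iota>(2) injD[OF \<iota>(1), of "lk p' t" 0] by (auto simp: in_keys_iff)
  qed
  then show ?thesis using l by (intro exI[of _ p']) (auto simp: derivs_def peval_def)
qed

lemma emb_simps:
  "emb (dconst c) = dconst c" "emb (dv w) = dv (toU w)" "emb (p + q) = emb p + emb q" "emb (p * q) = emb p * emb q"
  "emb (p - q) = emb p - emb q" "emb (prod f I) = (\<Prod>i\<in>I. emb (f i))" "emb (p ^ k) = emb p ^ k"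
  unfolding emb_def
  by (simp_all add: peval_dconst[OF subring_UNIV rhom_dconst] peval_dv[OF subring_UNIV rhom_dconst]
      peval_add[OF subring_UNIV rhom_dconst] peval_mult[OF subring_UNIV rhom_dconst] peval_diff[OF subring_UNIV rhom_dconst]
      peval_prod[OF subring_UNIV rhom_dconst] peval_power[OF subring_UNIV rhom_dconst])

lemma emb_dpoly_deriv:
  assumes "delta_ring d" shows "emb (dpoly_deriv d i p) = dpoly_deriv d i (emb p)"
  unfolding emb_def
  by (rule peval_dpoly_deriv[OF assms delta_ring_dpoly_deriv[OF assms] subring_UNIV rhom_dconst])
     (simp_all add: assms deriv_shift_toU)

lemma dpoly_eval_emb:
  assumes "delta_ring d" shows "dpoly_eval dconst (dpoly_deriv d) (\<lambda>i. dvar (U i)) p = emb p"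
  unfolding dpoly_eval_eq_peval emb_def by (simp add: theta_dvar[OF assms] toU_def)

lemma pder_psub:
  fixes p :: "('m,('r,'n) xu,'a::comm_ring_1) dpoly" and \<phi> :: "'a \<Rightarrow> 'b::comm_ring_1"
  assumes \<phi>: "rhom_on UNIV \<phi>"
  shows "pder v (psub \<phi> \<xi> p) = psub \<phi> \<xi> (pder (toU v) p)"
proof -
  have h: "rhom_on UNIV (\<lambda>c. dconst (\<phi> c) :: ('m,'n,'b) dpoly)"
    using \<phi> by (simp add: rhom_on_def dconst_add dconst_mult)
  note ps = peval_dconst[OF subring_UNIV h] peval_dv[OF subring_UNIV h] peval_add[OF subring_UNIV h] peval_mult[OF subring_UNIV h] peval_1[OF subring_UNIV h]
  have p0: "p \<in> over UNIV" "derivs p \<subseteq> UNIV" by simp_all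
  show ?thesis using p0
  proof (induction p rule: dpoly_induct)
    case (var w)
    show ?case
      by (cases w rule: toU_cases) (auto simp: psub_def ps pder_dv gen_def toU_def prod_eq_iff)
  qed (simp_all add: psub_def ps pder_add pder_mult)
qed

subsection \<open>The ideal of relations as a kernel\<close>

lemma delta_ideal_gen_ideal: "delta_ideal D (delta_ideal_gen D S)"
  unfolding delta_ideal_gen_def by (rule hull_in) (auto simp: delta_ideal_def)

locale generic_point =
  fixes \<delta>F :: "'m::{finite,linorder} \<Rightarrow> 'f::field_char_0 \<Rightarrow> 'f"
    and \<iota> :: "'f \<Rightarrow> 'k::field" and \<delta> :: "'m \<Rightarrow> 'k \<Rightarrow> 'k"
    and u :: "'n::{finite,linorder} \<Rightarrow> 'k" and w :: "'r::{finite,linorder} \<Rightarrow> 'k"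
  assumes ext: "delta_field_extension \<delta>F \<iota> \<delta>" and ind: "delta_indeterminates \<iota> \<delta> u"
    and wfrac: "\<And>j. \<exists>p q. w j = dpoly_eval \<iota> \<delta> u p / dpoly_eval \<iota> \<delta> u q"
begin

lemma \<iota>hom: "rhom_on R \<iota>" and \<iota>_delta: "\<iota> (\<delta>F i a) = \<delta> i (\<iota> a)" and drF: "delta_ring \<delta>F" and drK: "delta_ring \<delta>"
  using ext by (auto simp: delta_field_extension_def rhom_on_def)

lemmas \<iota>0 = rhom_on_0[OF subring_UNIV \<iota>hom] and \<iota>1 = rhom_onD(1)[OF \<iota>hom]

lemma \<iota>_eq_0: assumes "\<iota> a = 0" shows "a = 0"
proof (rule ccontr)
  assume "a \<noteq> 0"
  then have "\<iota> (a * inverse a) = 1" using \<iota>1 by simp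
  then show False using assms rhom_onD(3)[OF \<iota>hom, of a UNIV "inverse a"] by simp
qed

lemma \<iota>_inj: "inj \<iota>"
proof (rule injI)
  fix a b assume "\<iota> a = \<iota> b"
  then have "\<iota> (a + - b) = 0"
    using rhom_onD(2)[OF \<iota>hom, of a UNIV "- b"] rhom_on_uminus[OF subring_UNIV \<iota>hom, of b] by simp
  from \<iota>_eq_0[OF this] show "a = b" by simp
qed

sublocale dext "nless :: ('m,'n) deriv \<Rightarrow> ('m,'n) deriv \<Rightarrow> bool" \<delta> "range \<iota>" u
proof -
  interpret N: wf_ranking "nless :: ('m,'n) deriv \<Rightarrow> _" by (rule wf_ranking_nless)
  have inv: "\<iota> (inverse a) = inverse (\<iota> a)" for a
  proof (cases "a = 0")
    case True then show ?thesis by (simp add: \<iota>0)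
  next
    case False
    then have "\<iota> a * \<iota> (inverse a) = 1" using rhom_onD(3)[OF \<iota>hom, of a UNIV "inverse a"] \<iota>1 by simp
    then show ?thesis by (rule inverse_unique[symmetric])
  qed
  have diff: "\<iota> (a - b) = \<iota> a - \<iota> b" for a b
    using rhom_onD(2)[OF \<iota>hom, of a UNIV "- b"] rhom_on_uminus[OF subring_UNIV \<iota>hom, of b] by simp
  have nat: "\<iota> (of_nat k) = of_nat k" for k
    by (induction k) (simp_all add: \<iota>0 \<iota>1 rhom_onD(2)[OF \<iota>hom, of _ UNIV])
  show "dext (nless :: ('m,'n) deriv \<Rightarrow> _) \<delta> (range \<iota>) u"
  proof
    show "delta_ring \<delta>" by (rule drK)
    show "delta_subfield \<delta> (range \<iota>)"
      unfolding delta_subfield_def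
      by (auto simp: \<iota>1[symmetric] diff[symmetric] inv[symmetric] \<iota>_delta[symmetric] rhom_onD(3)[OF \<iota>hom, of _ UNIV, symmetric])
    show "char0 TYPE('k)" unfolding char0_def using nat \<iota>_eq_0 by (metis of_nat_eq_0_iff neq0_conv)
    fix p :: "('m,'n,'k) dpoly"
    assume p: "p \<in> over (range \<iota>)" "peval (\<lambda>x. x) (\<lambda>w. theta \<delta> (snd w) (u (fst w))) p = 0"
    from over_range_descend[OF \<iota>_inj \<iota>0 p(1)] obtain p' where p': "ks p' = ks p" "\<forall>\<rho>. peval \<iota> \<rho> p' = peval (\<lambda>x. x) \<rho> p" by blast
    have "p' = 0" using ind p(2) p'(2) unfolding delta_indeterminates_def dpoly_eval_eq_peval by auto
    then have "ks p = {}" using p'(1) by simp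
    then show "p = 0" by simp
  qed
qed

abbreviation \<xi> :: "'r \<Rightarrow> ('m \<Rightarrow> nat) \<Rightarrow> 'k" where "\<xi> j e \<equiv> theta \<delta> e (w j)"
abbreviation gp :: "('m,('r,'n) xu) deriv \<Rightarrow> 'k" where "gp \<equiv> gen \<xi> val"
abbreviation evx :: "('m,('r,'n) xu,'f) dpoly \<Rightarrow> 'k" where "evx \<equiv> peval \<iota> gp"
abbreviation dx :: "'m \<Rightarrow> ('m,('r,'n) xu,'f) dpoly \<Rightarrow> ('m,('r,'n) xu,'f) dpoly" where "dx \<equiv> dpoly_deriv \<delta>F"

lemma dpoly_eval_u: "dpoly_eval \<iota> \<delta> u = peval \<iota> val"
  unfolding dpoly_eval_eq_peval val_def ..

lemma evx_simps:
  "evx (p + q) = evx p + evx q" "evx (p * q) = evx p * evx q" "evx (p - q) = evx p - evx q" "evx (p ^ k) = evx p ^ k"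
  "evx (prod f I) = (\<Prod>i\<in>I. evx (f i))" "evx (dv v) = gp v" "evx (dconst c) = \<iota> c" "evx 1 = 1"
  by (simp_all add: peval_dconst[OF subring_UNIV \<iota>hom] peval_dv[OF subring_UNIV \<iota>hom] peval_add[OF subring_UNIV \<iota>hom]
      peval_mult[OF subring_UNIV \<iota>hom] peval_diff[OF subring_UNIV \<iota>hom] peval_prod[OF subring_UNIV \<iota>hom]
      peval_power[OF subring_UNIV \<iota>hom] peval_1[OF subring_UNIV \<iota>hom])

lemma evx_emb: "evx (emb p) = peval \<iota> val p"
  using peval_emb[OF subring_UNIV \<iota>hom, of p gp] by simp

lemma val_eq_0: "peval \<iota> val p = 0 \<Longrightarrow> p = 0"
  using ind unfolding delta_indeterminates_def dpoly_eval_u by blast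

lemma gp_shift: "\<delta> i (gp v) = gp (deriv_shift i v)"
proof (cases v rule: toU_cases)
  case (1 j e)
  then show ?thesis using theta_Suc[of \<delta> e i "w j", OF dcomm] by (simp add: deriv_shift_def)
next
  case (2 v')
  then show ?thesis by (simp add: val_shift deriv_shift_toU)
qed

lemma evx_dx: "evx (dx i p) = \<delta> i (evx p)"
  by (rule peval_dpoly_deriv[OF drF drK subring_UNIV \<iota>hom]) (simp_all add: \<iota>_delta gp_shift)

lemma evx_theta: "evx (theta dx e p) = theta \<delta> e (evx p)"
  by (rule theta_hom[where f = evx, OF delta_ringD(2)[OF delta_ring_dpoly_deriv[OF drF]] dcomm evx_dx])

text \<open>Multiplied by a power of h, every polynomial is congruent modulo the ideal to some
  \<open>emb q\<close> in the derivatives of u alone: the generators achieve this for the x, the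
  quotient rule for their derivatives. If p vanishes at the generic point, so does q, and q = 0 by
  independence. Conversely h does not vanish there, so it can be cancelled.\<close>

lemma saturation_eq_kernel:
  assumes Q: "\<And>j. Q j \<noteq> 0" and wPQ: "\<And>j. w j = peval \<iota> val (P j) / peval \<iota> val (Q j)"
  shows "saturation (delta_ideal_gen dx (range (\<lambda>j. dvar (X j) * emb (Q j) - emb (P j)))) (\<Prod>j\<in>UNIV. emb (Q j)) = {p. evx p = 0}"
proof -
  define I where "I = delta_ideal_gen dx (range (\<lambda>j. dvar (X j) * emb (Q j) - emb (P j)))"
  define h :: "('m,('r,'n) xu,'f) dpoly" where "h = (\<Prod>j\<in>UNIV. emb (Q j))"
  have h_emb: "h = emb (\<Prod>j\<in>UNIV. Q j)" unfolding h_def by (simp add: emb_simps)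
  have di: "delta_ideal dx I" unfolding I_def by (rule delta_ideal_gen_ideal)
  have I0: "0 \<in> I" and Iadd: "\<And>a b. a \<in> I \<Longrightarrow> b \<in> I \<Longrightarrow> a + b \<in> I" and Imult: "\<And>c a. a \<in> I \<Longrightarrow> c * a \<in> I"
    and Id: "\<And>i a. a \<in> I \<Longrightarrow> dx i a \<in> I" using di unfolding delta_ideal_def by blast+
  have evQ: "peval \<iota> val (Q j) \<noteq> 0" for j using Q[of j] val_eq_0 by blast
  have evh: "evx h \<noteq> 0" unfolding h_def by (simp add: evx_simps evx_emb evQ)
  have gI: "dvar (X j) * emb (Q j) - emb (P j) \<in> I" for j
    unfolding I_def delta_ideal_gen_def using hull_subset[of "range (\<lambda>j. dvar (X j) * emb (Q j) - emb (P j))" "delta_ideal dx"] by blast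
  have IK: "I \<subseteq> {p. evx p = 0}" unfolding I_def delta_ideal_gen_def
  proof (rule hull_minimal)
    show "delta_ideal dx {p. evx p = 0}" unfolding delta_ideal_def by (simp add: evx_simps evx_dx d0)
    show "range (\<lambda>j. dvar (X j) * emb (Q j) - emb (P j)) \<subseteq> {p. evx p = 0}"
    proof -
      have "evx (dvar (X j) * emb (Q j) - emb (P j)) = w j * peval \<iota> val (Q j) - peval \<iota> val (P j)" for j
        by (simp add: evx_simps evx_emb dvar_eq_dv)
      then show ?thesis using wPQ evQ by auto
    qed
  qed
  have *: "\<exists>k q. h ^ k * p - emb q \<in> I" for p
  proof -
    have "p \<in> over UNIV" "derivs p \<subseteq> UNIV" by simp_all
    then show ?thesis
    proof (induction p rule: dpoly_induct)
      case (const c)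
      have "h ^ 0 * dconst c - emb (dconst c) \<in> I" using I0 by (simp add: emb_simps)
      then show ?case by blast
    next
      case (var v)
      show ?case
      proof (cases v rule: toU_cases)
        case (2 v')
        have "h ^ 0 * dv v - emb (dv v') \<in> I" using I0 by (simp add: emb_simps 2)
        then show ?thesis by blast
      next
        case (1 j e)
        have "\<exists>k q. h ^ k * dv (X j, e) - emb q \<in> I"
        proof (induction e rule: exponent_induct)
          case zero
          let ?h = "\<Prod>l\<in>UNIV - {j}. Q l"
          have "h = emb (Q j) * emb ?h" unfolding h_def by (subst prod.remove[of _ j]) (simp_all add: emb_simps)
          then have "h ^ 1 * dv (X j, \<lambda>_. 0) - emb (?h * P j) = emb ?h * (dvar (X j) * emb (Q j) - emb (P j))"
            by (simp add: emb_simps dvar_eq_dv algebra_simps)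
          also have "\<dots> \<in> I" by (rule Imult[OF gI])
          finally show ?case by blast
        next
          case (Suc e i)
          then obtain k q where kq: "h ^ k * dv (X j, e) - emb q \<in> I" by blast
          have dmul: "dx i (a * b) = dx i a * b + a * dx i b" and dsub: "dx i (a - b) = dx i a - dx i b" for a b
            using deriv_onD(2)[OF deriv_on_dpoly_deriv[OF drF], of a UNIV b i] deriv_on_diff[OF subring_UNIV deriv_on_dpoly_deriv[OF drF], of a b i] by simp_all
          have dvS: "dx i (dv (X j, e)) = dv (X j, e(i := Suc (e i)))" by (simp add: drF deriv_shift_def)
          \<comment> \<open>Quotient rule: multiply the derivative of the congruence by
            \<open>h ^ k\<close> and subtract the part in which the power of h is
            differentiated.\<close>
          have "h ^ k * dx i (h ^ k * dv (X j, e) - emb q) - dx i (h ^ k) * (h ^ k * dv (X j, e) - emb q) \<in> I"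
            using Iadd[OF Imult[OF Id[OF kq]] Imult[OF kq, of "- dx i (h ^ k)"]] by simp
          also have "h ^ k * dx i (h ^ k * dv (X j, e) - emb q) - dx i (h ^ k) * (h ^ k * dv (X j, e) - emb q)
             = h ^ (k + k) * dv (X j, e(i := Suc (e i))) - (h ^ k * dx i (emb q) - dx i (h ^ k) * emb q)"
            unfolding dmul dsub dvS by (simp add: algebra_simps power_add)
          also have "h ^ k * dx i (emb q) - dx i (h ^ k) * emb q
             = emb ((\<Prod>j\<in>UNIV. Q j) ^ k * dpoly_deriv \<delta>F i q - dpoly_deriv \<delta>F i ((\<Prod>j\<in>UNIV. Q j) ^ k) * q)"
            unfolding h_emb by (simp only: emb_simps emb_dpoly_deriv[OF drF])
          finally show ?case by blast
        qed
        then show ?thesis by (simp only: 1)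
      qed
    next
      case (add p p')
      then obtain k q k' q' where kq: "h ^ k * p - emb q \<in> I" "h ^ k' * p' - emb q' \<in> I" by blast
      have "h ^ (k + k') * (p + p') - emb ((\<Prod>j\<in>UNIV. Q j) ^ k' * q + (\<Prod>j\<in>UNIV. Q j) ^ k * q')
          = h ^ k' * (h ^ k * p - emb q) + h ^ k * (h ^ k' * p' - emb q')"
        unfolding h_emb by (simp add: emb_simps algebra_simps power_add)
      also have "\<dots> \<in> I" by (intro Iadd Imult kq)
      finally show ?case by blast
    next
      case (mult p p')
      then obtain k q k' q' where kq: "h ^ k * p - emb q \<in> I" "h ^ k' * p' - emb q' \<in> I" by blast
      have "h ^ (k + k') * (p * p') - emb (q * q') = (h ^ k' * p') * (h ^ k * p - emb q) + emb q * (h ^ k' * p' - emb q')"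
        by (simp add: emb_simps algebra_simps power_add)
      also have "\<dots> \<in> I" by (intro Iadd Imult kq)
      finally show ?case by blast
    qed simp
  qed
  have "p \<in> saturation I h \<longleftrightarrow> evx p = 0" for p
  proof
    assume "p \<in> saturation I h"
    then obtain k where "h ^ k * p \<in> I" by (auto simp: saturation_def)
    then have "evx (h ^ k * p) = 0" using IK by blast
    then show "evx p = 0" using evh by (simp add: evx_simps)
  next
    assume p: "evx p = 0"
    from * obtain k q where kq: "h ^ k * p - emb q \<in> I" by blast
    then have "evx (h ^ k * p - emb q) = 0" using IK by blast
    then have "peval \<iota> val q = 0" using p by (simp add: evx_simps evx_emb)
    then have "q = 0" by (rule val_eq_0)
    then have "h ^ k * p \<in> I" using kq by (simp add: emb_def)
    then show "p \<in> saturation I h" by (auto simp: saturation_def)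
  qed
  then show ?thesis unfolding I_def h_def by blast
qed

end

subsection \<open>Characteristic sets of the ideal of relations\<close>

locale char_point = generic_point \<delta>F \<iota> \<delta> u w
  for \<delta>F :: "'m::{finite,linorder} \<Rightarrow> 'f::field_char_0 \<Rightarrow> 'f"
    and \<iota> :: "'f \<Rightarrow> 'k::field" and \<delta> :: "'m \<Rightarrow> 'k \<Rightarrow> 'k"
    and u :: "'n::{finite,linorder} \<Rightarrow> 'k" and w :: "'r::{finite,linorder} \<Rightarrow> 'k" +
  fixes C :: "('m,('r,'n) xu,'f) dpoly set"
  assumes charset: "characteristic_set elim_less {p. evx p = 0} C"
begin

sublocale E: wf_ranking "elim_less :: ('m,('r,'n) xu) deriv \<Rightarrow> ('m,('r,'n) xu) deriv \<Rightarrow> bool"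
  by (rule wf_ranking_elim_less)

abbreviation ld :: "('m,('r,'n) xu,'f) dpoly \<Rightarrow> ('m,('r,'n) xu) deriv" where "ld \<equiv> leader elim_less"
abbreviation ldeg :: "('m,('r,'n) xu,'f) dpoly \<Rightarrow> nat" where "ldeg f \<equiv> deg_in f (ld f)"

lemma C_zero: "f \<in> C \<Longrightarrow> evx f = 0" using charset by (auto simp: characteristic_set_def)

lemma C_reduced: "f \<in> C \<Longrightarrow> g \<in> C \<Longrightarrow> g \<noteq> f \<Longrightarrow> reduced_wrt elim_less g f"
  using charset by (auto simp: characteristic_set_def autoreduced_def)

lemma C_reduced_zero: "evx g = 0 \<Longrightarrow> (\<And>f. f \<in> C \<Longrightarrow> reduced_wrt elim_less g f) \<Longrightarrow> g = 0"
  using charset unfolding characteristic_set_def by blast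

lemma ld_props:
  assumes "f \<in> C"
  shows "ld f \<in> derivs f" "v \<in> derivs f \<Longrightarrow> E.le v (ld f)" "0 < ldeg f"
proof -
  have "f \<notin> range dconst" using charset assms by (auto simp: characteristic_set_def autoreduced_def)
  then have "derivs f \<noteq> {}" using derivs_empty[of f] by blast
  then obtain x where x: "x \<in> derivs f" "\<forall>v\<in>derivs f. E.le v x" using E.ex_max_ball[OF derivs_finite] by blast
  have "ld f = x" unfolding leader_def
  proof (rule the_equality)
    show "x \<in> derivs f \<and> (\<forall>w'\<in>derivs f. w' \<noteq> x \<longrightarrow> elim_less w' x)" using x by blast
    fix y assume y: "y \<in> derivs f \<and> (\<forall>w'\<in>derivs f. w' \<noteq> y \<longrightarrow> elim_less w' y)"
    show "y = x"
    proof (rule ccontr)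
      assume "y \<noteq> x"
      then have "elim_less x y" "elim_less y x"
        using bspec[OF conjunct2[OF y] x(1)] bspec[OF x(2) conjunct1[OF y]] by simp_all
      then have "elim_less x x" by (rule E.trans)
      then show False by simp
    qed
  qed
  then show "ld f \<in> derivs f" "v \<in> derivs f \<Longrightarrow> E.le v (ld f)" "0 < ldeg f"
    using x deg_in_eq_0_iff[of f x] by blast+
qed

lemma E_le_not_proper: "E.le v x \<Longrightarrow> \<not> proper_derivative v x"
proof
  assume le: "E.le v x" and "proper_derivative v x"
  then obtain e where "e \<noteq> (\<lambda>_. 0)" "v = dmult e x" unfolding proper_derivative_iff by blast
  then have "elim_less x v" using E.dmult_gt by simp
  then show False using le E.trans[of x v x] by auto
qed

text \<open>Such an s inherits reducedness with respect to the other elements from f and is reduced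
  with respect to f by its smaller degree, so it is not in the ideal. It is applied to initials and
  separants.\<close>

lemma C_factor_nonzero:
  assumes f: "f \<in> C" and s: "s \<noteq> 0" "derivs s \<subseteq> derivs f" "\<And>v. deg_in s v \<le> deg_in f v" "deg_in s (ld f) < ldeg f"
  shows "evx s \<noteq> 0"
proof
  assume z: "evx s = 0"
  have "reduced_wrt elim_less s f'" if f': "f' \<in> C" for f'
  proof (cases "f' = f")
    case True
    have "\<not> proper_derivative v (ld f)" if "v \<in> derivs s" for v
      using E_le_not_proper[OF ld_props(2)[OF f, of v]] that s(2) by blast
    then show ?thesis unfolding reduced_wrt_def True using s(4) by blast
  next
    case False
    have r: "\<forall>v\<in>derivs f. \<not> proper_derivative v (ld f')" "deg_in f (ld f') < ldeg f'"
      using C_reduced[OF f' f] False by (auto simp: reduced_wrt_def)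
    then show ?thesis unfolding reduced_wrt_def using s(2) s(3)[of "ld f'"] by auto
  qed
  then have "s = 0" by (rule C_reduced_zero[OF z])
  then show False using s(1) by simp
qed

lemma initial_nonzero:
  assumes f: "f \<in> C" shows "evx (coef_in (ld f) (ldeg f) f) \<noteq> 0"
proof (rule C_factor_nonzero[OF f])
  have "f \<noteq> 0" using ld_props(1)[OF f] by auto
  then show "coef_in (ld f) (ldeg f) f \<noteq> 0" by (rule coef_in_deg_neq_0)
  have "ld f \<notin> derivs (coef_in (ld f) (ldeg f) f)" using derivs_coef_in by blast
  then show "deg_in (coef_in (ld f) (ldeg f) f) (ld f) < ldeg f" using ld_props(3)[OF f] deg_in_eq_0_iff by metis
  show "derivs (coef_in (ld f) (ldeg f) f) \<subseteq> derivs f" using derivs_coef_in[of "ld f" "ldeg f" f] by blast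
qed (rule deg_in_coef_in)

lemma separant_nonzero:
  assumes f: "f \<in> C" shows "evx (pder (ld f) f) \<noteq> 0"
  by (rule C_factor_nonzero[OF f pder_neq_0[OF char0_field_char_0 ld_props(1)[OF f]] derivs_pder deg_in_pder
        deg_in_pder_same[OF ld_props(1)[OF f]]])

text \<open>Reduction modulo a part of C, later the elements led by some x. The bound on the
  derivatives of the remainders then keeps polynomials in the x free of u.\<close>

lemma partial_reduction:
  assumes C': "C' \<subseteq> C" and A: "finite A"
  shows "\<exists>b r. evx b \<noteq> 0 \<and> (\<forall>a\<in>A. evx (r a) = evx b * evx a \<and> (\<forall>f\<in>C'. reduced_wrt elim_less (r a) f) \<and>
    (\<forall>v\<in>derivs (r a). \<exists>x\<in>(\<Union>a\<in>A. derivs a). E.le v x))"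
proof -
  define lf where "lf v = (SOME f. f \<in> C' \<and> ld f = v)" for v
  \<comment> \<open>Proper derivatives of leaders must not occur at all; this case takes precedence
    over being a leader. Autoreducedness makes \<open>lf\<close> the only element with a given
    leader.\<close>
  define bd where "bd v = (if \<exists>f\<in>C'. proper_derivative v (ld f) then Some 1
     else if \<exists>f\<in>C'. ld f = v then Some (deg_in (lf v) v) else None)" for v
  have lf: "lf v \<in> C' \<and> ld (lf v) = v" if "\<exists>f\<in>C'. ld f = v" for v
    unfolding lf_def by (rule someI_ex) (use that in blast)
  have lf_unique: "lf (ld f) = f" if f: "f \<in> C'" for f
  proof (rule ccontr)
    assume n: "lf (ld f) \<noteq> f"
    have l: "lf (ld f) \<in> C'" "ld (lf (ld f)) = ld f" using lf[of "ld f"] f by blast+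
    have "deg_in f (ld f) < deg_in (lf (ld f)) (ld f)" "deg_in (lf (ld f)) (ld f) < deg_in f (ld f)"
      using C_reduced[of "lf (ld f)" f] C_reduced[of f "lf (ld f)"] n l f C' unfolding reduced_wrt_def by auto
    then show False by simp
  qed
  define K where "K = {p. evx p = 0}"
  define M where "M = {p. evx p \<noteq> 0}"
  have I: "0 \<in> K" "\<And>a b. a \<in> K \<Longrightarrow> b \<in> K \<Longrightarrow> a + b \<in> K" "\<And>c a. c \<in> over UNIV \<Longrightarrow> a \<in> K \<Longrightarrow> c * a \<in> K"
    unfolding K_def by (simp_all add: evx_simps)
  have M: "1 \<in> M" "\<And>a b. a \<in> M \<Longrightarrow> b \<in> M \<Longrightarrow> a * b \<in> M" "M \<subseteq> over UNIV"
    unfolding M_def by (simp_all add: evx_simps subset_iff)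
  have rel: "\<exists>s\<in>M. \<exists>r\<in>over UNIV. (\<forall>v\<in>derivs s. elim_less v x) \<and> (\<forall>v\<in>derivs r. E.le v x) \<and> deg_in r x < k \<and> s * dv x ^ k - r \<in> K"
    if bx: "bd x = Some k" for x k
  proof (cases "\<exists>f\<in>C'. proper_derivative x (ld f)")
    case True
    then have k: "k = 1" using bx by (simp add: bd_def)
    from True obtain f where f: "f \<in> C'" "proper_derivative x (ld f)" by blast
    have fC: "f \<in> C" using f C' by blast
    from f(2) obtain e where e: "e \<noteq> (\<lambda>_. 0)" "x = dmult e (ld f)" unfolding proper_derivative_iff by blast
    note th = E.theta_relation[OF char0_field_char_0 drF ld_props(2)[OF fC] e(1), folded e(2)]
    show ?thesis
    proof (intro bexI conjI)
      show "pder (ld f) f \<in> M" using separant_nonzero[OF fC] by (simp add: M_def)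
      show "deg_in (pder (ld f) f * dv x ^ 1 - theta dx e f) x < k" using th(3) k by simp
      have "evx (theta dx e f) = 0" unfolding evx_theta C_zero[OF fC] by (rule theta_zero[OF drK])
      then show "pder (ld f) f * dv x ^ k - (pder (ld f) f * dv x ^ 1 - theta dx e f) \<in> K" by (simp add: K_def k)
    qed (use th in simp_all)
  next
    case False
    then have ex: "\<exists>f\<in>C'. ld f = x" and k: "k = deg_in (lf x) x" using bx by (auto simp: bd_def split: if_splits)
    define f where "f = lf x"
    have f: "f \<in> C" "x = ld f" using lf[OF ex] C' by (auto simp: f_def)
    note th = E.leader_relation[OF ld_props(2)[OF f(1)] ld_props(1)[OF f(1)], folded f(2)]
    have k': "k = deg_in f x" using k by (simp add: f_def)
    show ?thesis
    proof (intro bexI conjI)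
      show "coef_in x k f \<in> M" using initial_nonzero[OF f(1), folded f(2)] unfolding M_def k' by (rule CollectI)
      show "coef_in x k f * dv x ^ k - (coef_in x k f * dv x ^ k - f) \<in> K" using C_zero[OF f(1)] by (simp add: K_def)
    qed (use th in \<open>simp_all add: k'\<close>)
  qed
  have "\<exists>b\<in>M. \<exists>r. \<forall>a\<in>A. r a \<in> over UNIV \<and> b * a - r a \<in> K \<and> (\<forall>x k. bd x = Some k \<longrightarrow> deg_in (r a) x < k) \<and>
    (\<forall>v\<in>derivs (r a). \<exists>x\<in>(\<Union>a\<in>A. derivs a). E.le v x)"
    by (rule E.ritt_reduction[OF subring_UNIV I M rel A]) (simp_all add: subset_iff)
  then obtain b r where b: "b \<in> M" and r: "\<forall>a\<in>A. r a \<in> over UNIV \<and> b * a - r a \<in> K \<and> (\<forall>x k. bd x = Some k \<longrightarrow> deg_in (r a) x < k) \<and>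
    (\<forall>v\<in>derivs (r a). \<exists>x\<in>(\<Union>a\<in>A. derivs a). E.le v x)" by (elim bexE exE)
  have red: "reduced_wrt elim_less (r a) f" if a: "a \<in> A" and f: "f \<in> C'" for a f
  proof -
    have bda: "deg_in (r a) x < k" if "bd x = Some k" for x k using bspec[OF r a] that by blast
    show ?thesis unfolding reduced_wrt_def
    proof (intro conjI ballI notI)
      fix v assume v: "v \<in> derivs (r a)" "proper_derivative v (ld f)"
      then have "bd v = Some 1" using f unfolding bd_def by auto
      then show False using bda[of v 1] v(1) deg_in_eq_0_iff[of "r a" v] by simp
    next
      show "deg_in (r a) (ld f) < ldeg f"
      proof (cases "\<exists>f'\<in>C'. proper_derivative (ld f) (ld f')")
        case True
        then have "bd (ld f) = Some 1" by (simp add: bd_def)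
        then show ?thesis using bda[of "ld f" 1] ld_props(3)[of f] f C' by auto
      next
        case False
        then have "bd (ld f) = Some (ldeg f)" using f lf_unique[OF f] by (auto simp: bd_def)
        then show ?thesis by (rule bda)
      qed
    qed
  qed
  show ?thesis
  proof (intro exI conjI ballI)
    show "evx b \<noteq> 0" using b by (simp add: M_def)
    fix a assume a: "a \<in> A"
    have "b * a - r a \<in> K" using bspec[OF r a] by blast
    then show "evx (r a) = evx b * evx a" by (simp add: K_def evx_simps)
    show "reduced_wrt elim_less (r a) f" if "f \<in> C'" for f by (rule red[OF a that])
    show "\<exists>x\<in>(\<Union>a\<in>A. derivs a). E.le v x" if "v \<in> derivs (r a)" for v using bspec[OF r a] that by blast
  qed
qed

section \<open>Relations over G and the elements of the characteristic set led by some u\<close>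

abbreviation GG :: "'k set" where "GG \<equiv> FG (range w)"

lemma isX_le: "elim_less v x \<Longrightarrow> isX x \<Longrightarrow> isX v"
  by (cases v rule: toU_cases; cases x rule: toU_cases) (auto simp: elim_less_def toU_def isX_def)

text \<open>Clear denominators in g and reduce its coefficients modulo the elements led by some x.
  The lift h is a nonzero element of the ideal, reduced with respect to those elements, so an
  element f led by some u obstructs its reducedness; since h has no greater degree than g in any
  derivative of u, f obstructs g as well.\<close>

lemma coefficient_reduction:
  assumes g: "g \<in> over GG" "g \<noteq> 0" "ev g = 0"
  shows "\<exists>f\<in>C. \<exists>v. ld f = toU v \<and> ((\<exists>x\<in>derivs g. proper_derivative x v) \<or> ldeg f \<le> deg_in g v)"
proof -
  let ?S = "xring (\<lambda>x. x) (range \<iota>) \<xi> UNIV"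
  have "lk g ` ks g \<subseteq> fracs ?S" using FG_subset_fracs[of w] g(1) by (auto dest: overD)
  from fracs_common_denominator[OF subring_xring[OF FR rhom_on_id] _ this]
  obtain b0 where b0: "b0 \<in> ?S" "b0 \<noteq> 0" "\<forall>s\<in>lk g ` ks g. b0 * s \<in> ?S" by auto
  have "\<forall>m\<in>ks g. \<exists>a. (\<forall>v\<in>derivs a. isX v) \<and> evx a = b0 * lk g m"
  proof
    fix m assume "m \<in> ks g"
    then have "b0 * lk g m \<in> ?S" using b0(3) by blast
    from xring_lift[OF FR rhom_on_id this, where 'n = 'n and \<nu> = val]
    obtain p :: "('m,('r,'n) xu,'k) dpoly" where p: "p \<in> over (range \<iota>)" "derivs p \<subseteq> {w. \<exists>j\<in>UNIV. fst w = X j}" "b0 * lk g m = pe gp p" by blast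
    from over_range_descend[OF \<iota>_inj \<iota>0 p(1)] obtain p' where p': "derivs p' = derivs p" "\<forall>\<rho>. peval \<iota> \<rho> p' = pe \<rho> p" by blast
    have "\<forall>v\<in>derivs p'. isX v" using p(2) unfolding p'(1) isX_def by blast
    then show "\<exists>a. (\<forall>v\<in>derivs a. isX v) \<and> evx a = b0 * lk g m" using p(3) p'(2) by metis
  qed
  from bchoice[OF this] obtain a where a: "\<forall>m\<in>ks g. (\<forall>v\<in>derivs (a m). isX v) \<and> evx (a m) = b0 * lk g m" by blast
  define CX where "CX = {f \<in> C. isX (ld f)}"
  have "CX \<subseteq> C" by (auto simp: CX_def)
  from partial_reduction[OF this, of "a ` ks g"] obtain b r where br: "evx b \<noteq> 0"
    "\<forall>x\<in>a ` ks g. evx (r x) = evx b * evx x \<and> (\<forall>f\<in>CX. reduced_wrt elim_less (r x) f) \<and>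
      (\<forall>v\<in>derivs (r x). \<exists>y\<in>(\<Union>x\<in>a ` ks g. derivs x). E.le v y)" by auto
  define a' where "a' m = r (a m)" for m
  have a'X: "isX v" if "m \<in> ks g" "v \<in> derivs (a' m)" for m v
  proof -
    have "\<forall>v\<in>derivs (r (a m)). \<exists>y\<in>(\<Union>x\<in>a ` ks g. derivs x). E.le v y"
      using bspec[OF br(2) imageI[OF that(1)]] by (elim conjE)
    from bspec[OF this that(2)[unfolded a'_def]] obtain y where "y \<in> (\<Union>x\<in>a ` ks g. derivs x)" "E.le v y" by (elim bexE)
    moreover from this(1) have "isX y" using a by blast
    ultimately show ?thesis using isX_le by blast
  qed
  have a'ev: "evx (a' m) = evx b * b0 * lk g m" if "m \<in> ks g" for m using br(2) a that by (simp add: a'_def)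
  have a'red: "reduced_wrt elim_less (a' m) f" if "m \<in> ks g" "f \<in> CX" for m f using br(2) that by (simp add: a'_def)
  define h where "h = lift a' g"
  have ph: "psub \<iota> \<xi> h = dconst (evx b * b0) * g" unfolding h_def by (rule lift_psub[OF \<iota>hom a'X a'ev])
  have "evx h = ev (psub \<iota> \<xi> h)" by (rule peval_psub[OF \<iota>hom, symmetric])
  then have hz: "evx h = 0" unfolding ph by (simp add: pe_simps g(3))
  have "dconst (evx b * b0) * g \<noteq> 0"
  proof
    assume "dconst (evx b * b0) * g = 0"
    then have "lk (dconst (evx b * b0) * g) m = 0" for m by simp
    then have "g = 0" using br(1) b0(2) by (intro poly_mapping_eqI) (simp add: lookup_dconst_mult)
    then show False using g(2) by simp
  qed
  then have "h \<noteq> 0" using ph by (auto simp: psub_def)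
  then obtain f where f: "f \<in> C" "\<not> reduced_wrt elim_less h f" using C_reduced_zero[OF hz] by blast
  have nX: "\<not> isX (ld f)"
  proof
    assume X: "isX (ld f)"
    then have fX: "f \<in> CX" using f(1) by (simp add: CX_def)
    have "\<not> proper_derivative v (ld f)" if v: "v \<in> derivs h" for v
    proof
      assume pv: "proper_derivative v (ld f)"
      then have vX: "isX v" using X by (auto simp: proper_derivative_def isX_def)
      have "deg_in (a' m) v \<le> 0" if "m \<in> ks g" for m
        using a'red[OF that fX] pv deg_in_eq_0_iff[of "a' m" v] unfolding reduced_wrt_def by auto
      then have "deg_in h v \<le> 0" unfolding h_def by (rule deg_in_lift_X[OF vX])
      then show False using v deg_in_eq_0_iff[of h v] by simp
    qed
    moreover have "deg_in h (ld f) \<le> ldeg f - 1" unfolding h_def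
    proof (rule deg_in_lift_X[OF X])
      fix m assume "m \<in> ks g"
      then show "deg_in (a' m) (ld f) \<le> ldeg f - 1" using a'red[OF _ fX, of m] unfolding reduced_wrt_def by linarith
    qed
    ultimately have "reduced_wrt elim_less h f" using ld_props(3)[OF f(1)] unfolding reduced_wrt_def by fastforce
    then show False using f(2) by simp
  qed
  then obtain v where v: "ld f = toU v" by (cases "ld f" rule: toU_cases) auto
  have dU: "deg_in h (toU x) \<le> deg_in g x" for x unfolding h_def by (rule deg_in_lift_U[OF a'X])
  have "(\<exists>x\<in>derivs g. proper_derivative x v) \<or> ldeg f \<le> deg_in g v"
  proof (rule disjCI)
    assume "\<not> ldeg f \<le> deg_in g v"
    then have "deg_in h (ld f) < ldeg f" using dU[of v] v by simp
    then obtain y where y: "y \<in> derivs h" "proper_derivative y (toU v)" using f(2) v unfolding reduced_wrt_def by auto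
    obtain x where x: "y = toU x" using y(2) by (cases y rule: toU_cases) (auto simp: proper_derivative_def toU_def)
    have "proper_derivative x v" using y(2) by (simp add: x proper_derivative_def toU_def)
    moreover have "x \<in> derivs g" using y(1) dU[of x] deg_in_eq_0_iff[of g x] deg_in_eq_0_iff[of h y] x by auto
    ultimately show "\<exists>x\<in>derivs g. proper_derivative x v" by blast
  qed
  then show ?thesis using f(1) v by blast
qed

lemma GG_props: "subring GG" "range \<iota> \<subseteq> GG" "\<xi> j e \<in> GG" "GG \<subseteq> FU" "delta_subfield \<delta> GG"
proof -
  show ds: "delta_subfield \<delta> GG" and "range \<iota> \<subseteq> GG" by (rule FG_delta_subfield)+
  show "subring GG" using subfield_subring[OF delta_subfield_subfield[OF ds]] .
  have "w j \<in> GG" using FG_delta_subfield(3)[of "range w"] by blast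
  then show "\<xi> j e \<in> GG" by (intro theta_closed[of \<delta> GG, OF dcomm]) (use ds in \<open>auto simp: delta_subfield_def\<close>)
  have "w j \<in> FU" for j
  proof -
    obtain p q where pq: "w j = peval \<iota> val p / peval \<iota> val q" using wfrac[of j] unfolding dpoly_eval_u by blast
    have "peval \<iota> val p' \<in> FU" for p' by (rule peval_in[OF subring_UNIV \<iota>hom over_UNIV FUR]) (use F_FU val_FU in auto)
    then show ?thesis unfolding pq by (intro subfield_divide[OF FU_subfield])
  qed
  then show "GG \<subseteq> FU" by (intro FG_least FU_delta_subfield F_FU) auto
qed

lemma psub_props:
  assumes f: "f \<in> C" "ld f = toU v"
  shows "psub \<iota> \<xi> f \<in> over GG" "ev (psub \<iota> \<xi> f) = 0" "psub \<iota> \<xi> f \<noteq> 0"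
    "x \<in> derivs (psub \<iota> \<xi> f) \<Longrightarrow> toU x \<in> derivs f" "x \<in> derivs (psub \<iota> \<xi> f) \<Longrightarrow> le x v"
proof -
  show "psub \<iota> \<xi> f \<in> over GG" unfolding psub_def
  proof (rule peval_in[OF subring_UNIV _ over_UNIV subring_over[OF GG_props(1)]])
    show "rhom_on UNIV (\<lambda>c. dconst (\<iota> c) :: ('m,'n,'k) dpoly)"
      using \<iota>hom[of UNIV] by (simp add: rhom_on_def dconst_add dconst_mult)
    show "dconst (\<iota> c) \<in> over GG" for c using GG_props(2) by (intro over_dconst GG_props(1)) auto
    show "gen (\<lambda>j e. dconst (\<xi> j e)) dv x \<in> over GG" for x :: "('m,('r,'n) xu) deriv"
      by (cases x rule: toU_cases) (auto intro!: over_dconst over_dv GG_props)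
  qed
  show "ev (psub \<iota> \<xi> f) = 0" unfolding peval_psub[OF \<iota>hom] by (rule C_zero[OF f(1)])
  \<comment> \<open>The substitution commutes with \<open>pder\<close>, and the separant does not
    vanish at the generic point, so f cannot become 0.\<close>
  have "ev (pder v (psub \<iota> \<xi> f)) \<noteq> 0" unfolding pder_psub[OF \<iota>hom] peval_psub[OF \<iota>hom] using separant_nonzero[OF f(1)] f(2) by simp
  moreover have "pder v (0 :: ('m,'n,'k) dpoly) = 0" by (rule pder_eq_0) simp
  ultimately show "psub \<iota> \<xi> f \<noteq> 0" by (metis peval_0)
  show *: "toU x \<in> derivs f" if "x \<in> derivs (psub \<iota> \<xi> f)" for x
    using that deg_in_psub[of \<iota> \<xi> f x] deg_in_eq_0_iff[of "psub \<iota> \<xi> f" x] deg_in_eq_0_iff[of f "toU x"] by auto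
  show "le x v" if "x \<in> derivs (psub \<iota> \<xi> f)"
    using ld_props(2)[OF f(1) *[OF that]] unfolding f(2) by (simp add: elim_less_toU)
qed

definition CU :: "('m,('r,'n) xu,'f) dpoly set" where "CU = {f \<in> C. \<not> isX (ld f)}"

text \<open>f is then the only possible obstruction in \<open>coefficient_reduction\<close>, so its
  leader and degree form a leading pair, realized by f with the x replaced by their values.\<close>

lemma Red_Alg_of_single:
  assumes "CU = {f}" shows "\<exists>t e. Red GG t e \<and> Alg GG t e"
proof -
  have f: "f \<in> C" "\<not> isX (ld f)" using assms by (auto simp: CU_def)
  then obtain v where v: "ld f = toU v" by (cases "ld f" rule: toU_cases) auto
  have red: "Red GG v (ldeg f)" unfolding Red_def
  proof (intro ballI impI, rule ccontr)
    fix g assume g: "g \<in> over GG" "ev g = 0" "\<forall>w\<in>derivs g. \<not> proper_derivative w v" "deg_in g v < ldeg f" "g \<noteq> 0"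
    from coefficient_reduction[OF g(1,5,2)] obtain f' v' where f': "f' \<in> C" "ld f' = toU v'"
      "(\<exists>x\<in>derivs g. proper_derivative x v') \<or> ldeg f' \<le> deg_in g v'" by blast
    have "f' \<in> CU" using f'(1,2) by (simp add: CU_def)
    then have "f' = f" using assms by simp
    then have "v' = v" using f'(2) v by simp
    then show False using f'(3) g(3,4) \<open>f' = f\<close> by auto
  qed
  note ps = psub_props[OF f(1) v]
  have "deg_in (psub \<iota> \<xi> f) v = ldeg f"
  proof (rule ccontr)
    assume "deg_in (psub \<iota> \<xi> f) v \<noteq> ldeg f"
    then have "deg_in (psub \<iota> \<xi> f) v < ldeg f" using deg_in_psub[of \<iota> \<xi> f v] v by simp
    then have "psub \<iota> \<xi> f = 0" using RedD[OF red ps(1,2) le_not_proper[OF ps(5)]] by blast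
    then show False using ps(3) by simp
  qed
  then have "Alg GG v (ldeg f)" unfolding Alg_def using ps ld_props(3)[OF f(1)] by (intro conjI bexI[of _ "psub \<iota> \<xi> f"]) auto
  then show ?thesis using red by blast
qed

text \<open>An f that obstructs A has a leader at most t, and \<open>Red\<close> excludes anything
  smaller than (t, e) for its image, so f has leader t and degree e. Any other element led by some u
  is reduced with respect to f, so its image would be reduced with respect to (t, e), vanish at u
  and yet be nonzero.\<close>

lemma single_of_Red_Alg:
  assumes red: "Red GG t e" and alg: "Alg GG t e" shows "\<exists>f. CU = {f}"
proof -
  from alg obtain A where A: "1 \<le> e" "A \<in> over GG" "ev A = 0" "\<forall>w\<in>derivs A. le w t" "deg_in A t = e" unfolding Alg_def by blast
  have "A \<noteq> 0" using A(1,5) by auto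
  from coefficient_reduction[OF A(2) this A(3)] obtain f v where f: "f \<in> C" "ld f = toU v"
    "(\<exists>x\<in>derivs A. proper_derivative x v) \<or> ldeg f \<le> deg_in A v" by blast
  note ps = psub_props[OF f(1,2)]
  have vt: "le v t"
  proof (cases "\<exists>x\<in>derivs A. proper_derivative x v")
    case True
    then obtain x where x: "x \<in> derivs A" "proper_derivative x v" by blast
    then obtain e where e: "e \<noteq> (\<lambda>_. 0)" "x = dmult e v" unfolding proper_derivative_iff by blast
    have "nless v x" unfolding e(2) by (rule dmult_gt[OF e(1)])
    moreover have "le x t" using A(4) x(1) by blast
    ultimately show ?thesis using trans[of v x t] by blast
  next
    case False
    then have "deg_in A v \<noteq> 0" using f(3) ld_props(3)[OF f(1)] by simp
    then have "v \<in> derivs A" using deg_in_eq_0_iff[of A v] by simp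
    then show ?thesis by (rule bspec[OF A(4)])
  qed
  have et: "e \<le> deg_in (psub \<iota> \<xi> f) t"
  proof (rule ccontr)
    assume "\<not> ?thesis"
    then have lt: "deg_in (psub \<iota> \<xi> f) t < e" by simp
    have "le x t" if "x \<in> derivs (psub \<iota> \<xi> f)" for x using ps(5)[OF that] vt trans[of x v t] by blast
    then have "psub \<iota> \<xi> f = 0" using RedD[OF red ps(1,2) le_not_proper lt] by blast
    then show False using ps(3) by simp
  qed
  then have "t \<in> derivs (psub \<iota> \<xi> f)" using A(1) deg_in_eq_0_iff[of "psub \<iota> \<xi> f" t] by linarith
  then have "le t v" by (rule ps(5))
  then have tv: "v = t" using vt trans[of t v t] irrefl[of t] by blast
  have "\<not> (\<exists>x\<in>derivs A. proper_derivative x v)" using A(4) le_not_proper tv by blast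
  then have lf: "ldeg f = e" using f(3) A(5) et deg_in_psub[of \<iota> \<xi> f t] f(2) by (simp add: tv)
  have "f' = f" if f': "f' \<in> C" "\<not> isX (ld f')" for f'
  proof (rule ccontr)
    assume "f' \<noteq> f"
    then have r: "\<forall>w\<in>derivs f'. \<not> proper_derivative w (toU t)" "deg_in f' (toU t) < e"
      using C_reduced[OF f(1) f'(1)] lf f(2) by (auto simp: reduced_wrt_def tv)
    obtain v' where v': "ld f' = toU v'" using f'(2) by (cases "ld f'" rule: toU_cases) auto
    note ps' = psub_props[OF f'(1) v']
    have np: "\<not> proper_derivative x t" if "x \<in> derivs (psub \<iota> \<xi> f')" for x
    proof -
      have "\<not> proper_derivative (toU x) (toU t :: ('m,('r,'n) xu) deriv)" using r(1) ps'(4)[OF that] by blast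
      then show ?thesis by (simp add: proper_derivative_def toU_def)
    qed
    have "deg_in (psub \<iota> \<xi> f') t < e" using deg_in_psub[of \<iota> \<xi> f' t] r(2) by simp
    then have "psub \<iota> \<xi> f' = 0" using RedD[OF red ps'(1,2) np] by blast
    then show False using ps'(3) by simp
  qed
  moreover have "f \<in> CU" using f(1,2) by (simp add: CU_def)
  ultimately have "CU = {f}" unfolding CU_def by blast
  then show ?thesis by blast
qed

end

subsection \<open>Growth of the number of derivatives of bounded order\<close>

definition nexp :: "'m::finite itself \<Rightarrow> nat \<Rightarrow> nat" where
  "nexp _ s = card {e :: 'm \<Rightarrow> nat. sum e UNIV \<le> s}"

lemma nexp_pos: "0 < nexp TYPE('m::finite) s"
proof -
  have "(\<lambda>_. 0) \<in> {e :: 'm \<Rightarrow> nat. sum e UNIV \<le> s}" by simp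
  then show ?thesis unfolding nexp_def using finite_exponents[of s] card_gt_0_iff by blast
qed

lemma nexp_le: "nexp TYPE('m::finite) s \<le> (s + 1) ^ CARD('m)"
proof -
  have "nexp TYPE('m) s \<le> card (PiE (UNIV :: 'm set) (\<lambda>_. {..s}))" unfolding nexp_def
  proof (rule card_mono)
    show "{e :: 'm \<Rightarrow> nat. sum e UNIV \<le> s} \<subseteq> PiE UNIV (\<lambda>_. {..s})"
    proof
      fix e :: "'m \<Rightarrow> nat" assume "e \<in> {e. sum e UNIV \<le> s}"
      then have "e i \<le> s" for i using member_le_sum[of i UNIV e] by simp
      then show "e \<in> PiE UNIV (\<lambda>_. {..s})" by auto
    qed
  qed (simp add: finite_PiE)
  then show ?thesis by (simp add: card_PiE)
qed

text \<open>Otherwise each step by c would multiply the number of operators by at least (K + 1) / K,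
  giving exponential growth against the polynomial bound \<open>nexp_le\<close>.\<close>

lemma nexp_growth:
  "\<exists>s. K * nexp TYPE('m::finite) (s + c) < (K + 1) * nexp TYPE('m) s"
proof (rule ccontr)
  let ?N = "nexp TYPE('m)"
  assume "\<not> ?thesis"
  then have st: "(K + 1) * ?N s \<le> K * ?N (s + c)" for s by (auto simp: not_less)
  have it: "(K + 1) ^ j * ?N 0 \<le> K ^ j * ?N (j * c)" for j
  proof (induction j)
    case (Suc j)
    have "(K + 1) ^ Suc j * ?N 0 = (K + 1) * ((K + 1) ^ j * ?N 0)" by (simp only: power_Suc mult.assoc)
    also have "\<dots> \<le> (K + 1) * (K ^ j * ?N (j * c))" by (rule mult_le_mono2[OF Suc])
    also have "\<dots> = K ^ j * ((K + 1) * ?N (j * c))" by (simp only: mult_ac)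
    also have "\<dots> \<le> K ^ j * (K * ?N (j * c + c))" by (rule mult_le_mono2[OF st])
    also have "\<dots> = K ^ Suc j * ?N (Suc j * c)" by (simp add: mult_ac add.commute)
    finally show ?case .
  qed simp
  have K: "1 \<le> K" using st[of 0] nexp_pos[where 'm = 'm, of 0] by (cases K) auto
  have bern: "K ^ i * (K + i) \<le> K * (K + 1) ^ i" for i
  proof (induction i)
    case (Suc i)
    have "K ^ Suc i * (K + Suc i) \<le> (K + 1) * (K ^ i * (K + i))" by (simp add: algebra_simps)
    also have "\<dots> \<le> (K + 1) * (K * (K + 1) ^ i)" by (rule mult_le_mono2[OF Suc])
    also have "\<dots> = K * (K + 1) ^ Suc i" by (simp only: power_Suc mult_ac)
    finally show ?case .
  qed simp
  define m where "m = CARD('m)"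
  \<comment> \<open>q (1 + i) bounds j c + 1. The factor m + 1 in j turns Bernoulli's linear lower
    bound into one of degree m + 1, which exceeds the upper bound of degree m at i = K^(m+1)
    q^m.\<close>
  define q where "q = (m + 1) * c + 1"
  define i where "i = K ^ (m + 1) * q ^ m"
  define j where "j = i * (m + 1)"
  have "K ^ i * (1 + i) \<le> K ^ i * (K + i)" by (rule mult_le_mono2) (use K in simp)
  then have b: "K ^ i * (1 + i) \<le> K * (K + 1) ^ i" using bern[of i] by linarith
  have pos: "0 < K ^ j" using K by simp
  have jc: "j * c + 1 \<le> q * (1 + i)" unfolding j_def q_def by (simp add: algebra_simps)
  have "(K + 1) ^ j \<le> (K + 1) ^ j * ?N 0" using nexp_pos[where 'm = 'm, of 0] by simp
  also have "\<dots> \<le> K ^ j * ?N (j * c)" by (rule it)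
  also have "\<dots> \<le> K ^ j * (j * c + 1) ^ m" unfolding m_def by (rule mult_le_mono2[OF nexp_le])
  also have "\<dots> \<le> K ^ j * (q * (1 + i)) ^ m" by (rule mult_le_mono2[OF power_mono[OF jc]]) simp
  finally have up: "(K + 1) ^ j \<le> K ^ j * (q * (1 + i)) ^ m" .
  have "K ^ j * (1 + i) ^ (m + 1) = (K ^ i * (1 + i)) ^ (m + 1)" unfolding j_def power_mult_distrib power_mult ..
  also have "\<dots> \<le> (K * (K + 1) ^ i) ^ (m + 1)" by (rule power_mono[OF b]) simp
  also have "\<dots> = K ^ (m + 1) * (K + 1) ^ j" unfolding j_def power_mult_distrib power_mult ..
  also have "\<dots> \<le> K ^ (m + 1) * (K ^ j * (q * (1 + i)) ^ m)" by (rule mult_le_mono2[OF up])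
  also have "\<dots> = K ^ j * (i * (1 + i) ^ m)" unfolding i_def power_mult_distrib by (simp only: mult_ac)
  finally have "(1 + i) ^ (m + 1) \<le> i * (1 + i) ^ m" using pos by simp
  then have "(1 + i) * (1 + i) ^ m \<le> i * (1 + i) ^ m" by simp
  then show False by simp
qed

lemma finite_xu: "finite (A :: ('r::finite,'n::finite) xu set)"
proof (rule finite_subset)
  show "A \<subseteq> range X \<union> range U"
  proof
    fix z show "z \<in> range X \<union> range U" by (cases z) auto
  qed
qed simp

lemma derivs_dpoly_deriv_subset:
  assumes "delta_ring d"
  shows "derivs (dpoly_deriv d i p) \<subseteq> derivs p \<union> deriv_shift i ` derivs p"
proof -
  have d0: "d i 0 = 0" by (rule delta_ring_0[OF assms])
  have "dpoly_deriv d i p = cder (d i) p + (\<Sum>v\<in>derivs p. pder v p * dv (deriv_shift i v))"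
    unfolding dpoly_deriv_eq_mder by (rule mder_expand[of "derivs p" p "d i" "\<lambda>v. dv (deriv_shift i v)", OF derivs_finite subset_refl d0])
  moreover have "derivs (cder (d i) p) \<subseteq> derivs p"
  proof -
    have "ks (cder (d i) p) \<subseteq> ks p"
    proof
      fix t assume "t \<in> ks (cder (d i) p)"
      then show "t \<in> ks p" using d0 by (cases "lk p t = 0") (simp_all add: in_keys_iff lookup_cder[of "d i", OF d0])
    qed
    then show ?thesis unfolding derivs_def by blast
  qed
  moreover have "derivs (\<Sum>v\<in>derivs p. pder v p * dv (deriv_shift i v)) \<subseteq> derivs p \<union> deriv_shift i ` derivs p"
  proof (rule order_trans[OF derivs_sum], rule UN_least)
    fix v assume "v \<in> derivs p"
    then show "derivs (pder v p * dv (deriv_shift i v)) \<subseteq> derivs p \<union> deriv_shift i ` derivs p"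
      using derivs_mult[of "pder v p" "dv (deriv_shift i v)"] derivs_pder[of v p] by auto
  qed
  ultimately show ?thesis using derivs_add by fastforce
qed

subsection \<open>Counting monomials: algebraic dependence\<close>

context generic_point
begin

text \<open>Counting: the monomials of degree at most B in each element of T outnumber, for large B,
  the monomials in S that occur in their values multiplied by a fixed power of the common
  denominator. Linear algebra over F gives a relation.\<close>

lemma algebraic_dependence:
  fixes \<rho> :: "('m,'v) deriv \<Rightarrow> 'k"
  assumes T: "finite T" and S: "finite S" "card S < card T"
    and \<rho>: "\<And>t. t \<in> T \<Longrightarrow> \<rho> t \<in> FU \<and> {v. pd v (\<rho> t) \<noteq> 0} \<subseteq> S"
  shows "\<exists>p :: ('m,'v,'f) dpoly. p \<noteq> 0 \<and> derivs p \<subseteq> T \<and> peval \<iota> \<rho> p = 0"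
proof -
  have "\<exists>b\<in>over (range \<iota>). b \<noteq> 0 \<and> derivs b \<subseteq> S \<and> (\<exists>a. \<forall>s\<in>\<rho> ` T. a s \<in> over (range \<iota>) \<and> derivs (a s) \<subseteq> S \<and> ev (a s) = s * ev b)"
    by (rule common_denominator) (use T \<rho> in blast)+
  then obtain b a where b: "b \<in> over (range \<iota>)" "b \<noteq> 0" "derivs b \<subseteq> S"
    and a: "\<forall>s\<in>\<rho> ` T. a s \<in> over (range \<iota>) \<and> derivs (a s) \<subseteq> S \<and> ev (a s) = s * ev b" by (elim bexE exE conjE)
  have a': "a (\<rho> t) \<in> over (range \<iota>)" "derivs (a (\<rho> t)) \<subseteq> S" "ev (a (\<rho> t)) = \<rho> t * ev b" if "t \<in> T" for t
    using bspec[OF a imageI[OF that]] by blast+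
  have evb: "ev b \<noteq> 0" using b ev_eq_0 by blast
  define Y where "Y = insert b (a ` \<rho> ` T)"
  have finY: "finite Y" using T by (simp add: Y_def)
  define D where "D = (\<Sum>q\<in>Y. \<Sum>v\<in>S. deg_in q v)"
  have D: "deg_in q v \<le> D" if "q \<in> Y" for q v
  proof (cases "v \<in> S")
    case True
    have "deg_in q v \<le> (\<Sum>v\<in>S. deg_in q v)" by (rule member_le_sum[OF True _ S(1)]) simp
    also have "\<dots> \<le> D" unfolding D_def by (rule member_le_sum[OF that _ finY]) simp
    finally show ?thesis .
  next
    case False
    have "derivs q \<subseteq> S" using that b(3) a'(2) by (auto simp: Y_def)
    then have "deg_in q v = 0" using False deg_in_eq_0_iff[of q v] by blast
    then show ?thesis by simp
  qed
  \<comment> \<open>Chosen so that (N + 1)^|S| \<le> (q (B + 1))^|S| = B (B + 1)^|S| < (B + 1)^(|S|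
    + 1) \<le> (B + 1)^|T|.\<close>
  define q where "q = card T * D + 1"
  define B where "B = q ^ card S"
  define N where "N = card T * B * D"
  define Mo where "Mo = PiE T (\<lambda>_. {..B})"
  define Qp where "Qp \<mu> = (\<Prod>t\<in>T. a (\<rho> t) ^ \<mu> t * b ^ (B - \<mu> t))" for \<mu>
  have Mo: "finite Mo" "card Mo = (B + 1) ^ card T" unfolding Mo_def using T by (simp_all add: finite_PiE card_PiE)
  have \<mu>B: "\<mu> t \<le> B" if "\<mu> \<in> Mo" "t \<in> T" for \<mu> t using that by (auto simp: Mo_def dest: PiE_mem)
  have Qdeg: "deg_in (Qp \<mu>) v \<le> N" if \<mu>: "\<mu> \<in> Mo" for \<mu> v
  proof -
    have "deg_in (Qp \<mu>) v \<le> (\<Sum>t\<in>T. deg_in (a (\<rho> t) ^ \<mu> t * b ^ (B - \<mu> t)) v)" unfolding Qp_def by (rule deg_in_prod)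
    also have "\<dots> \<le> (\<Sum>t\<in>T. B * D)"
    proof (rule sum_mono)
      fix t assume t: "t \<in> T"
      have 1: "deg_in (a (\<rho> t) ^ \<mu> t) v \<le> \<mu> t * D"
        by (rule order_trans[OF deg_in_power mult_le_mono2[OF D]]) (use t in \<open>simp add: Y_def\<close>)
      have 2: "deg_in (b ^ (B - \<mu> t)) v \<le> (B - \<mu> t) * D"
        by (rule order_trans[OF deg_in_power mult_le_mono2[OF D]]) (simp add: Y_def)
      have "\<mu> t * D + (B - \<mu> t) * D = B * D" using \<mu>B[OF \<mu> t] by (simp add: add_mult_distrib[symmetric])
      then show "deg_in (a (\<rho> t) ^ \<mu> t * b ^ (B - \<mu> t)) v \<le> B * D"
        using deg_in_mult[of "a (\<rho> t) ^ \<mu> t" "b ^ (B - \<mu> t)" v] 1 2 by linarith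
    qed
    finally show ?thesis by (simp add: N_def mult.assoc)
  qed
  have Qder: "derivs (Qp \<mu>) \<subseteq> S" for \<mu>
    unfolding Qp_def
  proof (rule order_trans[OF derivs_prod], rule UN_least)
    fix t assume t: "t \<in> T"
    show "derivs (a (\<rho> t) ^ \<mu> t * b ^ (B - \<mu> t)) \<subseteq> S"
      using derivs_mult[of "a (\<rho> t) ^ \<mu> t" "b ^ (B - \<mu> t)"] derivs_power[of "a (\<rho> t)" "\<mu> t"] derivs_power[of b "B - \<mu> t"] a'(2)[OF t] b(3) by blast
  qed
  have Qov: "Qp \<mu> \<in> over (range \<iota>)" for \<mu> unfolding Qp_def using a'(1) b(1) by (intro overI FR)
  have Qev: "ev (Qp \<mu>) = (\<Prod>t\<in>T. \<rho> t ^ \<mu> t) * ev b ^ (B * card T)" if \<mu>: "\<mu> \<in> Mo" for \<mu>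
  proof -
    have "ev (Qp \<mu>) = (\<Prod>t\<in>T. \<rho> t ^ \<mu> t * ev b ^ B)" unfolding Qp_def pe_prod
    proof (rule prod.cong[OF refl])
      fix t assume t: "t \<in> T"
      have "ev b ^ \<mu> t * ev b ^ (B - \<mu> t) = ev b ^ B" using \<mu>B[OF \<mu> t] by (simp add: power_add[symmetric])
      then show "ev (a (\<rho> t) ^ \<mu> t * b ^ (B - \<mu> t)) = \<rho> t ^ \<mu> t * ev b ^ B"
        by (simp add: pe_simps a'(3)[OF t] power_mult_distrib mult.assoc)
    qed
    then show ?thesis by (simp add: prod.distrib power_mult)
  qed
  define Ms where "Ms = {m :: ('m,'n) deriv \<Rightarrow>\<^sub>0 nat. ks m \<subseteq> S \<and> (\<forall>v. lk m v \<le> N)}"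
  let ?r = "\<lambda>m :: ('m,'n) deriv \<Rightarrow>\<^sub>0 nat. restrict (lk m) S"
  have inj: "inj_on ?r Ms"
  proof (rule inj_onI)
    fix m m' assume m: "m \<in> Ms" "m' \<in> Ms" "?r m = ?r m'"
    show "m = m'"
    proof (rule poly_mapping_eqI)
      fix v
      show "lk m v = lk m' v"
      proof (cases "v \<in> S")
        case True
        then show ?thesis using fun_cong[OF m(3), of v] by simp
      next
        case False
        then have "v \<notin> ks m" "v \<notin> ks m'" using m(1,2) by (auto simp: Ms_def)
        then show ?thesis by (simp add: in_keys_iff)
      qed
    qed
  qed
  have img: "?r ` Ms \<subseteq> PiE S (\<lambda>_. {..N})" unfolding Ms_def by auto
  have finP: "finite (PiE S (\<lambda>_. {..N}))" using S(1) by (simp add: finite_PiE)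
  have finMs: "finite Ms" by (rule inj_on_finite[OF inj img finP])
  have "card Ms \<le> card (PiE S (\<lambda>_. {..N}))" by (rule card_inj_on_le[OF inj img finP])
  then have "card Ms \<le> (N + 1) ^ card S" using S(1) by (simp add: card_PiE)
  also have "\<dots> \<le> (q * (B + 1)) ^ card S"
    by (rule power_mono) (simp_all add: N_def q_def algebra_simps)
  also have "\<dots> = B * (B + 1) ^ card S" unfolding B_def by (simp only: power_mult_distrib)
  also have "\<dots> < (B + 1) ^ Suc (card S)" by simp
  also have "\<dots> \<le> (B + 1) ^ card T" using S(2) by (intro power_increasing) simp_all
  finally have "card Ms < card Mo" unfolding Mo(2) .
  from linear_dependence[OF finMs Mo(1) this, of "\<lambda>\<mu> m. inv \<iota> (lk (Qp \<mu>) m)"]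
  obtain l where l: "\<exists>\<mu>\<in>Mo. l \<mu> \<noteq> 0" "\<forall>m\<in>Ms. (\<Sum>\<mu>\<in>Mo. l \<mu> * inv \<iota> (lk (Qp \<mu>) m)) = 0" by blast
  have zero: "(\<Sum>\<mu>\<in>Mo. dconst (\<iota> (l \<mu>)) * Qp \<mu>) = 0"
  proof (rule poly_mapping_eqI)
    fix m
    have "(\<Sum>\<mu>\<in>Mo. \<iota> (l \<mu>) * lk (Qp \<mu>) m) = 0"
    proof (cases "m \<in> Ms")
      case True
      have "\<iota> (\<Sum>\<mu>\<in>Mo. l \<mu> * inv \<iota> (lk (Qp \<mu>) m)) = (\<Sum>\<mu>\<in>Mo. \<iota> (l \<mu>) * \<iota> (inv \<iota> (lk (Qp \<mu>) m)))"
        by (simp add: rhom_on_sum[OF subring_UNIV \<iota>hom] rhom_onD(3)[OF \<iota>hom[of UNIV]])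
      also have "\<dots> = (\<Sum>\<mu>\<in>Mo. \<iota> (l \<mu>) * lk (Qp \<mu>) m)"
        using overD[OF Qov] by (simp add: f_inv_into_f)
      finally show ?thesis using bspec[OF l(2) True] \<iota>0 by simp
    next
      case False
      have "lk (Qp \<mu>) m = 0" if \<mu>: "\<mu> \<in> Mo" for \<mu>
      proof (rule ccontr)
        assume "lk (Qp \<mu>) m \<noteq> 0"
        then have mk: "m \<in> ks (Qp \<mu>)" by (simp add: in_keys_iff)
        have "ks m \<subseteq> S" using derivsI[OF mk] Qder by blast
        moreover have "lk m v \<le> N" for v using lookup_le_deg_in[OF mk, of v] Qdeg[OF \<mu>, of v] by linarith
        ultimately show False using False by (simp add: Ms_def)
      qed
      then show ?thesis by simp
    qed
    then show "lk (\<Sum>\<mu>\<in>Mo. dconst (\<iota> (l \<mu>)) * Qp \<mu>) m = lk 0 m" by (simp add: lookup_sum lookup_dconst_mult)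
  qed
  define mon :: "(('m,'v) deriv \<Rightarrow> nat) \<Rightarrow> (('m,'v) deriv \<Rightarrow>\<^sub>0 nat)" where "mon \<mu> = (\<Sum>t\<in>T. sg t (\<mu> t))" for \<mu>
  have lmon: "lk (mon \<mu>) t = (if t \<in> T then \<mu> t else 0)" for \<mu> t
    unfolding mon_def using T by (simp add: lookup_sum lookup_single when_def sum.delta)
  have mon_inj: "\<mu> = \<mu>'" if "\<mu> \<in> Mo" "\<mu>' \<in> Mo" "mon \<mu> = mon \<mu>'" for \<mu> \<mu>'
  proof (rule PiE_ext[of _ T "\<lambda>_. {..B}"])
    show "\<mu> \<in> PiE T (\<lambda>_. {..B})" "\<mu>' \<in> PiE T (\<lambda>_. {..B})" using that by (simp_all add: Mo_def)
    fix t assume "t \<in> T"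
    then show "\<mu> t = \<mu>' t" using lmon[of \<mu> t] lmon[of \<mu>' t] that(3) by simp
  qed
  define p where "p = (\<Sum>\<mu>\<in>Mo. sg (mon \<mu>) (l \<mu>))"
  have "p \<noteq> 0"
  proof
    assume p0: "p = 0"
    from l(1) obtain \<mu>0 where \<mu>0: "\<mu>0 \<in> Mo" "l \<mu>0 \<noteq> 0" by blast
    have "lk p (mon \<mu>0) = (\<Sum>\<mu>\<in>Mo. if \<mu> = \<mu>0 then l \<mu> else 0)"
      unfolding p_def lookup_sum by (rule sum.cong) (use mon_inj \<mu>0(1) in \<open>auto simp: lookup_single when_def\<close>)
    then show False using p0 \<mu>0 Mo(1) by (simp add: sum.delta)
  qed
  moreover have "derivs p \<subseteq> T" unfolding p_def
  proof (rule order_trans[OF derivs_sum], rule UN_least)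
    fix \<mu>
    have "ks (mon \<mu>) \<subseteq> T" using lmon[of \<mu>] by (auto simp: in_keys_iff split: if_splits)
    then show "derivs (sg (mon \<mu>) (l \<mu>)) \<subseteq> T" by (auto simp: derivs_def split: if_splits)
  qed
  moreover have "peval \<iota> \<rho> p = 0"
  proof -
    have mv: "mono_val (mon \<mu>) \<rho> = (\<Prod>t\<in>T. \<rho> t ^ \<mu> t)" for \<mu>
    proof -
      have "ks (mon \<mu>) \<subseteq> T" using lmon[of \<mu>] by (auto simp: in_keys_iff split: if_splits)
      from mono_val_superset[OF T this, of \<rho>] show ?thesis by (simp add: lmon)
    qed
    have "peval \<iota> \<rho> p * ev b ^ (B * card T) = (\<Sum>\<mu>\<in>Mo. \<iota> (l \<mu>) * ev (Qp \<mu>))"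
      unfolding p_def
      by (simp add: peval_sum[OF subring_UNIV \<iota>hom] peval_single[OF subring_UNIV \<iota>hom] mv Qev sum_distrib_right mult.assoc)
    also have "\<dots> = ev (\<Sum>\<mu>\<in>Mo. dconst (\<iota> (l \<mu>)) * Qp \<mu>)" by (simp add: pe_simps)
    finally show ?thesis unfolding zero using evb by simp
  qed
  ultimately show ?thesis by blast
qed

lemma gp_theta: "gp (z, e) = theta \<delta> e (gp (z, \<lambda>_. 0))"
  by (cases z) (simp_all add: val_def)

lemma gp_FU: "gp v \<in> FU"
proof (cases v rule: toU_cases)
  case (1 j e)
  obtain p q where pq: "w j = peval \<iota> val p / peval \<iota> val q" using wfrac[of j] unfolding dpoly_eval_u by blast
  have "peval \<iota> val p' \<in> FU" for p' by (rule peval_in[OF subring_UNIV \<iota>hom over_UNIV FUR]) (use F_FU val_FU in auto)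
  then have wj: "w j \<in> FU" unfolding pq by (intro subfield_divide[OF FU_subfield])
  show ?thesis unfolding 1 gen_simps by (rule theta_closed[of \<delta> FU, OF dcomm FU_delta wj])
qed (simp add: val_FU)

lemma pd_order_delta:
  assumes a: "a \<in> FU" "\<And>v. s < sum (snd v) UNIV \<Longrightarrow> pd v a = 0" and v: "Suc s < sum (snd v) UNIV"
  shows "pd v (\<delta> i a) = 0"
proof (cases "v \<in> range (deriv_shift i)")
  case True
  then obtain v' where v': "v = deriv_shift i v'" by blast
  have "sum (snd v) UNIV = Suc (sum (snd v') UNIV)" unfolding v' deriv_shift_def snd_conv by (rule sum_fun_upd_Suc)
  then have "pd v' a = 0" "pd v a = 0" using a(2) v by simp_all
  then show ?thesis using pd_delta(1)[OF a(1), of i v'] unfolding v' by (simp add: d0)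
next
  case False
  then show ?thesis using pd_delta(2)[OF a(1) False] a(2)[of v] v by (simp add: d0)
qed

lemma pd_order_theta:
  assumes a: "a \<in> FU" "\<And>v. s < sum (snd v) UNIV \<Longrightarrow> pd v a = 0"
  shows "\<forall>v. s + sum e UNIV < sum (snd v) UNIV \<longrightarrow> pd v (theta \<delta> e a) = 0"
proof (induction e rule: exponent_induct)
  case zero
  then show ?case using a(2) by simp
next
  case (Suc e i)
  have "theta \<delta> e a \<in> FU" by (rule theta_closed[of \<delta> FU, OF dcomm FU_delta a(1)])
  then show ?case using pd_order_delta[of "theta \<delta> e a" "s + sum e UNIV" _ i] Suc
    unfolding theta_Suc[of \<delta>, OF dcomm] sum_fun_upd_Suc add_Suc_right by blast
qed

text \<open>There are finitely many variables and each depends on finitely many derivatives of u;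
  every \<delta> raises the order by at most one. Hence one constant c serves for all.\<close>

lemma gp_order: "\<exists>c. \<forall>v x. c + sum (snd v) UNIV < sum (snd x) UNIV \<longrightarrow> pd x (gp v) = 0"
proof -
  define B where "B z = (\<Sum>x\<in>{x. pd x (gp (z, \<lambda>_. 0)) \<noteq> 0}. sum (snd x) UNIV)" for z
  define c where "c = (\<Sum>z\<in>UNIV. B z)"
  have 1: "pd x (gp (z, \<lambda>_. 0)) = 0" if "c < sum (snd x) UNIV" for x z
  proof (rule ccontr)
    assume n: "pd x (gp (z, \<lambda>_. 0)) \<noteq> 0"
    have "sum (snd x) UNIV \<le> B z" unfolding B_def
      by (rule member_le_sum[where f = "\<lambda>x. sum (snd x) UNIV"]) (use n finite_pd[OF gp_FU] in auto)
    also have "\<dots> \<le> c" unfolding c_def by (rule member_le_sum) (auto simp: finite_xu)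
    finally show False using that by simp
  qed
  have "pd x (gp v) = 0" if "c + sum (snd v) UNIV < sum (snd x) UNIV" for v x
  proof -
    have "\<forall>x. c + sum (snd v) UNIV < sum (snd x) UNIV \<longrightarrow> pd x (theta \<delta> (snd v) (gp (fst v, \<lambda>_. 0))) = 0"
      by (rule pd_order_theta[OF gp_FU 1])
    then show ?thesis using that unfolding gp_theta[of "fst v" "snd v", unfolded prod.collapse] by blast
  qed
  then show ?thesis by blast
qed

lemma pd_evx:
  "pd \<phi> (evx g) = (\<Sum>x\<in>derivs g. evx (pder x g) * pd \<phi> (gp x))"
proof -
  define h where "h = mapc \<iota> g"
  have lh: "lk h t = \<iota> (lk g t)" for t unfolding h_def by (rule lookup_mapc[of \<iota>, OF \<iota>0])
  have pem: "pe \<rho> (mapc \<iota> p) = peval \<iota> \<rho> p" for \<rho> and p :: "('m,('r,'n) xu,'f) dpoly"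
  proof -
    have "ks (mapc \<iota> p) = ks p" using \<iota>_eq_0 \<iota>0 by (auto simp: in_keys_iff lookup_mapc)
    then show ?thesis by (simp add: peval_def lookup_mapc[of \<iota>, OF \<iota>0])
  qed
  have dh: "derivs h = derivs g"
  proof -
    have "ks h = ks g" using \<iota>_eq_0 \<iota>0 by (auto simp: in_keys_iff lh)
    then show ?thesis by (simp add: derivs_def)
  qed
  have nat: "\<iota> (of_nat k * x) = of_nat k * \<iota> x" for k x
    by (induction k) (simp_all add: \<iota>0 rhom_onD(2)[OF \<iota>hom[of UNIV]] distrib_right)
  have ph: "pder x h = mapc \<iota> (pder x g)" for x
    by (rule poly_mapping_eqI) (simp only: lookup_pder lh lookup_mapc[of \<iota>, OF \<iota>0] nat)
  have "h \<in> over (range \<iota>)" using lh by (auto simp: over_def)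
  from pd_peval[OF this gp_FU, of \<phi>] show ?thesis unfolding dh ph pem unfolding h_def pem .
qed

end

subsection \<open>The number of leading variables\<close>

context char_point
begin

abbreviation LV :: "('r,'n) xu set" where "LV \<equiv> leading_var elim_less ` C"

text \<open>With more than n variables that are not leading, their derivatives of order up to s
  outnumber, for suitable s, the derivatives of u of order up to s + c on which they depend. The
  resulting algebraic relation involves no leading variable, so it is a nonzero element of the ideal
  reduced with respect to C.\<close>

lemma card_parametric_le: "card (- LV) \<le> CARD('n)"
proof (rule ccontr)
  assume "\<not> ?thesis"
  then have gt: "CARD('n) + 1 \<le> card (- LV)" by simp
  obtain c where c: "\<forall>v x. c + sum (snd v) UNIV < sum (snd x) UNIV \<longrightarrow> pd x (gp v) = 0" using gp_order by blast
  from nexp_growth[where 'm = 'm, of "CARD('n)" c] obtain s where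
    s: "CARD('n) * nexp TYPE('m) (s + c) < (CARD('n) + 1) * nexp TYPE('m) s" by blast
  define T where "T = (- LV) \<times> {e :: 'm \<Rightarrow> nat. sum e UNIV \<le> s}"
  define S where "S = (UNIV :: 'n set) \<times> {e :: 'm \<Rightarrow> nat. sum e UNIV \<le> s + c}"
  have fin: "finite T" "finite S" unfolding T_def S_def by (simp_all add: finite_exponents finite_xu)
  have "card S < (CARD('n) + 1) * nexp TYPE('m) s" using s by (simp add: S_def card_cartesian_product nexp_def)
  also have "\<dots> \<le> card T" using mult_le_mono1[OF gt] by (simp add: T_def card_cartesian_product nexp_def)
  finally have lt: "card S < card T" .
  have supp: "gp t \<in> FU \<and> {v. pd v (gp t) \<noteq> 0} \<subseteq> S" if "t \<in> T" for t
  proof (intro conjI subsetI gp_FU)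
    fix v assume "v \<in> {v. pd v (gp t) \<noteq> 0}"
    then have "\<not> c + sum (snd t) UNIV < sum (snd v) UNIV" using c by blast
    then have "sum (snd v) UNIV \<le> s + c" using that by (auto simp: T_def)
    then show "v \<in> S" by (auto simp: S_def mem_Times_iff)
  qed
  have "\<exists>p :: ('m,('r,'n) xu,'f) dpoly. p \<noteq> 0 \<and> derivs p \<subseteq> T \<and> evx p = 0"
    by (rule algebraic_dependence[OF fin lt supp])
  then obtain p :: "('m,('r,'n) xu,'f) dpoly" where
    p: "p \<noteq> 0" "derivs p \<subseteq> T" "evx p = 0" by (elim exE conjE)
  have "reduced_wrt elim_less p f" if f: "f \<in> C" for f
  proof -
    have L: "fst v \<noteq> fst (ld f)" if "v \<in> derivs p" for v
      using that p(2) f by (auto simp: T_def leading_var_def)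
    have "deg_in p (ld f) = 0" using L deg_in_eq_0_iff[of p "ld f"] by blast
    then show ?thesis unfolding reduced_wrt_def proper_derivative_def using L ld_props(3)[OF f] by auto
  qed
  then show False using C_reduced_zero[OF p(3)] p(1) by blast
qed

text \<open>A dimension count with gradients: derivatives of u have independent gradients, all
  spanned by those of derivatives outside the multiples of chosen leaders. Bounding the number of
  the latter by subtracting the multiples of the leaders from all derivatives of bounded order gives
  the inequality, up to a shift of the order that \<open>nexp_growth\<close> absorbs.\<close>

lemma card_parametric_ge: "CARD('n) \<le> card (- LV)"
proof -
  have "\<forall>z\<in>LV. \<exists>f. f \<in> C \<and> fst (ld f) = z" by (auto simp: leading_var_def)
  from bchoice[OF this] obtain f where f: "\<forall>z\<in>LV. f z \<in> C \<and> fst (ld (f z)) = z" by blast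
  define c where "c = (\<Sum>z\<in>LV. \<Sum>v\<in>derivs (f z). sum (snd v) UNIV)"
  \<comment> \<open>Below the leader an element may contain derivatives of higher order in smaller
    variables. A weight c per position outweighs this, since c bounds all orders in the chosen
    \<open>f z\<close>; so leaders have maximal weight and rewriting never raises weights.\<close>
  define wt :: "('m,('r,'n) xu) deriv \<Rightarrow> nat" where "wt v = sum (snd v) UNIV + c * xu_pos (fst v)" for v
  have cb: "sum (snd v) UNIV \<le> c" if "z \<in> LV" "v \<in> derivs (f z)" for z v
  proof -
    have "sum (snd v) UNIV \<le> (\<Sum>v\<in>derivs (f z). sum (snd v) UNIV)"
      by (rule member_le_sum[where f = "\<lambda>v. sum (snd v) UNIV", OF that(2)]) simp_all
    also have "\<dots> \<le> c" unfolding c_def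
      by (rule member_le_sum[where f = "\<lambda>z. \<Sum>v\<in>derivs (f z). sum (snd v) UNIV", OF that(1)]) (simp_all add: finite_xu)
    finally show ?thesis .
  qed
  have wt_shift: "wt (deriv_shift i v) = Suc (wt v)" for i v
    unfolding wt_def deriv_shift_def fst_conv snd_conv sum_fun_upd_Suc by simp
  have wt_dmult: "wt (dmult e v) = wt v + sum e UNIV" for e v
    unfolding wt_def dmult_def by (simp add: sum.distrib)
  have wt_leader: "wt v \<le> wt (ld (f z))" if z: "z \<in> LV" and v: "v \<in> derivs (f z)" for z v
  proof -
    have fz: "f z \<in> C" using f z by blast
    have "E.le v (ld (f z))" by (rule ld_props(2)[OF fz v])
    then consider "xu_less (fst v) (fst (ld (f z)))"
      | "fst v = fst (ld (f z))" "sum (snd v) UNIV \<le> sum (snd (ld (f z))) UNIV"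
      unfolding elim_less_def theta_less_def by fastforce
    then show ?thesis
    proof cases
      case 1
      have "Suc (xu_pos (fst v)) \<le> xu_pos (fst (ld (f z)))" by (rule Suc_leI[OF xu_pos_less[OF 1]])
      then have "c * Suc (xu_pos (fst v)) \<le> c * xu_pos (fst (ld (f z)))" by (rule mult_le_mono2)
      then show ?thesis unfolding wt_def using cb[OF z v] by simp
    next
      case 2
      then show ?thesis by (simp add: wt_def)
    qed
  qed
  have wt_theta: "\<forall>v\<in>derivs (theta dx e (f z)). wt v \<le> wt (ld (f z)) + sum e UNIV" if z: "z \<in> LV" for z e
  proof (induction e rule: exponent_induct)
    case zero
    then show ?case using wt_leader[OF z] by simp
  next
    case (Suc e i)
    show ?case unfolding theta_Suc[of dx, OF delta_ringD(2)[OF delta_ring_dpoly_deriv[OF drF]]] sum_fun_upd_Suc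
    proof
      fix v assume "v \<in> derivs (dx i (theta dx e (f z)))"
      then have "v \<in> derivs (theta dx e (f z)) \<or> v \<in> deriv_shift i ` derivs (theta dx e (f z))"
        using derivs_dpoly_deriv_subset[OF drF, of i "theta dx e (f z)"] by blast
      then show "wt v \<le> wt (ld (f z)) + Suc (sum e UNIV)" using Suc by (auto simp: wt_shift intro: le_SucI)
    qed
  qed
  define Irr where "Irr s = {v. wt v \<le> s \<and> \<not> (fst v \<in> LV \<and> snd (ld (f (fst v))) \<le> snd v)}" for s
  have finIrr: "finite (Irr s)" for s
  proof (rule finite_subset)
    show "Irr s \<subseteq> UNIV \<times> {e. sum e UNIV \<le> s}" unfolding Irr_def wt_def by auto
    show "finite ((UNIV :: ('r,'n) xu set) \<times> {e :: 'm \<Rightarrow> nat. sum e UNIV \<le> s})" by (simp add: finite_exponents finite_xu)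
  qed
  \<comment> \<open>The vanishing of \<theta> (f z) at the generic point, with the separant as
    partial derivative with respect to v, expresses the gradient of v by those of smaller
    derivatives of no greater weight.\<close>
  have span: "wt v \<le> s \<longrightarrow> (\<exists>a. \<forall>\<phi>. pd \<phi> (gp v) = (\<Sum>b\<in>Irr s. a b * pd \<phi> (gp b)))" for v s
  proof (induction v rule: wfp_induct_rule[OF E.wf])
    case (1 v)
    show ?case
    proof (intro impI)
      assume ws: "wt v \<le> s"
      show "\<exists>a. \<forall>\<phi>. pd \<phi> (gp v) = (\<Sum>b\<in>Irr s. a b * pd \<phi> (gp b))"
      proof (cases "v \<in> Irr s")
        case True
        have "pd \<phi> (gp v) = (\<Sum>b\<in>Irr s. (if b = v then 1 else 0) * pd \<phi> (gp b))" for \<phi>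
        proof -
          have "(\<Sum>b\<in>Irr s. (if b = v then 1 else 0) * pd \<phi> (gp b)) = (\<Sum>b\<in>Irr s. if b = v then pd \<phi> (gp b) else 0)"
            by (rule sum.cong) auto
          then show ?thesis using True finIrr by (simp add: sum.delta)
        qed
        then show ?thesis by (intro exI[of _ "\<lambda>b. if b = v then 1 else 0"]) blast
      next
        case False
        define z where "z = fst v"
        have z: "z \<in> LV" "snd (ld (f z)) \<le> snd v" using False ws by (auto simp: Irr_def z_def)
        have fz: "f z \<in> C" "fst (ld (f z)) = z" using f z(1) by blast+
        define e where "e i = snd v i - snd (ld (f z)) i" for i
        have ve: "v = dmult e (ld (f z))" unfolding dmult_def e_def
        proof (rule prod_eqI)
          show "snd v = snd (fst (ld (f z)), \<lambda>i. snd (ld (f z)) i + (snd v i - snd (ld (f z)) i))" using z(2) by (auto simp: le_fun_def fun_eq_iff)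
        qed (simp only: fst_conv fz(2) z_def[symmetric])
        define g where "g = theta dx e (f z)"
        have g0: "evx g = 0" unfolding g_def evx_theta C_zero[OF fz(1)] by (rule theta_zero[OF drK])
        have pg: "pder v g = pder (ld (f z)) (f z)" unfolding g_def ve by (rule E.leading_pder(2)[OF drF ld_props(2)[OF fz(1)]])
        define sv where "sv = evx (pder v g)"
        have sv: "sv \<noteq> 0" unfolding sv_def pg by (rule separant_nonzero[OF fz(1)])
        have vg: "v \<in> derivs g"
        proof (rule ccontr)
          assume "v \<notin> derivs g"
          then have "pder v g = 0" by (rule pder_eq_0)
          then show False using sv by (simp add: sv_def)
        qed
        have "\<exists>a. \<forall>\<phi>. pd \<phi> (gp x) = (\<Sum>b\<in>Irr s. a b * pd \<phi> (gp b))" if x: "x \<in> derivs g - {v}" for x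
        proof -
          have "E.le x v" unfolding ve using E.derivs_theta[OF char0_field_char_0 drF ld_props(2)[OF fz(1)]] x unfolding g_def by blast
          then have "elim_less x v" using x by blast
          moreover have "wt x \<le> s" using bspec[OF wt_theta[OF z(1), of e], of x] x ws unfolding ve wt_dmult g_def by simp
          ultimately show ?thesis using 1 by blast
        qed
        then have "\<forall>x\<in>derivs g - {v}. \<exists>a. \<forall>\<phi>. pd \<phi> (gp x) = (\<Sum>b\<in>Irr s. a b * pd \<phi> (gp b))" by blast
        from bchoice[OF this] obtain a where a: "\<forall>x\<in>derivs g - {v}. \<forall>\<phi>. pd \<phi> (gp x) = (\<Sum>b\<in>Irr s. a x b * pd \<phi> (gp b))" by blast
        define Sb where "Sb b = (\<Sum>x\<in>derivs g - {v}. evx (pder x g) * a x b)" for b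
        define a' where "a' b = - Sb b / sv" for b
        have "pd \<phi> (gp v) = (\<Sum>b\<in>Irr s. a' b * pd \<phi> (gp b))" for \<phi>
        proof -
          have "0 = pd \<phi> (evx g)" unfolding g0 by (rule pd_0[symmetric])
          also have "\<dots> = sv * pd \<phi> (gp v) + (\<Sum>x\<in>derivs g - {v}. evx (pder x g) * pd \<phi> (gp x))"
            unfolding pd_evx sv_def by (rule sum.remove[OF derivs_finite vg])
          also have "(\<Sum>x\<in>derivs g - {v}. evx (pder x g) * pd \<phi> (gp x))
              = (\<Sum>x\<in>derivs g - {v}. evx (pder x g) * (\<Sum>b\<in>Irr s. a x b * pd \<phi> (gp b)))"
          proof (rule sum.cong[OF refl])
            fix x assume "x \<in> derivs g - {v}"
            then have "pd \<phi> (gp x) = (\<Sum>b\<in>Irr s. a x b * pd \<phi> (gp b))" using a by blast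
            then show "evx (pder x g) * pd \<phi> (gp x) = evx (pder x g) * (\<Sum>b\<in>Irr s. a x b * pd \<phi> (gp b))" by (simp only:)
          qed
          also have "\<dots> = (\<Sum>b\<in>Irr s. Sb b * pd \<phi> (gp b))"
            unfolding Sb_def sum_distrib_left sum_distrib_right by (subst sum.swap) (simp only: mult.assoc)
          finally have "sv * pd \<phi> (gp v) = - (\<Sum>b\<in>Irr s. Sb b * pd \<phi> (gp b))"
            by (simp add: eq_neg_iff_add_eq_0)
          then have "pd \<phi> (gp v) = - (\<Sum>b\<in>Irr s. Sb b * pd \<phi> (gp b)) / sv"
            using sv by (simp add: field_simps)
          also have "\<dots> = (\<Sum>b\<in>Irr s. a' b * pd \<phi> (gp b))" unfolding a'_def
            by (simp add: sum_negf sum_divide_distrib)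
          finally show ?thesis .
        qed
        then show ?thesis by blast
      qed
    qed
  qed
  \<comment> \<open>The gradients of the derivatives of u are unit vectors, so no nontrivial
    combination of them vanishes.\<close>
  have le: "card {v :: ('m,'n) deriv. wt (toU v) \<le> s} \<le> card (Irr s)" for s
  proof (rule ccontr)
    let ?W = "{v :: ('m,'n) deriv. wt (toU v) \<le> s}"
    assume "\<not> card ?W \<le> card (Irr s)"
    then have lt: "card (Irr s) < card ?W" by simp
    have finW: "finite ?W"
    proof (rule finite_subset)
      show "?W \<subseteq> UNIV \<times> {e. sum e UNIV \<le> s}" unfolding wt_def toU_def by auto
      show "finite ((UNIV :: 'n set) \<times> {e :: 'm \<Rightarrow> nat. sum e UNIV \<le> s})" by (simp add: finite_exponents)
    qed
    have "\<forall>v\<in>?W. \<exists>a. \<forall>\<phi>. pd \<phi> (val v) = (\<Sum>b\<in>Irr s. a b * pd \<phi> (gp b))"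
    proof
      fix v assume "v \<in> ?W"
      then have "wt (toU v) \<le> s" by (rule CollectD)
      then show "\<exists>a. \<forall>\<phi>. pd \<phi> (val v) = (\<Sum>b\<in>Irr s. a b * pd \<phi> (gp b))" using span[of "toU v" s] unfolding gen_toU by blast
    qed
    from bchoice[OF this] obtain a where a: "\<forall>v\<in>?W. \<forall>\<phi>. pd \<phi> (val v) = (\<Sum>b\<in>Irr s. a v b * pd \<phi> (gp b))" by blast
    from linear_dependence[OF finIrr finW lt, of a] obtain l where
      l: "\<exists>v\<in>?W. l v \<noteq> 0" "\<forall>b\<in>Irr s. (\<Sum>v\<in>?W. l v * a v b) = 0" by blast
    from l(1) obtain \<phi> where \<phi>: "\<phi> \<in> ?W" "l \<phi> \<noteq> 0" by (elim bexE)
    have "(\<Sum>v\<in>?W. l v * pd \<phi> (val v)) = (\<Sum>v\<in>?W. l v * (\<Sum>b\<in>Irr s. a v b * pd \<phi> (gp b)))"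
    proof (rule sum.cong[OF refl])
      fix v assume "v \<in> ?W"
      then have "pd \<phi> (val v) = (\<Sum>b\<in>Irr s. a v b * pd \<phi> (gp b))" using a by blast
      then show "l v * pd \<phi> (val v) = l v * (\<Sum>b\<in>Irr s. a v b * pd \<phi> (gp b))" by (simp only:)
    qed
    also have "\<dots> = (\<Sum>b\<in>Irr s. (\<Sum>v\<in>?W. l v * a v b) * pd \<phi> (gp b))"
      unfolding sum_distrib_left sum_distrib_right by (subst sum.swap) (simp only: mult.assoc)
    also have "\<dots> = 0" using l(2) by simp
    finally have "(\<Sum>v\<in>?W. l v * pd \<phi> (val v)) = 0" .
    moreover have "(\<Sum>v\<in>?W. l v * pd \<phi> (val v)) = (\<Sum>v\<in>?W. if v = \<phi> then l v else 0)"
      by (rule sum.cong[OF refl]) (simp add: pd_val)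
    moreover have "\<dots> = l \<phi>" using finW \<phi>(1) by (subst sum.delta[OF finW]) (simp only: if_True)
    ultimately show False using \<phi>(2) by argo
  qed
  define h where "h = (\<Sum>z\<in>LV. sum (snd (ld (f z))) UNIV)"
  \<comment> \<open>One shift for two purposes: h absorbs the orders of the leaders, the other
    summand the gap between order and weight.\<close>
  define k where "k = h + c * (\<Sum>z\<in>UNIV. xu_pos (z :: ('r,'n) xu))"
  let ?N = "nexp TYPE('m)"
  \<comment> \<open>The number of all variables.\<close>
  let ?K = "card (- LV) + card LV"
  from nexp_growth[where 'm = 'm, of ?K k] obtain s where s: "?K * ?N (s + k) < (?K + 1) * ?N s" by blast
  have "CARD('n) * ?N s = card ((UNIV :: 'n set) \<times> {e :: 'm \<Rightarrow> nat. sum e UNIV \<le> s})" by (simp add: card_cartesian_product nexp_def)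
  also have "\<dots> \<le> card {v :: ('m,'n) deriv. wt (toU v) \<le> s + k}"
  proof (rule card_mono)
    show "finite {v :: ('m,'n) deriv. wt (toU v) \<le> s + k}"
    proof (rule finite_subset)
      show "{v :: ('m,'n) deriv. wt (toU v) \<le> s + k} \<subseteq> UNIV \<times> {e. sum e UNIV \<le> s + k}" unfolding wt_def toU_def by auto
      show "finite ((UNIV :: 'n set) \<times> {e :: 'm \<Rightarrow> nat. sum e UNIV \<le> s + k})" by (simp add: finite_exponents)
    qed
    have "xu_pos (z :: ('r,'n) xu) \<le> (\<Sum>z\<in>UNIV. xu_pos (z :: ('r,'n) xu))" for z by (rule member_le_sum) (simp_all add: finite_xu)
    then have ck: "c * xu_pos (z :: ('r,'n) xu) \<le> k" for z unfolding k_def using mult_le_mono2 trans_le_add2 by blast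
    show "(UNIV :: 'n set) \<times> {e :: 'm \<Rightarrow> nat. sum e UNIV \<le> s} \<subseteq> {v. wt (toU v) \<le> s + k}"
    proof
      fix v :: "('m,'n) deriv" assume "v \<in> UNIV \<times> {e. sum e UNIV \<le> s}"
      then have "sum (snd (toU v :: ('m,('r,'n) xu) deriv)) UNIV \<le> s" by (auto simp: toU_def)
      then have "wt (toU v) \<le> s + k" unfolding wt_def by (rule add_mono[OF _ ck])
      then show "v \<in> {v. wt (toU v) \<le> s + k}" by (rule CollectI)
    qed
  qed
  also have "\<dots> \<le> card (Irr (s + k))" by (rule le)
  finally have A: "CARD('n) * ?N s \<le> card (Irr (s + k))" .
  \<comment> \<open>Multiples of one leader per leading variable; they are disjoint from
    \<open>Irr\<close> and distinct for distinct pairs.\<close>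
  define R where "R = (\<lambda>(z, e). dmult e (ld (f z))) ` (LV \<times> {e :: 'm \<Rightarrow> nat. sum e UNIV \<le> s})"
  have "inj_on (\<lambda>(z, e). dmult e (ld (f z))) (LV \<times> {e :: 'm \<Rightarrow> nat. sum e UNIV \<le> s})"
  proof (rule inj_onI)
    fix x y assume x: "x \<in> LV \<times> {e :: 'm \<Rightarrow> nat. sum e UNIV \<le> s}" and y: "y \<in> LV \<times> {e :: 'm \<Rightarrow> nat. sum e UNIV \<le> s}"
      and "(case x of (z, e) \<Rightarrow> dmult e (ld (f z))) = (case y of (z, e) \<Rightarrow> dmult e (ld (f z)))"
    then have eq: "dmult (snd x) (ld (f (fst x))) = dmult (snd y) (ld (f (fst y)))" by (simp add: case_prod_beta)
    have "fst x \<in> LV" "fst y \<in> LV" using x y by (simp_all only: mem_Times_iff)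
    then have "fst (ld (f (fst x))) = fst x" "fst (ld (f (fst y))) = fst y" using f by blast+
    then have 1: "fst x = fst y" using arg_cong[OF eq, of fst] by (simp add: dmult_def)
    then have "snd x = snd y" using eq E.dmult_inject by simp
    then show "x = y" by (rule prod_eqI[OF 1])
  qed
  then have "card R = card (LV \<times> {e :: 'm \<Rightarrow> nat. sum e UNIV \<le> s})" unfolding R_def by (rule card_image)
  then have cR: "card R = card LV * ?N s" by (simp add: card_cartesian_product nexp_def)
  have Rsub: "R \<subseteq> UNIV \<times> {e. sum e UNIV \<le> s + k}"
  proof
    fix v assume "v \<in> R"
    then obtain z e where ze: "z \<in> LV" "sum e UNIV \<le> s" "v = dmult e (ld (f z))" by (auto simp: R_def)
    have "sum (snd (ld (f z))) UNIV \<le> h" unfolding h_def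
      by (rule member_le_sum[where f = "\<lambda>z. sum (snd (ld (f z))) UNIV", OF ze(1)]) (simp_all add: finite_xu)
    then have "sum (snd v) UNIV \<le> s + k" using ze(2) by (simp add: ze(3) dmult_def sum.distrib k_def)
    then show "v \<in> UNIV \<times> {e. sum e UNIV \<le> s + k}" by (simp add: mem_Times_iff)
  qed
  have Isub: "Irr (s + k) \<subseteq> UNIV \<times> {e. sum e UNIV \<le> s + k}" unfolding Irr_def wt_def by auto
  have disj: "Irr (s + k) \<inter> R = {}"
  proof -
    have "v \<notin> Irr (s + k)" if "v \<in> R" for v
    proof -
      from that obtain z e where ze: "z \<in> LV" "v = dmult e (ld (f z))" by (auto simp: R_def)
      have "fst v = z" "snd (ld (f z)) \<le> snd v" using f ze by (auto simp: dmult_def le_fun_def)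
      then show ?thesis using ze(1) by (simp add: Irr_def)
    qed
    then show ?thesis by blast
  qed
  have finB: "finite ((UNIV :: ('r,'n) xu set) \<times> {e :: 'm \<Rightarrow> nat. sum e UNIV \<le> s + k})" by (simp add: finite_exponents finite_xu)
  have "card (Irr (s + k)) + card R = card (Irr (s + k) \<union> R)"
    by (rule card_Un_disjoint[OF finIrr finite_subset[OF Rsub finB] disj, symmetric])
  also have "\<dots> \<le> card ((UNIV :: ('r,'n) xu set) \<times> {e :: 'm \<Rightarrow> nat. sum e UNIV \<le> s + k})"
    by (rule card_mono[OF finB]) (use Isub Rsub in blast)
  also have "\<dots> = ?K * ?N (s + k)"
  proof -
    have "card (UNIV :: ('r,'n) xu set) = card (- LV \<union> LV)" by (simp add: Un_commute)
    also have "\<dots> = ?K" by (rule card_Un_disjoint) (auto simp: finite_xu)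
    finally show ?thesis by (simp add: card_cartesian_product nexp_def)
  qed
  finally have "(CARD('n) + card LV) * ?N s \<le> ?K * ?N (s + k)" using A cR by (simp add: add_mult_distrib)
  then have "(CARD('n) + card LV) * ?N s < (?K + 1) * ?N s" using s by linarith
  then have "CARD('n) + card LV < ?K + 1" by (metis mult_less_cancel2)
  then show ?thesis by simp
qed

lemma card_leading_X_U: "card {j. X j \<notin> LV} = card {i. U i \<in> LV}"
proof -
  have "- LV = X ` {j. X j \<notin> LV} \<union> U ` {i. U i \<notin> LV}"
  proof (intro equalityI subsetI)
    fix z assume "z \<in> - LV"
    then show "z \<in> X ` {j. X j \<notin> LV} \<union> U ` {i. U i \<notin> LV}" by (cases z) auto
  next
    fix z assume "z \<in> X ` {j. X j \<notin> LV} \<union> U ` {i. U i \<notin> LV}"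
    then show "z \<in> - LV" by (elim UnE imageE) simp_all
  qed
  then have "card (- LV) = card (X ` {j. X j \<notin> LV} \<union> U ` {i. U i \<notin> LV})" by (rule arg_cong)
  also have "\<dots> = card (X ` {j. X j \<notin> LV} :: ('r,'n) xu set) + card (U ` {i. U i \<notin> LV} :: ('r,'n) xu set)"
    by (rule card_Un_disjoint) auto
  also have "\<dots> = card {j. X j \<notin> LV} + card {i. U i \<notin> LV}" by (simp add: card_image inj_on_def)
  finally have "card {j. X j \<notin> LV} + card {i. U i \<notin> LV} = CARD('n)"
    using card_parametric_le card_parametric_ge by simp
  moreover have "card {i. U i \<in> LV} + card {i. U i \<notin> LV} = CARD('n)"
  proof -
    have "card {i. U i \<in> LV} + card {i. U i \<notin> LV} = card ({i. U i \<in> LV} \<union> {i. U i \<notin> LV})"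
      by (rule card_Un_disjoint[symmetric]) auto
    also have "{i. U i \<in> LV} \<union> {i. U i \<notin> LV} = UNIV" by blast
    finally show ?thesis .
  qed
  ultimately show ?thesis by linarith
qed

lemma lueroth_iff_single:
  assumes "\<And>j. w j \<notin> range \<iota>"
  shows "(\<exists>v\<in>GG. GG = FG {v}) \<longleftrightarrow> (\<exists>f. CU = {f})"
proof
  assume "\<exists>v\<in>GG. GG = FG {v}"
  then obtain v where v: "v \<in> GG" "GG = FG {v}" by blast
  \<comment> \<open>Otherwise G would be F, although it contains the fractions w, which are not in
    F.\<close>
  have "v \<notin> range \<iota>"
  proof
    assume "v \<in> range \<iota>"
    then have "FG {v} \<subseteq> range \<iota>" by (intro FG_least Fsub) auto
    moreover have "w undefined \<in> GG" using FG_delta_subfield(3)[of "range w"] by blast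
    ultimately show False using assms[of undefined] v(2) by blast
  qed
  moreover have "v \<in> FU" using v(1) GG_props(4) by blast
  ultimately have "\<exists>t e. Red (FG {v}) t e \<and> Alg (FG {v}) t e" by (intro simple_extension)
  then show "\<exists>f. CU = {f}" unfolding v(2)[symmetric] using single_of_Red_Alg by blast
next
  assume "\<exists>f. CU = {f}"
  then obtain t e where "Red GG t e" "Alg GG t e" using Red_Alg_of_single by blast
  then show "\<exists>v\<in>GG. GG = FG {v}" by (rule lueroth_generator[OF GG_props(5,2,4)])
qed

end

theorem theorem4p2:
  fixes \<delta>F :: "'m::{finite,linorder} \<Rightarrow> 'f::field_char_0 \<Rightarrow> 'f"
    and \<iota> :: "'f \<Rightarrow> 'k::field"
    and \<delta> :: "'m \<Rightarrow> 'k \<Rightarrow> 'k"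
    and u :: "'n::{finite,linorder} \<Rightarrow> 'k"
    and P Q :: "'r::{finite,linorder} \<Rightarrow> ('m, 'n, 'f) dpoly"
    and \<G> :: "'k set"
    and PU QU :: "'r \<Rightarrow> ('m, ('r, 'n) xu, 'f) dpoly"
    and \<P> \<C> :: "('m, ('r, 'n) xu, 'f) dpoly set"
    and us :: "'n list"
    and d :: nat
    and l :: "nat \<Rightarrow> nat"
  assumes m: "CARD('m) > 1"
    and ext: "delta_field_extension \<delta>F \<iota> \<delta>"
    and u: "delta_indeterminates \<iota> \<delta> u"
    and Q_nz: "\<And>j. Q j \<noteq> 0"
    and PQ_rel_prime: "\<And>j. relatively_prime (P j) (Q j)"
    and PQ_notin_F: "\<And>j. dpoly_eval \<iota> \<delta> u (P j) / dpoly_eval \<iota> \<delta> u (Q j) \<notin> range \<iota>"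
    and \<G>: "\<G> = delta_field_gen \<iota> \<delta>
                   (range (\<lambda>j. dpoly_eval \<iota> \<delta> u (P j) / dpoly_eval \<iota> \<delta> u (Q j)))"
    and PU: "\<And>j. PU j = dpoly_eval dconst (dpoly_deriv \<delta>F) (\<lambda>i. dvar (U i)) (P j)"
    and QU: "\<And>j. QU j = dpoly_eval dconst (dpoly_deriv \<delta>F) (\<lambda>i. dvar (U i)) (Q j)"
    and \<P>: "\<P> = saturation
                   (delta_ideal_gen (dpoly_deriv \<delta>F) (range (\<lambda>j. dvar (X j) * QU j - PU j)))
                   (\<Prod>j\<in>UNIV. QU j)"
    and \<C>: "characteristic_set elim_less \<P> \<C>"
    and d: "d = card {j. X j \<notin> leading_var elim_less ` \<C>}"
    and us: "us = sorted_list_of_set {i. U i \<in> leading_var elim_less ` \<C>}"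
    and l: "\<And>i. l i = card {f \<in> \<C>. leading_var elim_less f = U (us ! (i - 1))}"
  shows "(\<exists>v\<in>\<G>. \<G> = delta_field_gen \<iota> \<delta> {v}) \<longleftrightarrow> d = 1 \<and> l 1 = 1"
proof -
  define w where "w j = dpoly_eval \<iota> \<delta> u (P j) / dpoly_eval \<iota> \<delta> u (Q j)" for j
  interpret G: generic_point \<delta>F \<iota> \<delta> u w
    by (unfold_locales) (use ext u in \<open>auto simp: w_def\<close>)
  have emb: "PU j = emb (P j)" "QU j = emb (Q j)" for j
    unfolding PU QU by (rule dpoly_eval_emb[OF G.drF])+
  have ker: "\<P> = {p. G.evx p = 0}"
    unfolding \<P> emb by (rule G.saturation_eq_kernel[OF Q_nz]) (simp add: w_def G.dpoly_eval_u)
  interpret C: char_point \<delta>F \<iota> \<delta> u w \<C>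
    by unfold_locales (use \<C> in \<open>simp add: ker\<close>)
  have gen: "delta_field_gen \<iota> \<delta> A = G.FG A" for A unfolding delta_field_gen_def G.FG_def ..
  have \<G>': "\<G> = C.GG" unfolding \<G> gen w_def ..
  \<comment> \<open>d is given by the x that are not leading; counted by the leading u instead, both
    conditions speak about elements led by some u.\<close>
  have dU: "d = card {i. U i \<in> C.LV}" unfolding d by (rule C.card_leading_X_U)
  have wF: "w j \<notin> range \<iota>" for j unfolding w_def by (rule PQ_notin_F)
  have CU: "f \<in> C.CU \<longleftrightarrow> f \<in> \<C> \<and> (\<exists>i. leading_var elim_less f = U i)" for f
  proof -
    have "\<not> isX (C.ld f) \<longleftrightarrow> (\<exists>i. fst (C.ld f) = U i)" unfolding isX_def using xu.exhaust xu.distinct(1) by metis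
    then show ?thesis by (simp add: C.CU_def leading_var_def)
  qed
  have "(\<exists>f. C.CU = {f}) \<longleftrightarrow> d = 1 \<and> l 1 = 1"
  proof
    assume "\<exists>f. C.CU = {f}"
    then obtain f where f: "C.CU = {f}" by blast
    then obtain i where i: "f \<in> \<C>" "leading_var elim_less f = U i" using CU[of f] by blast
    have uniq: "g = f" if "g \<in> \<C>" "leading_var elim_less g = U k" for g k using CU[of g] that f by blast
    have L: "{i. U i \<in> C.LV} = {i}"
    proof (intro equalityI subsetI)
      fix k assume "k \<in> {i. U i \<in> C.LV}"
      then obtain g where g: "g \<in> \<C>" "leading_var elim_less g = U k" by (metis (no_types, lifting) imageE mem_Collect_eq)
      then show "k \<in> {i}" using uniq[OF g] i(2) by simp
    next
      fix k assume "k \<in> {i}"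
      then show "k \<in> {i. U i \<in> C.LV}" using i by (metis (no_types, lifting) imageI mem_Collect_eq singletonD)
    qed
    \<comment> \<open>The variables are numbered from 1 but the list is indexed from 0, hence
      \<open>us ! (1 - 1)\<close> for the first one.\<close>
    have "us = [i]" unfolding us L by simp
    then have "us ! (1 - 1) = i" by simp
    then have "{g \<in> \<C>. leading_var elim_less g = U (us ! (1 - 1))} = {f}" using i uniq by blast
    then have "l 1 = 1" unfolding l by simp
    then show "d = 1 \<and> l 1 = 1" unfolding dU L by simp
  next
    assume dl: "d = 1 \<and> l 1 = 1"
    then obtain i where L: "{i. U i \<in> C.LV} = {i}" unfolding dU by (metis card_1_singletonE)
    have usi: "us = [i]" unfolding us L by simp
    have "C.CU = {g \<in> \<C>. leading_var elim_less g = U i}"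
    proof (intro equalityI subsetI)
      fix g assume "g \<in> C.CU"
      then obtain k where k: "g \<in> \<C>" "leading_var elim_less g = U k" using CU by blast
      then have "k \<in> {i. U i \<in> C.LV}" by (metis (no_types, lifting) imageI mem_Collect_eq)
      then show "g \<in> {g \<in> \<C>. leading_var elim_less g = U i}" using k unfolding L by simp
    next
      fix g assume "g \<in> {g \<in> \<C>. leading_var elim_less g = U i}"
      then show "g \<in> C.CU" using CU by blast
    qed
    moreover have "card {g \<in> \<C>. leading_var elim_less g = U i} = 1" using dl l[of 1] usi by simp
    ultimately show "\<exists>f. C.CU = {f}" by (metis card_1_singletonE)
  qed
  then show ?thesis using C.lueroth_iff_single[OF wF] unfolding \<G>' gen by simp
qed

end
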